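(* Let $N\ge1$, let $p\ge1$ be an integer, let $f\in\mathfrak{LC}_p(\mathbb R^{2N},\mathbb R^N)$ have $L^1_{loc}$-equicontinuous $m$-bounds, and let $\Theta=\{\theta^I_j\}$ be the suitable set of moduli of continuity given by the $m$-bounds of $\{f_\tau:\tau\in\mathbb R\}$, i.e. $\theta^I_j(s)=\theta_j(s)=\sup_{t\in\mathbb R}\int_t^{t+s}m^j_f(u)\,du$. Let $D$ be any countable dense subset of $\mathbb R^N$ and $\mathcal C=C([-1,0],\mathbb R^N)$. For a space $E$ of functions $\mathbb R\times\mathbb R^{2N}\to\mathbb R^N$ with topology $\mathcal T$ as in (i), (ii) below, let $$\mathcal U_{(E,\mathcal T)}=\{(t,g,\phi): g\in\mathrm{Hull}_{(E,\mathcal T)}(f),\ \phi\in\mathcal C,\ t\in I_{g,\phi},\ t\ge0\}$$ and consider the map $$\mathcal U_{(E,\mathcal T)}\to\mathrm{Hull}_{(E,\mathcal T)}(f)\times\mathcal C,\qquad (t,g,\phi)\mapsto\big(g_t,x_t(\cdot,g,\phi)\big).\qquad( * )$$ (i) If $(E,\mathcal T)=(\mathfrak{LC}_p,\mathcal T_{\Theta B})$, the map $( * )$ defines a local continuous skew-product semiflow on $\mathrm{Hull}_{(\mathfrak{LC}_p,\mathcal T_{\Theta B})}(f)\times\mathcal C$. (ii) If $f$ has $L^1_{loc}$-bounded $l_2$-bounds and $(E,\mathcal T)\in\{(\mathfrak{LC},\mathcal T_{\Theta D}),(\mathfrak{LC},\sigma_{\Theta D})\}$, then the map $( * )$ defines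 a local continuous skew-product semiflow on $\mathrm{Hull}_{(E,\mathcal T)}(f)\times\mathcal C$.
   Context: $B_j$ is the closed ball of radius $j$ centered at the origin; $C(I,W)$ is the space of continuous functions $I\to W$; $\mathcal C$ carries the sup norm. $L^p_{loc}$ is the set of real functions on $\mathbb R$ belonging to $L^p(I)$ for every compact interval $I$. $\mathfrak{LC}_p(\mathbb R^{2N},\mathbb R^N)$ is the set of functions $f:\mathbb R\times\mathbb R^{2N}\to\mathbb R^N$ such that: $f$ is Borel measurable; for every compact $K\subset\mathbb R^{2N}$ there are $m^K,l^K\in L^p_{loc}$ such that for a.e. $t\in\mathbb R$, $|f(t,z)|\le m^K(t)$ and $|f(t,z_1)-f(t,z_2)|\le l^K(t)|z_1-z_2|$ for all $z,z_1,z_2\in K$. Functions differing only on a negligible set are identified. $\mathfrak{LC}=\mathfrak{LC}_1$. Points of $\mathbb R^{2N}$ are written $(x,u)$. Time translation: $f_t(s,z)=f(s+t,z)$. $\mathrm{Hull}_{(E,\mathcal T)}(f)$ is the closure of $\{f_t: t\in\mathbb R\}$ in $(E,\mathcal T)$, with the induced topology. Optimal bounds of $g$ on $B_j\subset\mathbb R^{2N}$: $m^j_g(t)=\sup_{z\in B_j}|g(t,z)|$ and $l^j_{2,g}(t)=\sup|g(t,x,u_1)-g(t,x,u_2)|/|u_1-u_2|$ over $(x,u_1),(x,u_2)\in B_j$, $u_1\ne u_2$. $f$ has $L^1_{loc}$-equicontinuous $m$-bounds if for every $j\in\mathbb N$, $r,\varepsilon>0$ there is $\delta>0$ with $\sup_{\tau\in\mathbb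 R}\int_s^t m^j_{f_\tau}(u)\,du<\varepsilon$ whenever $-r\le s\le t\le r$, $t-s<\delta$. $f$ has $L^1_{loc}$-bounded $l_2$-bounds if $\sup_{\tau\in\mathbb R}\int_{-r}^r l^j_{2,f_\tau}(t)\,dt<\infty$ for every $j\in\mathbb N$, $r>0$. A suitable set of moduli of continuity is a countable set $\{\theta^I_j: j\in\mathbb N,\ I=[q_1,q_2],\ q_1,q_2\in\mathbb Q\}$ of non-decreasing continuous functions $[0,\infty)\to[0,\infty)$ with $\theta^I_j(0)=0$ and $\theta^{I_1}_{j_1}\le\theta^{I_2}_{j_2}$ whenever $I_1\subseteq I_2$, $j_1\le j_2$. $\mathcal K^I_j$ is the set of $x\in C(I,B_j)$, $B_j\subset\mathbb R^N$, with $|x(t)-x(s)|\le\theta^I_j(|t-s|)$ for all $t,s\in I$. Topologies, generated by the following seminorms over all $I=[q_1,q_2]$, $q_1,q_2\in\mathbb Q$, $j\in\mathbb N$ ($I-1$ is the translate of $I$): - $\mathcal T_{\Theta B}$ on $\mathfrak{LC}_p$: $\sup_{x\in\mathcal K^I_j,\,u\in C(I-1,B_j)}[\int_I|f(t,x(t),u(t-1))|^pdt]^{1/p}$; - $\mathcal T_{\Theta D}$ on $\mathfrak{LC}$: $\sup_{x\in\mathcal K^I_j}\int_I|f(t,x(t),u)|\,dt$, $u\in D$; - $\sigma_{\Theta D}$ on $\mathfrak{LC}$: $\sup_{x\in\mathcal K^I_j}|\int_If(t,x(t),u)\,dt|$, $u\in D$. For $g\in\mathfrak{LC}(\mathbb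 R^{2N},\mathbb R^N)$ and $\phi\in\mathcal C$, $x(\cdot,g,\phi)$ denotes the unique maximal continuous (Carathéodory) solution, with maximal interval of definition $I_{g,\phi}=[-1,b_{g,\phi})$, of $\dot x=g(t,x(t),x(t-1))$ for $t>0$, $x(t)=\phi(t)$ for $t\in[-1,0]$. For $t\ge0$, $x_t(\cdot,g,\phi)\in\mathcal C$ is $s\mapsto x(t+s,g,\phi)$, $s\in[-1,0]$. A local continuous semiflow on a topological space $X$ is a continuous map $\Phi:\mathcal U\to X$, with $\mathcal U\subset[0,\infty)\times X$ relatively open and containing $\{0\}\times X$, such that $\Phi(0,x)=x$ and $\Phi(t+s,x)=\Phi(t,\Phi(s,x))$ whenever $(s,x)\in\mathcal U$ and $(t,\Phi(s,x))\in\mathcal U$. It is a skew-product semiflow if $X=Y\times Z$ and the $Y$-component of $\Phi(t,y,z)$ depends only on $(t,y)$. *)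

theory Defs
  imports "HOL-Analysis.Analysis"
begin

(* A point of R x R^(2N) is a triple (t, x, u) = (t, (x, u)); the product norm on
   (real^'n) x (real^'n) is the Euclidean norm of R^(2N). *)
type_synonym 'n dfield = "real \<times> ((real ^ 'n) \<times> (real ^ 'n)) \<Rightarrow> real ^ 'n"

section \<open>Lipschitz Caratheodory functions\<close>

definition Lp_loc :: "nat \<Rightarrow> (real \<Rightarrow> real) set" where
  "Lp_loc p = {m \<in> borel_measurable lebesgue.
     \<forall>a b. set_integrable lebesgue {a..b} (\<lambda>t. \<bar>m t\<bar> ^ p)}"

definition LC :: "nat \<Rightarrow> ('n::finite) dfield set" where
  "LC p = {f \<in> borel_measurable borel. \<forall>K. compact K \<longrightarrow>
     (\<exists>m\<in>Lp_loc p. \<exists>l\<in>Lp_loc p. AE t in lebesgue.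
        (\<forall>z\<in>K. norm (f (t, z)) \<le> m t) \<and>
        (\<forall>z1\<in>K. \<forall>z2\<in>K. norm (f (t, z1) - f (t, z2)) \<le> l t * norm (z1 - z2)))}"

(* Functions that differ on a negligible set are identified, so the elements of the
   function spaces below are equivalence classes. *)
definition LC_rel :: "nat \<Rightarrow> (('n::finite) dfield \<times> 'n dfield) set" where
  "LC_rel p = {(f, g). f \<in> LC p \<and> g \<in> LC p \<and> negligible {w. f w \<noteq> g w}}"

definition LC_space :: "nat \<Rightarrow> ('n::finite) dfield set set" where
  "LC_space p = LC p // LC_rel p"

definition LC_class :: "nat \<Rightarrow> ('n::finite) dfield \<Rightarrow> 'n dfield set" where
  "LC_class p f = LC_rel p `` {f}"

(* Equivalent functions agree, for a.e. t, at all z simultaneously (both are continuous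
   in z), so neither the seminorms nor the solutions defined below depend on the choice
   of representative. *)
definition rep :: "('n::finite) dfield set \<Rightarrow> 'n dfield" where
  "rep G = (SOME g. g \<in> G)"

definition translate :: "real \<Rightarrow> ('n::finite) dfield \<Rightarrow> 'n dfield" where
  "translate t f = (\<lambda>(s, z). f (s + t, z))"

section \<open>Optimal bounds\<close>

(* These suprema may be infinite for t in a null set, hence the type ennreal. *)
definition m_bound :: "nat \<Rightarrow> ('n::finite) dfield \<Rightarrow> real \<Rightarrow> ennreal" where
  "m_bound j g t = (SUP z\<in>cball 0 (real j). ennreal (norm (g (t, z))))"

definition l2_bound :: "nat \<Rightarrow> ('n::finite) dfield \<Rightarrow> real \<Rightarrow> ennreal" where
  "l2_bound j g t =
     (SUP (x, u1, u2) \<in> {(x, u1, u2). (x, u1) \<in> cball 0 (real j) \<and> (x, u2) \<in> cball 0 (real j) \<and> u1 \<noteq> u2}.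
        ennreal (norm (g (t, x, u1) - g (t, x, u2)) / norm (u1 - u2)))"

definition L1loc_equicontinuous_m_bounds :: "('n::finite) dfield \<Rightarrow> bool" where
  "L1loc_equicontinuous_m_bounds f \<longleftrightarrow>
     (\<forall>j::nat. \<forall>r>0. \<forall>\<epsilon>>0. \<exists>\<delta>>0. \<forall>s t. - r \<le> s \<and> s \<le> t \<and> t \<le> r \<and> t - s < \<delta> \<longrightarrow>
        (SUP \<tau>::real. \<integral>\<^sup>+ u\<in>{s..t}. m_bound j (translate \<tau> f) u \<partial>lebesgue) < ennreal \<epsilon>)"

definition L1loc_bounded_l2_bounds :: "('n::finite) dfield \<Rightarrow> bool" where
  "L1loc_bounded_l2_bounds f \<longleftrightarrow>
     (\<forall>j::nat. \<forall>r>0.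
        (SUP \<tau>::real. \<integral>\<^sup>+ t\<in>{-r..r}. l2_bound j (translate \<tau> f) t \<partial>lebesgue) < \<infinity>)"

section \<open>Moduli of continuity\<close>

definition rational_intervals :: "real set set" where
  "rational_intervals = {{q1..q2} | q1 q2. q1 \<in> \<rat> \<and> q2 \<in> \<rat> \<and> q1 \<le> q2}"

definition suitable_moduli :: "(real set \<Rightarrow> nat \<Rightarrow> real \<Rightarrow> real) \<Rightarrow> bool" where
  "suitable_moduli \<Theta> \<longleftrightarrow>
     (\<forall>I\<in>rational_intervals. \<forall>j.
        \<Theta> I j ` {0..} \<subseteq> {0..} \<and> mono_on {0..} (\<Theta> I j) \<and>
        continuous_on {0..} (\<Theta> I j) \<and> \<Theta> I j 0 = 0) \<and>
     (\<forall>I1\<in>rational_intervals. \<forall>I2\<in>rational_intervals. \<forall>j1 j2. I1 \<subseteq> I2 \<and> j1 \<le> j2 \<longrightarrow>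
        (\<forall>s\<ge>0. \<Theta> I1 j1 s \<le> \<Theta> I2 j2 s))"

definition m_bound_moduli :: "('n::finite) dfield \<Rightarrow> real set \<Rightarrow> nat \<Rightarrow> real \<Rightarrow> real" where
  "m_bound_moduli f I j s =
     enn2real (SUP t::real. \<integral>\<^sup>+ u\<in>{t..t + s}. m_bound j f u \<partial>lebesgue)"

lemma m_bound_measurable:
  fixes f :: "('n::finite) dfield"
  assumes "f \<in> LC p"
  shows "m_bound j f \<in> borel_measurable lebesgue"
proof -
  let ?B = "cball (0 :: (real ^ 'n) \<times> (real ^ 'n)) (real j)"
  obtain Q where Q: "countable Q" "Q \<subseteq> ?B" "?B \<subseteq> closure Q"
    using separable[of ?B] by blast
  have f: "f \<in> borel_measurable borel"
    using assms by (simp add: LC_def)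
  define M where "M t = (SUP z\<in>Q. ennreal (norm (f (t, z))))" for t
  have "(\<lambda>t. f (t, z)) \<in> borel_measurable borel" for z
    by (rule measurable_compose[OF borel_measurable_continuous_onI f]) (intro continuous_intros)
  then have "M \<in> borel_measurable borel"
    unfolding M_def by (intro borel_measurable_SUP Q(1)) simp_all
  then have M: "M \<in> borel_measurable lebesgue"
    by (simp add: measurable_completion)
  obtain m l where "AE t in lebesgue. (\<forall>z\<in>?B. norm (f (t, z)) \<le> m t) \<and>
        (\<forall>z1\<in>?B. \<forall>z2\<in>?B. norm (f (t, z1) - f (t, z2)) \<le> l t * norm (z1 - z2))"
    using assms compact_cball[of "0 :: (real ^ 'n) \<times> (real ^ 'n)" "real j"] unfolding LC_def by blast
  then have ae: "AE t in lebesgue. M t = m_bound j f t"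
  proof eventually_elim
    case (elim t)
    have "norm (f (t, z1) - f (t, z2)) \<le> max 0 (l t) * norm (z1 - z2)"
      if "z1 \<in> ?B" "z2 \<in> ?B" for z1 z2
    proof -
      have "norm (f (t, z1) - f (t, z2)) \<le> l t * norm (z1 - z2)"
        using elim that by blast
      also have "\<dots> \<le> max 0 (l t) * norm (z1 - z2)"
        by (intro mult_right_mono) auto
      finally show ?thesis .
    qed
    then have "(max 0 (l t))-lipschitz_on ?B (\<lambda>z. f (t, z))"
      by (auto simp: lipschitz_on_def dist_norm)
    then have cont: "continuous_on ?B (\<lambda>z. f (t, z))"
      by (rule lipschitz_on_continuous_on)
    have "ennreal (norm (f (t, z))) \<le> M t" if z: "z \<in> ?B" for z
    proof -
      obtain w where w: "\<And>n. w n \<in> Q" "w \<longlonglongrightarrow> z"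
        using z Q(3) closure_sequential by blast
      have "(\<lambda>n. f (t, w n)) \<longlonglongrightarrow> f (t, z)"
        using cont z w Q(2) unfolding continuous_on_sequentially comp_def by blast
      then have "(\<lambda>n. ennreal (norm (f (t, w n)))) \<longlonglongrightarrow> ennreal (norm (f (t, z)))"
        by (intro tendsto_intros)
      then show ?thesis
        by (rule LIMSEQ_le_const2) (auto simp: M_def intro!: SUP_upper w)
    qed
    then have "m_bound j f t \<le> M t"
      unfolding m_bound_def by (intro SUP_least)
    moreover have "M t \<le> m_bound j f t"
      unfolding M_def m_bound_def by (intro SUP_subset_mono Q(2)) simp
    ultimately show ?case by simp
  qed
  then obtain N where N: "N \<in> null_sets lebesgue" "\<And>t. t \<notin> N \<Longrightarrow> M t = m_bound j f t"
    by (auto simp: completion.AE_iff_null_sets eventually_ae_filter)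
  show ?thesis
  proof (rule measurableI)
    fix A :: "ennreal set" assume "A \<in> sets borel"
    then have 1: "M -` A \<inter> space lebesgue \<in> sets lebesgue"
      using M by (rule measurable_sets[rotated])
    have 2: "m_bound j f -` A \<inter> N \<in> sets lebesgue"
      using N(1) completion.complete2[of "m_bound j f -` A \<inter> N" N lborel] by (auto simp: null_sets_def)
    have "m_bound j f -` A \<inter> space lebesgue = (M -` A \<inter> space lebesgue - N) \<union> (m_bound j f -` A \<inter> N)"
      using N(2) by auto
    also have "\<dots> \<in> sets lebesgue"
      using 1 2 N(1) by auto
    finally show "m_bound j f -` A \<inter> space lebesgue \<in> sets lebesgue" .
  qed simp
qed

lemma m_bound_translate: "m_bound j (translate \<tau> f) u = m_bound j f (u + \<tau>)"
  by (simp add: m_bound_def translate_def)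

lemma suitable_m_bound_moduli:
  fixes f :: "('n::finite) dfield"
  assumes f: "f \<in> LC p" and eq: "L1loc_equicontinuous_m_bounds f"
  shows "suitable_moduli (m_bound_moduli f)"
proof -
  define F where "F j t s = (\<integral>\<^sup>+ u\<in>{t..t + s}. m_bound j f u \<partial>lebesgue)" for j and t s :: real
  define G where "G j s = (SUP t. F j t s)" for j s
  have meas [measurable]: "m_bound j f \<in> borel_measurable lebesgue" for j
    by (rule m_bound_measurable[OF f])
  have mono: "G j s \<le> G j' s'" if "j \<le> j'" "s \<le> s'" for j j' s s'
  proof -
    have "m_bound j f u \<le> m_bound j' f u" for u
      unfolding m_bound_def by (intro SUP_subset_mono subset_cball) (use that in auto)
    then show ?thesis
      unfolding G_def F_def using that
      by (intro SUP_mono' nn_integral_mono mult_mono) (auto simp: indicator_def)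
  qed
  have sub: "G j (s + h) \<le> G j s + G j h" if "0 \<le> s" "0 \<le> h" for j s h
    unfolding G_def
  proof (intro SUP_least)
    fix t
    have "F j t (s + h) \<le> (\<integral>\<^sup>+ u. m_bound j f u * indicator {t..t + s} u + m_bound j f u * indicator {t + s..t + s + h} u \<partial>lebesgue)"
      unfolding F_def by (intro nn_integral_mono) (auto simp: indicator_def)
    also have "\<dots> = F j t s + F j (t + s) h"
      unfolding F_def by (intro nn_integral_add borel_measurable_times_ennreal borel_measurable_indicator meas) auto
    also have "\<dots> \<le> (SUP t. F j t s) + (SUP t. F j t h)"
      by (intro add_mono SUP_upper) auto
    finally show "F j t (s + h) \<le> (SUP t. F j t s) + (SUP t. F j t h)" .
  qed
  have shift: "(\<integral>\<^sup>+ u\<in>{0..h}. m_bound j (translate \<tau> f) u \<partial>lebesgue) = F j \<tau> h" for j \<tau> h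
  proof -
    have "F j \<tau> h = (\<integral>\<^sup>+ u. m_bound j f (\<tau> + 1 * u) * indicator {\<tau>..\<tau> + h} (\<tau> + 1 * u) \<partial>lebesgue)"
      unfolding F_def by (subst nn_integral_real_affine_lebesgue[where c = 1 and t = \<tau>])
        (auto intro!: borel_measurable_times_ennreal borel_measurable_indicator meas)
    then show ?thesis
      by (simp add: m_bound_translate add.commute indicator_def)
  qed
  have small: "\<exists>\<delta>>0. \<forall>h. h < \<delta> \<longrightarrow> G j h < ennreal e" if "e > 0" for j and e :: real
  proof -
    obtain \<delta> where \<delta>: "\<delta> > 0" "\<And>s t. \<lbrakk>- 1 \<le> s; s \<le> t; t \<le> 1; t - s < \<delta>\<rbrakk> \<Longrightarrow>
        (SUP \<tau>::real. \<integral>\<^sup>+ u\<in>{s..t}. m_bound j (translate \<tau> f) u \<partial>lebesgue) < ennreal e"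
      using eq[unfolded L1loc_equicontinuous_m_bounds_def, rule_format, of 1 e j] \<open>e > 0\<close> by auto
    show ?thesis
    proof (intro exI conjI allI impI)
      show "0 < min \<delta> 1" using \<delta>(1) by simp
      fix h assume h: "h < min \<delta> 1"
      have "G j (max 0 h) < ennreal e"
        using \<delta>(2)[of 0 "max 0 h"] h \<delta>(1) by (simp add: shift G_def)
      then show "G j h < ennreal e"
        using mono[of j j h "max 0 h"] by simp
    qed
  qed
  have fin: "G j s < \<infinity>" for j s
  proof -
    obtain \<delta> where \<delta>: "\<delta> > 0" "\<And>h. h < \<delta> \<Longrightarrow> G j h < ennreal 1"
      using small[of 1 j] by auto
    have n: "G j (real n * (\<delta> / 2)) < \<infinity>" for n
    proof (induction n)
      case 0 then show ?case using \<delta>(2)[of 0] \<delta>(1) by (simp add: order_less_le_trans[of _ 1])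
    next
      case (Suc n)
      have "G j (real n * (\<delta> / 2) + \<delta> / 2) \<le> G j (real n * (\<delta> / 2)) + G j (\<delta> / 2)"
        using \<delta>(1) by (intro sub) auto
      also have "\<dots> < \<infinity>"
        using Suc \<delta>(2)[of "\<delta> / 2"] \<delta>(1) by (auto simp: less_top[symmetric])
      also have "real n * (\<delta> / 2) + \<delta> / 2 = real (Suc n) * (\<delta> / 2)"
        by (simp add: field_simps)
      finally show ?case .
    qed
    obtain n where "s \<le> real n * (\<delta> / 2)"
      using reals_Archimedean3[of "\<delta> / 2"] \<delta>(1) less_imp_le by (meson half_gt_zero)
    then show ?thesis
      by (intro le_less_trans[OF mono[OF order_refl] n])
  qed
  define g where "g j s = enn2real (G j s)" for j s
  have Gg: "G j s = ennreal (g j s)" for j s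
    using fin[of j s] by (simp add: g_def)
  have g0: "0 \<le> g j s" for j s by (simp add: g_def)
  have th: "m_bound_moduli f I j = g j" for I j
    by (rule ext) (simp add: m_bound_moduli_def g_def G_def F_def)
  have gmono: "g j s \<le> g j' s'" if "j \<le> j'" "s \<le> s'" for j j' s s'
    using mono[OF that] g0 by (simp add: Gg)
  have gsub: "g j (s + h) \<le> g j s + g j h" if "0 \<le> s" "0 \<le> h" for j s h
    using sub[OF that] g0 by (simp add: Gg flip: ennreal_plus)
  have gsmall: "\<exists>\<delta>>0. \<forall>h. h < \<delta> \<longrightarrow> g j h < e" if "e > 0" for j and e :: real
    using small[OF that, of j] g0 that by (simp add: Gg ennreal_less_iff)
  have gz: "g j 0 = 0" for j
  proof (rule ccontr)
    assume "g j 0 \<noteq> 0"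
    then have "g j 0 > 0" using g0[of j 0] by simp
    then show False using gsmall[of "g j 0" j] by auto
  qed
  have gcont: "continuous_on {0..} (g j)" for j
    unfolding continuous_on_iff
  proof (intro ballI allI impI)
    fix s e :: real assume s: "s \<in> {0..}" and "0 < e"
    obtain \<delta> where \<delta>: "\<delta> > 0" "\<And>h. h < \<delta> \<Longrightarrow> g j h < e"
      using gsmall[OF \<open>0 < e\<close>, of j] by auto
    have "\<bar>g j s' - g j s\<bar> < e" if "0 \<le> s'" "\<bar>s' - s\<bar> < \<delta>" for s'
    proof (cases "s \<le> s'")
      case True
      then show ?thesis
        using gsub[of s "s' - s" j] gmono[of j j s s'] \<delta>(2)[of "s' - s"] s that by auto
    next
      case False
      then show ?thesis
        using gsub[of s' "s - s'" j] gmono[of j j s' s] \<delta>(2)[of "s - s'"] s that by auto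
    qed
    then show "\<exists>d>0. \<forall>x'\<in>{0..}. dist x' s < d \<longrightarrow> dist (g j x') (g j s) < e"
      using \<delta>(1) by (auto simp: dist_real_def)
  qed
  show ?thesis
    unfolding suitable_moduli_def th
    using g0 gz gcont gmono by (auto intro!: mono_onI)
qed

definition moduli_ball ::
  "(real set \<Rightarrow> nat \<Rightarrow> real \<Rightarrow> real) \<Rightarrow> real set \<Rightarrow> nat \<Rightarrow> (real \<Rightarrow> real ^ 'n::finite) set" where
  "moduli_ball \<Theta> I j = {x. continuous_on I x \<and> x ` I \<subseteq> cball 0 (real j) \<and>
     (\<forall>t\<in>I. \<forall>s\<in>I. norm (x t - x s) \<le> \<Theta> I j \<bar>t - s\<bar>)}"

section \<open>Seminorms and topologies\<close>

definition seminorm_ThetaB ::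
  "(real set \<Rightarrow> nat \<Rightarrow> real \<Rightarrow> real) \<Rightarrow> nat \<Rightarrow> real set \<Rightarrow> nat \<Rightarrow> ('n::finite) dfield \<Rightarrow> real" where
  "seminorm_ThetaB \<Theta> p I j f =
     (SUP (x, u) \<in> moduli_ball \<Theta> I j \<times>
                   {u. continuous_on ((\<lambda>t. t - 1) ` I) u \<and> u ` ((\<lambda>t. t - 1) ` I) \<subseteq> cball 0 (real j)}.
        root p (LINT t:I|lebesgue. norm (f (t, x t, u (t - 1))) ^ p))"

definition seminorm_ThetaD ::
  "(real set \<Rightarrow> nat \<Rightarrow> real \<Rightarrow> real) \<Rightarrow> real ^ 'n \<Rightarrow> real set \<Rightarrow> nat \<Rightarrow> ('n::finite) dfield \<Rightarrow> real" where
  "seminorm_ThetaD \<Theta> u I j f =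
     (SUP x \<in> moduli_ball \<Theta> I j. LINT t:I|lebesgue. norm (f (t, x t, u)))"

definition seminorm_sigma_ThetaD ::
  "(real set \<Rightarrow> nat \<Rightarrow> real \<Rightarrow> real) \<Rightarrow> real ^ 'n \<Rightarrow> real set \<Rightarrow> nat \<Rightarrow> ('n::finite) dfield \<Rightarrow> real" where
  "seminorm_sigma_ThetaD \<Theta> u I j f =
     (SUP x \<in> moduli_ball \<Theta> I j. norm (LINT t:I|lebesgue. f (t, x t, u)))"

definition seminorm_topology ::
  "('n::finite) dfield set set \<Rightarrow> ('n dfield \<Rightarrow> real) set \<Rightarrow> 'n dfield set topology" where
  "seminorm_topology E S = topology_generated_by
     {{H \<in> E. \<rho> (\<lambda>w. rep H w - rep G w) < \<epsilon>} | \<rho> G \<epsilon>. \<rho> \<in> S \<and> G \<in> E \<and> 0 < \<epsilon>}"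

definition T_ThetaB ::
  "(real set \<Rightarrow> nat \<Rightarrow> real \<Rightarrow> real) \<Rightarrow> nat \<Rightarrow> ('n::finite) dfield set topology" where
  "T_ThetaB \<Theta> p = seminorm_topology (LC_space p)
     {seminorm_ThetaB \<Theta> p I j | I j. I \<in> rational_intervals}"

definition T_ThetaD ::
  "(real set \<Rightarrow> nat \<Rightarrow> real \<Rightarrow> real) \<Rightarrow> (real ^ 'n) set \<Rightarrow> ('n::finite) dfield set topology" where
  "T_ThetaD \<Theta> D = seminorm_topology (LC_space 1)
     {seminorm_ThetaD \<Theta> u I j | u I j. u \<in> D \<and> I \<in> rational_intervals}"

definition sigma_ThetaD ::
  "(real set \<Rightarrow> nat \<Rightarrow> real \<Rightarrow> real) \<Rightarrow> (real ^ 'n) set \<Rightarrow> ('n::finite) dfield set topology" where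
  "sigma_ThetaD \<Theta> D = seminorm_topology (LC_space 1)
     {seminorm_sigma_ThetaD \<Theta> u I j | u I j. u \<in> D \<and> I \<in> rational_intervals}"

definition translation_hull :: "nat \<Rightarrow> ('n::finite) dfield set topology \<Rightarrow> 'n dfield \<Rightarrow> 'n dfield set set" where
  "translation_hull p T f = T closure_of (range (\<lambda>t. LC_class p (translate t f)))"

section \<open>Caratheodory solutions of the delay equation\<close>

definition phase_space :: "(real \<Rightarrow> real ^ 'n::finite) metric" where
  "phase_space = cfunspace (top_of_set {-1..0}) euclidean_metric"

definition absolutely_continuous_on_interval ::
  "real \<Rightarrow> real \<Rightarrow> (real \<Rightarrow> 'a::real_normed_vector) \<Rightarrow> bool" where
  "absolutely_continuous_on_interval a b x \<longleftrightarrow>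
     (\<forall>\<epsilon>>0. \<exists>\<delta>>0. \<forall>\<D>. \<D> division_of \<Union>\<D> \<and> \<Union>\<D> \<subseteq> {a..b} \<and> (\<Sum>K\<in>\<D>. Sup K - Inf K) < \<delta> \<longrightarrow>
        (\<Sum>K\<in>\<D>. norm (x (Sup K) - x (Inf K))) < \<epsilon>)"

definition solution_interval :: "ereal \<Rightarrow> real set" where
  "solution_interval b = {t. -1 \<le> t \<and> ereal t < b}"

definition is_solution ::
  "('n::finite) dfield \<Rightarrow> (real \<Rightarrow> real ^ 'n) \<Rightarrow> ereal \<Rightarrow> (real \<Rightarrow> real ^ 'n) \<Rightarrow> bool" where
  "is_solution g \<phi> b x \<longleftrightarrow> 0 < b \<and>
     continuous_on (solution_interval b) x \<and>
     (\<forall>t\<in>{-1..0}. x t = \<phi> t) \<and>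
     (\<forall>c\<ge>0. ereal c < b \<longrightarrow> absolutely_continuous_on_interval 0 c x) \<and>
     (AE t in lebesgue. 0 < t \<and> ereal t < b \<longrightarrow>
        (x has_vector_derivative g (t, x t, x (t - 1))) (at t))"

(* Solutions are made extensional so that the maximal one is unique as a total function. *)
definition is_maximal_solution ::
  "('n::finite) dfield \<Rightarrow> (real \<Rightarrow> real ^ 'n) \<Rightarrow> ereal \<Rightarrow> (real \<Rightarrow> real ^ 'n) \<Rightarrow> bool" where
  "is_maximal_solution g \<phi> b x \<longleftrightarrow>
     is_solution g \<phi> b x \<and> x \<in> extensional (solution_interval b) \<and>
     (\<forall>c y. is_solution g \<phi> c y \<and> b \<le> c \<and> (\<forall>t\<in>solution_interval b. y t = x t) \<longrightarrow> c = b)"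

definition maximal_solution ::
  "('n::finite) dfield \<Rightarrow> (real \<Rightarrow> real ^ 'n) \<Rightarrow> ereal \<times> (real \<Rightarrow> real ^ 'n)" where
  "maximal_solution g \<phi> = (THE bx. is_maximal_solution g \<phi> (fst bx) (snd bx))"

definition sol_interval :: "('n::finite) dfield \<Rightarrow> (real \<Rightarrow> real ^ 'n) \<Rightarrow> real set" where
  "sol_interval g \<phi> = solution_interval (fst (maximal_solution g \<phi>))"

definition sol :: "('n::finite) dfield \<Rightarrow> (real \<Rightarrow> real ^ 'n) \<Rightarrow> real \<Rightarrow> real ^ 'n" where
  "sol g \<phi> = snd (maximal_solution g \<phi>)"

definition sol_segment ::
  "real \<Rightarrow> ('n::finite) dfield \<Rightarrow> (real \<Rightarrow> real ^ 'n) \<Rightarrow> real \<Rightarrow> real ^ 'n" where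
  "sol_segment t g \<phi> = restrict (\<lambda>s. sol g \<phi> (t + s)) {-1..0}"

section \<open>Local semiflows\<close>

definition local_continuous_semiflow ::
  "'a topology \<Rightarrow> (real \<times> 'a) set \<Rightarrow> (real \<times> 'a \<Rightarrow> 'a) \<Rightarrow> bool" where
  "local_continuous_semiflow X U \<Phi> \<longleftrightarrow>
     openin (prod_topology (top_of_set {0..}) X) U \<and>
     {0} \<times> topspace X \<subseteq> U \<and>
     continuous_map (subtopology (prod_topology (top_of_set {0..}) X) U) X \<Phi> \<and>
     (\<forall>x\<in>topspace X. \<Phi> (0, x) = x) \<and>
     (\<forall>s t x. (s, x) \<in> U \<and> (t, \<Phi> (s, x)) \<in> U \<longrightarrow>
        (t + s, x) \<in> U \<and> \<Phi> (t + s, x) = \<Phi> (t, \<Phi> (s, x)))"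

definition local_continuous_skew_product_semiflow ::
  "'y topology \<Rightarrow> 'z topology \<Rightarrow> (real \<times> 'y \<times> 'z) set \<Rightarrow> (real \<times> 'y \<times> 'z \<Rightarrow> 'y \<times> 'z) \<Rightarrow> bool" where
  "local_continuous_skew_product_semiflow Y Z U \<Phi> \<longleftrightarrow>
     local_continuous_semiflow (prod_topology Y Z) U \<Phi> \<and>
     (\<forall>t y z z'. (t, y, z) \<in> U \<and> (t, y, z') \<in> U \<longrightarrow> fst (\<Phi> (t, y, z)) = fst (\<Phi> (t, y, z')))"

definition flow_domain ::
  "('n::finite) dfield set set \<Rightarrow> (real \<times> 'n dfield set \<times> (real \<Rightarrow> real ^ 'n)) set" where
  "flow_domain H = {(t, G, \<phi>). G \<in> H \<and> \<phi> \<in> mspace phase_space \<and> t \<in> sol_interval (rep G) \<phi> \<and> 0 \<le> t}"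

(* The translate of a class is the image of the class under translation. *)
definition flow_map ::
  "real \<times> ('n::finite) dfield set \<times> (real \<Rightarrow> real ^ 'n) \<Rightarrow> 'n dfield set \<times> (real \<Rightarrow> real ^ 'n)" where
  "flow_map = (\<lambda>(t, G, \<phi>). (translate t ` G, sol_segment t (rep G) \<phi>))"

definition defines_skew_product_semiflow ::
  "nat \<Rightarrow> ('n::finite) dfield set topology \<Rightarrow> 'n dfield \<Rightarrow> bool" where
  "defines_skew_product_semiflow p T f \<longleftrightarrow>
     local_continuous_skew_product_semiflow (subtopology T (translation_hull p T f)) (mtopology_of phase_space)
       (flow_domain (translation_hull p T f)) flow_map"

end

theory Submission
  imports Defs
begin

text \<open>Let \<open>x\<close> solve the equation for \<open>g\<close>, and let \<open>y\<close> be a solution for a nearby pair \<open>(g', \<phi>')\<close>, projected to a large ball.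
  Then \<open>y\<close> solves the equation for \<open>g\<close> up to the error \<open>\<integral> g'(r, y r, y (r - 1)) - g(r, y r, y (r - 1)) dr\<close>,
  and a Gronwall argument for the field \<open>g\<close> alone bounds the distance of \<open>y\<close> from \<open>x\<close>; this gives both the continuity of the
  solution and the openness of the domain, as soon as that error is small uniformly in \<open>y\<close>. The \<open>m\<close>-bounds of \<open>f\<close> pass to
  the whole hull, so that \<open>y\<close> has the modulus of continuity \<open>\<theta>\<close> and is one of the curves over which the seminorms take
  their supremum. For the topology with continuous delayed arguments this already controls the error. For the topologies with
  delayed arguments frozen in \<open>D\<close> the equicontinuous delayed curve is replaced by a step function with values in a
  finite part of \<open>D\<close>, and the integrals of the \<open>l\<^sub>2\<close>-bounds, which are also inherited by the hull, make the
  replacement harmless. Translation acts continuously because it is continuous in \<open>L\<^sup>p\<close> along bounded curves,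
  uniformly in the curve.\<close>

section \<open>Absolutely continuous functions and a delay Gronwall inequality\<close>

text \<open>The obstacle: the seminorms test a field only along curves with prescribed moduli, so a
  member of the hull cannot be compared with the orbit along an arbitrary continuous curve, and it
  is not known beforehand that solutions of its own equation obey those moduli. Constants, however,
  belong to the test curves whatever the moduli are. A continuous curve is therefore replaced by a
  step function on a rational grid with delayed values in \<open>D\<close>. Along it finitely many
  neighbourhoods bring some \<open>translate \<tau> f\<close> as close as desired, and the bound of
  the orbit is inherited. The replacement leaves the ball slightly, which is why a curve of radius
  \<open>j\<close> gets the modulus of index \<open>Suc j\<close>; \<open>2 * R\<close> is the
  radius of the pair of present and delayed value. Times are arbitrary reals while the seminorms
  know only rational intervals; where the seminorm is not monotone in the interval, the uniform
  modulus of the hull pays for the leftover pieces. Solutions are treated through the integrated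
  equation, and existence, uniqueness and comparison all rest on the weight
  \<open>W\<close>.\<close>

lemma has_integral_AC_derivative:
  fixes F :: "real \<Rightarrow> 'a::real_normed_vector"
  assumes "a \<le> b" and AC: "absolutely_continuous_on_interval a b F"
    and N: "negligible N"
    and der: "\<And>t. t \<in> {a..b} - N \<Longrightarrow> (F has_vector_derivative f t) (at t within {a..b})"
  shows "(f has_integral F b - F a) {a..b}"
proof -
  \<comment> \<open>Tags in \<open>N\<close> then contribute no Riemann term, and only the
    increments of \<open>F\<close> are left there.\<close>
  define f' where "f' t = (if t \<in> N then 0 else f t)" for t
  have "(f' has_integral F b - F a) {a..b}"
    unfolding has_integral_real
  proof (intro allI impI)
    fix e :: real assume "0 < e"
    \<comment> \<open>The \<open>+ 1\<close> keeps the denominator positive when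
      \<open>a = b\<close>.\<close>
    define e1 where "e1 = e / (2 * (b - a + 1))"
    have e1: "0 < e1" "e1 * (b - a) < e / 2"
      using \<open>0 < e\<close> \<open>a \<le> b\<close> by (auto simp: e1_def field_simps)
    obtain \<delta> where \<delta>: "0 < \<delta>" "\<And>\<D>. \<lbrakk>\<D> division_of \<Union>\<D>; \<Union>\<D> \<subseteq> {a..b}; (\<Sum>K\<in>\<D>. Sup K - Inf K) < \<delta>\<rbrakk>
        \<Longrightarrow> (\<Sum>K\<in>\<D>. norm (F (Sup K) - F (Inf K))) < e / 2"
      using AC[unfolded absolutely_continuous_on_interval_def, rule_format, OF half_gt_zero[OF \<open>0 < e\<close>]] by auto
    have "N \<in> sets lebesgue" using N by (simp add: negligible_iff_null_sets null_setsD2)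
    \<comment> \<open>An open set around the null set \<open>N\<close>, smaller than the threshold
      \<open>\<delta>\<close> of absolute continuity: intervals tagged in \<open>N\<close> will lie
      inside it, so their total length is below \<open>\<delta>\<close>.\<close>
    then obtain W where W: "open W" "N \<subseteq> W" "W - N \<in> lmeasurable" "emeasure lebesgue (W - N) < ennreal \<delta>"
      using sets_lebesgue_outer_open \<delta>(1) by metis
    have Om: "W \<in> lmeasurable" "measure lebesgue W < \<delta>"
    proof -
      have "N \<in> lmeasurable" using N negligible_iff_measure by blast
      moreover have "W = (W - N) \<union> N" using W(2) by auto
      ultimately show 1: "W \<in> lmeasurable" using W(3) by (metis fmeasurable.Un)
      have "emeasure lebesgue W = emeasure lebesgue (W - N)"
        using emeasure_Diff_null_set[of N lebesgue W] N 1 by (simp add: negligible_iff_null_sets fmeasurableD)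
      then have "ennreal (measure lebesgue W) < ennreal \<delta>"
        using W(4) 1 by (simp add: emeasure_eq_measure2)
      then show "measure lebesgue W < \<delta>" by (simp add: ennreal_less_iff)
    qed
    \<comment> \<open>The gauge has two regimes: at tags in \<open>N\<close> it keeps the interval
      inside \<open>W\<close>, at the other tags it makes the difference quotient over any interval
      straddling the tag close to the derivative.\<close>
    have "\<exists>r>0. (t \<in> N \<longrightarrow> ball t r \<subseteq> W) \<and> (t \<in> {a..b} - N \<longrightarrow>
        (\<forall>u v. u \<in> {a..b} \<and> v \<in> {a..b} \<and> u \<le> t \<and> t \<le> v \<and> {u..v} \<subseteq> ball t r \<longrightarrow>
           norm ((v - u) *\<^sub>R f t - (F v - F u)) \<le> e1 * (v - u)))" for t
    proof (cases "t \<in> {a..b} - N")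
      case True
      then have "(F has_derivative (\<lambda>x. x *\<^sub>R f t)) (at t within {a..b})"
        using der by (simp add: has_vector_derivative_def)
      then obtain r where r: "r > 0" "\<And>y. \<lbrakk>y \<in> {a..b}; norm (y - t) < r\<rbrakk> \<Longrightarrow>
           norm (F y - F t - (y - t) *\<^sub>R f t) \<le> e1 * norm (y - t)"
        unfolding has_derivative_within_alt using e1(1) by blast
      show ?thesis
      proof (intro exI conjI impI allI)
        show "0 < r" by fact
        show "ball t r \<subseteq> W" if "t \<in> N" using True that by auto
        fix u v assume uv: "u \<in> {a..b} \<and> v \<in> {a..b} \<and> u \<le> t \<and> t \<le> v \<and> {u..v} \<subseteq> ball t r"
        then have "u \<in> {u..v}" "v \<in> {u..v}" by auto
        then have "u \<in> ball t r" "v \<in> ball t r" using uv by blast+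
        then have "norm (F u - F t - (u - t) *\<^sub>R f t) \<le> e1 * (t - u)" "norm (F v - F t - (v - t) *\<^sub>R f t) \<le> e1 * (v - t)"
          using r(2)[of u] r(2)[of v] uv by (auto simp: dist_real_def)
        moreover have eq: "(v - u) *\<^sub>R f t - (F v - F u) = (F u - F t - (u - t) *\<^sub>R f t) - (F v - F t - (v - t) *\<^sub>R f t)"
          by (simp add: algebra_simps)
        ultimately have "norm ((v - u) *\<^sub>R f t - (F v - F u)) \<le> e1 * (t - u) + e1 * (v - t)"
          unfolding eq by (intro order_trans[OF norm_triangle_ineq4 add_mono])
        then show "norm ((v - u) *\<^sub>R f t - (F v - F u)) \<le> e1 * (v - u)" by (simp add: algebra_simps)
      qed
    next
      case False
      show ?thesis
      proof (cases "t \<in> N")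
        case True
        then obtain r where "r > 0" "ball t r \<subseteq> W" using W(1,2) openE by blast
        then show ?thesis using False by auto
      next
        case False2: False
        then show ?thesis using False by (intro exI[of _ 1]) auto
      qed
    qed
    then obtain r where r: "\<And>t. r t > 0" "\<And>t. t \<in> N \<Longrightarrow> ball t (r t) \<subseteq> W"
      "\<And>t u v. \<lbrakk>t \<in> {a..b} - N; u \<in> {a..b}; v \<in> {a..b}; u \<le> t; t \<le> v; {u..v} \<subseteq> ball t (r t)\<rbrakk>
        \<Longrightarrow> norm ((v - u) *\<^sub>R f t - (F v - F u)) \<le> e1 * (v - u)" by metis
    show "\<exists>\<gamma>. gauge \<gamma> \<and> (\<forall>\<D>. \<D> tagged_division_of {a..b} \<and> \<gamma> fine \<D> \<longrightarrow>
        norm ((\<Sum>(x, k)\<in>\<D>. measure lborel k *\<^sub>R f' x) - (F b - F a)) < e)"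
    proof (intro exI conjI allI impI)
      show "gauge (\<lambda>t. ball t (r t))" using r(1) by (simp add: gauge_ball_dependent)
      fix \<D> assume "\<D> tagged_division_of {a..b} \<and> (\<lambda>t. ball t (r t)) fine \<D>"
      then have td: "\<D> tagged_division_of {a..b}" and fine: "\<And>x K. (x,K) \<in> \<D> \<Longrightarrow> K \<subseteq> ball x (r x)"
        by (auto simp: fine_def)
      note finD = tagged_division_of_finite[OF td]
      have elt: "\<exists>u v. K = {u..v} \<and> u \<le> v \<and> u \<in> {a..b} \<and> v \<in> {a..b} \<and> u \<le> x \<and> x \<le> v \<and> Sup K = v \<and> Inf K = u \<and> measure lborel K = v - u"
        if xK: "(x, K) \<in> \<D>" for x K
      proof -
        obtain u v where K: "K = {u..v}" using tagged_division_ofD(4)[OF td xK] by auto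
        have "x \<in> K" "K \<subseteq> {a..b}" using tagged_division_ofD(2,3)[OF td xK] by blast+
        then have "u \<le> v" "u \<in> {a..b}" "v \<in> {a..b}" "u \<le> x" "x \<le> v" using K by auto
        then show ?thesis using K by (intro exI[of _ u] exI[of _ v]) simp
      qed
      have tel: "(\<Sum>(x,K)\<in>\<D>. F (Sup K) - F (Inf K)) = F b - F a" "(\<Sum>(x,K)\<in>\<D>. Sup K - Inf K) = b - a"
        using additive_tagged_division_1[OF \<open>a \<le> b\<close> td, of F] additive_tagged_division_1[OF \<open>a \<le> b\<close> td, of "\<lambda>x. x"] by simp_all
      define DN where "DN = {(x,K) \<in> \<D>. x \<in> N}"
      have DN: "DN \<subseteq> \<D>" "finite DN" using finD by (auto simp: DN_def intro: finite_subset)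
      define h where "h = (\<lambda>(x,K). measure lborel K *\<^sub>R f' x - (F (Sup K) - F (Inf K)))"
      define S where "S = snd ` DN"
      have part: "DN tagged_partial_division_of {a..b}"
        using td unfolding tagged_division_of_def by (intro tagged_partial_division_subset[OF _ DN(1)]) blast
      have Sdiv: "S division_of \<Union>S" unfolding S_def by (rule partial_division_of_tagged_division[OF part])
      have Ssub: "\<Union>S \<subseteq> {a..b}"
      proof
        fix y assume "y \<in> \<Union>S"
        then obtain x K where "(x,K) \<in> DN" "y \<in> K" by (auto simp: S_def)
        then show "y \<in> {a..b}" using tagged_division_ofD(3)[OF td, of x K] DN(1) by blast
      qed
      have SO: "\<Union>S \<subseteq> W"
      proof
        fix y assume "y \<in> \<Union>S"
        then obtain x K where "(x,K) \<in> DN" "y \<in> K" by (auto simp: S_def)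
        then show "y \<in> W" using fine[of x K] r(2)[of x] by (auto simp: DN_def)
      qed
      have lenS: "(\<Sum>K\<in>S. Sup K - Inf K) < \<delta>"
      proof -
        have "(\<Sum>K\<in>S. Sup K - Inf K) = (\<Sum>K\<in>S. measure lebesgue K)"
        proof (rule sum.cong[OF refl])
          fix K assume "K \<in> S"
          then obtain x where "(x,K) \<in> \<D>" using DN(1) by (auto simp: S_def)
          then obtain u v where "K = {u..v}" "u \<le> v" using elt[of x K] by blast
          then show "Sup K - Inf K = measure lebesgue K" by simp
        qed
        also have "\<dots> = measure lebesgue (\<Union>S)" using content_division[OF Sdiv] by simp
        also have "\<dots> \<le> measure lebesgue W"
        proof (rule measure_mono_fmeasurable[OF SO _ Om(1)])
          show "\<Union>S \<in> sets lebesgue" using lmeasurable_division[OF Sdiv] by (simp add: fmeasurableD)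
        qed
        finally show ?thesis using Om(2) by simp
      qed
      have sumN: "(\<Sum>z\<in>DN. norm (h z)) < e / 2"
      proof -
        have "(\<Sum>z\<in>DN. norm (h z)) = (\<Sum>(x,K)\<in>DN. norm (F (Sup K) - F (Inf K)))"
          by (intro sum.cong) (auto simp: DN_def h_def f'_def norm_minus_commute)
        also have "\<dots> = (\<Sum>K\<in>S. norm (F (Sup K) - F (Inf K)))"
        proof -
          have eqS: "DN tagged_division_of \<Union>S"
            using part unfolding S_def tagged_partial_division_of_def tagged_division_of_def by auto
          \<comment> \<open>The passage from tagged pairs to intervals wants a summand that vanishes
            on every interval with empty interior, the empty one included, where \<open>Sup\<close>
            and \<open>Inf\<close> are unspecified.\<close>
          define d where "d K = (if K = {} then 0 else norm (F (Sup K) - F (Inf K)))" for K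
          have "(\<Sum>(x,K)\<in>DN. norm (F (Sup K) - F (Inf K))) = (\<Sum>(x,K)\<in>DN. d K)"
          proof (intro sum.cong[OF refl], clarify)
            fix x K assume "(x,K) \<in> DN"
            then have "x \<in> K" using tagged_division_ofD(2)[OF td, of x K] DN(1) by blast
            then show "norm (F (Sup K) - F (Inf K)) = d K" by (auto simp: d_def)
          qed
          also have "\<dots> = (\<Sum>K\<in>snd ` DN. d K)"
          proof (rule sum.over_tagged_division_lemma[OF eqS])
            fix u v :: real assume "box u v = {}"
            then have "u \<ge> v" by (simp add: box_real)
            then show "d (cbox u v) = 0" by (cases "u = v") (auto simp: d_def)
          qed
          also have "\<dots> = (\<Sum>K\<in>S. norm (F (Sup K) - F (Inf K)))"
            unfolding S_def[symmetric] using division_ofD(3)[OF Sdiv] by (intro sum.cong) (auto simp: d_def)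
          finally show ?thesis .
        qed
        also have "\<dots> < e / 2" by (rule \<delta>(2)[OF Sdiv Ssub lenS])
        finally show ?thesis .
      qed
      have sumO: "(\<Sum>z\<in>\<D> - DN. norm (h z)) \<le> e1 * (b - a)"
      proof -
        have "(\<Sum>z\<in>\<D> - DN. norm (h z)) \<le> (\<Sum>(x,K)\<in>\<D> - DN. e1 * (Sup K - Inf K))"
        proof (rule sum_mono, clarify)
          fix x K assume xK: "(x,K) \<in> \<D>" "(x,K) \<notin> DN"
          then have "x \<notin> N" by (auto simp: DN_def)
          obtain u v where uv: "K = {u..v}" "u \<le> v" "u \<in> {a..b}" "v \<in> {a..b}" "u \<le> x" "x \<le> v" "Sup K = v" "Inf K = u" "measure lborel K = v - u"
            using elt[OF xK(1)] by blast
          then show "norm (h (x, K)) \<le> e1 * (Sup K - Inf K)"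
            using r(3)[of x u v] fine[OF xK(1)] \<open>x \<notin> N\<close> by (auto simp: h_def f'_def)
        qed
        also have "\<dots> \<le> (\<Sum>(x,K)\<in>\<D>. e1 * (Sup K - Inf K))"
        proof (rule sum_mono2[OF finD], blast)
          fix z assume "z \<in> \<D> - (\<D> - DN)"
          then obtain x K where z: "z = (x,K)" "(x,K) \<in> \<D>" by (cases z) auto
          then show "0 \<le> (case z of (x, K) \<Rightarrow> e1 * (Sup K - Inf K))" using elt[OF z(2)] e1(1) by auto
        qed
        also have "\<dots> = e1 * (b - a)" using tel(2) by (simp add: sum_distrib_left[symmetric] case_prod_unfold)
        finally show ?thesis .
      qed
      have "norm ((\<Sum>(x, k)\<in>\<D>. measure lborel k *\<^sub>R f' x) - (F b - F a)) = norm (\<Sum>z\<in>\<D>. h z)"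
        unfolding tel(1)[symmetric] h_def by (simp add: sum_subtractf case_prod_unfold)
      also have "\<dots> \<le> (\<Sum>z\<in>\<D>. norm (h z))" by (rule norm_sum)
      also have "\<dots> = (\<Sum>z\<in>\<D> - DN. norm (h z)) + (\<Sum>z\<in>DN. norm (h z))"
        by (rule sum.subset_diff[OF DN(1) finD])
      also have "\<dots> < e" using sumN sumO e1(2) by linarith
      finally show "norm ((\<Sum>(x, k)\<in>\<D>. measure lborel k *\<^sub>R f' x) - (F b - F a)) < e" .
    qed
  qed
  then show ?thesis
    by (rule has_integral_spike[OF N, rotated]) (auto simp: f'_def)
qed


text \<open>Used with \<open>x\<close> an indefinite integral: increments of the exponential weight,
  and of a solution of the integrated equation, are dominated by increments of such an
  integral.\<close>

lemma AC_lipschitz_image: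
  fixes x :: "real \<Rightarrow> 'a::real_normed_vector" and y :: "real \<Rightarrow> 'b::real_normed_vector"
  assumes AC: "absolutely_continuous_on_interval a b x"
    and B: "\<And>u v. \<lbrakk>u \<in> {a..b}; v \<in> {a..b}\<rbrakk> \<Longrightarrow> norm (y v - y u) \<le> B * norm (x v - x u)"
  shows "absolutely_continuous_on_interval a b y"
  unfolding absolutely_continuous_on_interval_def
proof (intro allI impI)
  fix e :: real assume "0 < e"
  define C where "C = max 1 B"
  have "C > 0" by (simp add: C_def)
  obtain \<delta> where \<delta>: "0 < \<delta>" "\<And>\<D>. \<lbrakk>\<D> division_of \<Union>\<D>; \<Union>\<D> \<subseteq> {a..b}; (\<Sum>K\<in>\<D>. Sup K - Inf K) < \<delta>\<rbrakk>
        \<Longrightarrow> (\<Sum>K\<in>\<D>. norm (x (Sup K) - x (Inf K))) < e / C"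
    using AC[unfolded absolutely_continuous_on_interval_def, rule_format, of "e / C"] \<open>0 < e\<close> \<open>C > 0\<close> by auto
  show "\<exists>\<delta>>0. \<forall>\<D>. \<D> division_of \<Union>\<D> \<and> \<Union>\<D> \<subseteq> {a..b} \<and> (\<Sum>K\<in>\<D>. Sup K - Inf K) < \<delta> \<longrightarrow>
        (\<Sum>K\<in>\<D>. norm (y (Sup K) - y (Inf K))) < e"
  proof (intro exI[of _ \<delta>] conjI allI impI \<delta>(1), elim conjE)
    fix \<D> assume D: "\<D> division_of \<Union>\<D>" "\<Union>\<D> \<subseteq> {a..b}" "(\<Sum>K\<in>\<D>. Sup K - Inf K) < \<delta>"
    have "(\<Sum>K\<in>\<D>. norm (y (Sup K) - y (Inf K))) \<le> (\<Sum>K\<in>\<D>. C * norm (x (Sup K) - x (Inf K)))"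
    proof (rule sum_mono)
      fix K assume K: "K \<in> \<D>"
      obtain u v where uv: "K = {u..v}" using division_ofD(4)[OF D(1) K] by auto
      have "K \<noteq> {}" using division_ofD(3)[OF D(1) K] .
      then have "u \<le> v" using uv by auto
      have "K \<subseteq> {a..b}" using K D(2) by blast
      then have "norm (y v - y u) \<le> B * norm (x v - x u)"
        using B[of u v] uv \<open>u \<le> v\<close> by auto
      also have "\<dots> \<le> C * norm (x v - x u)" by (intro mult_right_mono) (auto simp: C_def)
      finally show "norm (y (Sup K) - y (Inf K)) \<le> C * norm (x (Sup K) - x (Inf K))"
        using uv \<open>u \<le> v\<close> by simp
    qed
    also have "\<dots> < C * (e / C)"
      unfolding sum_distrib_left[symmetric] using \<delta>(2)[OF D] \<open>C > 0\<close> by (intro mult_strict_left_mono)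
    finally show "(\<Sum>K\<in>\<D>. norm (y (Sup K) - y (Inf K))) < e" using \<open>C > 0\<close> by simp
  qed
qed

text \<open>Truncation: \<open>norm (f t)\<close> is at most \<open>m\<close> plus the excess
  \<open>h m t\<close>, and by dominated convergence the excess has integral below
  \<open>e / 2\<close> for some \<open>m\<close>. On intervals of total length below
  \<open>\<delta>\<close> the bounded part contributes at most
  \<open>m * \<delta> \<le> e / 2\<close>.\<close>

lemma AC_indefinite_integral:
  fixes f :: "real \<Rightarrow> 'a::euclidean_space"
  assumes f: "f absolutely_integrable_on {a..b}"
  shows "absolutely_continuous_on_interval a b (\<lambda>t. integral {a..t} f)"
  unfolding absolutely_continuous_on_interval_def
proof (intro allI impI)
  fix e :: real assume "0 < e"
  define n where "n t = norm (f t)" for t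
  have n: "n absolutely_integrable_on {a..b}" using absolutely_integrable_norm[OF f] by (simp add: n_def[abs_def] comp_def)
  define h where "h k t = max (n t - real k) 0" for k :: nat and t
  have h: "h k absolutely_integrable_on {a..b}" for k
    unfolding h_def by (intro absolutely_integrable_max_1 set_integral_diff n) auto
  have hi: "h k integrable_on {a..b}" for k using h set_lebesgue_integral_eq_integral(1) by blast
  have "(\<lambda>k. integral {a..b} (h k)) \<longlonglongrightarrow> integral {a..b} (\<lambda>t. 0)"
  proof (rule dominated_convergence(2)[OF hi])
    show "n integrable_on {a..b}" using n set_lebesgue_integral_eq_integral(1) by blast
    show "norm (h k t) \<le> n t" for k t by (auto simp: h_def n_def)
    show "(\<lambda>k. h k t) \<longlonglongrightarrow> 0" if "t \<in> {a..b}" for t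
    proof (rule tendsto_eventually)
      obtain m :: nat where "n t \<le> m" using real_arch_simple by blast
      then show "\<forall>\<^sub>F k in sequentially. h k t = 0"
        unfolding eventually_sequentially h_def by (intro exI[of _ m]) auto
    qed
  qed
  then have "(\<lambda>k. integral {a..b} (h k)) \<longlonglongrightarrow> 0" by simp
  then obtain m where m: "integral {a..b} (h m) < e / 2"
    using eventually_happens'[OF sequentially_bot order_tendstoD(2)[of _ 0 sequentially "e / 2"]] \<open>0 < e\<close> by auto
  define \<delta> where "\<delta> = e / (2 * (real m + 1))"
  have \<delta>: "\<delta> > 0" "real m * \<delta> \<le> e / 2" using \<open>0 < e\<close> by (auto simp: \<delta>_def field_simps)
  show "\<exists>\<delta>>0. \<forall>\<D>. \<D> division_of \<Union>\<D> \<and> \<Union>\<D> \<subseteq> {a..b} \<and> (\<Sum>K\<in>\<D>. Sup K - Inf K) < \<delta> \<longrightarrow>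
        (\<Sum>K\<in>\<D>. norm (integral {a..Sup K} f - integral {a..Inf K} f)) < e"
  proof (intro exI[of _ \<delta>] conjI allI impI \<delta>(1), elim conjE)
    fix \<D> assume D: "\<D> division_of \<Union>\<D>" "\<Union>\<D> \<subseteq> {a..b}" "(\<Sum>K\<in>\<D>. Sup K - Inf K) < \<delta>"
    have hK: "h m integrable_on K" if K: "K \<in> \<D>" for K
    proof -
      obtain u v where uv: "K = {u..v}" using division_ofD(4)[OF D(1) K] by auto
      moreover have "K \<subseteq> {a..b}" using K D(2) by blast
      ultimately show ?thesis using integrable_on_subinterval[OF hi] by blast
    qed
    have "(\<Sum>K\<in>\<D>. norm (integral {a..Sup K} f - integral {a..Inf K} f)) \<le> (\<Sum>K\<in>\<D>. integral K (h m) + real m * (Sup K - Inf K))"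
    proof (rule sum_mono)
      fix K assume K: "K \<in> \<D>"
      obtain u v where uv: "K = {u..v}" using division_ofD(4)[OF D(1) K] by auto
      have "K \<noteq> {}" using division_ofD(3)[OF D(1) K] .
      then have "u \<le> v" using uv by auto
      have sub: "{u..v} \<subseteq> {a..b}" using K D(2) uv by blast
      then have av: "a \<le> u" "v \<le> b" using \<open>u \<le> v\<close> by auto
      have fi: "f integrable_on {a..b}" using f set_lebesgue_integral_eq_integral(1) by blast
      have fi': "f integrable_on {a..v}" "f integrable_on {u..v}" using av \<open>u \<le> v\<close> integrable_on_subinterval[OF fi] by auto
      have "integral {a..v} f - integral {a..u} f = integral {u..v} f"
        using Henstock_Kurzweil_Integration.integral_combine[of a u v f] av \<open>u \<le> v\<close> fi'(1) by (auto simp: algebra_simps)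
      moreover have "norm (integral {u..v} f) \<le> integral {u..v} (\<lambda>t. h m t + real m)"
      proof (rule integral_norm_bound_integral[OF fi'(2)])
        show "(\<lambda>t. h m t + real m) integrable_on {u..v}" using hK[OF K] uv by (intro integrable_add) auto
      qed (auto simp: h_def n_def)
      moreover have "integral {u..v} (\<lambda>t. h m t + real m) = integral {u..v} (h m) + real m * (v - u)"
        using hK[OF K] uv \<open>u \<le> v\<close> by (subst integral_add) auto
      ultimately show "norm (integral {a..Sup K} f - integral {a..Inf K} f) \<le> integral K (h m) + real m * (Sup K - Inf K)"
        using uv \<open>u \<le> v\<close> by simp
    qed
    also have "\<dots> = integral (\<Union>\<D>) (h m) + real m * (\<Sum>K\<in>\<D>. Sup K - Inf K)"
      using integral_combine_division_bottomup[OF D(1) hK] by (simp add: sum.distrib sum_distrib_left)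
    also have "integral (\<Union>\<D>) (h m) \<le> integral {a..b} (h m)"
    proof (rule integral_subset_le[OF D(2) _ hi])
      show "h m integrable_on \<Union>\<D>" by (rule integrable_combine_division[OF D(1) hK])
    qed (auto simp: h_def)
    also have "integral {a..b} (h m) + real m * (\<Sum>K\<in>\<D>. Sup K - Inf K) < e"
    proof -
      have "real m * (\<Sum>K\<in>\<D>. Sup K - Inf K) \<le> real m * \<delta>" using D(3) by (intro mult_left_mono) auto
      then show ?thesis using m \<delta>(2) by linarith
    qed
    finally show "(\<Sum>K\<in>\<D>. norm (integral {a..Sup K} f - integral {a..Inf K} f)) < e" by simp
  qed
qed

text \<open>Lebesgue differentiation is applied twice, each time for increments to the right: to the
  function itself and to its reflection. Off the two exceptional sets the right and left derivatives
  both equal \<open>f t\<close>.\<close>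

lemma indefinite_integral_has_vector_derivative_AE:
  fixes f :: "real \<Rightarrow> 'a::euclidean_space"
  assumes f: "\<And>c. f integrable_on {a..c}"
  obtains N where "negligible N"
    "\<And>t. \<lbrakk>a < t; t \<notin> N\<rbrakk> \<Longrightarrow> ((\<lambda>t. integral {a..t} f) has_vector_derivative f t) (at t)"
proof -
  \<comment> \<open>Extension by zero gives integrability on every interval, to the left of
    \<open>a\<close> as well, so that the reflected function is also covered.\<close>
  define g where "g t = (if t \<in> {a..} then f t else 0)" for t
  have g: "g integrable_on {c..d}" for c d
  proof -
    have "f integrable_on {max a c..d}"
      by (rule integrable_on_subinterval[OF f[of d]]) auto
    moreover have "{a..} \<inter> {c..d} = {max a c..d}" by auto
    ultimately show ?thesis unfolding g_def by (simp only: integrable_restrict_Int)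
  qed
  have gr: "(\<lambda>t. g (- t)) integrable_on {c..d}" for c d
    using Henstock_Kurzweil_Integration.integrable_reflect_real[where f = g and a = "-d" and b = "-c"] g[of "-d" "-c"] by simp
  have gi: "integral {u..v} g = integral {u..v} f" if "a \<le> u" for u v
    by (rule integral_cong) (use that in \<open>auto simp: g_def\<close>)
  obtain N1 where N1: "negligible N1" "\<And>x e. \<lbrakk>x \<notin> N1; 0 < e\<rbrakk> \<Longrightarrow>
      \<exists>d>0. \<forall>h. 0 < h \<and> h < d \<longrightarrow> norm (integral {x..x + h} g /\<^sub>R h - g x) < e"
    using integrable_ccontinuous_explicit[of g] g by auto
  obtain N2 where N2: "negligible N2" "\<And>x e. \<lbrakk>x \<notin> N2; 0 < e\<rbrakk> \<Longrightarrow>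
      \<exists>d>0. \<forall>h. 0 < h \<and> h < d \<longrightarrow> norm (integral {x..x + h} (\<lambda>t. g (- t)) /\<^sub>R h - g (- x)) < e"
    using integrable_ccontinuous_explicit[of "\<lambda>t. g (- t)"] gr by auto
  have neg: "negligible (N1 \<union> uminus ` N2)"
    using N1(1) N2(1) by (intro negligible_Un negligible_differentiable_image_negligible)
      (auto intro!: derivative_intros)
  show ?thesis
  proof (rule that[OF neg])
    fix t assume t: "a < t" "t \<notin> N1 \<union> uminus ` N2"
    have tN: "t \<notin> N1" "- t \<notin> N2" using t(2) by (auto simp: image_iff)
    show "((\<lambda>t. integral {a..t} f) has_vector_derivative f t) (at t)"
      unfolding has_vector_derivative_def has_derivative_at_alt
    proof (intro conjI allI impI)
      show "bounded_linear (\<lambda>x. x *\<^sub>R f t)" by (rule bounded_linear_scaleR_left)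
      fix e :: real assume "0 < e"
      obtain d1 where d1: "d1 > 0" "\<And>h. 0 < h \<and> h < d1 \<Longrightarrow> norm (integral {t..t + h} g /\<^sub>R h - g t) < e"
        using N1(2)[OF tN(1) \<open>0 < e\<close>] by blast
      obtain d2 where d2: "d2 > 0" "\<And>h. 0 < h \<and> h < d2 \<Longrightarrow> norm (integral {-t..-t + h} (\<lambda>t. g (- t)) /\<^sub>R h - g t) < e"
        using N2(2)[OF tN(2) \<open>0 < e\<close>] by auto
      have gt: "g t = f t" using t by (simp add: g_def)
      have scale: "norm (I - h *\<^sub>R c) \<le> e * h" if "0 < h" "norm (I /\<^sub>R h - c) < e" for I c :: 'a and h
      proof -
        have "I - h *\<^sub>R c = h *\<^sub>R (I /\<^sub>R h - c)" using that(1) by (simp add: algebra_simps)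
        then have "norm (I - h *\<^sub>R c) = h * norm (I /\<^sub>R h - c)" using that(1) by simp
        then show ?thesis using that by (simp add: mult.commute)
      qed
      show "\<exists>d>0. \<forall>y. norm (y - t) < d \<longrightarrow>
          norm (integral {a..y} f - integral {a..t} f - (y - t) *\<^sub>R f t) \<le> e * norm (y - t)"
      proof (intro exI conjI allI impI)
        show "min (min d1 d2) (t - a) > 0" using d1 d2 t by simp
        fix y assume y: "norm (y - t) < min (min d1 d2) (t - a)"
        consider "y = t" | "y > t" | "y < t" by linarith
        then show "norm (integral {a..y} f - integral {a..t} f - (y - t) *\<^sub>R f t) \<le> e * norm (y - t)"
        proof cases
          case 2
          have "integral {a..y} f - integral {a..t} f = integral {t..t + (y - t)} g"
            using Henstock_Kurzweil_Integration.integral_combine[of a t y f] f[of y] t 2 by (auto simp: gi algebra_simps)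
          then show ?thesis using scale[OF _ d1(2)[of "y - t"]] y 2 gt by (simp add: gt)
        next
          case 3
          have "integral {-t..-t + (t - y)} (\<lambda>t. g (- t)) = integral {y..t} g"
            using integral_reflect_real[where f = g and a = y and b = t] by simp
          also have "\<dots> = integral {a..t} f - integral {a..y} f"
            using Henstock_Kurzweil_Integration.integral_combine[of a y t f] f[of t] t y 3 by (auto simp: gi algebra_simps)
          finally have "norm ((integral {a..t} f - integral {a..y} f) - (t - y) *\<^sub>R g t) \<le> e * (t - y)"
            using scale[OF _ d2(2)[of "t - y"]] y 3 by simp
          moreover have eq: "integral {a..y} f - integral {a..t} f - (y - t) *\<^sub>R f t = - ((integral {a..t} f - integral {a..y} f) - (t - y) *\<^sub>R g t)"
            by (simp add: gt algebra_simps)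
          moreover have "norm (y - t) = t - y" using 3 by simp
          ultimately show ?thesis unfolding eq norm_minus_cancel by simp
        qed simp
      qed
    qed
  qed
qed


lemma continuous_on_integral_from:
  fixes f :: "real \<Rightarrow> 'a::euclidean_space"
  assumes f: "\<And>c. f integrable_on {a..c}"
  shows "continuous_on S (\<lambda>t. integral {a..t} f)"
proof -
  have "isCont (\<lambda>t. integral {a..max a t} f) t" for t
  proof -
    have "continuous_on {- 1 - \<bar>t\<bar>..1 + \<bar>t\<bar>} (\<lambda>t. integral {a..max a t} f)"
      by (rule continuous_on_compose2[OF indefinite_integral_continuous_1[OF f[of "max a (1 + \<bar>t\<bar>)"]]])
        (auto intro!: continuous_intros)
    then show ?thesis
      by (rule continuous_on_interior) (auto simp: interior_atLeastAtMost_real)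
  qed
  moreover have "integral {a..max a t} f = integral {a..t} f" for t
    by (cases "t \<ge> a") (auto simp: max_def)
  ultimately show ?thesis
    by (auto intro: continuous_at_imp_continuous_on)
qed

section \<open>Weighted sup norms: delay Gronwall inequality and global solutions\<close>

locale kernel =
  fixes k :: "real \<Rightarrow> real"
  assumes k_nonneg: "\<And>t. 0 \<le> k t"
    and k_integrable: "\<And>c. k integrable_on {0..c}"
begin

text \<open>The weight of a Bielecki norm: dividing by \<open>W\<close> turns the Picard operator into a contraction
  on the whole line, and the factor 4 leaves room for both the present and the delayed argument.\<close>

definition W :: "real \<Rightarrow> real" where "W t = exp (4 * integral {0..t} k)"

lemma integral_k_nonneg: "0 \<le> integral {0..t} k"
  by (intro integral_nonneg k_integrable k_nonneg)

lemma k_absolutely_integrable: "k absolutely_integrable_on {0..c}"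
  by (intro nonnegative_absolutely_integrable_1 k_integrable k_nonneg)

lemma integral_k_mono: "s \<le> t \<Longrightarrow> integral {0..s} k \<le> integral {0..t} k"
  by (intro integral_subset_le k_integrable) (auto simp: k_nonneg)

lemma W_ge_1: "1 \<le> W t" and W_pos: "0 < W t" and W_mono: "s \<le> t \<Longrightarrow> W s \<le> W t"
  using integral_k_nonneg integral_k_mono by (auto simp: W_def)

lemma W_nonpos: "t \<le> 0 \<Longrightarrow> W t = 1"
  by (cases "t = 0") (auto simp: W_def)

lemma W_ge_integral: "integral {0..t} k \<le> W t"
  unfolding W_def using integral_k_nonneg[of t] exp_ge_add_one_self[of "4 * integral {0..t} k"] by linarith

lemma continuous_on_W: "continuous_on S W"
  unfolding W_def by (intro continuous_intros continuous_on_integral_from k_integrable)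

text \<open>The function \<open>W / 4\<close> is absolutely continuous with derivative
  \<open>k * W\<close> almost everywhere, and \<open>W 0 = 1\<close>.\<close>

lemma has_integral_k_W:
  assumes "0 \<le> t"
  shows "((\<lambda>s. k s * W s) has_integral (W t - 1) / 4) {0..t}"
proof -
  obtain N where N: "negligible N" "\<And>s. \<lbrakk>0 < s; s \<notin> N\<rbrakk> \<Longrightarrow> ((\<lambda>t. integral {0..t} k) has_vector_derivative k s) (at s)"
    using indefinite_integral_has_vector_derivative_AE[OF k_integrable] by blast
  have "((\<lambda>s. k s * W s) has_integral W t / 4 - W 0 / 4) {0..t}"
  proof (rule has_integral_AC_derivative[OF assms])
    show "negligible (insert 0 N)" using N(1) by simp
    show "absolutely_continuous_on_interval 0 t (\<lambda>s. W s / 4)"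
    proof (rule AC_lipschitz_image[OF AC_indefinite_integral[OF k_absolutely_integrable]])
      \<comment> \<open>The tangent inequality for \<open>exp\<close> dominates increments of
        \<open>W\<close> on \<open>{0..t}\<close> by \<open>W t\<close> times increments of the
        integral of \<open>k\<close>; this is what transfers absolute continuity.\<close>
      have *: "exp x - exp y \<le> exp x * (x - y)" for x y :: real
        using exp_ge_add_one_self[of "y - x"] mult_left_mono[of "1 + (y - x)" "exp (y - x)" "exp x"]
        by (simp add: exp_diff algebra_simps)
      have **: "W v / 4 - W u / 4 \<le> W t * (integral {0..v} k - integral {0..u} k)" if "u \<le> v" "v \<le> t" for u v
      proof -
        have "W v / 4 - W u / 4 \<le> W v * (integral {0..v} k - integral {0..u} k)"
          using *[of "4 * integral {0..v} k" "4 * integral {0..u} k"] by (simp add: W_def algebra_simps)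
        also have "\<dots> \<le> W t * (integral {0..v} k - integral {0..u} k)"
          using that W_mono integral_k_mono by (intro mult_right_mono) auto
        finally show ?thesis .
      qed
      show "norm (W v / 4 - W u / 4) \<le> W t * norm (integral {0..v} k - integral {0..u} k)"
        if "u \<in> {0..t}" "v \<in> {0..t}" for u v
        using that **[of u v] **[of v u] W_mono[of u v] W_mono[of v u] integral_k_mono[of u v] integral_k_mono[of v u]
        by (cases "u \<le> v") auto
    qed
    fix s assume s: "s \<in> {0..t} - insert 0 N"
    then have "((\<lambda>t. integral {0..t} k) has_real_derivative k s) (at s within {0..t})"
      using N(2)[of s] by (auto simp: has_real_derivative_iff_has_vector_derivative intro: has_vector_derivative_at_within)
    then have "((\<lambda>s. W s / 4) has_real_derivative k s * W s) (at s within {0..t})"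
      unfolding W_def by (auto intro!: derivative_eq_intros)
    then show "((\<lambda>s. W s / 4) has_vector_derivative k s * W s) (at s within {0..t})"
      by (simp add: has_real_derivative_iff_has_vector_derivative)
  qed
  then show ?thesis by (simp add: W_nonpos diff_divide_distrib)
qed

text \<open>As \<open>W\<close> is nondecreasing, the delayed term costs no more than the present
  one. Two such terms against the factor 4 in the exponent leave the contraction constant
  \<open>1 / 2\<close>.\<close>

lemma delay_integral_bound:
  assumes t: "0 \<le> t" and M: "0 \<le> M" and "h integrable_on {0..t}"
    and h: "\<And>s. \<lbrakk>0 \<le> s; s \<le> t\<rbrakk> \<Longrightarrow> h s \<le> k s * (M * W s + M * W (s - 1))"
  shows "integral {0..t} h \<le> M / 2 * W t"
proof -
  have hi: "((\<lambda>s. 2 * M * (k s * W s)) has_integral 2 * M * ((W t - 1) / 4)) {0..t}"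
    by (intro has_integral_mult_right has_integral_k_W t)
  have "integral {0..t} h \<le> integral {0..t} (\<lambda>s. 2 * M * (k s * W s))"
  proof (rule integral_le)
    fix s assume s: "s \<in> {0..t}"
    have "h s \<le> k s * (M * W s + M * W (s - 1))" using h s by auto
    also have "\<dots> \<le> k s * (M * W s + M * W s)"
      using M k_nonneg W_mono[of "s - 1" s] by (intro mult_left_mono add_mono) auto
    finally show "h s \<le> 2 * M * (k s * W s)" by (simp add: algebra_simps)
  qed (use assms hi in auto)
  also have "\<dots> \<le> M / 2 * W t" using integral_unique[OF hi] M by (simp add: field_simps)
  finally show ?thesis .
qed

text \<open>Let \<open>M\<close> be the supremum of \<open>d / W\<close>, finite by continuity on a
  compact interval. The integral inequality divided by \<open>W\<close> gives
  \<open>M \<le> \<epsilon> + M / 2\<close>, hence \<open>M \<le> 2 * \<epsilon>\<close>; no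
  iteration over intervals of the length of the delay is involved.\<close>

lemma delay_gronwall:
  assumes T: "0 \<le> T" and \<epsilon>: "0 \<le> \<epsilon>" and d: "continuous_on {-1..T} d" "\<And>t. t \<in> {-1..T} \<Longrightarrow> 0 \<le> d t"
    and init: "\<And>t. t \<in> {-1..0} \<Longrightarrow> d t \<le> \<epsilon>"
    and ineq: "\<And>t. t \<in> {0..T} \<Longrightarrow> d t \<le> \<epsilon> + integral {0..t} (\<lambda>s. k s * (d s + d (s - 1)))"
    and t: "t \<in> {-1..T}"
  shows "d t \<le> 2 * \<epsilon> * W T"
proof -
  obtain C where C: "\<And>t. t \<in> {-1..T} \<Longrightarrow> d t \<le> C"
    using compact_imp_bounded[OF compact_continuous_image[OF d(1) compact_Icc]]
    by (auto simp: bounded_iff) (metis abs_le_D1 atLeastAtMost_iff)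
  define M where "M = (SUP t\<in>{-1..T}. d t / W t)"
  have bdd: "bdd_above ((\<lambda>t. d t / W t) ` {-1..T})"
  proof (rule bdd_aboveI2)
    fix t assume t: "t \<in> {-1..T}"
    show "d t / W t \<le> C" using C[OF t] d(2)[OF t] W_ge_1[of t] W_pos[of t]
      by (smt (verit) divide_le_eq mult_left_mono mult_cancel_left1)
  qed
  have dM: "d t \<le> M * W t" if "t \<in> {-1..T}" for t
  proof -
    have "d t / W t \<le> M" unfolding M_def by (rule cSUP_upper[OF that bdd])
    then show ?thesis using W_pos[of t] by (simp add: field_simps)
  qed
  have M0: "0 \<le> M"
    using dM[of 0] d(2)[of 0] T by (simp add: W_nonpos)
  have int: "(\<lambda>s. k s * (d s + d (s - 1))) integrable_on {0..t}" if "t \<in> {0..T}" for t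
  proof -
    have c: "continuous_on {0..t} (\<lambda>s. d s + d (s - 1))"
      by (intro continuous_intros continuous_on_compose2[OF d(1)]) (use that in auto)
    have "(\<lambda>s. (d s + d (s - 1)) * k s) absolutely_integrable_on {0..t}"
      by (rule absolutely_integrable_bounded_measurable_product_real[OF _ _ _ k_absolutely_integrable])
        (auto intro: compact_imp_bounded[OF compact_continuous_image[OF c]]
          continuous_imp_measurable_on_sets_lebesgue[OF c])
    then show ?thesis using set_lebesgue_integral_eq_integral(1) by (simp add: mult.commute)
  qed
  have "d t / W t \<le> \<epsilon> + M / 2" if t: "t \<in> {-1..T}" for t
  proof (cases "t \<le> 0")
    case True
    then show ?thesis using init[of t] t M0 by (simp add: W_nonpos)
  next
    case False
    have "integral {0..t} (\<lambda>s. k s * (d s + d (s - 1))) \<le> M / 2 * W t"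
    proof (rule delay_integral_bound)
      fix s assume "0 \<le> s" "s \<le> t"
      then show "k s * (d s + d (s - 1)) \<le> k s * (M * W s + M * W (s - 1))"
        using t by (intro mult_left_mono add_mono dM k_nonneg) auto
    qed (use t False M0 int in auto)
    then have "d t \<le> \<epsilon> + M / 2 * W t" using ineq[of t] t False by auto
    also have "\<dots> \<le> \<epsilon> * W t + M / 2 * W t" using W_ge_1[of t] \<epsilon> by (simp add: mult_le_cancel_left1)
    finally show ?thesis using W_pos[of t] by (simp add: field_simps)
  qed
  then have "M \<le> \<epsilon> + M / 2" unfolding M_def using T by (intro cSUP_least) auto
  then have "M \<le> 2 * \<epsilon>" by simp
  have "d t \<le> M * W t" by (rule dM[OF t])
  also have "\<dots> \<le> (2 * \<epsilon>) * W T"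
    using \<open>M \<le> 2 * \<epsilon>\<close> W_mono[of t T] t W_pos[of t] \<epsilon> by (intro mult_mono) auto
  finally show ?thesis .
qed

end

locale caratheodory = kernel k for k +
  fixes h :: "real \<Rightarrow> 'a::euclidean_space \<Rightarrow> 'a \<Rightarrow> 'a"
  assumes h_bound: "\<And>t y u. norm (h t y u) \<le> k t"
    and h_lipschitz: "\<And>t y u y' u'. norm (h t y u - h t y' u') \<le> k t * (norm (y - y') + norm (u - u'))"
    and h_measurable: "\<And>y u. \<lbrakk>continuous_on UNIV y; continuous_on UNIV u\<rbrakk> \<Longrightarrow> (\<lambda>t. h t (y t) (u t)) \<in> borel_measurable lebesgue"
begin

lemma h_integrable:
  assumes "continuous_on UNIV y" "continuous_on UNIV u"
  shows "(\<lambda>t. h t (y t) (u t)) integrable_on {0..c}"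
proof (rule measurable_bounded_by_integrable_imp_integrable[OF _ k_integrable])
  show "(\<lambda>t. h t (y t) (u t)) \<in> borel_measurable (lebesgue_on {0..c})"
    by (rule measurable_restrict_space1[OF h_measurable[OF assms]])
qed (auto intro: h_bound)

text \<open>Banach's theorem for the unknown \<open>z = y / W\<close> among bounded continuous
  functions on the whole line. Boundedness of the Picard image follows from
  \<open>norm (h t y u) \<le> k t\<close> and from the fact that \<open>W\<close> dominates the
  integral of \<open>k\<close>; the weight makes the map contract by \<open>1 / 2\<close> without
  any restriction on time.\<close>

theorem global_solution:
  assumes \<psi>: "continuous_on UNIV \<psi>" "bounded (range \<psi>)"
  obtains y where "continuous_on UNIV y" "\<And>t. t \<le> 0 \<Longrightarrow> y t = \<psi> t"
    "\<And>t. 0 \<le> t \<Longrightarrow> y t = \<psi> 0 + integral {0..t} (\<lambda>s. h s (y s) (y (s - 1)))"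
proof -
  define P where "P z s = h s (W s *\<^sub>R apply_bcontfun z s) (W (s - 1) *\<^sub>R apply_bcontfun z (s - 1))" for z s
  \<comment> \<open>For \<open>t \<le> 0\<close> the integral vanishes and \<open>W t = 1\<close>,
    so the same formula prescribes the history \<open>\<psi>\<close> and integrates the
    equation.\<close>
  define A where "A z t = (\<psi> (min t 0) + integral {0..t} (P z)) /\<^sub>R W t" for z t
  obtain B where B: "\<And>t. norm (\<psi> t) \<le> B" using \<psi>(2) by (auto simp: bounded_iff)
  have B0: "0 \<le> B" using order_trans[OF norm_ge_zero B] .
  have cont: "continuous_on UNIV (\<lambda>s. W s *\<^sub>R apply_bcontfun z s)"
    "continuous_on UNIV (\<lambda>s. W (s - 1) *\<^sub>R apply_bcontfun z (s - 1))" for z :: "real \<Rightarrow>\<^sub>C 'a"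
    by (intro continuous_intros continuous_on_W continuous_on_compose2[OF continuous_on_W[of UNIV]]
        continuous_on_compose2[OF continuous_on_apply_bcontfun[of UNIV]]; simp)+
  have Pint: "P z integrable_on {0..c}" for z c
    unfolding P_def by (intro h_integrable cont)
  have Pk: "norm (integral {0..t} (P z)) \<le> integral {0..t} k" for z t
    by (rule integral_norm_bound_integral[OF Pint k_integrable]) (simp add: P_def h_bound)
  have Abcont: "A z \<in> bcontfun" for z
  proof (rule bcontfun_normI)
    have "W t \<noteq> 0" for t using W_pos[of t] by simp
    then show "continuous_on UNIV (A z)"
      unfolding A_def by (intro continuous_intros continuous_on_compose2[OF \<psi>(1)] continuous_on_W
          continuous_on_integral_from Pint) auto
    show "norm (A z t) \<le> B + 1" for t
    proof -
      have "norm (\<psi> (min t 0) + integral {0..t} (P z)) \<le> B + integral {0..t} k"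
        by (intro norm_triangle_mono B Pk)
      also have "\<dots> \<le> B * W t + W t"
        using W_ge_1[of t] W_ge_integral[of t] B0 by (intro add_mono) (auto simp: mult_le_cancel_left1)
      finally have "norm (\<psi> (min t 0) + integral {0..t} (P z)) / W t \<le> B + 1"
        using W_pos[of t] by (simp add: field_simps)
      moreover have "norm (A z t) = norm (\<psi> (min t 0) + integral {0..t} (P z)) / W t"
        using W_pos[of t] unfolding A_def norm_scaleR by (simp add: divide_inverse mult.commute)
      ultimately show ?thesis by simp
    qed
  qed
  define \<A> where "\<A> z = Bcontfun (A z)" for z
  have \<A>: "apply_bcontfun (\<A> z) t = A z t" for z t
    unfolding \<A>_def using Abcont by (simp add: Bcontfun_inverse)
  have "\<exists>!z. \<A> z = z"
  proof (rule banach_fix_type[of "1 / 2"])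
    show "\<forall>x y. dist (\<A> x) (\<A> y) \<le> 1 / 2 * dist x y"
    proof (intro allI dist_bound)
      fix z1 z2 :: "real \<Rightarrow>\<^sub>C 'a" and t
      define M where "M = dist z1 z2"
      have M: "0 \<le> M" by (simp add: M_def)
      have zd: "norm (apply_bcontfun z1 s - apply_bcontfun z2 s) \<le> M" for s
        using dist_bounded[of z1 s z2] by (simp add: M_def dist_norm)
      have A12: "A z1 t - A z2 t = integral {0..t} (\<lambda>s. P z1 s - P z2 s) /\<^sub>R W t"
        by (simp add: A_def integral_diff Pint scaleR_diff_right[symmetric])
      show "dist (\<A> z1 t) (\<A> z2 t) \<le> 1 / 2 * dist z1 z2"
      proof (cases "t \<ge> 0")
        case True
        have Pd: "(\<lambda>s. P z1 s - P z2 s) integrable_on {0..t}" by (intro integrable_diff Pint)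
        have bd: "norm (P z1 s - P z2 s) \<le> k s * (M * W s + M * W (s - 1))" for s
        proof -
          have "norm (W s *\<^sub>R apply_bcontfun z1 s - W s *\<^sub>R apply_bcontfun z2 s) \<le> M * W s" for s
            using zd[of s] W_pos[of s] by (simp add: scaleR_diff_right[symmetric])
          then show ?thesis unfolding P_def
            by (intro order_trans[OF h_lipschitz] mult_left_mono add_mono k_nonneg)
        qed
        have kW: "(\<lambda>s. 2 * M * (k s * W s)) integrable_on {0..t}"
          using has_integral_k_W[OF True] by (intro integrable_on_mult_right) auto
        have "norm (integral {0..t} (\<lambda>s. P z1 s - P z2 s)) \<le> integral {0..t} (\<lambda>s. 2 * M * (k s * W s))"
        proof (rule integral_norm_bound_integral[OF Pd kW])
          fix s
          have "k s * (M * W s + M * W (s - 1)) \<le> k s * (M * W s + M * W s)"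
            using W_mono[of "s - 1" s] M k_nonneg by (intro mult_left_mono add_mono) auto
          then show "norm (P z1 s - P z2 s) \<le> 2 * M * (k s * W s)" using bd[of s] by (simp add: algebra_simps)
        qed
        also have "\<dots> = 2 * M * ((W t - 1) / 4)"
          using has_integral_k_W[OF True] by (simp add: integral_unique)
        also have "\<dots> \<le> M / 2 * W t" using M by (simp add: field_simps)
        finally have "norm (integral {0..t} (\<lambda>s. P z1 s - P z2 s)) / W t \<le> M / 2"
          using W_pos[of t] by (simp add: field_simps)
        then have "dist (\<A> z1 t) (\<A> z2 t) \<le> 1 / 2 * M"
          unfolding \<A> dist_norm A12 using W_pos[of t] by (simp add: field_simps)
        then show ?thesis by (simp only: M_def)
      next
        case False
        then show ?thesis unfolding \<A> dist_norm A12 by simp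
      qed
    qed
  qed auto
  then obtain z where z: "\<A> z = z" by blast
  define y where "y t = W t *\<^sub>R apply_bcontfun z t" for t
  have P: "P z s = h s (y s) (y (s - 1))" for s by (simp add: P_def y_def)
  have y: "y t = \<psi> (min t 0) + integral {0..t} (P z)" for t
    using \<A>[of z t] W_pos[of t] by (simp add: z y_def A_def)
  show ?thesis
  proof (rule that)
    show "continuous_on UNIV y" unfolding y_def by (rule cont)
    show "y t = \<psi> t" if "t \<le> 0" for t
      using y[of t] that by (cases "t = 0") (auto simp: min_def)
    show "y t = \<psi> 0 + integral {0..t} (\<lambda>s. h s (y s) (y (s - 1)))" if "0 \<le> t" for t
      using y[of t] that by (simp add: P[abs_def] min_def cong: if_cong)
  qed
qed

end

section \<open>Lipschitz Caratheodory fields and their classes\<close>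

lemma absolutely_integrable_dominated:
  fixes h :: "'a::euclidean_space \<Rightarrow> 'b::euclidean_space"
  assumes h: "h \<in> borel_measurable (lebesgue_on S)" "S \<in> sets lebesgue"
    and k: "k integrable_on S" and N: "negligible N"
    and le: "\<And>t. \<lbrakk>t \<in> S; t \<notin> N\<rbrakk> \<Longrightarrow> norm (h t) \<le> k t"
  shows "h absolutely_integrable_on S" "norm (integral S h) \<le> integral S k"
proof -
  \<comment> \<open>On the exceptional set the dominating function is replaced by
    \<open>norm (h t)\<close> itself; the bound then holds everywhere and the integral does not
    change.\<close>
  define k' where "k' t = (if t \<in> N then norm (h t) else k t)" for t
  have k': "k' integrable_on S" by (rule integrable_spike[OF k N]) (auto simp: k'_def)
  have le': "norm (h t) \<le> k' t" if "t \<in> S" for t using le that by (auto simp: k'_def)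
  show *: "h absolutely_integrable_on S"
    by (rule measurable_bounded_by_integrable_imp_absolutely_integrable[OF h k' le'])
  have "norm (integral S h) \<le> integral S k'"
    by (rule integral_norm_bound_integral[OF set_lebesgue_integral_eq_integral(1)[OF *] k' le'])
  also have "\<dots> = integral S k" by (rule integral_spike[OF N]) (auto simp: k'_def)
  finally show "norm (integral S h) \<le> integral S k" .
qed

lemma power_add_le: "0 \<le> a \<Longrightarrow> 0 \<le> b \<Longrightarrow> (a + b) ^ p \<le> 2 ^ p * (a ^ p + b ^ p)" for a b :: real
proof -
  assume ab: "0 \<le> a" "0 \<le> b"
  have "(a + b) ^ p \<le> (2 * max a b) ^ p" using ab by (intro power_mono) auto
  also have "\<dots> \<le> 2 ^ p * (a ^ p + b ^ p)" using ab by (auto simp: power_mult_distrib max_def)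
  finally show ?thesis .
qed

lemma le_one_add_power: "1 \<le> p \<Longrightarrow> 0 \<le> x \<Longrightarrow> x \<le> 1 + x ^ p" for x :: real
proof (cases "x \<le> 1")
  case False
  assume "1 \<le> p"
  then have "x ^ 1 \<le> x ^ p" using False by (intro power_increasing) auto
  then show ?thesis by simp
qed (auto intro: order_trans add_increasing2)

lemma measurable_shift_lebesgue:
  "m \<in> borel_measurable lebesgue \<Longrightarrow> (\<lambda>t::real. m (t + c)) \<in> borel_measurable lebesgue"
  using measurable_compose[OF lebesgue_affine_measurable[where c= "\<lambda>x::real. 1" and t = c], of m borel]
  by (simp add: add.commute)

lemma integrable_on_shift_real:
  fixes f :: "real \<Rightarrow> 'a::euclidean_space"
  assumes "f integrable_on {a + c..b + c}"
  shows "(\<lambda>t. f (t + c)) integrable_on {a..b}"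
    "integral {a..b} (\<lambda>t. f (t + c)) = integral {a + c..b + c} f"
proof -
  have "((\<lambda>t. f (t + c)) has_integral integral {a + c..b + c} f) {a..b}"
    using has_integral_affinity[of f "integral {a + c..b + c} f" "a + c" "b + c" 1 c] assms
    by (simp add: integrable_integral)
  then show "(\<lambda>t. f (t + c)) integrable_on {a..b}"
    "integral {a..b} (\<lambda>t. f (t + c)) = integral {a + c..b + c} f" by auto
qed

lemma negligible_shift: "negligible N \<Longrightarrow> negligible {t::real. t + c \<in> N}"
proof -
  assume "negligible N"
  then have "negligible ((+) (- c) ` N)" by (rule negligible_translation)
  moreover have "(+) (- c) ` N = {t. t + c \<in> N}" by force
  ultimately show ?thesis by simp
qed

lemma AE_lebesgue_negligible: "(AE t in lebesgue. P t) \<longleftrightarrow> (\<exists>N. negligible N \<and> (\<forall>t. t \<notin> N \<longrightarrow> P t))"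
proof
  assume "AE t in lebesgue. P t"
  then obtain N where "{t \<in> space lebesgue. \<not> P t} \<subseteq> N" "N \<in> null_sets lebesgue"
    by (auto elim!: AE_E simp: null_sets_def)
  then show "\<exists>N. negligible N \<and> (\<forall>t. t \<notin> N \<longrightarrow> P t)" by (auto simp: negligible_iff_null_sets)
next
  assume "\<exists>N. negligible N \<and> (\<forall>t. t \<notin> N \<longrightarrow> P t)"
  then obtain N where N: "N \<in> null_sets lebesgue" "\<And>t. t \<notin> N \<Longrightarrow> P t" by (auto simp: negligible_iff_null_sets)
  show "AE t in lebesgue. P t" by (rule AE_I'[OF N(1)]) (use N(2) in auto)
qed

lemma Lp_loc_iff:
  "m \<in> Lp_loc p \<longleftrightarrow> m \<in> borel_measurable lebesgue \<and> (\<forall>a b. (\<lambda>t. \<bar>m t\<bar> ^ p) integrable_on {a..b})"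
  unfolding Lp_loc_def using set_lebesgue_integral_eq_integral(1) by (auto intro!: nonnegative_absolutely_integrable_1)

lemma Lp_loc_dominated:
  assumes "m \<in> borel_measurable lebesgue" "\<And>a b. g integrable_on {a..b}" "\<And>t. \<bar>m t\<bar> ^ p \<le> g t"
  shows "m \<in> Lp_loc p"
  unfolding Lp_loc_iff
proof (intro conjI allI assms(1))
  fix a b
  have "(\<lambda>t. \<bar>m t\<bar> ^ p) \<in> borel_measurable (lebesgue_on {a..b})"
    by (intro measurable_restrict_space1 borel_measurable_power borel_measurable_abs assms(1))
  then show "(\<lambda>t. \<bar>m t\<bar> ^ p) integrable_on {a..b}"
    by (rule measurable_bounded_by_integrable_imp_integrable[OF _ assms(2)]) (use assms(3) in auto)
qed

lemma Lp_loc_add: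
  assumes "m1 \<in> Lp_loc p" "m2 \<in> Lp_loc p"
  shows "(\<lambda>t. \<bar>m1 t\<bar> + \<bar>m2 t\<bar>) \<in> Lp_loc p"
proof (rule Lp_loc_dominated)
  show "(\<lambda>t. 2 ^ p * (\<bar>m1 t\<bar> ^ p + \<bar>m2 t\<bar> ^ p)) integrable_on {a..b}" for a b
    using assms unfolding Lp_loc_iff by (intro integrable_on_mult_right integrable_add) auto
  show "\<bar>\<bar>m1 t\<bar> + \<bar>m2 t\<bar>\<bar> ^ p \<le> 2 ^ p * (\<bar>m1 t\<bar> ^ p + \<bar>m2 t\<bar> ^ p)" for t
    using power_add_le[of "\<bar>m1 t\<bar>" "\<bar>m2 t\<bar>" p] by simp
qed (use assms in \<open>auto simp: Lp_loc_iff\<close>)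

lemma Lp_loc_shift: "m \<in> Lp_loc p \<Longrightarrow> (\<lambda>t. m (t + c)) \<in> Lp_loc p"
  unfolding Lp_loc_iff
  by (auto intro!: measurable_shift_lebesgue integrable_on_shift_real(1)[where f = "\<lambda>t. \<bar>m t\<bar> ^ p"])

lemma Lp_loc_imp_L1: "1 \<le> p \<Longrightarrow> m \<in> Lp_loc p \<Longrightarrow> m \<in> Lp_loc 1"
proof (rule Lp_loc_dominated)
  assume p: "1 \<le> p" and m: "m \<in> Lp_loc p"
  then show "(\<lambda>t. 1 + \<bar>m t\<bar> ^ p) integrable_on {a..b}" for a b
    by (auto simp: Lp_loc_iff intro!: integrable_add)
  show "\<bar>m t\<bar> ^ 1 \<le> 1 + \<bar>m t\<bar> ^ p" for t using le_one_add_power[OF p, of "\<bar>m t\<bar>"] by simp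
qed (auto simp: Lp_loc_iff)

section \<open>Algebra of Lipschitz Caratheodory fields, envelopes and equivalence classes\<close>

lemma LC_borel: "f \<in> LC p \<Longrightarrow> f \<in> borel_measurable borel"
  by (simp add: LC_def)

lemma LC_subset_LC1: "1 \<le> p \<Longrightarrow> f \<in> LC p \<Longrightarrow> f \<in> LC 1"
  unfolding LC_def using Lp_loc_imp_L1 by blast

lemma LC_diff:
  assumes f: "f \<in> LC p" and g: "g \<in> LC p"
  shows "(\<lambda>w. f w - g w) \<in> LC p"
  unfolding LC_def
proof (intro CollectI conjI allI impI)
  show "(\<lambda>w. f w - g w) \<in> borel_measurable borel"
    using LC_borel[OF f] LC_borel[OF g] by simp
  fix K :: "((real ^ 'a) \<times> (real ^ 'a)) set" assume K: "compact K"
  from f K obtain m1 l1 where 1: "m1 \<in> Lp_loc p" "l1 \<in> Lp_loc p" "AE t in lebesgue. (\<forall>z\<in>K. norm (f (t, z)) \<le> m1 t) \<and>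
        (\<forall>z1\<in>K. \<forall>z2\<in>K. norm (f (t, z1) - f (t, z2)) \<le> l1 t * norm (z1 - z2))"
    unfolding LC_def by blast
  from g K obtain m2 l2 where 2: "m2 \<in> Lp_loc p" "l2 \<in> Lp_loc p" "AE t in lebesgue. (\<forall>z\<in>K. norm (g (t, z)) \<le> m2 t) \<and>
        (\<forall>z1\<in>K. \<forall>z2\<in>K. norm (g (t, z1) - g (t, z2)) \<le> l2 t * norm (z1 - z2))"
    unfolding LC_def by blast
  show "\<exists>m\<in>Lp_loc p. \<exists>l\<in>Lp_loc p. AE t in lebesgue. (\<forall>z\<in>K. norm (f (t, z) - g (t, z)) \<le> m t) \<and>
        (\<forall>z1\<in>K. \<forall>z2\<in>K. norm (f (t, z1) - g (t, z1) - (f (t, z2) - g (t, z2))) \<le> l t * norm (z1 - z2))"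
  proof (intro bexI)
    show "AE t in lebesgue. (\<forall>z\<in>K. norm (f (t, z) - g (t, z)) \<le> \<bar>m1 t\<bar> + \<bar>m2 t\<bar>) \<and>
        (\<forall>z1\<in>K. \<forall>z2\<in>K. norm (f (t, z1) - g (t, z1) - (f (t, z2) - g (t, z2))) \<le> (\<bar>l1 t\<bar> + \<bar>l2 t\<bar>) * norm (z1 - z2))"
      using 1(3) 2(3)
    proof eventually_elim
      case (elim t)
      show ?case
      proof (intro conjI ballI)
        fix z assume "z \<in> K"
        then have "norm (f (t, z)) \<le> m1 t" "norm (g (t, z)) \<le> m2 t" using elim by auto
        then show "norm (f (t, z) - g (t, z)) \<le> \<bar>m1 t\<bar> + \<bar>m2 t\<bar>"
          using norm_triangle_ineq4[of "f (t, z)" "g (t, z)"] by linarith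
      next
        fix z1 z2 assume z: "z1 \<in> K" "z2 \<in> K"
        have "norm (f (t, z1) - f (t, z2)) \<le> \<bar>l1 t\<bar> * norm (z1 - z2)" "norm (g (t, z1) - g (t, z2)) \<le> \<bar>l2 t\<bar> * norm (z1 - z2)"
          using elim z by (smt (verit) mult_right_mono norm_ge_zero abs_ge_self)+
        moreover have "f (t, z1) - g (t, z1) - (f (t, z2) - g (t, z2)) = (f (t, z1) - f (t, z2)) - (g (t, z1) - g (t, z2))" by simp
        ultimately show "norm (f (t, z1) - g (t, z1) - (f (t, z2) - g (t, z2))) \<le> (\<bar>l1 t\<bar> + \<bar>l2 t\<bar>) * norm (z1 - z2)"
          using norm_triangle_ineq4[of "f (t, z1) - f (t, z2)" "g (t, z1) - g (t, z2)"] by (simp only: distrib_right)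
      qed
    qed
  qed (use 1 2 Lp_loc_add in auto)
qed

lemma LC_zero: "0 < p \<Longrightarrow> (\<lambda>w. 0) \<in> LC p"
  unfolding LC_def by (auto simp: Lp_loc_iff zero_power intro!: bexI[of _ "\<lambda>_. 0"])

lemma LC_translate:
  assumes "f \<in> LC p" shows "translate c f \<in> LC p"
  unfolding LC_def
proof (intro CollectI conjI allI impI)
  have "(\<lambda>w. (fst w + c, snd w)) \<in> borel_measurable (borel :: (real \<times> (real ^ 'a) \<times> (real ^ 'a)) measure)"
    by (intro borel_measurable_continuous_onI continuous_intros)
  from measurable_compose[OF this LC_borel[OF assms]]
  show "translate c f \<in> borel_measurable borel"
    by (simp add: translate_def case_prod_unfold)
  fix K :: "((real ^ 'a) \<times> (real ^ 'a)) set" assume K: "compact K"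
  from assms K obtain m1 l1 where 1: "m1 \<in> Lp_loc p" "l1 \<in> Lp_loc p" "AE t in lebesgue. (\<forall>z\<in>K. norm (f (t, z)) \<le> m1 t) \<and>
        (\<forall>z1\<in>K. \<forall>z2\<in>K. norm (f (t, z1) - f (t, z2)) \<le> l1 t * norm (z1 - z2))"
    unfolding LC_def by blast
  then obtain N where N: "negligible N" "\<And>t. t \<notin> N \<Longrightarrow> (\<forall>z\<in>K. norm (f (t, z)) \<le> m1 t) \<and>
        (\<forall>z1\<in>K. \<forall>z2\<in>K. norm (f (t, z1) - f (t, z2)) \<le> l1 t * norm (z1 - z2))"
    unfolding AE_lebesgue_negligible by blast
  show "\<exists>m\<in>Lp_loc p. \<exists>l\<in>Lp_loc p. AE t in lebesgue. (\<forall>z\<in>K. norm (translate c f (t, z)) \<le> m t) \<and>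
        (\<forall>z1\<in>K. \<forall>z2\<in>K. norm (translate c f (t, z1) - translate c f (t, z2)) \<le> l t * norm (z1 - z2))"
  proof (intro bexI)
    show "AE t in lebesgue. (\<forall>z\<in>K. norm (translate c f (t, z)) \<le> m1 (t + c)) \<and>
        (\<forall>z1\<in>K. \<forall>z2\<in>K. norm (translate c f (t, z1) - translate c f (t, z2)) \<le> l1 (t + c) * norm (z1 - z2))"
      unfolding AE_lebesgue_negligible using negligible_shift[OF N(1), of c] N(2)
      by (intro exI[of _ "{t. t + c \<in> N}"]) (auto simp: translate_def)
  qed (intro Lp_loc_shift 1)+
qed

lemma translate_translate: "translate s (translate t f) = translate (s + t) f"
  by (auto simp: translate_def add.assoc)

lemma translate_zero: "translate 0 f = f"
  by (simp add: translate_def)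

text \<open>The almost everywhere quantifiers of \<open>LC\<close> made explicit on one ball: a
  single nonnegative \<open>k\<close> serves as bound and as Lipschitz constant, is integrable
  together with its \<open>p\<close>-th power, and all exceptions sit in one null set
  \<open>N\<close>. One \<open>k\<close> for both purposes is what the fixed point argument asks
  for.\<close>

definition envelope :: "nat \<Rightarrow> real \<Rightarrow> ('n::finite) dfield \<Rightarrow> (real \<Rightarrow> real) \<Rightarrow> real set \<Rightarrow> bool" where
  "envelope p r f k N \<longleftrightarrow> k \<in> borel_measurable lebesgue \<and> (\<forall>t. 0 \<le> k t) \<and> (\<forall>a b. (\<lambda>t. k t ^ p) integrable_on {a..b}) \<and>
     (\<forall>a b. k integrable_on {a..b}) \<and> negligible N \<and>
     (\<forall>t z. t \<notin> N \<and> norm z \<le> r \<longrightarrow> norm (f (t, z)) \<le> k t) \<and>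
     (\<forall>t z1 z2. t \<notin> N \<and> norm z1 \<le> r \<and> norm z2 \<le> r \<longrightarrow> norm (f (t, z1) - f (t, z2)) \<le> k t * norm (z1 - z2))"

lemma envelopeD:
  assumes "envelope p r f k N"
  shows "k \<in> borel_measurable lebesgue" "0 \<le> k t" "(\<lambda>t. k t ^ p) integrable_on {a..b}" "k integrable_on {a..b}" "negligible N"
    "\<lbrakk>t \<notin> N; norm z \<le> r\<rbrakk> \<Longrightarrow> norm (f (t, z)) \<le> k t"
    "\<lbrakk>t \<notin> N; norm z1 \<le> r; norm z2 \<le> r\<rbrakk> \<Longrightarrow> norm (f (t, z1) - f (t, z2)) \<le> k t * norm (z1 - z2)"
  using assms unfolding envelope_def by blast+

lemma LC_envelope:
  assumes f: "f \<in> LC p" and p: "1 \<le> p"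
  obtains k N where "envelope p r f k N"
proof -
  obtain m l where ml: "m \<in> Lp_loc p" "l \<in> Lp_loc p" "AE t in lebesgue. (\<forall>z\<in>cball 0 r. norm (f (t, z)) \<le> m t) \<and>
        (\<forall>z1\<in>cball 0 r. \<forall>z2\<in>cball 0 r. norm (f (t, z1) - f (t, z2)) \<le> l t * norm (z1 - z2))"
    using f compact_cball unfolding LC_def by blast
  then obtain N where N: "negligible N" "\<And>t. t \<notin> N \<Longrightarrow> (\<forall>z\<in>cball 0 r. norm (f (t, z)) \<le> m t) \<and>
        (\<forall>z1\<in>cball 0 r. \<forall>z2\<in>cball 0 r. norm (f (t, z1) - f (t, z2)) \<le> l t * norm (z1 - z2))"
    unfolding AE_lebesgue_negligible by blast
  define k where "k t = \<bar>m t\<bar> + \<bar>l t\<bar>" for t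
  have k: "k \<in> Lp_loc p" "k \<in> Lp_loc 1" unfolding k_def using Lp_loc_add[OF ml(1,2)] Lp_loc_imp_L1[OF p] by auto
  have "envelope p r f k N"
    unfolding envelope_def
  proof (intro conjI allI impI N(1))
    have k0: "\<bar>k t\<bar> = k t" for t by (simp add: k_def)
    show "k \<in> borel_measurable lebesgue" "(\<lambda>t. k t ^ p) integrable_on {a..b}" "k integrable_on {a..b}" for a b
      using k k0 by (auto simp: Lp_loc_iff)
    show "0 \<le> k t" for t by (simp add: k_def)
    show "norm (f (t, z)) \<le> k t" if "t \<notin> N \<and> norm z \<le> r" for t z
    proof -
      have "norm (f (t, z)) \<le> m t" using N(2)[of t] that by simp
      then show ?thesis by (simp add: k_def)
    qed
    show "norm (f (t, z1) - f (t, z2)) \<le> k t * norm (z1 - z2)" if "t \<notin> N \<and> norm z1 \<le> r \<and> norm z2 \<le> r" for t z1 z2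
    proof -
      have "norm (f (t, z1) - f (t, z2)) \<le> l t * norm (z1 - z2)" using N(2)[of t] that by simp
      also have "\<dots> \<le> k t * norm (z1 - z2)" by (intro mult_right_mono) (auto simp: k_def)
      finally show ?thesis .
    qed
  qed
  then show ?thesis by (rule that)
qed

lemma field_measurable:
  fixes f :: "('n::finite) dfield"
  assumes f: "f \<in> LC p" and z: "z \<in> borel_measurable (lebesgue_on S)"
  shows "(\<lambda>t. f (t, z t)) \<in> borel_measurable (lebesgue_on S)"
proof -
  have "(\<lambda>t::real. t) \<in> borel_measurable (lebesgue_on S)"
    using id_borel_measurable_lebesgue_on by (simp add: id_def)
  from measurable_compose[OF borel_measurable_Pair[OF this z] LC_borel[OF f]]
  show ?thesis .
qed

lemma field_integrable:
  fixes f :: "('n::finite) dfield"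
  assumes f: "f \<in> LC p" and env: "envelope p r f k N"
    and z: "z \<in> borel_measurable (lebesgue_on {a..b})" "\<And>t. t \<in> {a..b} \<Longrightarrow> norm (z t) \<le> r"
  shows "(\<lambda>t. f (t, z t)) absolutely_integrable_on {a..b}"
    "norm (integral {a..b} (\<lambda>t. f (t, z t))) \<le> integral {a..b} k"
    "(\<lambda>t. norm (f (t, z t)) ^ p) absolutely_integrable_on {a..b}"
    "integral {a..b} (\<lambda>t. norm (f (t, z t)) ^ p) \<le> integral {a..b} (\<lambda>t. k t ^ p)"
proof -
  note E = envelopeD[OF env]
  have m: "(\<lambda>t. f (t, z t)) \<in> borel_measurable (lebesgue_on {a..b})"
    by (rule field_measurable[OF f z(1)])
  have bd: "norm (f (t, z t)) \<le> k t" if "t \<in> {a..b}" "t \<notin> N" for t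
    by (rule E(6)[OF that(2) z(2)[OF that(1)]])
  have mp: "(\<lambda>t. norm (f (t, z t)) ^ p) \<in> borel_measurable (lebesgue_on {a..b})" using m by simp
  show "(\<lambda>t. f (t, z t)) absolutely_integrable_on {a..b}"
    "norm (integral {a..b} (\<lambda>t. f (t, z t))) \<le> integral {a..b} k"
    by (rule absolutely_integrable_dominated[OF m _ E(4,5)]; use bd in auto)+
  show "(\<lambda>t. norm (f (t, z t)) ^ p) absolutely_integrable_on {a..b}"
    by (rule absolutely_integrable_dominated[OF mp _ E(3,5)]) (use bd in \<open>auto intro!: power_mono\<close>)
  have "norm (integral {a..b} (\<lambda>t. norm (f (t, z t)) ^ p)) \<le> integral {a..b} (\<lambda>t. k t ^ p)"
    by (rule absolutely_integrable_dominated[OF mp _ E(3,5)]) (use bd in \<open>auto intro!: power_mono\<close>)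
  then show "integral {a..b} (\<lambda>t. norm (f (t, z t)) ^ p) \<le> integral {a..b} (\<lambda>t. k t ^ p)" by simp
qed

text \<open>The graph of a curve is negligible in the product space, so equality almost everywhere
  says nothing along it. Here the exceptional set constrains \<open>t\<close> alone, and
  substitution of any curve is harmless.\<close>

definition field_eq :: "('n::finite) dfield \<Rightarrow> 'n dfield \<Rightarrow> bool" where
  "field_eq f g \<longleftrightarrow> (\<exists>N. negligible N \<and> (\<forall>t z. t \<notin> N \<longrightarrow> f (t, z) = g (t, z)))"

lemma field_eq_sym: "field_eq f g \<Longrightarrow> field_eq g f"
  unfolding field_eq_def by metis

text \<open>The exceptional sets of the envelopes on all balls of integer radius are united; their
  union is still negligible.\<close>

lemma LC_continuous_AE:
  fixes f :: "('n::finite) dfield"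
  assumes f: "f \<in> LC p" and p: "1 \<le> p"
  obtains N where "negligible N" "\<And>t. t \<notin> N \<Longrightarrow> continuous_on UNIV (\<lambda>z. f (t, z))"
proof -
  have "\<exists>k N. envelope p (real n) f k N" for n using LC_envelope[OF f p] by blast
  then obtain k N where env: "\<And>n. envelope p (real n) f (k n) (N n)" by metis
  have neg: "negligible (\<Union>n. N n)" using envelopeD(5)[OF env] by (intro negligible_countable_Union) auto
  show ?thesis
  proof (rule that[OF neg])
    fix t assume t: "t \<notin> (\<Union>n. N n)"
    show "continuous_on UNIV (\<lambda>z. f (t, z))"
    proof (rule continuous_at_imp_continuous_on, intro ballI)
      fix z :: "(real^'n) \<times> (real^'n)"
      obtain n :: nat where n: "norm z < n" using reals_Archimedean2 by blast
      have "(k n t)-lipschitz_on (ball 0 n) (\<lambda>z. f (t, z))"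
      proof (rule lipschitz_onI)
        fix z1 z2 :: "(real^'n) \<times> (real^'n)" assume "z1 \<in> ball 0 n" "z2 \<in> ball 0 n"
        then show "dist (f (t, z1)) (f (t, z2)) \<le> k n t * dist z1 z2"
          unfolding dist_norm using t by (intro envelopeD(7)[OF env]) (simp_all only: mem_ball dist_0_norm less_imp_le, blast)
      qed (rule envelopeD(2)[OF env])
      then have "continuous_on (ball 0 n) (\<lambda>z. f (t, z))" by (rule lipschitz_on_continuous_on)
      then show "isCont (\<lambda>z. f (t, z)) z" using n by (simp add: continuous_on_eq_continuous_at)
    qed
  qed
qed

text \<open>By Fubini, for almost every \<open>t\<close> the two fields agree for almost every
  \<open>z\<close>. Both are continuous in \<open>z\<close> for almost every \<open>t\<close>, so
  the set of disagreement is open and negligible, hence empty.\<close>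

lemma LC_rel_imp_field_eq:
  fixes f g :: "('n::finite) dfield"
  assumes fg: "(f, g) \<in> LC_rel p" and p: "1 \<le> p"
  shows "field_eq f g"
proof -
  have f: "f \<in> LC p" and g: "g \<in> LC p" and n: "negligible {w. f w \<noteq> g w}" using fg by (auto simp: LC_rel_def)
  note [measurable] = LC_borel[OF f] LC_borel[OF g]
  have "{w \<in> space borel. f w \<noteq> g w} \<in> sets borel" by measurable
  \<comment> \<open>The set is Borel, so the argument may leave the completed measure for
    \<open>lborel\<close>, which is a product measure and admits Fubini.\<close>
  then have "{w. f w \<noteq> g w} \<in> null_sets lborel"
    using n by (simp add: negligible_iff_null_sets null_sets_completion_iff)
  then have "AE w in lborel. f w = g w" by (rule AE_I') auto
  moreover have eq: "(lborel :: real measure) \<Otimes>\<^sub>M (lborel :: ((real^'n) \<times> (real^'n)) measure) = lborel"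
    by (rule lborel_prod)
  ultimately have "AE w in (lborel :: real measure) \<Otimes>\<^sub>M (lborel :: ((real^'n) \<times> (real^'n)) measure). f w = g w"
    by (simp only: eq)
  then have "AE t in (lborel :: real measure). AE z in (lborel :: ((real^'n) \<times> (real^'n)) measure). f (t, z) = g (t, z)"
    by (rule lborel_pair.AE_pair)
  then have "AE t in (lebesgue :: real measure). AE z in (lborel :: ((real^'n) \<times> (real^'n)) measure). f (t, z) = g (t, z)"
    by (rule AE_completion)
  then obtain N where N: "negligible N" "\<And>t. t \<notin> N \<Longrightarrow> AE z in (lborel :: ((real^'n) \<times> (real^'n)) measure). f (t, z) = g (t, z)"
    unfolding AE_lebesgue_negligible by blast
  obtain N1 where N1: "negligible N1" "\<And>t. t \<notin> N1 \<Longrightarrow> continuous_on UNIV (\<lambda>z. f (t, z))" using LC_continuous_AE[OF f p] by blast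
  obtain N2 where N2: "negligible N2" "\<And>t. t \<notin> N2 \<Longrightarrow> continuous_on UNIV (\<lambda>z. g (t, z))" using LC_continuous_AE[OF g p] by blast
  show ?thesis unfolding field_eq_def
  proof (intro exI conjI allI impI)
    show "negligible (N \<union> N1 \<union> N2)" using N N1 N2 by simp
    fix t z assume t: "t \<notin> N \<union> N1 \<union> N2"
    then have "continuous_on UNIV (\<lambda>z. f (t, z))" "continuous_on UNIV (\<lambda>z. g (t, z))" using N1(2) N2(2) by auto
    then have op: "open {z. f (t, z) \<noteq> g (t, z)}" by (rule open_Collect_neq)
    have "AE z in (lebesgue :: ((real^'n) \<times> (real^'n)) measure). f (t, z) = g (t, z)"
      using N(2) t by (intro AE_completion) auto
    then obtain M where M: "negligible M" "\<And>z. z \<notin> M \<Longrightarrow> f (t, z) = g (t, z)" unfolding AE_lebesgue_negligible by blast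
    have "{z. f (t, z) \<noteq> g (t, z)} \<subseteq> M" using M(2) by blast
    then have "negligible {z. f (t, z) \<noteq> g (t, z)}" by (rule negligible_subset[OF M(1)])
    then have "{z. f (t, z) \<noteq> g (t, z)} = {}" using op open_not_negligible by blast
    then show "f (t, z) = g (t, z)" by blast
  qed
qed

lemma equiv_LC_rel: "equiv (LC p) (LC_rel p)"
proof (rule equivI)
  show "LC_rel p \<subseteq> LC p \<times> LC p" by (auto simp: LC_rel_def)
  show "refl_on (LC p) (LC_rel p)" by (auto simp: refl_on_def LC_rel_def)
  show "sym (LC_rel p)" by (auto simp: sym_def LC_rel_def eq_commute)
  show "trans (LC_rel p)"
  proof (rule transI)
    fix f g h assume "(f, g) \<in> LC_rel p" "(g, h) \<in> LC_rel p"
    then show "(f, h) \<in> LC_rel p" unfolding LC_rel_def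
      by (auto intro: negligible_subset[OF negligible_Un[of "{w. f w \<noteq> g w}" "{w. g w \<noteq> h w}"]])
  qed
qed

lemma LC_space_iff: "G \<in> LC_space p \<longleftrightarrow> (\<exists>g\<in>LC p. G = LC_class p g)"
  unfolding LC_space_def LC_class_def quotient_def by auto

lemma LC_class_self: "f \<in> LC p \<Longrightarrow> f \<in> LC_class p f"
  unfolding LC_class_def using equiv_class_self[OF equiv_LC_rel] .

lemma rep_in: "G \<in> LC_space p \<Longrightarrow> rep G \<in> G"
  unfolding rep_def LC_space_iff using LC_class_self by (metis someI)

lemma LC_space_memD: "G \<in> LC_space p \<Longrightarrow> g \<in> G \<Longrightarrow> g \<in> LC p \<and> G = LC_class p g"
proof -
  assume "G \<in> LC_space p" "g \<in> G"
  then obtain g0 where g0: "G = LC_rel p `` {g0}" "(g0, g) \<in> LC_rel p" unfolding LC_space_iff LC_class_def by blast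
  then have "g \<in> LC p" by (simp add: LC_rel_def)
  then show ?thesis using g0 equiv_class_eq[OF equiv_LC_rel g0(2)] by (simp add: LC_class_def)
qed

lemma rep_LC: "G \<in> LC_space p \<Longrightarrow> rep G \<in> LC p" and LC_class_rep: "G \<in> LC_space p \<Longrightarrow> LC_class p (rep G) = G"
  using LC_space_memD rep_in by metis+

lemma rep_LC_class: "\<lbrakk>f \<in> LC p; 1 \<le> p\<rbrakk> \<Longrightarrow> field_eq (rep (LC_class p f)) f"
proof -
  assume f: "f \<in> LC p" and p: "1 \<le> p"
  then have "LC_class p f \<in> LC_space p" by (auto simp: LC_space_iff)
  from rep_in[OF this] have "(f, rep (LC_class p f)) \<in> LC_rel p" by (simp add: LC_class_def)
  then show ?thesis using LC_rel_imp_field_eq[OF _ p] field_eq_sym by blast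
qed

lemma LC_rel_translate:
  assumes "(f, g) \<in> LC_rel p" shows "(translate c f, translate c g) \<in> LC_rel p"
proof -
  have "negligible ((+) (- c, 0) ` {w. f w \<noteq> g w})"
    using assms by (intro negligible_translation) (simp add: LC_rel_def)
  moreover have "(+) (- c, 0) ` {w. f w \<noteq> g w} = {w. translate c f w \<noteq> translate c g w}"
  proof (intro set_eqI iffI)
    fix w assume "w \<in> {w. translate c f w \<noteq> translate c g w}"
    then have "f (w + (c, 0)) \<noteq> g (w + (c, 0))" by (cases w) (auto simp: translate_def)
    then show "w \<in> (+) (- c, 0) ` {w. f w \<noteq> g w}"
      by (intro image_eqI[of _ _ "w + (c, 0)"]) (cases w, auto)
  qed (auto simp: translate_def)
  ultimately show ?thesis using assms by (auto simp: LC_rel_def LC_translate)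
qed

lemma translate_image_class: "f \<in> LC p \<Longrightarrow> translate c ` LC_class p f = LC_class p (translate c f)"
proof (intro set_eqI iffI)
  fix g assume "f \<in> LC p" "g \<in> LC_class p (translate c f)"
  then have "(translate (- c) (translate c f), translate (- c) g) \<in> LC_rel p"
    by (intro LC_rel_translate) (simp add: LC_class_def)
  then have "translate (- c) g \<in> LC_class p f" by (simp add: LC_class_def translate_translate translate_zero)
  then show "g \<in> translate c ` LC_class p f"
    by (intro image_eqI[of _ _ "translate (- c) g"]) (simp_all add: translate_translate translate_zero)
qed (auto simp: LC_class_def intro: LC_rel_translate)

lemma translate_image_LC_space:
  assumes "G \<in> LC_space p"
  shows "translate c ` G = LC_class p (translate c (rep G))" "translate c ` G \<in> LC_space p"
  using translate_image_class[OF rep_LC[OF assms], of c] LC_class_rep[OF assms] LC_translate[OF rep_LC[OF assms], of c]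
  by (auto simp: LC_space_iff)

text \<open>The choice made by \<open>rep\<close> is independent in each class, so it commutes with
  translation only up to \<open>field_eq\<close>.\<close>

lemma rep_translate_image:
  "\<lbrakk>G \<in> LC_space p; 1 \<le> p\<rbrakk> \<Longrightarrow> field_eq (rep (translate c ` G)) (translate c (rep G))"
  using translate_image_LC_space(1) rep_LC_class LC_translate rep_LC by metis

section \<open>Solutions of the delay equation\<close>

definition pr :: "real \<Rightarrow> 'a::euclidean_space \<Rightarrow> 'a" where
  "pr R = closest_point (cball 0 R)"

lemma norm_pr_le: "0 \<le> R \<Longrightarrow> norm (pr R x) \<le> R"
  using closest_point_in_set[of "cball 0 R" x] by (simp add: pr_def)

lemma pr_self: "norm x \<le> R \<Longrightarrow> pr R x = x"
  by (simp add: pr_def closest_point_self)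

lemma pr_lipschitz: "0 \<le> R \<Longrightarrow> norm (pr R x - pr R y) \<le> norm (x - y)"
  using closest_point_lipschitz[of "cball 0 R" x y] by (simp add: pr_def dist_norm)

lemma continuous_on_pr:
  assumes "0 \<le> R" "continuous_on S x"
  shows "continuous_on S (\<lambda>t. pr R (x t))"
proof (rule continuous_on_compose2[OF _ assms(2) subset_UNIV])
  have "1-lipschitz_on UNIV (pr R :: 'b \<Rightarrow> 'b)"
    by (rule lipschitz_onI) (use pr_lipschitz[OF assms(1)] in \<open>auto simp: dist_norm\<close>)
  then show "continuous_on UNIV (pr R :: 'b \<Rightarrow> 'b)" by (rule lipschitz_on_continuous_on)
qed

text \<open>The origin of the radius \<open>2 * R\<close> in the envelopes used for delay equations:
  present and delayed value are each bounded by \<open>R\<close>.\<close>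

lemma norm_Pair_le_add: "norm x \<le> R \<Longrightarrow> norm u \<le> R \<Longrightarrow> norm (x, u) \<le> 2 * R"
  using norm_Pair_le[of x u] by simp

lemma kernel_envelope: "envelope p r g k N \<Longrightarrow> kernel k"
  by unfold_locales (auto dest: envelopeD)

text \<open>The projections make the local bounds of an envelope global, and the value 0 on
  \<open>N\<close> turns almost everywhere bounds into everywhere ones, as the locale
  \<open>caratheodory\<close> demands.\<close>

definition cut :: "real \<Rightarrow> real set \<Rightarrow> ('n::finite) dfield \<Rightarrow> real \<Rightarrow> real ^ 'n \<Rightarrow> real ^ 'n \<Rightarrow> real ^ 'n" where
  "cut R N g t y u = (if t \<in> N then 0 else g (t, pr R y, pr R u))"

lemma caratheodory_cut:
  fixes g :: "('n::finite) dfield"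
  assumes g: "g \<in> LC p" and env: "envelope p (2 * R) g k N" and R: "0 \<le> R"
  shows "caratheodory k (cut R N g)"
proof -
  interpret kernel k by (rule kernel_envelope[OF env])
  note E = envelopeD[OF env]
  show ?thesis
  proof
    have b: "norm (pr R y, pr R u) \<le> 2 * R" for y u :: "real ^ 'n"
      by (intro norm_Pair_le_add norm_pr_le R)
    show "norm (cut R N g t y u) \<le> k t" for t y u
      using E(2,6) b by (auto simp: cut_def)
    show "norm (cut R N g t y u - cut R N g t y' u') \<le> k t * (norm (y - y') + norm (u - u'))" for t y u y' u'
    proof (cases "t \<in> N")
      case False
      then have "norm (cut R N g t y u - cut R N g t y' u') \<le> k t * norm ((pr R y, pr R u) - (pr R y', pr R u'))"
        using E(7)[OF False b b] by (simp add: cut_def)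
      also have "\<dots> \<le> k t * (norm (pr R y - pr R y') + norm (pr R u - pr R u'))"
        using norm_Pair_le[of "pr R y - pr R y'" "pr R u - pr R u'"] E(2) by (intro mult_left_mono) auto
      also have "\<dots> \<le> k t * (norm (y - y') + norm (u - u'))"
        by (intro mult_left_mono add_mono pr_lipschitz R E(2))
      finally show ?thesis .
    qed (simp add: cut_def E(2))
    fix y u :: "real \<Rightarrow> real ^ 'n" assume "continuous_on UNIV y" "continuous_on UNIV u"
    then have "continuous_on UNIV (\<lambda>t. (pr R (y t), pr R (u t)))"
      by (intro continuous_intros continuous_on_pr R)
    then have "(\<lambda>t. (pr R (y t), pr R (u t))) \<in> borel_measurable (lebesgue_on UNIV)"
      by (intro continuous_imp_measurable_on_sets_lebesgue) auto
    then have "(\<lambda>t. g (t, pr R (y t), pr R (u t))) \<in> borel_measurable lebesgue"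
      using field_measurable[OF g, of "\<lambda>t. (pr R (y t), pr R (u t))" UNIV] by simp
    moreover have "{t \<in> space lebesgue. t \<in> N} \<in> sets lebesgue"
      using E(5) by (simp add: negligible_iff_null_sets null_setsD2)
    ultimately show "(\<lambda>t. cut R N g t (y t) (u t)) \<in> borel_measurable lebesgue"
      unfolding cut_def by (intro measurable_If) auto
  qed
qed

text \<open>Projecting the arguments into a ball excludes blow-up, so the truncated equation is
  solvable for all times. It solves the original equation as long as the solution stays in the
  ball.\<close>

lemma truncated_solution:
  fixes g :: "('n::finite) dfield"
  assumes g: "g \<in> LC p" "1 \<le> p" and R: "0 \<le> R" and \<phi>: "continuous_on {-1..0} \<phi>"
  obtains y where "continuous_on UNIV y" "\<And>t. t \<in> {-1..0} \<Longrightarrow> y t = \<phi> t"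
    "\<And>t. 0 \<le> t \<Longrightarrow> y t = \<phi> 0 + integral {0..t} (\<lambda>s. g (s, pr R (y s), pr R (y (s - 1))))"
proof -
  obtain k N where env: "envelope p (2 * R) g k N" using LC_envelope[OF g] by blast
  interpret caratheodory k "cut R N g" by (rule caratheodory_cut[OF g(1) env R])
  \<comment> \<open>The history is continued by constants on both sides of \<open>{-1..0}\<close>,
    which keeps it continuous and bounded on the line.\<close>
  define \<psi> where "\<psi> t = \<phi> (max (-1) (min t 0))" for t
  have "continuous_on UNIV \<psi>" unfolding \<psi>_def
    by (rule continuous_on_compose2[OF \<phi>]) (auto intro!: continuous_intros)
  moreover have "bounded (range \<psi>)"
    by (rule bounded_subset[OF compact_imp_bounded[OF compact_continuous_image[OF \<phi>]]]) (auto simp: \<psi>_def)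
  ultimately obtain y where y: "continuous_on UNIV y" "\<And>t. t \<le> 0 \<Longrightarrow> y t = \<psi> t"
    "\<And>t. 0 \<le> t \<Longrightarrow> y t = \<psi> 0 + integral {0..t} (\<lambda>s. cut R N g s (y s) (y (s - 1)))"
    using global_solution by blast
  show ?thesis
  proof (rule that[OF y(1)])
    show "y t = \<phi> t" if "t \<in> {-1..0}" for t using y(2)[of t] that by (simp add: \<psi>_def)
    have "integral {0..t} (\<lambda>s. cut R N g s (y s) (y (s - 1))) = integral {0..t} (\<lambda>s. g (s, pr R (y s), pr R (y (s - 1))))" for t
      by (rule integral_spike[OF envelopeD(5)[OF env]]) (auto simp: cut_def)
    then show "y t = \<phi> 0 + integral {0..t} (\<lambda>s. g (s, pr R (y s), pr R (y (s - 1))))" if "0 \<le> t" for t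
      using y(3)[OF that] by (simp add: \<psi>_def)
  qed
qed

lemma bounded_on_interval:
  fixes x :: "real \<Rightarrow> 'a::real_normed_vector"
  assumes "continuous_on {a..b} x"
  obtains R where "0 \<le> R" "\<And>t. t \<in> {a..b} \<Longrightarrow> norm (x t) \<le> R"
proof -
  have "bounded (x ` {a..b})" by (rule compact_imp_bounded[OF compact_continuous_image[OF assms compact_Icc]])
  then obtain R where "\<forall>v\<in>x ` {a..b}. norm v \<le> R" unfolding bounded_iff by blast
  then have "norm (x t) \<le> max R 0" if "t \<in> {a..b}" for t using that by force
  then show ?thesis by (intro that[of "max R 0"]) auto
qed

lemma delay_field_integrable:
  fixes g :: "('n::finite) dfield"
  assumes g: "g \<in> LC p" "1 \<le> p" and x: "continuous_on {a..b} x" "continuous_on {a..b} u"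
  shows "(\<lambda>s. g (s, x s, u s)) absolutely_integrable_on {a..b}"
proof -
  have c: "continuous_on {a..b} (\<lambda>s. (x s, u s))" by (intro continuous_intros x)
  obtain r where r: "\<And>t. t \<in> {a..b} \<Longrightarrow> norm (x t, u t) \<le> r"
    using bounded_on_interval[OF c] by blast
  obtain k N where env: "envelope p r g k N" using LC_envelope[OF g] by blast
  show ?thesis
    by (rule field_integrable(1)[OF g(1) env continuous_imp_measurable_on_sets_lebesgue[OF c] r]) auto
qed

lemma continuous_on_shift1: "continuous_on {-1..T} x \<Longrightarrow> continuous_on {0..T} (\<lambda>s. x (s - 1 :: real))"
  by (rule continuous_on_compose2[of "{-1..T}"]) (auto intro!: continuous_intros)

lemma solution_rhs_integrable:
  fixes g :: "('n::finite) dfield"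
  assumes g: "g \<in> LC p" "1 \<le> p" and x: "continuous_on {-1..T} x" and st: "0 \<le> s" "t \<le> T"
  shows "(\<lambda>s. g (s, x s, x (s - 1))) absolutely_integrable_on {s..t}"
proof (rule delay_field_integrable[OF g])
  show "continuous_on {s..t} x" by (rule continuous_on_subset[OF x]) (use st in auto)
  show "continuous_on {s..t} (\<lambda>s. x (s - 1))" by (rule continuous_on_subset[OF continuous_on_shift1[OF x]]) (use st in auto)
qed

text \<open>Integrated form of the equation on a compact interval. It suits gluing, change of
  representative and Gronwall estimates better than the derivative almost everywhere in
  \<open>is_solution\<close>; the lemmas below pass from one form to the other.\<close>

definition integral_solution ::
  "('n::finite) dfield \<Rightarrow> (real \<Rightarrow> real ^ 'n) \<Rightarrow> real \<Rightarrow> (real \<Rightarrow> real ^ 'n) \<Rightarrow> bool" where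
  "integral_solution g \<phi> T x \<longleftrightarrow> continuous_on {-1..T} x \<and> (\<forall>t\<in>{-1..0}. x t = \<phi> t) \<and>
     (\<forall>t\<in>{0..T}. x t = \<phi> 0 + integral {0..t} (\<lambda>s. g (s, x s, x (s - 1))))"

lemma integral_solution_mono: "integral_solution g \<phi> T x \<Longrightarrow> S \<le> T \<Longrightarrow> integral_solution g \<phi> S x"
  unfolding integral_solution_def by (auto elim: continuous_on_subset)

lemma integral_solution_cong:
  assumes "integral_solution g \<phi> T x" "\<And>t. t \<in> {-1..T} \<Longrightarrow> y t = x t" "0 \<le> T"
  shows "integral_solution g \<phi> T y"
proof -
  have "integral {0..t} (\<lambda>s. g (s, y s, y (s - 1))) = integral {0..t} (\<lambda>s. g (s, x s, x (s - 1)))" if "t \<in> {0..T}" for t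
    by (rule integral_cong) (use that assms(2) in auto)
  moreover have "continuous_on {-1..T} y"
    by (rule continuous_on_eq[of _ x]) (use assms in \<open>auto simp: integral_solution_def\<close>)
  ultimately show ?thesis using assms unfolding integral_solution_def by auto
qed

lemma integral_solution_field_eq:
  assumes "integral_solution g \<phi> T x" "field_eq g g'"
  shows "integral_solution g' \<phi> T x"
proof -
  obtain N where N: "negligible N" "\<And>t z. t \<notin> N \<Longrightarrow> g (t, z) = g' (t, z)" using assms(2) unfolding field_eq_def by blast
  have "integral {0..t} (\<lambda>s. g (s, x s, x (s - 1))) = integral {0..t} (\<lambda>s. g' (s, x s, x (s - 1)))" for t
    by (rule integral_spike[OF N(1)]) (simp add: N(2))
  then show ?thesis using assms(1) by (simp add: integral_solution_def)
qed

lemma is_solution_imp_integral_solution: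
  fixes g :: "('n::finite) dfield"
  assumes x: "is_solution g \<phi> b x" and T: "0 \<le> T" "ereal T < b"
  shows "integral_solution g \<phi> T x"
  unfolding integral_solution_def
proof (intro conjI ballI)
  have sub: "{-1..T} \<subseteq> solution_interval b"
    using T(2) by (auto simp: solution_interval_def intro: le_less_trans[of _ "ereal T"])
  show "continuous_on {-1..T} x" using x sub by (auto simp: is_solution_def intro: continuous_on_subset)
  show "x t = \<phi> t" if "t \<in> {-1..0}" for t using x that by (simp add: is_solution_def)
  obtain N where N: "negligible N" "\<And>t. \<lbrakk>t \<notin> N; 0 < t; ereal t < b\<rbrakk> \<Longrightarrow> (x has_vector_derivative g (t, x t, x (t - 1))) (at t)"
    using x unfolding is_solution_def AE_lebesgue_negligible by blast
  fix t assume t: "t \<in> {0..T}"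
  have tb: "ereal s < b" if "s \<le> t" for s using t T(2) that by (auto intro: le_less_trans[of _ "ereal T"])
  have "((\<lambda>s. g (s, x s, x (s - 1))) has_integral x t - x 0) {0..t}"
  proof (rule has_integral_AC_derivative)
    show "absolutely_continuous_on_interval 0 t x" using x t tb[of t] by (simp add: is_solution_def)
    \<comment> \<open>The equation is only assumed for \<open>0 < t\<close>, so the left endpoint
      joins the exceptional set.\<close>
    show "negligible (insert 0 N)" using N(1) by simp
    show "(x has_vector_derivative g (s, x s, x (s - 1))) (at s within {0..t})" if "s \<in> {0..t} - insert 0 N" for s
      by (rule has_vector_derivative_at_within[OF N(2)]) (use that tb[of s] in auto)
  qed (use t in auto)
  then show "x t = \<phi> 0 + integral {0..t} (\<lambda>s. g (s, x s, x (s - 1)))"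
    using x T by (auto simp: integral_unique is_solution_def)
qed

text \<open>The bound \<open>b\<close> may be infinite, and integrability is known only on compact
  parts of the interval. Differentiability is therefore obtained below each rational
  \<open>q\<close> with \<open>ereal q < b\<close>, and the countably many null sets are
  united.\<close>

lemma integral_solution_imp_is_solution:
  fixes g :: "('n::finite) dfield"
  assumes g: "g \<in> LC p" "1 \<le> p" and b: "0 < b"
    and x: "\<And>T. \<lbrakk>0 \<le> T; ereal T < b\<rbrakk> \<Longrightarrow> integral_solution g \<phi> T x"
  shows "is_solution g \<phi> b x"
proof -
  have between: "\<exists>q\<in>\<rat>. t < q \<and> 0 < q \<and> ereal q < b" if t: "ereal t < b" for t
  proof -
    have "ereal (max t 0) < b" using t b by (auto simp: max_def zero_ereal_def)
    then obtain c where c: "ereal (max t 0) < ereal c" "ereal c < b" using ereal_dense2 by blast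
    then obtain q where "q \<in> \<rat>" "max t 0 < q" "q < c" using Rats_dense_in_real[of "max t 0" c] by auto
    then show ?thesis using c(2) by (intro bexI[of _ q]) (auto intro: less_trans[of _ "ereal c"])
  qed
  have cont: "continuous_on {-1..T} x" if "0 \<le> T" "ereal T < b" for T
    using x[OF that] by (simp add: integral_solution_def)
  have int: "(\<lambda>s. g (s, x s, x (s - 1))) absolutely_integrable_on {0..T}" if "0 \<le> T" "ereal T < b" for T
    by (rule solution_rhs_integrable[OF g cont[OF that]]) auto
  show ?thesis
    unfolding is_solution_def
  proof (intro conjI ballI allI impI)
    show "0 < b" by fact
    show "continuous_on (solution_interval b) x"
      unfolding continuous_on_eq_continuous_within
    proof
      fix t assume t: "t \<in> solution_interval b"
      then obtain q where q: "t < q" "0 < q" "ereal q < b" using between[of t] by (auto simp: solution_interval_def)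
      have "ereal s < b" if "s \<le> q" for s using that q(3) by (auto intro: le_less_trans[of _ "ereal q"])
      then have "at t within solution_interval b = at t within {-1..q}"
        using q t by (intro at_within_nhd[of t "{..<q}"]) (auto simp: solution_interval_def)
      then show "continuous (at t within solution_interval b) x"
        using cont[of q] q t by (auto simp: continuous_on_eq_continuous_within solution_interval_def)
    qed
    show "x t = \<phi> t" if "t \<in> {-1..0}" for t using x[of 0] b that by (auto simp: integral_solution_def zero_ereal_def)
    show "absolutely_continuous_on_interval 0 c x" if "0 \<le> c" "ereal c < b" for c
    proof (rule AC_lipschitz_image[OF AC_indefinite_integral[OF int[OF that]]])
      fix u v assume "u \<in> {0..c}" "v \<in> {0..c}"
      then show "norm (x v - x u) \<le> 1 * norm (integral {0..v} (\<lambda>s. g (s, x s, x (s - 1))) - integral {0..u} (\<lambda>s. g (s, x s, x (s - 1))))"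
        using x[OF that] by (auto simp: integral_solution_def)
    qed
    have "\<exists>M. negligible M \<and> (\<forall>t. t \<notin> M \<and> 0 < t \<and> t < q \<longrightarrow> (x has_vector_derivative g (t, x t, x (t - 1))) (at t))"
      if q: "0 < q" "ereal q < b" for q
    proof -
      \<comment> \<open>Cut off at \<open>q\<close> because the differentiation lemma wants
        integrability on all intervals starting at 0, while \<open>x\<close> is controlled only
        below \<open>b\<close>.\<close>
      define F where "F s = (if s \<in> {0..q} then g (s, x s, x (s - 1)) else 0)" for s
      have "F integrable_on {0..c}" for c
      proof -
        have "(\<lambda>s. g (s, x s, x (s - 1))) integrable_on {0..min q c}"
          by (rule integrable_on_subinterval[OF set_lebesgue_integral_eq_integral(1)[OF int[of q]]]) (use q in auto)
        moreover have "{0..q} \<inter> {0..c} = {0..min q c}" by auto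
        ultimately show ?thesis unfolding F_def by (simp only: integrable_restrict_Int)
      qed
      then obtain M where M: "negligible M" "\<And>t. \<lbrakk>0 < t; t \<notin> M\<rbrakk> \<Longrightarrow> ((\<lambda>t. integral {0..t} F) has_vector_derivative F t) (at t)"
        using indefinite_integral_has_vector_derivative_AE[of F 0] by blast
      have "(x has_vector_derivative g (t, x t, x (t - 1))) (at t)" if t: "t \<notin> M" "0 < t" "t < q" for t
      proof -
        have "((\<lambda>t. \<phi> 0 + integral {0..t} F) has_vector_derivative F t) (at t)"
          using M(2)[of t] t by (auto intro!: derivative_eq_intros)
        then have "(x has_vector_derivative F t) (at t)"
        proof (rule has_vector_derivative_transform_within_open)
          fix y assume y: "y \<in> {0<..<q}"
          have "integral {0..y} F = integral {0..y} (\<lambda>s. g (s, x s, x (s - 1)))"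
            by (rule integral_cong) (use y in \<open>auto simp: F_def\<close>)
          then show "\<phi> 0 + integral {0..y} F = x y" using x[of q] q y by (simp add: integral_solution_def)
        qed (use t in auto)
        then show ?thesis using t by (simp add: F_def)
      qed
      then show ?thesis using M(1) by blast
    qed
    then obtain M where M: "\<And>q. \<lbrakk>0 < q; ereal q < b\<rbrakk> \<Longrightarrow> negligible (M q)"
      "\<And>q t. \<lbrakk>0 < q; ereal q < b; t \<notin> M q; 0 < t; t < q\<rbrakk> \<Longrightarrow> (x has_vector_derivative g (t, x t, x (t - 1))) (at t)"
      by metis
    define Q where "Q = {q \<in> \<rat>. 0 < q \<and> ereal q < b}"
    have "countable Q" unfolding Q_def by (rule countable_subset[OF _ countable_rat]) auto
    then have "negligible (\<Union>q\<in>Q. M q)" using M(1) by (intro negligible_countable_Union) (auto simp: Q_def)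
    then show "AE t in lebesgue. 0 < t \<and> ereal t < b \<longrightarrow> (x has_vector_derivative g (t, x t, x (t - 1))) (at t)"
      unfolding AE_lebesgue_negligible
    proof (intro exI[of _ "\<Union>q\<in>Q. M q"] conjI allI impI)
      fix t assume t: "t \<notin> (\<Union>q\<in>Q. M q)" "0 < t \<and> ereal t < b"
      then obtain q where "q \<in> \<rat>" "t < q" "0 < q" "ereal q < b" using between[of t] by blast
      then show "(x has_vector_derivative g (t, x t, x (t - 1))) (at t)" using M(2)[of q t] t by (auto simp: Q_def)
    qed
  qed
qed

text \<open>Projecting the arguments with \<open>pr R\<close> removes the need for an a priori bound on \<open>y\<close>.\<close>

lemma solution_compare:
  fixes g :: "('n::finite) dfield"
  assumes g: "g \<in> LC p" "1 \<le> p" and env: "envelope p (2 * R) g k N" and R: "0 \<le> R" and T: "0 \<le> T"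
    and x: "integral_solution g \<phi> T x" "\<And>t. t \<in> {-1..T} \<Longrightarrow> norm (x t) \<le> R"
    and y: "continuous_on {-1..T} y" "\<And>t. t \<in> {-1..0} \<Longrightarrow> norm (x t - y t) \<le> \<epsilon>"
      "\<And>t. t \<in> {0..T} \<Longrightarrow> norm (y t - y 0 - integral {0..t} (\<lambda>s. g (s, pr R (y s), pr R (y (s - 1))))) \<le> \<epsilon>"
    and t: "t \<in> {-1..T}"
  shows "norm (x t - y t) \<le> 4 * \<epsilon> * kernel.W k T"
proof -
  interpret kernel k by (rule kernel_envelope[OF env])
  note E = envelopeD[OF env]
  have \<epsilon>0: "0 \<le> \<epsilon>" using order_trans[OF norm_ge_zero y(2)[of 0]] by simp
  have xc: "continuous_on {-1..T} x" using x(1) by (simp add: integral_solution_def)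
  define d where "d t = norm (x t - y t)" for t
  have dc: "continuous_on {-1..T} d" unfolding d_def by (intro continuous_intros xc y(1))
  have wc: "continuous_on {-1..T} (\<lambda>s. pr R (y s))" by (intro continuous_on_pr R y(1))
  \<comment> \<open>The initial mismatch and the defect of \<open>y\<close> in the equation
    contribute \<open>\<epsilon>\<close> each, so Gronwall is applied with
    \<open>2 * \<epsilon>\<close>.\<close>
  have "d t \<le> 2 * (2 * \<epsilon>) * W T"
  proof (rule delay_gronwall[OF T _ dc _ _ _ t])
    show "0 \<le> 2 * \<epsilon>" using \<epsilon>0 by simp
    show "d t \<le> 2 * \<epsilon>" if "t \<in> {-1..0}" for t using y(2)[OF that] \<epsilon>0 by (simp add: d_def)
    fix t assume t: "t \<in> {0..T}"
    let ?a = "\<lambda>s. g (s, x s, x (s - 1))" and ?b = "\<lambda>s. g (s, pr R (y s), pr R (y (s - 1)))"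
    have ai: "?a integrable_on {0..t}" "?b integrable_on {0..t}"
      using set_lebesgue_integral_eq_integral(1)[OF solution_rhs_integrable[OF g xc, of 0 t]]
        set_lebesgue_integral_eq_integral(1)[OF solution_rhs_integrable[OF g wc, of 0 t]] t by auto
    have ki: "(\<lambda>s. k s * (d s + d (s - 1))) integrable_on {0..t}"
    proof -
      have c: "continuous_on {0..t} (\<lambda>s. d s + d (s - 1))"
        by (intro continuous_intros continuous_on_compose2[OF dc]) (use t in auto)
      have "(\<lambda>s. (d s + d (s - 1)) * k s) absolutely_integrable_on {0..t}"
        by (rule absolutely_integrable_bounded_measurable_product_real[OF _ _ _ k_absolutely_integrable])
          (auto intro: compact_imp_bounded[OF compact_continuous_image[OF c]] continuous_imp_measurable_on_sets_lebesgue[OF c])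
      then show ?thesis using set_lebesgue_integral_eq_integral(1) by (simp add: mult.commute)
    qed
    have "norm (integral {0..t} (\<lambda>s. ?a s - ?b s)) \<le> integral {0..t} (\<lambda>s. k s * (d s + d (s - 1)))"
    proof (rule absolutely_integrable_dominated(2)[OF _ _ ki E(5)])
      show "(\<lambda>s. ?a s - ?b s) \<in> borel_measurable (lebesgue_on {0..t})"
        using integrable_diff[OF ai] by (rule integrable_imp_measurable)
      fix s assume s: "s \<in> {0..t}" "s \<notin> N"
      have nx: "norm (x s) \<le> R" "norm (x (s - 1)) \<le> R" using x(2) s t by auto
      have "norm (?a s - ?b s) \<le> k s * norm ((x s, x (s - 1)) - (pr R (y s), pr R (y (s - 1))))"
        by (intro E(7) s norm_Pair_le_add nx norm_pr_le R)
      also have "\<dots> \<le> k s * (norm (x s - pr R (y s)) + norm (x (s - 1) - pr R (y (s - 1))))"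
        using norm_Pair_le[of "x s - pr R (y s)" "x (s - 1) - pr R (y (s - 1))"] E(2) by (intro mult_left_mono) auto
      also have "\<dots> \<le> k s * (d s + d (s - 1))"
        unfolding d_def using pr_lipschitz[OF R, of "x s" "y s"] pr_lipschitz[OF R, of "x (s - 1)" "y (s - 1)"] nx
        by (intro mult_left_mono add_mono E(2)) (auto simp: pr_self)
      finally show "norm (?a s - ?b s) \<le> k s * (d s + d (s - 1))" .
    qed simp
    moreover have eq: "x t - y t = (x 0 - y 0) + integral {0..t} (\<lambda>s. ?a s - ?b s) - (y t - y 0 - integral {0..t} ?b)"
    proof -
      have 1: "x t = x 0 + integral {0..t} ?a" using x(1) t T by (auto simp: integral_solution_def)
      show ?thesis unfolding integral_diff[OF ai] 1 by simp
    qed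
    moreover have "norm (x 0 - y 0) \<le> \<epsilon>" using y(2)[of 0] by simp
    ultimately show "d t \<le> 2 * \<epsilon> + integral {0..t} (\<lambda>s. k s * (d s + d (s - 1)))"
      using y(3)[OF t]
        norm_triangle_ineq4[of "(x 0 - y 0) + integral {0..t} (\<lambda>s. ?a s - ?b s)" "y t - y 0 - integral {0..t} ?b"]
        norm_triangle_ineq[of "x 0 - y 0" "integral {0..t} (\<lambda>s. ?a s - ?b s)"]
      unfolding d_def[of t] eq by linarith
  qed (simp add: d_def)
  then show ?thesis by (simp add: d_def)
qed

text \<open>Comparison with error 0. The radius \<open>R\<close> bounds both solutions, so the
  projections in the comparison do nothing.\<close>

lemma integral_solution_unique:
  fixes g :: "('n::finite) dfield"
  assumes g: "g \<in> LC p" "1 \<le> p" and T: "0 \<le> T"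
    and x: "integral_solution g \<phi> T x" and y: "integral_solution g \<phi> T y" and t: "t \<in> {-1..T}"
  shows "x t = y t"
proof -
  have c: "continuous_on {-1..T} x" "continuous_on {-1..T} y" using x y by (simp_all add: integral_solution_def)
  obtain R1 where R1: "0 \<le> R1" "\<And>t. t \<in> {-1..T} \<Longrightarrow> norm (x t) \<le> R1" using bounded_on_interval[OF c(1)] by blast
  obtain R2 where R2: "0 \<le> R2" "\<And>t. t \<in> {-1..T} \<Longrightarrow> norm (y t) \<le> R2" using bounded_on_interval[OF c(2)] by blast
  define R where "R = max R1 R2"
  have R: "0 \<le> R" "\<And>t. t \<in> {-1..T} \<Longrightarrow> norm (x t) \<le> R" "\<And>t. t \<in> {-1..T} \<Longrightarrow> norm (y t) \<le> R"
    using R1 R2 by (auto simp: R_def max.coboundedI1 max.coboundedI2)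
  obtain k N where env: "envelope p (2 * R) g k N" using LC_envelope[OF g] by blast
  have "norm (x t - y t) \<le> 4 * 0 * kernel.W k T"
  proof (rule solution_compare[OF g env R(1) T x R(2) c(2) _ _ t])
    show "norm (x t - y t) \<le> 0" if "t \<in> {-1..0}" for t using x y that by (simp add: integral_solution_def)
    fix t assume t: "t \<in> {0..T}"
    have "integral {0..t} (\<lambda>s. g (s, pr R (y s), pr R (y (s - 1)))) = integral {0..t} (\<lambda>s. g (s, y s, y (s - 1)))"
      by (rule integral_cong) (use t R(3) in \<open>simp add: pr_self\<close>)
    then show "norm (y t - y 0 - integral {0..t} (\<lambda>s. g (s, pr R (y s), pr R (y (s - 1))))) \<le> 0"
      using y t T by (simp add: integral_solution_def)
  qed
  then show ?thesis by simp
qed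

lemma is_solution_unique:
  fixes g :: "('n::finite) dfield"
  assumes g: "g \<in> LC p" "1 \<le> p" and x: "is_solution g \<phi> b x" and y: "is_solution g \<phi> c y"
    and t: "t \<in> solution_interval b" "t \<in> solution_interval c"
  shows "x t = y t"
proof -
  have "ereal (max t 0) < b" "ereal (max t 0) < c"
    using t x y by (auto simp: solution_interval_def is_solution_def max_def zero_ereal_def)
  then show ?thesis
    using integral_solution_unique[OF g, of "max t 0"] is_solution_imp_integral_solution[OF x, of "max t 0"]
      is_solution_imp_integral_solution[OF y, of "max t 0"] t by (auto simp: solution_interval_def)
qed

text \<open>The truncation radius exceeds the bound of the history by 1. By continuity at 0 the
  truncated solution stays in that ball for a short time, during which it solves the original
  equation.\<close>

lemma is_solution_exists:
  fixes g :: "('n::finite) dfield"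
  assumes g: "g \<in> LC p" "1 \<le> p" and \<phi>: "continuous_on {-1..0} \<phi>"
  obtains b x where "is_solution g \<phi> b x"
proof -
  obtain R0 where R0: "0 \<le> R0" "\<And>t. t \<in> {-1..0} \<Longrightarrow> norm (\<phi> t) \<le> R0" using bounded_on_interval[OF \<phi>] by blast
  define R where "R = R0 + 1"
  obtain y where y: "continuous_on UNIV y" "\<And>t. t \<in> {-1..0} \<Longrightarrow> y t = \<phi> t"
    "\<And>t. 0 \<le> t \<Longrightarrow> y t = \<phi> 0 + integral {0..t} (\<lambda>s. g (s, pr R (y s), pr R (y (s - 1))))"
    using truncated_solution[OF g _ \<phi>, of R] R0(1) by (auto simp: R_def)
  have "continuous (at 0) y" using y(1) by (simp add: continuous_on_eq_continuous_at)
  then obtain \<tau> where \<tau>: "\<tau> > 0" "\<And>t. dist t 0 < \<tau> \<Longrightarrow> dist (y t) (y 0) < 1"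
    unfolding continuous_at_eps_delta by (meson zero_less_one)
  have yR: "norm (y t) \<le> R" if "-1 \<le> t" "t < \<tau>" for t
  proof (cases "t \<le> 0")
    case True then show ?thesis using R0(2)[of t] y(2)[of t] that by (simp add: R_def)
  next
    case False
    then have "norm (y t - y 0) < 1" using \<tau>(2)[of t] that by (simp add: dist_norm)
    moreover have "norm (y 0) \<le> R0" using R0(2)[of 0] y(2)[of 0] by simp
    ultimately show ?thesis using norm_triangle_sub[of "y t" "y 0"] by (simp add: R_def)
  qed
  have "is_solution g \<phi> (ereal \<tau>) y"
  proof (rule integral_solution_imp_is_solution[OF g])
    show "0 < ereal \<tau>" using \<tau> by simp
    fix T assume T: "0 \<le> T" "ereal T < ereal \<tau>"
    have "integral {0..t} (\<lambda>s. g (s, pr R (y s), pr R (y (s - 1)))) = integral {0..t} (\<lambda>s. g (s, y s, y (s - 1)))" if "t \<in> {0..T}" for t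
      by (rule integral_cong) (use that T yR in \<open>simp add: pr_self\<close>)
    then show "integral_solution g \<phi> T y"
      unfolding integral_solution_def using y by (auto intro: continuous_on_subset)
  qed
  then show ?thesis by (rule that)
qed

text \<open>All solutions agree where they overlap, so they can be pasted together up to the
  supremum \<open>b\<close> of their lengths. The result is the only maximal solution, which
  justifies the \<open>THE\<close> in \<open>maximal_solution\<close>.\<close>

lemma maximal_solution:
  fixes g :: "('n::finite) dfield"
  assumes g: "g \<in> LC p" "1 \<le> p" and \<phi>: "continuous_on {-1..0} \<phi>"
  obtains b where "sol_interval g \<phi> = solution_interval b" "is_solution g \<phi> b (sol g \<phi>)"
    "\<And>c y. is_solution g \<phi> c y \<Longrightarrow> c \<le> b"
proof -
  define B where "B = {b. \<exists>x. is_solution g \<phi> b x}"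
  define b where "b = Sup B"
  obtain b0 x0 where 0: "is_solution g \<phi> b0 x0" using is_solution_exists[OF g \<phi>] .
  have le: "c \<le> b" if "is_solution g \<phi> c y" for c y
    unfolding b_def B_def using that by (intro Sup_upper) auto
  have "0 < b" using 0 le[OF 0] by (auto simp: is_solution_def)
  have ex: "\<exists>c y. is_solution g \<phi> c y \<and> t \<in> solution_interval c" if "t \<in> solution_interval b" for t
    using that unfolding solution_interval_def b_def less_Sup_iff by (auto simp: B_def)
  \<comment> \<open>Uniqueness makes the value independent of the chosen solution;
    \<open>undefined\<close> outside the interval provides the extensionality required of a maximal
    solution.\<close>
  define x where "x t = (if t \<in> solution_interval b then (SOME v. \<exists>c y. is_solution g \<phi> c y \<and> t \<in> solution_interval c \<and> v = y t) else undefined)" for t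
  have xeq: "x t = y t" if y: "is_solution g \<phi> c y" "t \<in> solution_interval c" for c y t
  proof -
    have tb: "t \<in> solution_interval b" using that le[OF y(1)] by (auto simp: solution_interval_def)
    have "\<exists>c y. is_solution g \<phi> c y \<and> t \<in> solution_interval c \<and> (SOME v. \<exists>c y. is_solution g \<phi> c y \<and> t \<in> solution_interval c \<and> v = y t) = y t"
      by (rule someI_ex[of "\<lambda>v. \<exists>c y. is_solution g \<phi> c y \<and> t \<in> solution_interval c \<and> v = y t"]) (use y in blast)
    then obtain c' y' where "is_solution g \<phi> c' y'" "t \<in> solution_interval c'" "x t = y' t" using tb by (auto simp: x_def)
    then show ?thesis using is_solution_unique[OF g] y by metis
  qed
  have xs: "is_solution g \<phi> b x"
  proof (rule integral_solution_imp_is_solution[OF g \<open>0 < b\<close>])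
    fix T assume T: "0 \<le> T" "ereal T < b"
    then obtain c y where cy: "is_solution g \<phi> c y" "T \<in> solution_interval c" using ex[of T] by (auto simp: solution_interval_def)
    then have Tc: "ereal T < c" by (simp add: solution_interval_def)
    have "x t = y t" if "t \<in> {-1..T}" for t
      using that Tc by (intro xeq[OF cy(1)]) (auto simp: solution_interval_def intro: le_less_trans[of _ "ereal T"])
    then show "integral_solution g \<phi> T x"
      by (rule integral_solution_cong[OF is_solution_imp_integral_solution[OF cy(1) T(1) Tc]]) (use T in auto)
  qed
  have max: "is_maximal_solution g \<phi> b x"
    unfolding is_maximal_solution_def using xs le by (auto simp: x_def extensional_def intro: antisym)
  have uniq: "c = b \<and> y = x" if "is_maximal_solution g \<phi> c y" for c y
  proof -
    have cy: "is_solution g \<phi> c y" "y \<in> extensional (solution_interval c)" using that by (auto simp: is_maximal_solution_def)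
    have "\<forall>t\<in>solution_interval c. x t = y t" using xeq[OF cy(1)] by blast
    then have c: "c = b" using that le[OF cy(1)] xs unfolding is_maximal_solution_def by metis
    have "y t = x t" for t
      using xeq[OF cy(1), of t] cy(2) c by (cases "t \<in> solution_interval b") (auto simp: extensional_def x_def)
    then show ?thesis using c by auto
  qed
  have "maximal_solution g \<phi> = (b, x)"
    unfolding maximal_solution_def
  proof (rule the_equality)
    show "is_maximal_solution g \<phi> (fst (b, x)) (snd (b, x))" using max by simp
    show "bx = (b, x)" if "is_maximal_solution g \<phi> (fst bx) (snd bx)" for bx
      using uniq[OF that] by (simp add: prod_eq_iff)
  qed
  then show ?thesis using that[of b] xs le by (simp add: sol_interval_def sol_def)
qed

text \<open>A solution on \<open>{-1..T}\<close> gives \<open>is_solution\<close> with bound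
  \<open>T\<close>, whose interval is half-open; hence only times strictly below \<open>T\<close>
  are claimed.\<close>

lemma sol_intervalI:
  fixes g :: "('n::finite) dfield"
  assumes g: "g \<in> LC p" "1 \<le> p" and \<phi>: "continuous_on {-1..0} \<phi>"
    and y: "integral_solution g \<phi> T y" "0 < T" and t: "-1 \<le> t" "t < T"
  shows "t \<in> sol_interval g \<phi>" "sol g \<phi> t = y t"
proof -
  obtain b where b: "sol_interval g \<phi> = solution_interval b" "is_solution g \<phi> b (sol g \<phi>)"
    "\<And>c y. is_solution g \<phi> c y \<Longrightarrow> c \<le> b" using maximal_solution[OF g \<phi>] by blast
  have s: "is_solution g \<phi> (ereal T) y"
    by (rule integral_solution_imp_is_solution[OF g]) (use y in \<open>auto intro: integral_solution_mono\<close>)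
  have tT: "t \<in> solution_interval (ereal T)" using t by (simp add: solution_interval_def)
  then show "t \<in> sol_interval g \<phi>"
    using b(3)[OF s] t unfolding b(1) by (auto simp: solution_interval_def intro: less_le_trans[of _ "ereal T"])
  then show "sol g \<phi> t = y t" using is_solution_unique[OF g b(2) s _ tT] b(1) by simp
qed

text \<open>The interval of existence is open to the right, so the solution lives a little longer
  than \<open>t\<close>. The endpoint is taken rational because the seminorms are attached to
  rational intervals.\<close>

lemma sol_intervalE:
  fixes g :: "('n::finite) dfield"
  assumes g: "g \<in> LC p" "1 \<le> p" and \<phi>: "continuous_on {-1..0} \<phi>" and t: "t \<in> sol_interval g \<phi>" "0 \<le> t"
  obtains T where "T \<in> \<rat>" "t < T" "integral_solution g \<phi> T (sol g \<phi>)"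
proof -
  obtain b where b: "sol_interval g \<phi> = solution_interval b" "is_solution g \<phi> b (sol g \<phi>)"
    "\<And>c y. is_solution g \<phi> c y \<Longrightarrow> c \<le> b" using maximal_solution[OF g \<phi>] by blast
  then have "ereal t < b" using t by (simp add: solution_interval_def)
  then obtain c where c: "ereal t < ereal c" "ereal c < b" using ereal_dense2 by blast
  then obtain q where q: "q \<in> \<rat>" "t < q" "q < c" using Rats_dense_in_real[of t c] by auto
  then have "ereal q < b" using c(2) by (auto intro: less_trans[of _ "ereal c"])
  then show ?thesis using is_solution_imp_integral_solution[OF b(2), of q] q t(2) that[of q] by auto
qed

lemma zero_in_sol_interval:
  fixes g :: "('n::finite) dfield"
  assumes g: "g \<in> LC p" "1 \<le> p" and \<phi>: "continuous_on {-1..0} \<phi>"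
  shows "0 \<in> sol_interval g \<phi>" "t \<in> {-1..0} \<Longrightarrow> sol g \<phi> t = \<phi> t"
proof -
  obtain b where b: "sol_interval g \<phi> = solution_interval b" "is_solution g \<phi> b (sol g \<phi>)"
    "\<And>c y. is_solution g \<phi> c y \<Longrightarrow> c \<le> b" using maximal_solution[OF g \<phi>] by blast
  then show "0 \<in> sol_interval g \<phi>" "t \<in> {-1..0} \<Longrightarrow> sol g \<phi> t = \<phi> t"
    by (auto simp: is_solution_def solution_interval_def zero_ereal_def)
qed

section \<open>Dependence on the data and the semiflow criterion\<close>

lemma integral_solution_concat:
  fixes g :: "('n::finite) dfield"
  assumes g: "g \<in> LC p" "1 \<le> p" and s: "0 \<le> s" and T: "0 \<le> T"
    and x: "integral_solution g \<phi> s x"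
    and y: "integral_solution (translate s g) (\<lambda>r. x (s + r)) T y"
  shows "integral_solution g \<phi> (s + T) (\<lambda>r. if r \<le> s then x r else y (r - s))"
proof -
  define z where "z r = (if r \<le> s then x r else y (r - s))" for r
  \<comment> \<open>The history of \<open>y\<close> is the last unit segment of \<open>x\<close>, so
    the second formula is valid from \<open>s - 1\<close> on. This makes the delayed argument
    consistent right after the gluing point.\<close>
  have zy: "z r = y (r - s)" if "s - 1 \<le> r" for r
    using y that by (auto simp: z_def integral_solution_def)
  have xc: "continuous_on {-1..s} x" and yc: "continuous_on {-1..T} y" using x y by (simp_all add: integral_solution_def)
  have "continuous_on ({-1..s} \<union> {s..s+T}) z"
    unfolding z_def
  proof (rule continuous_on_If)
    show "continuous_on {s..s+T} (\<lambda>r. y (r - s))"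
      by (rule continuous_on_compose2[OF yc]) (auto intro!: continuous_intros)
    show "x r = y (r - s)" if "r \<in> {s..s+T}" "r \<le> s" for r
      using zy[of r] that by (simp add: z_def)
  qed (use xc in auto)
  moreover have "{-1..s} \<union> {s..s+T} = {-1..s+T}" using s T by auto
  ultimately have zc: "continuous_on {-1..s+T} z" by simp
  have "z t = \<phi> 0 + integral {0..t} (\<lambda>r. g (r, z r, z (r - 1)))" if t: "t \<in> {0..s+T}" for t
  proof -
    have I: "integral {0..r} (\<lambda>r. g (r, z r, z (r - 1))) = integral {0..r} (\<lambda>r. g (r, x r, x (r - 1)))" if "r \<le> s" for r
      by (rule integral_cong) (use that in \<open>auto simp: z_def\<close>)
    show ?thesis
    proof (cases "t \<le> s")
      case True
      then show ?thesis using x t I[OF True] by (auto simp: integral_solution_def z_def)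
    next
      case False
      have int: "(\<lambda>r. g (r, z r, z (r - 1))) integrable_on {0..t}"
        by (rule set_lebesgue_integral_eq_integral(1)[OF solution_rhs_integrable[OF g zc]]) (use t in auto)
      have "integral {0..t - s} (\<lambda>r. translate s g (r, y r, y (r - 1))) = integral {0..t - s} (\<lambda>r. g (r + s, z (r + s), z (r + s - 1)))"
        by (rule integral_cong) (auto simp: translate_def zy algebra_simps)
      also have "\<dots> = integral {0 + s..(t - s) + s} (\<lambda>r. g (r, z r, z (r - 1)))"
        by (rule integrable_on_shift_real(2)[where f = "\<lambda>r. g (r, z r, z (r - 1))"])
          (use integrable_on_subinterval[OF int] s in auto)
      finally have "y (t - s) = x s + integral {s..t} (\<lambda>r. g (r, z r, z (r - 1)))"
        using y t False by (auto simp: integral_solution_def)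
      moreover have "x s = \<phi> 0 + integral {0..s} (\<lambda>r. g (r, z r, z (r - 1)))"
        using x s I[of s] by (auto simp: integral_solution_def)
      moreover have "integral {0..s} (\<lambda>r. g (r, z r, z (r - 1))) + integral {s..t} (\<lambda>r. g (r, z r, z (r - 1))) = integral {0..t} (\<lambda>r. g (r, z r, z (r - 1)))"
        using Henstock_Kurzweil_Integration.integral_combine[OF s _ int] False by simp
      ultimately show ?thesis using False by (simp add: z_def add.assoc)
    qed
  qed
  moreover have "\<forall>t\<in>{-1..0}. z t = \<phi> t" using x s by (auto simp: z_def integral_solution_def)
  ultimately have "integral_solution g \<phi> (s + T) z" using zc by (simp add: integral_solution_def)
  then show ?thesis unfolding z_def[abs_def] .
qed

text \<open>The increments obey an inequality and not the equation itself, because the curve will be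
  a projected solution and projection can only shrink increments. Closeness to the fixed
  \<open>\<phi>\<close> controls the oscillation on the initial interval, where the differential
  equation says nothing.\<close>

definition controlled_curve ::
  "('n::finite) dfield \<Rightarrow> (real \<Rightarrow> real ^ 'n) \<Rightarrow> real \<Rightarrow> real \<Rightarrow> real \<Rightarrow> (real \<Rightarrow> real ^ 'n) \<Rightarrow> bool" where
  "controlled_curve g \<phi> \<delta> R T y \<longleftrightarrow> continuous_on {-1..T} y \<and> (\<forall>t\<in>{-1..T}. norm (y t) \<le> R) \<and>
     (\<forall>t\<in>{-1..0}. norm (\<phi> t - y t) \<le> \<delta>) \<and>
     (\<forall>s t. 0 \<le> s \<and> s \<le> t \<and> t \<le> T \<longrightarrow> norm (y t - y s) \<le> norm (integral {s..t} (\<lambda>r. g (r, y r, y (r - 1)))))"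

text \<open>The norm stays outside the integral: this is the kind of smallness that
  \<open>sigma_ThetaD\<close> provides, and it is exactly the defect that enters the Gronwall
  comparison.\<close>

definition weakly_close ::
  "('n::finite) dfield \<Rightarrow> 'n dfield \<Rightarrow> (real \<Rightarrow> real ^ 'n) \<Rightarrow> real \<Rightarrow> real \<Rightarrow> real \<Rightarrow> real \<Rightarrow> bool" where
  "weakly_close g' g \<phi> \<delta> R T \<eta> \<longleftrightarrow> (\<forall>y. controlled_curve g' \<phi> \<delta> R T y \<longrightarrow>
     (\<forall>t\<in>{0..T}. norm (integral {0..t} (\<lambda>r. g' (r, y r, y (r - 1)) - g (r, y r, y (r - 1)))) \<le> \<eta>))"

text \<open>The hypothesis on \<open>g'\<close> is quantified over all curves whose modulus of continuity is controlled by
  \<open>g'\<close> itself, so that it applies to the projected solution of the truncated equation.\<close>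

lemma solution_continuity:
  fixes g :: "('n::finite) dfield"
  assumes g: "g \<in> LC p" "1 \<le> p" and \<phi>: "continuous_on {-1..0} \<phi>" and t0: "t0 \<in> sol_interval g \<phi>" "0 \<le> t0"
  obtains T R where "T \<in> \<rat>" "t0 < T" "0 \<le> R" "integral_solution g \<phi> T (sol g \<phi>)"
    "\<And>\<epsilon>. 0 < \<epsilon> \<Longrightarrow> \<exists>\<eta>>0. \<forall>g'\<in>LC p. \<forall>\<phi>' \<delta>. continuous_on {-1..0} \<phi>' \<and> (\<forall>t\<in>{-1..0}. norm (\<phi> t - \<phi>' t) \<le> min \<eta> \<delta>) \<and>
        weakly_close g' g \<phi> \<delta> R T \<eta> \<longrightarrow>
        (\<forall>t\<in>{-1..<T}. t \<in> sol_interval g' \<phi>' \<and> norm (sol g \<phi> t - sol g' \<phi>' t) \<le> \<epsilon>)"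
proof -
  obtain T where T: "T \<in> \<rat>" "t0 < T" "integral_solution g \<phi> T (sol g \<phi>)" using sol_intervalE[OF g \<phi> t0] .
  define x where "x = sol g \<phi>"
  have xs: "integral_solution g \<phi> T x" using T(3) by (simp add: x_def)
  have xc: "continuous_on {-1..T} x" using xs by (simp add: integral_solution_def)
  have T0: "0 < T" using T t0 by simp
  obtain R0 where R0: "0 \<le> R0" "\<And>t. t \<in> {-1..T} \<Longrightarrow> norm (x t) \<le> R0" using bounded_on_interval[OF xc] by blast
  \<comment> \<open>The extra 1 is the room that makes the projection of a nearby solution inactive
    afterwards.\<close>
  define R where "R = R0 + 1"
  have R: "0 \<le> R" "\<And>t. t \<in> {-1..T} \<Longrightarrow> norm (x t) \<le> R" using R0(1) order_trans[OF R0(2)] by (auto simp: R_def)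
  obtain k N where env: "envelope p (2 * R) g k N" using LC_envelope[OF g] by blast
  interpret kernel k by (rule kernel_envelope[OF env])
  show ?thesis
  proof (rule that[OF T(1,2) R(1) T(3)])
    fix \<epsilon> :: real assume "0 < \<epsilon>"
    \<comment> \<open>Inverts the constant of \<open>solution_compare\<close>; the cap at 1 keeps
      the nearby solution within the room left in \<open>R\<close>.\<close>
    define \<eta> where "\<eta> = min \<epsilon> 1 / (4 * W T)"
    have \<eta>: "0 < \<eta>" "4 * \<eta> * W T = min \<epsilon> 1" using \<open>0 < \<epsilon>\<close> W_pos[of T] by (auto simp: \<eta>_def)
    show "\<exists>\<eta>>0. \<forall>g'\<in>LC p. \<forall>\<phi>' \<delta>. continuous_on {-1..0} \<phi>' \<and> (\<forall>t\<in>{-1..0}. norm (\<phi> t - \<phi>' t) \<le> min \<eta> \<delta>) \<and>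
        weakly_close g' g \<phi> \<delta> R T \<eta> \<longrightarrow>
        (\<forall>t\<in>{-1..<T}. t \<in> sol_interval g' \<phi>' \<and> norm (sol g \<phi> t - sol g' \<phi>' t) \<le> \<epsilon>)"
    proof (intro exI[of _ \<eta>] conjI \<eta>(1) ballI allI impI; elim conjE)
      fix g' :: "'n dfield" and \<phi>' \<delta> t
      assume g': "g' \<in> LC p" and \<phi>': "continuous_on {-1..0} \<phi>'" "\<forall>t\<in>{-1..0}. norm (\<phi> t - \<phi>' t) \<le> min \<eta> \<delta>"
        and H: "weakly_close g' g \<phi> \<delta> R T \<eta>"
        and t: "t \<in> {-1..<T}"
      obtain y where y: "continuous_on UNIV y" "\<And>t. t \<in> {-1..0} \<Longrightarrow> y t = \<phi>' t"
        "\<And>t. 0 \<le> t \<Longrightarrow> y t = \<phi>' 0 + integral {0..t} (\<lambda>s. g' (s, pr R (y s), pr R (y (s - 1))))"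
        using truncated_solution[OF g' g(2) R(1) \<phi>'(1)] by blast
      \<comment> \<open>The projected curve, unlike \<open>y\<close>, is bounded by \<open>R\<close>
        from the outset and is therefore the one to which the closeness of \<open>g'\<close> and
        \<open>g\<close> can be applied.\<close>
      define w where "w s = pr R (y s)" for s
      have yc: "continuous_on {-1..T} y" using y(1) continuous_on_subset by blast
      have wc: "continuous_on {-1..T} w" unfolding w_def by (intro continuous_on_pr R(1) yc)
      have yw: "y t = \<phi>' 0 + integral {0..t} (\<lambda>s. g' (s, w s, w (s - 1)))" if "0 \<le> t" for t
        using y(3)[OF that] by (simp add: w_def)
      have y0: "y 0 = \<phi>' 0" using y(2)[of 0] by simp
      have wi: "(\<lambda>s. h (s, w s, w (s - 1))) integrable_on {s..t}" if "h \<in> LC p" "0 \<le> s" "t \<le> T" for h s t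
        by (rule set_lebesgue_integral_eq_integral(1)[OF solution_rhs_integrable[OF that(1) g(2) wc that(2,3)]])
      have wy: "norm (w t - w s) \<le> norm (y t - y s)" for s t unfolding w_def by (rule pr_lipschitz[OF R(1)])
      have diff: "norm (integral {0..t} (\<lambda>r. g' (r, w r, w (r - 1)) - g (r, w r, w (r - 1)))) \<le> \<eta>" if "t \<in> {0..T}" for t
      proof -
        have "\<forall>t\<in>{-1..T}. norm (w t) \<le> R" using norm_pr_le[OF R(1)] by (auto simp: w_def)
        moreover have "\<forall>t\<in>{-1..0}. norm (\<phi> t - w t) \<le> \<delta>"
        proof
          fix t :: real assume t: "t \<in> {-1..0}"
          have "\<phi> t = pr R (x t)" using xs t R(2)[of t] T0 by (auto simp: integral_solution_def pr_self)
          then have "norm (\<phi> t - w t) \<le> norm (x t - y t)" unfolding w_def using pr_lipschitz[OF R(1)] by metis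
          also have "\<dots> = norm (\<phi> t - \<phi>' t)" using xs t y(2)[OF t] by (simp add: integral_solution_def)
          finally show "norm (\<phi> t - w t) \<le> \<delta>" using \<phi>'(2) t by force
        qed
        moreover have "\<forall>s t. 0 \<le> s \<and> s \<le> t \<and> t \<le> T \<longrightarrow> norm (w t - w s) \<le> norm (integral {s..t} (\<lambda>r. g' (r, w r, w (r - 1))))"
        proof (intro allI impI; elim conjE)
          fix s t assume st: "0 \<le> s" "s \<le> t" "t \<le> T"
          have "y t - y s = integral {s..t} (\<lambda>r. g' (r, w r, w (r - 1)))"
            using yw[of t] yw[of s] st Henstock_Kurzweil_Integration.integral_combine[OF st(1,2) wi[OF g', of 0 t]]
            by (simp add: algebra_simps)
          then show "norm (w t - w s) \<le> norm (integral {s..t} (\<lambda>r. g' (r, w r, w (r - 1))))" using wy[of t s] by simp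
        qed
        ultimately show ?thesis using H wc that unfolding weakly_close_def controlled_curve_def by blast
      qed
      have cmp: "norm (x t - y t) \<le> min \<epsilon> 1" if "t \<in> {-1..T}" for t
      proof -
        have "norm (x t - y t) \<le> 4 * \<eta> * W T"
        proof (rule solution_compare[OF g env R(1) _ xs R(2) yc _ _ that])
          show "norm (x t - y t) \<le> \<eta>" if "t \<in> {-1..0}" for t
            using \<phi>'(2) that xs y(2)[OF that] by (simp add: integral_solution_def)
          fix t assume t: "t \<in> {0..T}"
          have "y t - y 0 - integral {0..t} (\<lambda>s. g (s, w s, w (s - 1))) = integral {0..t} (\<lambda>r. g' (r, w r, w (r - 1)) - g (r, w r, w (r - 1)))"
            using yw[of t] y0 integral_diff[OF wi[OF g', of 0 t] wi[OF g(1), of 0 t]] t by simp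
          then show "norm (y t - y 0 - integral {0..t} (\<lambda>s. g (s, pr R (y s), pr R (y (s - 1))))) \<le> \<eta>"
            using diff[OF t] by (simp add: w_def)
        qed (use T0 in auto)
        then show ?thesis using \<eta>(2) by simp
      qed
      \<comment> \<open>The comparison has shown that \<open>y\<close> is within 1 of
        \<open>x\<close>, so it lies in the ball of radius \<open>R\<close> and solves the original
        equation for \<open>g'\<close>, up to time \<open>T\<close>. Existence up to
        \<open>T\<close> is thus a conclusion.\<close>
      have yR: "w t = y t" if "t \<in> {-1..T}" for t
      proof -
        have "norm (y t) \<le> norm (x t) + norm (x t - y t)" using norm_triangle_ineq4[of "x t" "x t - y t"] by simp
        then have "norm (y t) \<le> R" using cmp[OF that] R0(2)[OF that] by (simp add: R_def)
        then show ?thesis by (simp add: w_def pr_self)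
      qed
      have "integral {0..t} (\<lambda>s. g' (s, w s, w (s - 1))) = integral {0..t} (\<lambda>s. g' (s, y s, y (s - 1)))" if "t \<in> {0..T}" for t
        by (rule integral_cong) (use that yR in auto)
      then have ys: "integral_solution g' \<phi>' T y"
        unfolding integral_solution_def using yc y(2) yw by simp
      have "t \<in> sol_interval g' \<phi>'" "sol g' \<phi>' t = y t"
        using sol_intervalI[OF g' g(2) \<phi>'(1) ys T0] t by auto
      then show "t \<in> sol_interval g' \<phi>'" "norm (sol g \<phi> t - sol g' \<phi>' t) \<le> \<epsilon>"
        using cmp[of t] t by (auto simp: x_def)
    qed
  qed
qed

section \<open>Segments in the phase space, cocycle property and semiflow criterion\<close>

lemma mspace_phase_space:
  "\<phi> \<in> mspace (phase_space :: (real \<Rightarrow> real ^ 'n::finite) metric) \<longleftrightarrow> \<phi> \<in> extensional {-1..0} \<and> continuous_on {-1..0} \<phi>"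
proof -
  have "compactin (top_of_set {-1..0::real}) (topspace (top_of_set {-1..0}))"
    by (simp add: compactin_subtopology)
  from compactin_mspace_cfunspace[OF this, of "euclidean_metric :: (real ^ 'n) metric"]
  show ?thesis by (simp add: phase_space_def)
qed

lemma mdist_phase_space_le:
  assumes "0 \<le> B" "\<And>s. s \<in> {-1..0} \<Longrightarrow> norm (\<phi> s - \<psi> s) \<le> B"
  shows "mdist (phase_space :: (real \<Rightarrow> real ^ 'n::finite) metric) \<phi> \<psi> \<le> B"
  unfolding phase_space_def by (rule mdist_cfunspace_le[OF assms(1)]) (use assms(2) in \<open>auto simp: dist_norm\<close>)

lemma mdist_phase_space_less:
  assumes "\<phi> \<in> mspace phase_space" "\<psi> \<in> mspace phase_space"
    "mdist (phase_space :: (real \<Rightarrow> real ^ 'n::finite) metric) \<phi> \<psi> < B" "s \<in> {-1..0}"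
  shows "norm (\<phi> s - \<psi> s) \<le> B"
  using mdist_cfunspace_imp_mdist_le[of \<phi> "top_of_set {-1..0}" euclidean_metric \<psi> B s] assms
  unfolding phase_space_def by (simp add: dist_norm)

lemma sol_segment_in_phase_space:
  fixes g :: "('n::finite) dfield"
  assumes g: "g \<in> LC p" "1 \<le> p" and \<phi>: "continuous_on {-1..0} \<phi>" and t: "t \<in> sol_interval g \<phi>" "0 \<le> t"
  shows "sol_segment t g \<phi> \<in> mspace phase_space"
proof -
  obtain T where T: "t < T" "integral_solution g \<phi> T (sol g \<phi>)" using sol_intervalE[OF g \<phi> t] by blast
  then have "continuous_on {-1..T} (sol g \<phi>)" by (simp add: integral_solution_def)
  then have "continuous_on {-1..0} (\<lambda>s. sol g \<phi> (t + s))"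
    by (rule continuous_on_compose2) (use t T in \<open>auto intro!: continuous_intros\<close>)
  then have "continuous_on {-1..0} (sol_segment t g \<phi>)"
    by (rule continuous_on_eq) (auto simp: sol_segment_def)
  then show ?thesis by (simp add: mspace_phase_space sol_segment_def)
qed

lemma sol_field_eq:
  fixes g g' :: "('n::finite) dfield"
  assumes g: "g \<in> LC p" "g' \<in> LC p" "1 \<le> p" and \<phi>: "continuous_on {-1..0} \<phi>" and eq: "field_eq g g'"
    and t: "t \<in> sol_interval g \<phi>" "0 \<le> t"
  shows "t \<in> sol_interval g' \<phi>" "\<And>s. -1 \<le> s \<Longrightarrow> s \<le> t \<Longrightarrow> sol g' \<phi> s = sol g \<phi> s"
proof -
  obtain T where T: "t < T" "integral_solution g \<phi> T (sol g \<phi>)" using sol_intervalE[OF g(1,3) \<phi> t] by blast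
  note s = integral_solution_field_eq[OF T(2) eq]
  show "t \<in> sol_interval g' \<phi>" "\<And>s. -1 \<le> s \<Longrightarrow> s \<le> t \<Longrightarrow> sol g' \<phi> s = sol g \<phi> s"
    using sol_intervalI[OF g(2,3) \<phi> s] T t by auto
qed

text \<open>The solution of the translated field, started from the segment at time \<open>s\<close>,
  is glued to the original one; uniqueness identifies the result with the maximal solution for
  \<open>\<phi>\<close>.\<close>

lemma sol_cocycle:
  fixes g :: "('n::finite) dfield"
  assumes g: "g \<in> LC p" "1 \<le> p" and \<phi>: "continuous_on {-1..0} \<phi>" and s: "s \<in> sol_interval g \<phi>" "0 \<le> s"
    and t: "t \<in> sol_interval (translate s g) (sol_segment s g \<phi>)" "0 \<le> t"
  shows "t + s \<in> sol_interval g \<phi>" "sol_segment (t + s) g \<phi> = sol_segment t (translate s g) (sol_segment s g \<phi>)"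
proof -
  let ?h = "translate s g" and ?\<psi> = "sol_segment s g \<phi>"
  have h: "?h \<in> LC p" by (rule LC_translate[OF g(1)])
  have \<psi>: "continuous_on {-1..0} ?\<psi>" using sol_segment_in_phase_space[OF g \<phi> s] by (simp add: mspace_phase_space)
  obtain S where S: "s < S" "integral_solution g \<phi> S (sol g \<phi>)" using sol_intervalE[OF g \<phi> s] by blast
  obtain T where T: "t < T" "integral_solution ?h ?\<psi> T (sol ?h ?\<psi>)" using sol_intervalE[OF h g(2) \<psi> t] by blast
  have T': "integral_solution ?h (\<lambda>r. sol g \<phi> (s + r)) T (sol ?h ?\<psi>)"
    using T(2) by (simp add: integral_solution_def sol_segment_def)
  define z where "z r = (if r \<le> s then sol g \<phi> r else sol ?h ?\<psi> (r - s))" for r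
  have z: "integral_solution g \<phi> (s + T) z"
    unfolding z_def by (rule integral_solution_concat[OF g s(2) _ integral_solution_mono[OF S(2)] T']) (use T t S in auto)
  have zz: "r \<in> sol_interval g \<phi>" "sol g \<phi> r = z r" if "-1 \<le> r" "r < s + T" for r
    using sol_intervalI[OF g \<phi> z _ that] s t T by auto
  show "t + s \<in> sol_interval g \<phi>" using zz(1)[of "t + s"] s t T by simp
  show "sol_segment (t + s) g \<phi> = sol_segment t ?h ?\<psi>"
  proof
    fix r
    show "sol_segment (t + s) g \<phi> r = sol_segment t ?h ?\<psi> r"
    proof (cases "r \<in> {-1..0}")
      case r: True
      have "sol g \<phi> (t + s + r) = z (t + s + r)" using r s t T by (intro zz(2)) auto
      also have "\<dots> = sol ?h ?\<psi> (t + r)"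
      proof (cases "t + r \<le> 0")
        case True
        then have "sol ?h ?\<psi> (t + r) = sol g \<phi> (s + (t + r))" using T' r t by (simp add: integral_solution_def)
        then show ?thesis using True by (simp add: z_def algebra_simps)
      qed (simp add: z_def algebra_simps)
      finally show ?thesis using r unfolding sol_segment_def restrict_apply by (simp only: if_True)
    next
      case False
      then show ?thesis unfolding sol_segment_def restrict_apply by (simp only: if_False)
    qed
  qed
qed

lemma translation_hull_subset: "topspace T = LC_space p \<Longrightarrow> translation_hull p T f \<subseteq> LC_space p"
  unfolding translation_hull_def using closure_of_subset_topspace by metis

lemma orbit_subset_hull:
  assumes "topspace T = LC_space p" "f \<in> LC p"
  shows "range (\<lambda>t. LC_class p (translate t f)) \<subseteq> translation_hull p T f"
proof -
  have "LC_class p (translate t f) \<in> LC_space p" for t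
    unfolding LC_space_iff using LC_translate[OF assms(2)] by blast
  then show ?thesis unfolding translation_hull_def by (intro closure_of_subset) (auto simp: assms(1))
qed

text \<open>The orbit is mapped into itself by every translation, and a continuous map sends the
  closure of a set into the closure of its image.\<close>

lemma translation_hull_invariant:
  assumes top: "topspace T = LC_space p" and f: "f \<in> LC p"
    and cont: "continuous_map (subtopology T (translation_hull p T f)) T (\<lambda>G. translate t ` G)"
    and G: "G \<in> translation_hull p T f"
  shows "translate t ` G \<in> translation_hull p T f"
proof -
  let ?H = "translation_hull p T f" and ?O = "range (\<lambda>t. LC_class p (translate t f))"
  have OH: "?O \<subseteq> ?H" by (rule orbit_subset_hull[OF top f])
  have A: "(\<lambda>G. translate t ` G) ` ?O \<subseteq> ?O"
  proof clarify
    fix s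
    have "translate t ` LC_class p (translate s f) = LC_class p (translate (t + s) f)"
      using translate_image_class[OF LC_translate[OF f]] by (simp add: translate_translate)
    then show "translate t ` LC_class p (translate s f) \<in> ?O" by auto
  qed
  \<comment> \<open>Continuity of the translation is assumed on the hull only, so the orbit has to
    be dense in the hull with respect to the induced topology.\<close>
  have B: "subtopology T ?H closure_of ?O = ?H"
    unfolding closure_of_subtopology using OH by (simp add: Int_absorb1) (simp add: translation_hull_def)
  have "(\<lambda>G. translate t ` G) ` ?H \<subseteq> T closure_of ((\<lambda>G. translate t ` G) ` ?O)"
    using continuous_map_image_closure_subset[OF cont, of ?O] unfolding B .
  also have "\<dots> \<subseteq> T closure_of ?O" by (rule closure_of_mono[OF A])
  finally have "translate t ` G \<in> T closure_of ?O" using G by blast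
  then show ?thesis by (simp only: translation_hull_def)
qed

text \<open>Separates what depends on the topology from what does not. A topology has to supply
  neighbourhoods on which fields are weakly close, and joint continuity of translation; the
  comparison of solutions and the cocycle identity do the rest.\<close>

theorem skew_product_semiflow_criterion:
  fixes f :: "('n::finite) dfield"
  assumes p: "1 \<le> p" and f: "f \<in> LC p" and top: "topspace T = LC_space p"
    and H: "H = translation_hull p T f"
    and weak: "\<And>G \<phi> R S \<eta>. \<lbrakk>G \<in> H; continuous_on {-1..0} \<phi>; 0 \<le> R; S \<in> \<rat>; 0 < S; 0 < \<eta>\<rbrakk> \<Longrightarrow>
      \<exists>U \<delta>. openin T U \<and> G \<in> U \<and> 0 < \<delta> \<and> (\<forall>G'\<in>U \<inter> H. weakly_close (rep G') (rep G) \<phi> \<delta> R S \<eta>)"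
    and cont: "continuous_map (prod_topology (top_of_set {0..}) (subtopology T H)) T (\<lambda>(t, G). translate t ` G)"
  shows "defines_skew_product_semiflow p T f"
proof -
  let ?M = "phase_space :: (real \<Rightarrow> real ^ 'n) metric"
  define Z where "Z = prod_topology (top_of_set {0::real..}) (prod_topology (subtopology T H) (mtopology_of ?M))"
  define U where "U = flow_domain H"
  interpret M: Metric_space "mspace ?M" "mdist ?M" by (rule Metric_space_mspace_mdist)
  have HL: "H \<subseteq> LC_space p" unfolding H by (rule translation_hull_subset[OF top])
  have LCrep: "rep G \<in> LC p" if "G \<in> H" for G using rep_LC HL that by blast
  have tsH: "topspace (subtopology T H) = H" using HL top by auto
  have inv: "translate t ` G \<in> H" if "0 \<le> t" "G \<in> H" for t G
  proof -
    have "continuous_map (subtopology T H) (prod_topology (top_of_set {0..}) (subtopology T H)) (\<lambda>G. (t, G))"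
      by (intro continuous_map_pairedI continuous_map_const[THEN iffD2] continuous_map_id[unfolded id_def]) (use that in auto)
    from continuous_map_compose[OF this cont]
    have "continuous_map (subtopology T H) T (\<lambda>G. translate t ` G)" by (simp add: comp_def)
    then show ?thesis using translation_hull_invariant[OF top f] that(2) unfolding H by blast
  qed
  have Uiff: "(t, G, \<phi>) \<in> U \<longleftrightarrow> G \<in> H \<and> \<phi> \<in> mspace ?M \<and> t \<in> sol_interval (rep G) \<phi> \<and> 0 \<le> t" for t G \<phi>
    by (simp add: U_def flow_domain_def)
  \<comment> \<open>One neighbourhood serves twice: containment in \<open>U\<close> gives openness
    of the domain, the distance estimate gives continuity of the segments.\<close>
  have key: "\<exists>V. openin Z V \<and> (t, G, \<phi>) \<in> V \<and> V \<subseteq> U \<and>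
      (\<forall>t' G' \<phi>'. (t', G', \<phi>') \<in> V \<longrightarrow> mdist ?M (sol_segment t (rep G) \<phi>) (sol_segment t' (rep G') \<phi>') < \<epsilon>)"
    if tG: "(t, G, \<phi>) \<in> U" and "0 < \<epsilon>" for t G \<phi> \<epsilon>
  proof -
    have G: "G \<in> H" "\<phi> \<in> mspace ?M" "t \<in> sol_interval (rep G) \<phi>" "0 \<le> t" using tG by (simp_all add: Uiff)
    have \<phi>: "continuous_on {-1..0} \<phi>" using G(2) by (simp add: mspace_phase_space)
    define x where "x = sol (rep G) \<phi>"
    obtain S R where S: "S \<in> \<rat>" "t < S" and R: "0 \<le> R" and sol: "integral_solution (rep G) \<phi> S x" and
      close: "\<And>\<epsilon>. 0 < \<epsilon> \<Longrightarrow> \<exists>\<eta>>0. \<forall>g'\<in>LC p. \<forall>\<phi>' \<delta>. continuous_on {-1..0} \<phi>' \<and> (\<forall>t\<in>{-1..0}. norm (\<phi> t - \<phi>' t) \<le> min \<eta> \<delta>) \<and>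
        weakly_close g' (rep G) \<phi> \<delta> R S \<eta> \<longrightarrow>
        (\<forall>t\<in>{-1..<S}. t \<in> sol_interval g' \<phi>' \<and> norm (x t - sol g' \<phi>' t) \<le> \<epsilon>)"
      unfolding x_def by (rule solution_continuity[OF LCrep[OF G(1)] p \<phi> G(3,4)]) blast
    obtain \<eta> where \<eta>: "0 < \<eta>" "\<And>g' \<phi>' \<delta>. \<lbrakk>g' \<in> LC p; continuous_on {-1..0} \<phi>'; \<forall>t\<in>{-1..0}. norm (\<phi> t - \<phi>' t) \<le> min \<eta> \<delta>;
        weakly_close g' (rep G) \<phi> \<delta> R S \<eta>\<rbrakk> \<Longrightarrow>
        \<forall>t\<in>{-1..<S}. t \<in> sol_interval g' \<phi>' \<and> norm (x t - sol g' \<phi>' t) \<le> \<epsilon> / 3"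
    proof -
      \<comment> \<open>One third goes to the change of field and history, one third to the change
        of time; the last third makes the final inequality strict.\<close>
      have "0 < \<epsilon> / 3" using \<open>0 < \<epsilon>\<close> by simp
      from close[OF this] show ?thesis using that by blast
    qed
    have S0: "0 < S" using S G(4) by simp
    obtain W \<delta> where W: "openin T W" "G \<in> W" "0 < \<delta>" "\<forall>G'\<in>W \<inter> H. weakly_close (rep G') (rep G) \<phi> \<delta> R S \<eta>"
      using weak[OF G(1) \<phi> R S(1) S0 \<eta>(1)] by blast
    have xc: "continuous_on {-1..S} x" using sol by (simp add: integral_solution_def)
    have "uniformly_continuous_on {-1..S} x" by (rule compact_uniformly_continuous[OF xc compact_Icc])
    then obtain d where d: "0 < d" "\<And>s s'. \<lbrakk>s \<in> {-1..S}; s' \<in> {-1..S}; \<bar>s' - s\<bar> < d\<rbrakk> \<Longrightarrow> norm (x s' - x s) < \<epsilon> / 3"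
      unfolding uniformly_continuous_on_def dist_norm real_norm_def using \<open>0 < \<epsilon>\<close> by (metis divide_pos_pos zero_less_numeral)
    define V where "V = ({0..} \<inter> {t - d<..<min (t + d) S}) \<times> ((W \<inter> H) \<times> M.mball \<phi> (min \<eta> \<delta>))"
    have "openin Z V" unfolding Z_def V_def
      by (intro openin_prod_Times_iff[THEN iffD2] disjI2 conjI)
        (auto intro!: openin_subtopology_Int W(1) M.openin_mball openin_open_Int simp: mtopology_of_def)
    moreover have "(t, G, \<phi>) \<in> V" using G S d(1) W \<eta>(1) by (auto simp: V_def)
    moreover have good: "t' \<in> sol_interval (rep G') \<phi>'" "0 \<le> t'" "G' \<in> H" "\<phi>' \<in> mspace ?M"
      "mdist ?M (sol_segment t (rep G) \<phi>) (sol_segment t' (rep G') \<phi>') < \<epsilon>" if V': "(t', G', \<phi>') \<in> V" for t' G' \<phi>'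
    proof -
      have t': "0 \<le> t'" "\<bar>t' - t\<bar> < d" "t' < S" and G': "G' \<in> W" "G' \<in> H" and \<phi>': "\<phi>' \<in> mspace ?M" "mdist ?M \<phi> \<phi>' < min \<eta> \<delta>"
        using V' by (auto simp: V_def M.in_mball)
      then show "0 \<le> t'" "G' \<in> H" "\<phi>' \<in> mspace ?M" by auto
      have *: "\<forall>t\<in>{-1..<S}. t \<in> sol_interval (rep G') \<phi>' \<and> norm (x t - sol (rep G') \<phi>' t) \<le> \<epsilon> / 3"
      proof (rule \<eta>(2)[of "rep G'" \<phi>' \<delta>])
        show "rep G' \<in> LC p" by (rule LCrep[OF G'(2)])
        show "continuous_on {-1..0} \<phi>'" using \<phi>'(1) by (simp add: mspace_phase_space)
        show "\<forall>t\<in>{-1..0}. norm (\<phi> t - \<phi>' t) \<le> min \<eta> \<delta>"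
          using mdist_phase_space_less[OF G(2) \<phi>'] by blast
      qed (use W(4) G' in blast)
      then show "t' \<in> sol_interval (rep G') \<phi>'" using t' by auto
      have "mdist ?M (sol_segment t (rep G) \<phi>) (sol_segment t' (rep G') \<phi>') \<le> 2 * \<epsilon> / 3"
      proof (rule mdist_phase_space_le)
        fix s :: real assume s: "s \<in> {-1..0}"
        have "norm (x (t' + s) - sol (rep G') \<phi>' (t' + s)) \<le> \<epsilon> / 3" using *[rule_format, of "t' + s"] s t' by auto
        moreover have "norm (x (t + s) - x (t' + s)) < \<epsilon> / 3"
          by (rule d(2)) (use s t' S G(4) in \<open>auto simp: abs_minus_commute\<close>)
        moreover have "norm (x (t + s) - sol (rep G') \<phi>' (t' + s)) \<le> norm (x (t + s) - x (t' + s)) + norm (x (t' + s) - sol (rep G') \<phi>' (t' + s))"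
          using norm_triangle_ineq[of "x (t + s) - x (t' + s)" "x (t' + s) - sol (rep G') \<phi>' (t' + s)"] by simp
        ultimately have "norm (x (t + s) - sol (rep G') \<phi>' (t' + s)) \<le> 2 * \<epsilon> / 3" by simp
        then show "norm (sol_segment t (rep G) \<phi> s - sol_segment t' (rep G') \<phi>' s) \<le> 2 * \<epsilon> / 3"
          using s by (simp add: sol_segment_def x_def)
      qed (use \<open>0 < \<epsilon>\<close> in simp)
      then show "mdist ?M (sol_segment t (rep G) \<phi>) (sol_segment t' (rep G') \<phi>') < \<epsilon>" using \<open>0 < \<epsilon>\<close> by simp
    qed
    moreover have "V \<subseteq> U"
    proof
      fix v assume v: "v \<in> V"
      obtain t' G' \<phi>' where "v = (t', G', \<phi>')" by (cases v)
      then show "v \<in> U" using good[of t' G' \<phi>'] v by (simp add: Uiff)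
    qed
    ultimately show ?thesis by blast
  qed
  have openU: "openin Z U"
  proof (subst openin_subopen, intro ballI)
    fix u assume u: "u \<in> U"
    obtain t G \<phi> where "u = (t, G, \<phi>)" by (cases u)
    then show "\<exists>V. openin Z V \<and> u \<in> V \<and> V \<subseteq> U" using key[of t G \<phi> 1] u by auto
  qed
  have tsU: "topspace (subtopology Z U) = U"
    using openin_subset[OF openU] by auto
  have c1: "continuous_map (subtopology Z U) (subtopology T H) (\<lambda>(t, G, \<phi>). translate t ` G)"
    unfolding continuous_map_in_subtopology
  proof
    have "continuous_map (subtopology Z U) (prod_topology (top_of_set {0..}) (subtopology T H)) (\<lambda>z. (fst z, fst (snd z)))"
      unfolding Z_def by (intro continuous_map_pairedI continuous_map_from_subtopology continuous_map_fst
          continuous_map_compose[OF continuous_map_snd continuous_map_fst, unfolded comp_def])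
    from continuous_map_compose[OF this cont]
    show "continuous_map (subtopology Z U) T (\<lambda>(t, G, \<phi>). translate t ` G)"
      by (simp add: comp_def case_prod_unfold)
    show "(\<lambda>(t, G, \<phi>). translate t ` G) \<in> topspace (subtopology Z U) \<rightarrow> H"
      unfolding tsU using inv by (auto simp: Uiff)
  qed
  have c2: "continuous_map (subtopology Z U) (mtopology_of ?M) (\<lambda>(t, G, \<phi>). sol_segment t (rep G) \<phi>)"
    unfolding mtopology_of_def M.continuous_map_to_metric
  proof (intro ballI allI impI)
    fix u and \<epsilon> :: real assume u: "u \<in> topspace (subtopology Z U)" "0 < \<epsilon>"
    obtain t G \<phi> where tG: "u = (t, G, \<phi>)" by (cases u)
    then have uU: "(t, G, \<phi>) \<in> U" using u tsU by simp
    have mem: "sol_segment t (rep G) \<phi> \<in> mspace ?M" if "(t, G, \<phi>) \<in> U" for t G \<phi>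
      using that sol_segment_in_phase_space[OF LCrep p] by (simp add: Uiff mspace_phase_space)
    obtain V where V: "openin Z V" "(t, G, \<phi>) \<in> V" "V \<subseteq> U"
      "\<forall>t' G' \<phi>'. (t', G', \<phi>') \<in> V \<longrightarrow> mdist ?M (sol_segment t (rep G) \<phi>) (sol_segment t' (rep G') \<phi>') < \<epsilon>"
      using key[OF uU u(2)] by blast
    show "\<exists>V. openin (subtopology Z U) V \<and> u \<in> V \<and>
        (\<forall>v\<in>V. (case v of (t, G, \<phi>) \<Rightarrow> sol_segment t (rep G) \<phi>) \<in> M.mball (case u of (t, G, \<phi>) \<Rightarrow> sol_segment t (rep G) \<phi>) \<epsilon>)"
    proof (intro exI conjI ballI)
      show "openin (subtopology Z U) V" using V(1,3) openin_subtopology_alt by (metis image_eqI inf.absorb_iff2 mem_Collect_eq)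
      show "u \<in> V" using V(2) tG by simp
      fix v assume v: "v \<in> V"
      obtain t' G' \<phi>' where v': "v = (t', G', \<phi>')" by (cases v)
      then have "(t', G', \<phi>') \<in> U" using v V(3) by blast
      then show "(case v of (t, G, \<phi>) \<Rightarrow> sol_segment t (rep G) \<phi>) \<in> M.mball (case u of (t, G, \<phi>) \<Rightarrow> sol_segment t (rep G) \<phi>) \<epsilon>"
        using V(4) v v' tG mem uU by (simp add: M.in_mball)
    qed
  qed
  have c: "continuous_map (subtopology Z U) (prod_topology (subtopology T H) (mtopology_of ?M)) flow_map"
    using c1 c2 unfolding continuous_map_pairwise flow_map_def by (simp add: comp_def case_prod_unfold)
  have id: "flow_map (0, z) = z" if zH: "z \<in> H \<times> mspace ?M" for z
  proof -
    obtain G \<phi> where z: "z = (G, \<phi>)" "G \<in> H" "\<phi> \<in> mspace ?M" using zH by (cases z) simp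
    have \<phi>: "\<phi> \<in> extensional {-1..0}" "continuous_on {-1..0} \<phi>" using z(3) by (simp_all add: mspace_phase_space)
    have "sol_segment 0 (rep G) \<phi> = \<phi>"
      using zero_in_sol_interval(2)[OF LCrep[OF z(2)] p \<phi>(2)] \<phi>(1) by (auto simp: sol_segment_def extensional_def)
    moreover have "translate 0 ` G = G" by (simp add: translate_zero)
    ultimately show ?thesis by (simp add: z(1) flow_map_def)
  qed
  have zero: "{0} \<times> (H \<times> mspace ?M) \<subseteq> U"
    using zero_in_sol_interval(1)[OF LCrep p] by (auto simp: Uiff mspace_phase_space)
  have coc: "(t + s, z) \<in> U \<and> flow_map (t + s, z) = flow_map (t, flow_map (s, z))"
    if "(s, z) \<in> U \<and> (t, flow_map (s, z)) \<in> U" for s t z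
  proof -
    obtain G \<phi> where z: "z = (G, \<phi>)" by (cases z)
    define \<psi> where "\<psi> = sol_segment s (rep G) \<phi>"
    have G: "G \<in> H" "\<phi> \<in> mspace ?M" "s \<in> sol_interval (rep G) \<phi>" "0 \<le> s" using that by (simp_all add: z Uiff)
    have t: "translate s ` G \<in> H" "\<psi> \<in> mspace ?M" "t \<in> sol_interval (rep (translate s ` G)) \<psi>" "0 \<le> t"
      using that by (simp_all add: z Uiff flow_map_def \<psi>_def)
    have \<phi>: "continuous_on {-1..0} \<phi>" and \<psi>: "continuous_on {-1..0} \<psi>" using G t by (simp_all add: mspace_phase_space)
    \<comment> \<open>The second leg of the flow uses the representative of the translated class,
      the cocycle lemma the translate of the representative. Solutions are the same for
      both.\<close>
    have eq: "field_eq (rep (translate s ` G)) (translate s (rep G))" using rep_translate_image G(1) HL p by blast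
    note fe = sol_field_eq[OF LCrep[OF t(1)] LC_translate[OF LCrep[OF G(1)]] p \<psi> eq t(3,4)]
    have seg: "sol_segment t (rep (translate s ` G)) \<psi> = sol_segment t (translate s (rep G)) \<psi>"
      unfolding sol_segment_def by (rule restrict_ext) (use fe(2) t(4) in auto)
    note cc = sol_cocycle[OF LCrep[OF G(1)] p \<phi> G(3,4) fe(1)[unfolded \<psi>_def] t(4)]
    have "translate (t + s) ` G = translate t ` translate s ` G"
      by (simp add: image_image translate_translate)
    then show ?thesis using cc G t(4) seg by (simp add: z Uiff flow_map_def \<psi>_def)
  qed
  have fst_eq: "fst (flow_map (t, G, \<phi>)) = fst (flow_map (t, G, \<phi>'))" for t G \<phi> \<phi>' by (simp add: flow_map_def)
  have "local_continuous_semiflow (prod_topology (subtopology T H) (mtopology_of ?M)) U flow_map"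
    unfolding local_continuous_semiflow_def
    using openU[unfolded Z_def] c[unfolded Z_def] zero id coc tsH by (auto simp: topspace_prod_topology)
  then show ?thesis
    unfolding defines_skew_product_semiflow_def local_continuous_skew_product_semiflow_def H[symmetric] U_def[symmetric]
    using fst_eq by blast
qed

section \<open>Seminorms defined by families of curves\<close>

text \<open>Convexity of the \<open>p\<close>-th power by induction: the defect in the step is
  \<open>l * (1 - l) * ((x ^ p - y ^ p) * (x - y))\<close>, a product of factors that are
  nonnegative because powers are monotone.\<close>

lemma power_convex_combination:
  fixes x y l :: real
  assumes "0 \<le> x" "0 \<le> y" "0 \<le> l" "l \<le> 1"
  shows "(l * x + (1 - l) * y) ^ p \<le> l * x ^ p + (1 - l) * y ^ p"
proof (induction p)
  case (Suc p)
  have "0 \<le> (x ^ p - y ^ p) * (x - y)"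
    using assms power_mono[of x y p] power_mono[of y x p] by (cases "x \<le> y") (auto simp: mult_nonpos_nonpos)
  then have "0 \<le> l * (1 - l) * ((x ^ p - y ^ p) * (x - y))" using assms by simp
  moreover have "(l * x + (1 - l) * y) * (l * x + (1 - l) * y) ^ p \<le> (l * x + (1 - l) * y) * (l * x ^ p + (1 - l) * y ^ p)"
    using assms Suc by (intro mult_left_mono) auto
  moreover have "(l * x + (1 - l) * y) * (l * x ^ p + (1 - l) * y ^ p) =
      l * x ^ Suc p + (1 - l) * y ^ Suc p - l * (1 - l) * ((x ^ p - y ^ p) * (x - y))"
    by (simp add: algebra_simps)
  ultimately show ?case by simp
qed simp

text \<open>The usual proof by convexity: \<open>a + b\<close> is \<open>A + B\<close> times a
  convex combination of \<open>a / A\<close> and \<open>b / B\<close>, where \<open>A\<close> and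
  \<open>B\<close> are the norms.\<close>

lemma minkowski_integral:
  fixes a b :: "real \<Rightarrow> real"
  assumes p: "1 \<le> p" and nonneg: "\<And>t. t \<in> S \<Longrightarrow> 0 \<le> a t" "\<And>t. t \<in> S \<Longrightarrow> 0 \<le> b t"
    and int: "(\<lambda>t. a t ^ p) integrable_on S" "(\<lambda>t. b t ^ p) integrable_on S" "(\<lambda>t. c t ^ p) integrable_on S"
    and c: "\<And>t. t \<in> S \<Longrightarrow> 0 \<le> c t" "\<And>t. t \<in> S \<Longrightarrow> c t \<le> a t + b t"
  shows "root p (integral S (\<lambda>t. c t ^ p)) \<le> root p (integral S (\<lambda>t. a t ^ p)) + root p (integral S (\<lambda>t. b t ^ p))"
proof (rule field_le_epsilon)
  fix e :: real assume "0 < e"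
  \<comment> \<open>Half of \<open>e\<close> is added to each norm so that division by it is
    possible even if the function vanishes.\<close>
  define A where "A = root p (integral S (\<lambda>t. a t ^ p)) + e / 2"
  define B where "B = root p (integral S (\<lambda>t. b t ^ p)) + e / 2"
  have I0: "0 \<le> integral S (\<lambda>t. a t ^ p)" "0 \<le> integral S (\<lambda>t. b t ^ p)" "0 \<le> integral S (\<lambda>t. c t ^ p)"
    using int nonneg c(1) by (auto intro!: integral_nonneg)
  have AB: "0 < A" "0 < B" using I0 p \<open>0 < e\<close> by (auto simp: A_def B_def intro!: add_nonneg_pos)
  have le: "integral S (\<lambda>t. a t ^ p) \<le> A ^ p" "integral S (\<lambda>t. b t ^ p) \<le> B ^ p"
  proof -
    have "x \<le> (root p x + e / 2) ^ p" if "0 \<le> x" for x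
    proof -
      have "x = root p x ^ p" using that p by (simp add: real_root_pow_pos2)
      also have "\<dots> \<le> (root p x + e / 2) ^ p" using that p \<open>0 < e\<close> by (intro power_mono) auto
      finally show ?thesis .
    qed
    then show "integral S (\<lambda>t. a t ^ p) \<le> A ^ p" "integral S (\<lambda>t. b t ^ p) \<le> B ^ p" using I0 by (auto simp: A_def B_def)
  qed
  define l where "l = A / (A + B)"
  have l: "0 \<le> l" "l \<le> 1" "1 - l = B / (A + B)" using AB by (auto simp: l_def field_simps)
  define F where "F t = (A + B) ^ p * (l * (a t ^ p / A ^ p) + (1 - l) * (b t ^ p / B ^ p))" for t
  have cF: "c t ^ p \<le> F t" if t: "t \<in> S" for t
  proof -
    have "l * (a t / A) = a t / (A + B)" "(1 - l) * (b t / B) = b t / (A + B)"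
      unfolding l(3) using AB by (simp_all add: l_def)
    then have "a t + b t = (A + B) * (l * (a t / A) + (1 - l) * (b t / B))"
      using AB by (simp flip: add_divide_distrib)
    then have "(a t + b t) ^ p = (A + B) ^ p * (l * (a t / A) + (1 - l) * (b t / B)) ^ p"
      by (simp add: power_mult_distrib)
    also have "(l * (a t / A) + (1 - l) * (b t / B)) ^ p \<le> l * (a t / A) ^ p + (1 - l) * (b t / B) ^ p"
      by (rule power_convex_combination) (use l nonneg t AB in auto)
    finally have "(a t + b t) ^ p \<le> F t" using AB by (simp add: F_def power_divide mult_left_mono)
    moreover have "c t ^ p \<le> (a t + b t) ^ p" using c t by (intro power_mono) auto
    ultimately show ?thesis by simp
  qed
  have Fi: "F integrable_on S" unfolding F_def
    by (intro integrable_on_mult_right integrable_add integrable_on_divide int)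
  have "integral S (\<lambda>t. c t ^ p) \<le> integral S F" by (rule integral_le[OF int(3) Fi cF])
  also have "integral S F = (A + B) ^ p * (l * (integral S (\<lambda>t. a t ^ p) / A ^ p) + (1 - l) * (integral S (\<lambda>t. b t ^ p) / B ^ p))"
    unfolding F_def by (simp add: integral_add integrable_on_mult_right integrable_on_divide int)
  also have "\<dots> \<le> (A + B) ^ p * (l * 1 + (1 - l) * 1)"
    using le AB l by (intro mult_left_mono add_mono) auto
  finally have "integral S (\<lambda>t. c t ^ p) \<le> (A + B) ^ p" by simp
  then have "root p (integral S (\<lambda>t. c t ^ p)) \<le> root p ((A + B) ^ p)" using p by simp
  also have "\<dots> = A + B" using AB p by (simp add: real_root_power_cancel)
  finally show "root p (integral S (\<lambda>t. c t ^ p)) \<le> root p (integral S (\<lambda>t. a t ^ p)) + root p (integral S (\<lambda>t. b t ^ p)) + e"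
    by (simp add: A_def B_def)
qed

text \<open>The last clause makes \<open>\<rho>\<close> blind to the arbitrary choice in
  \<open>rep\<close>, so that neighbourhoods of classes can be handled through
  representatives.\<close>

definition LC_seminorm :: "nat \<Rightarrow> (('n::finite) dfield \<Rightarrow> real) \<Rightarrow> bool" where
  "LC_seminorm p \<rho> \<longleftrightarrow> \<rho> (\<lambda>w. 0) = 0 \<and> (\<forall>f\<in>LC p. \<forall>g\<in>LC p. \<rho> (\<lambda>w. f w + g w) \<le> \<rho> f + \<rho> g) \<and>
     (\<forall>f\<in>LC p. \<forall>g\<in>LC p. field_eq f g \<longrightarrow> \<rho> f = \<rho> g)"

lemma LC_seminorm_triangle:
  assumes "LC_seminorm p \<rho>" "f \<in> LC p" "g \<in> LC p" "h \<in> LC p"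
  shows "\<rho> (\<lambda>w. f w - h w) \<le> \<rho> (\<lambda>w. f w - g w) + \<rho> (\<lambda>w. g w - h w)"
proof -
  have eq: "(\<lambda>w. f w - h w) = (\<lambda>w. (f w - g w) + (g w - h w))" by auto
  have "\<forall>f\<in>LC p. \<forall>g\<in>LC p. \<rho> (\<lambda>w. f w + g w) \<le> \<rho> f + \<rho> g"
    using assms(1) by (simp add: LC_seminorm_def)
  from bspec[OF bspec[OF this LC_diff[OF assms(2,3)]] LC_diff[OF assms(3,4)]]
  show ?thesis unfolding eq .
qed

lemma field_eq_diff: "field_eq f f' \<Longrightarrow> field_eq g g' \<Longrightarrow> field_eq (\<lambda>w. f w - g w) (\<lambda>w. f' w - g' w)"
  unfolding field_eq_def by (metis (no_types, lifting) UnI1 UnI2 negligible_Un)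

lemma LC_seminorm_cong:
  assumes "LC_seminorm p \<rho>" "field_eq f f'" "field_eq g g'" "f \<in> LC p" "f' \<in> LC p" "g \<in> LC p" "g' \<in> LC p"
  shows "\<rho> (\<lambda>w. f w - g w) = \<rho> (\<lambda>w. f' w - g' w)"
  using assms field_eq_diff[OF assms(2,3)] LC_diff unfolding LC_seminorm_def by blast

locale seminorm_space =
  fixes p :: nat and S :: "(('n::finite) dfield \<Rightarrow> real) set"
  assumes p: "1 \<le> p" and S: "S \<noteq> {}" and seminorm: "\<And>\<rho>. \<rho> \<in> S \<Longrightarrow> LC_seminorm p \<rho>"
begin

abbreviation "T \<equiv> seminorm_topology (LC_space p) S"

definition nbh :: "('n dfield \<Rightarrow> real) \<Rightarrow> 'n dfield set \<Rightarrow> real \<Rightarrow> 'n dfield set set" where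
  "nbh \<rho> G \<epsilon> = {H \<in> LC_space p. \<rho> (\<lambda>w. rep H w - rep G w) < \<epsilon>}"

lemma center_in_nbh: "\<lbrakk>\<rho> \<in> S; G \<in> LC_space p; 0 < \<epsilon>\<rbrakk> \<Longrightarrow> G \<in> nbh \<rho> G \<epsilon>"
  using seminorm[of \<rho>] by (simp add: nbh_def LC_seminorm_def)

lemma openin_nbh: "\<lbrakk>\<rho> \<in> S; G \<in> LC_space p; 0 < \<epsilon>\<rbrakk> \<Longrightarrow> openin T (nbh \<rho> G \<epsilon>)"
  unfolding seminorm_topology_def by (rule topology_generated_by_Basis) (auto simp: nbh_def)

lemma topspace_T: "topspace T = LC_space p"
proof -
  have "\<exists>\<rho>. \<rho> \<in> S" using S by blast
  then obtain \<rho> where \<rho>: "\<rho> \<in> S" ..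
  show ?thesis
  proof
    show "topspace T \<subseteq> LC_space p" unfolding seminorm_topology_def topology_generated_by_topspace by blast
    show "LC_space p \<subseteq> topspace T"
    proof
      fix G :: "'n dfield set" assume G: "G \<in> LC_space p"
      show "G \<in> topspace T"
        using openin_subset[OF openin_nbh[OF \<rho> G zero_less_one]] center_in_nbh[OF \<rho> G zero_less_one] by blast
    qed
  qed
qed

text \<open>Generating open sets are centred at arbitrary classes; the triangle inequality recentres
  them at the image point, where the hypothesis applies.\<close>

lemma continuous_map_into_T:
  assumes mem: "\<And>x. x \<in> topspace X \<Longrightarrow> \<Psi> x \<in> LC_space p"
    and cont: "\<And>x \<rho> \<epsilon>. \<lbrakk>x \<in> topspace X; \<rho> \<in> S; 0 < \<epsilon>\<rbrakk> \<Longrightarrow>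
      \<exists>V. openin X V \<and> x \<in> V \<and> (\<forall>y\<in>V. \<rho> (\<lambda>w. rep (\<Psi> y) w - rep (\<Psi> x) w) < \<epsilon>)"
  shows "continuous_map X T \<Psi>"
  unfolding seminorm_topology_def
proof (rule continuous_on_generated_topo)
  let ?B = "{{H \<in> LC_space p. \<rho> (\<lambda>w. rep H w - rep G w) < \<epsilon>} |\<rho> G \<epsilon>. \<rho> \<in> S \<and> G \<in> LC_space p \<and> 0 < \<epsilon>}"
  have "\<Union>?B = LC_space p"
    using topspace_T unfolding seminorm_topology_def topology_generated_by_topspace .
  then show "\<Psi> ` topspace X \<subseteq> \<Union>?B" using mem by auto
  fix U assume "U \<in> ?B"
  then obtain \<rho> G \<epsilon> where U: "U = {H \<in> LC_space p. \<rho> (\<lambda>w. rep H w - rep G w) < \<epsilon>}" "\<rho> \<in> S" "G \<in> LC_space p" "0 < \<epsilon>" by blast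
  show "openin X (\<Psi> -` U \<inter> topspace X)"
  proof (subst openin_subopen, intro ballI)
    fix x assume x: "x \<in> \<Psi> -` U \<inter> topspace X"
    define d where "d = \<epsilon> - \<rho> (\<lambda>w. rep (\<Psi> x) w - rep G w)"
    have "0 < d" using x U by (auto simp: d_def)
    then obtain V where V: "openin X V" "x \<in> V" "\<forall>y\<in>V. \<rho> (\<lambda>w. rep (\<Psi> y) w - rep (\<Psi> x) w) < d"
      using cont[of x \<rho> d] x U by blast
    have "V \<subseteq> \<Psi> -` U \<inter> topspace X"
    proof
      fix y assume y: "y \<in> V"
      then have yX: "y \<in> topspace X" using openin_subset[OF V(1)] by blast
      have "\<rho> (\<lambda>w. rep (\<Psi> y) w - rep G w) \<le> \<rho> (\<lambda>w. rep (\<Psi> y) w - rep (\<Psi> x) w) + \<rho> (\<lambda>w. rep (\<Psi> x) w - rep G w)"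
        by (rule LC_seminorm_triangle[OF seminorm[OF U(2)]]) (use mem yX x U in \<open>auto intro: rep_LC\<close>)
      also have "\<dots> < \<epsilon>" using V(3) y by (auto simp: d_def)
      finally show "y \<in> \<Psi> -` U \<inter> topspace X" using U(1) mem[OF yX] yX by simp
    qed
    then show "\<exists>V. openin X V \<and> x \<in> V \<and> V \<subseteq> \<Psi> -` U \<inter> topspace X" using V by blast
  qed
qed

end

text \<open>Boundedness is essential: a supremum of reals is meaningful only for a nonempty set with
  an upper bound.\<close>

lemma LC_seminorm_SUP:
  fixes n :: "'i \<Rightarrow> ('n::finite) dfield \<Rightarrow> real"
  assumes ne: "X \<noteq> {}"
    and zero: "\<And>i. i \<in> X \<Longrightarrow> n i (\<lambda>w. 0) = (0::real)"
    and tri: "\<And>i f g. \<lbrakk>i \<in> X; f \<in> LC p; g \<in> LC p\<rbrakk> \<Longrightarrow> n i (\<lambda>w. f w + g w) \<le> n i f + n i g"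
    and cong: "\<And>i f g. \<lbrakk>i \<in> X; f \<in> LC p; g \<in> LC p; field_eq f g\<rbrakk> \<Longrightarrow> n i f = n i g"
    and bdd: "\<And>f. f \<in> LC p \<Longrightarrow> bdd_above ((\<lambda>i. n i f) ` X)"
  shows "LC_seminorm p (\<lambda>f. SUP i\<in>X. n i f)"
  unfolding LC_seminorm_def
proof (intro conjI ballI allI impI)
  show "(SUP i\<in>X. n i (\<lambda>w. 0)) = 0" using ne zero by (simp add: cong: SUP_cong_simp)
  fix f g :: "'n dfield" assume f: "f \<in> LC p" and g: "g \<in> LC p"
  show "(SUP i\<in>X. n i f) = (SUP i\<in>X. n i g)" if "field_eq f g"
    using cong[OF _ f g that] by (simp cong: SUP_cong_simp)
  show "(SUP i\<in>X. n i (\<lambda>w. f w + g w)) \<le> (SUP i\<in>X. n i f) + (SUP i\<in>X. n i g)"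
  proof (rule cSUP_least[OF ne])
    fix i assume i: "i \<in> X"
    show "n i (\<lambda>w. f w + g w) \<le> (SUP i\<in>X. n i f) + (SUP i\<in>X. n i g)"
      using tri[OF i f g] cSUP_upper[OF i bdd[OF f]] cSUP_upper[OF i bdd[OF g]] by linarith
  qed
qed

section \<open>Strong and weak seminorms along bounded curves\<close>

definition curves :: "real \<Rightarrow> real \<Rightarrow> real \<Rightarrow> (real \<Rightarrow> 'a::euclidean_space) set" where
  "curves r a b = {z. continuous_on {a..b} z \<and> (\<forall>t\<in>{a..b}. norm (z t) \<le> r)}"

text \<open>A common form of the seminorms behind \<open>T_ThetaB\<close> and, with
  \<open>p = 1\<close>, \<open>T_ThetaD\<close>; they differ in the family \<open>Z\<close> of pairs
  of present and delayed argument. The next definition does the same for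
  \<open>sigma_ThetaD\<close>.\<close>

definition strong_seminorm ::
  "nat \<Rightarrow> (real \<Rightarrow> (real ^ 'n) \<times> (real ^ 'n)) set \<Rightarrow> real set \<Rightarrow> ('n::finite) dfield \<Rightarrow> real" where
  "strong_seminorm p Z I f = (SUP z\<in>Z. root p (LINT t:I|lebesgue. norm (f (t, z t)) ^ p))"

definition weak_seminorm ::
  "(real \<Rightarrow> (real ^ 'n) \<times> (real ^ 'n)) set \<Rightarrow> real set \<Rightarrow> ('n::finite) dfield \<Rightarrow> real" where
  "weak_seminorm Z I f = (SUP z\<in>Z. norm (LINT t:I|lebesgue. f (t, z t)))"

lemma curve_integrable:
  fixes f :: "('n::finite) dfield"
  assumes f: "f \<in> LC p" "1 \<le> p" and z: "z \<in> curves r a b"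
  shows "(\<lambda>t. f (t, z t)) absolutely_integrable_on {a..b}" "(\<lambda>t. norm (f (t, z t)) ^ p) absolutely_integrable_on {a..b}"
    "(\<lambda>t. f (t, z t)) integrable_on {a..b}" "(\<lambda>t. norm (f (t, z t)) ^ p) integrable_on {a..b}"
    "(\<lambda>t. norm (f (t, z t))) integrable_on {a..b}"
    "(LINT t:{a..b}|lebesgue. f (t, z t)) = integral {a..b} (\<lambda>t. f (t, z t))"
    "(LINT t:{a..b}|lebesgue. norm (f (t, z t)) ^ p) = integral {a..b} (\<lambda>t. norm (f (t, z t)) ^ p)"
proof -
  obtain k N where env: "envelope p r f k N" using LC_envelope[OF f] by blast
  have zm: "z \<in> borel_measurable (lebesgue_on {a..b})" and zb: "\<And>t. t \<in> {a..b} \<Longrightarrow> norm (z t) \<le> r"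
    using z by (auto simp: curves_def intro: continuous_imp_measurable_on_sets_lebesgue)
  note F = field_integrable[OF f(1) env zm zb]
  show 1: "(\<lambda>t. f (t, z t)) absolutely_integrable_on {a..b}" by (rule F(1))
  show 2: "(\<lambda>t. norm (f (t, z t)) ^ p) absolutely_integrable_on {a..b}" by (rule F(3))
  show "(\<lambda>t. f (t, z t)) integrable_on {a..b}" "(LINT t:{a..b}|lebesgue. f (t, z t)) = integral {a..b} (\<lambda>t. f (t, z t))"
    using set_lebesgue_integral_eq_integral[OF 1] by simp_all
  show "(\<lambda>t. norm (f (t, z t)) ^ p) integrable_on {a..b}"
    "(LINT t:{a..b}|lebesgue. norm (f (t, z t)) ^ p) = integral {a..b} (\<lambda>t. norm (f (t, z t)) ^ p)"
    using set_lebesgue_integral_eq_integral[OF 2] by simp_all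
  have "(\<lambda>t. norm (f (t, z t))) absolutely_integrable_on {a..b}"
    using absolutely_integrable_norm[OF F(1)] by (simp add: comp_def)
  then show "(\<lambda>t. norm (f (t, z t))) integrable_on {a..b}" by (rule set_lebesgue_integral_eq_integral(1))
qed

text \<open>One envelope on the ball of radius \<open>r\<close> bounds the integrals along all these
  curves at once, which makes the suprema finite.\<close>

lemma curve_integral_bounded:
  fixes f :: "('n::finite) dfield"
  assumes f: "f \<in> LC p" "1 \<le> p"
  obtains B where "\<And>z. z \<in> curves r a b \<Longrightarrow> norm (integral {a..b} (\<lambda>t. f (t, z t))) \<le> B"
    "\<And>z. z \<in> curves r a b \<Longrightarrow> integral {a..b} (\<lambda>t. norm (f (t, z t)) ^ p) \<le> B"
proof -
  obtain k N where env: "envelope p r f k N" using LC_envelope[OF f] by blast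
  show ?thesis
  proof (rule that[of "max (integral {a..b} k) (integral {a..b} (\<lambda>t. k t ^ p))"])
    fix z :: "real \<Rightarrow> (real ^ 'n) \<times> (real ^ 'n)" assume z: "z \<in> curves r a b"
    have zm: "z \<in> borel_measurable (lebesgue_on {a..b})" and zb: "\<And>t. t \<in> {a..b} \<Longrightarrow> norm (z t) \<le> r"
      using z by (auto simp: curves_def intro: continuous_imp_measurable_on_sets_lebesgue)
    note F = field_integrable[OF f(1) env zm zb]
    show "norm (integral {a..b} (\<lambda>t. f (t, z t))) \<le> max (integral {a..b} k) (integral {a..b} (\<lambda>t. k t ^ p))"
      using F(2) by (simp add: le_max_iff_disj)
    show "integral {a..b} (\<lambda>t. norm (f (t, z t)) ^ p) \<le> max (integral {a..b} k) (integral {a..b} (\<lambda>t. k t ^ p))"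
      using F(4) by (simp add: le_max_iff_disj)
  qed
qed

lemma LC_add:
  assumes "f \<in> LC p" "g \<in> LC p" "0 < p"
  shows "(\<lambda>w. f w + g w) \<in> LC p"
proof -
  have "(\<lambda>w. 0 - g w) \<in> LC p" by (rule LC_diff[OF LC_zero[OF assms(3)] assms(2)])
  from LC_diff[OF assms(1) this] show ?thesis by simp
qed

lemma field_eq_integral:
  assumes "field_eq f g"
  shows "integral I (\<lambda>t. F (f (t, z t))) = integral I (\<lambda>t. F (g (t, z t)))"
proof -
  obtain N where N: "negligible N" "\<And>t z. t \<notin> N \<Longrightarrow> f (t, z) = g (t, z)" using assms unfolding field_eq_def by blast
  show ?thesis by (rule integral_spike[OF N(1)]) (simp add: N(2))
qed

lemma strong_seminorm_upper:
  fixes f :: "('n::finite) dfield"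
  assumes f: "f \<in> LC p" "1 \<le> p" and Z: "Z \<subseteq> curves r a b"
  shows "bdd_above ((\<lambda>z. root p (LINT t:{a..b}|lebesgue. norm (f (t, z t)) ^ p)) ` Z)"
    "z \<in> Z \<Longrightarrow> root p (integral {a..b} (\<lambda>t. norm (f (t, z t)) ^ p)) \<le> strong_seminorm p Z {a..b} f"
proof -
  obtain B where B: "\<And>z. z \<in> curves r a b \<Longrightarrow> integral {a..b} (\<lambda>t. norm (f (t, z t)) ^ p) \<le> B"
    using curve_integral_bounded[OF f] by metis
  show *: "bdd_above ((\<lambda>z. root p (LINT t:{a..b}|lebesgue. norm (f (t, z t)) ^ p)) ` Z)"
  proof (rule bdd_aboveI2)
    fix z assume "z \<in> Z"
    then have z: "z \<in> curves r a b" using Z by blast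
    show "root p (LINT t:{a..b}|lebesgue. norm (f (t, z t)) ^ p) \<le> root p B"
      using B[OF z] f(2) unfolding curve_integrable(7)[OF f z] by simp
  qed
  assume z: "z \<in> Z"
  then show "root p (integral {a..b} (\<lambda>t. norm (f (t, z t)) ^ p)) \<le> strong_seminorm p Z {a..b} f"
    unfolding strong_seminorm_def using cSUP_upper[OF z *] curve_integrable(7)[OF f, of z] Z by auto
qed

lemma strong_seminorm_least:
  fixes f :: "('n::finite) dfield"
  assumes f: "f \<in> LC p" "1 \<le> p" and Z: "Z \<subseteq> curves r a b" "Z \<noteq> {}"
    and B: "\<And>z. z \<in> Z \<Longrightarrow> root p (integral {a..b} (\<lambda>t. norm (f (t, z t)) ^ p)) \<le> B"
  shows "strong_seminorm p Z {a..b} f \<le> B"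
  unfolding strong_seminorm_def
proof (rule cSUP_least[OF Z(2)])
  fix z assume "z \<in> Z"
  then show "root p (LINT t:{a..b}|lebesgue. norm (f (t, z t)) ^ p) \<le> B"
    using B[of z] curve_integrable(7)[OF f, of z] Z(1) by auto
qed

lemma weak_seminorm_upper:
  fixes f :: "('n::finite) dfield"
  assumes f: "f \<in> LC p" "1 \<le> p" and Z: "Z \<subseteq> curves r a b"
  shows "bdd_above ((\<lambda>z. norm (LINT t:{a..b}|lebesgue. f (t, z t))) ` Z)"
    "z \<in> Z \<Longrightarrow> norm (integral {a..b} (\<lambda>t. f (t, z t))) \<le> weak_seminorm Z {a..b} f"
proof -
  obtain B where B: "\<And>z. z \<in> curves r a b \<Longrightarrow> norm (integral {a..b} (\<lambda>t. f (t, z t))) \<le> B"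
    using curve_integral_bounded[OF f] by metis
  show *: "bdd_above ((\<lambda>z. norm (LINT t:{a..b}|lebesgue. f (t, z t))) ` Z)"
  proof (rule bdd_aboveI2)
    fix z assume "z \<in> Z"
    then have z: "z \<in> curves r a b" using Z by blast
    show "norm (LINT t:{a..b}|lebesgue. f (t, z t)) \<le> B"
      using B[OF z] unfolding curve_integrable(6)[OF f z] .
  qed
  assume z: "z \<in> Z"
  then show "norm (integral {a..b} (\<lambda>t. f (t, z t))) \<le> weak_seminorm Z {a..b} f"
    unfolding weak_seminorm_def using cSUP_upper[OF z *] curve_integrable(6)[OF f, of z] Z by auto
qed

lemma weak_seminorm_least:
  fixes f :: "('n::finite) dfield"
  assumes f: "f \<in> LC p" "1 \<le> p" and Z: "Z \<subseteq> curves r a b" "Z \<noteq> {}"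
    and B: "\<And>z. z \<in> Z \<Longrightarrow> norm (integral {a..b} (\<lambda>t. f (t, z t))) \<le> B"
  shows "weak_seminorm Z {a..b} f \<le> B"
  unfolding weak_seminorm_def
proof (rule cSUP_least[OF Z(2)])
  fix z assume "z \<in> Z"
  then show "norm (LINT t:{a..b}|lebesgue. f (t, z t)) \<le> B"
    using B[of z] curve_integrable(6)[OF f, of z] Z(1) by auto
qed

lemma LC_seminorm_strong:
  assumes p: "1 \<le> p" and Z: "Z \<subseteq> curves r a b" "Z \<noteq> {}"
  shows "LC_seminorm p (strong_seminorm p Z {a..b} :: ('n::finite) dfield \<Rightarrow> real)"
proof -
  have "LC_seminorm p (\<lambda>f :: 'n dfield. SUP z\<in>Z. root p (LINT t:{a..b}|lebesgue. norm (f (t, z t)) ^ p))"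
  proof (rule LC_seminorm_SUP[OF Z(2)])
    show "root p (LINT t:{a..b}|lebesgue. norm (0 :: real ^ 'n) ^ p) = 0"
      using p by (simp add: zero_power)
    show "root p (LINT t:{a..b}|lebesgue. norm (f (t, z t)) ^ p) = root p (LINT t:{a..b}|lebesgue. norm (g (t, z t)) ^ p)"
      if "z \<in> Z" "f \<in> LC p" "g \<in> LC p" "field_eq f g" for f g :: "'n dfield" and z
      using field_eq_integral[OF that(4), of "{a..b}" "\<lambda>x. norm x ^ p" z] curve_integrable(7)[OF that(2) p, of z]
        curve_integrable(7)[OF that(3) p, of z] that(1) Z(1) by auto
    fix f :: "'n dfield" assume f: "f \<in> LC p"
    show "bdd_above ((\<lambda>z. root p (LINT t:{a..b}|lebesgue. norm (f (t, z t)) ^ p)) ` Z)"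
      by (rule strong_seminorm_upper(1)[OF f p Z(1)])
    fix z and g :: "'n dfield" assume g: "g \<in> LC p" and "z \<in> Z"
    then have z: "z \<in> curves r a b" using Z by blast
    have fg: "(\<lambda>w. f w + g w) \<in> LC p" using LC_add[OF f g] p by simp
    show "root p (LINT t:{a..b}|lebesgue. norm (f (t, z t) + g (t, z t)) ^ p)
        \<le> root p (LINT t:{a..b}|lebesgue. norm (f (t, z t)) ^ p) + root p (LINT t:{a..b}|lebesgue. norm (g (t, z t)) ^ p)"
      unfolding curve_integrable(7)[OF f p z] curve_integrable(7)[OF g p z] curve_integrable(7)[OF fg p z]
      by (rule minkowski_integral[OF p _ _ curve_integrable(4)[OF f p z] curve_integrable(4)[OF g p z] curve_integrable(4)[OF fg p z]])
        (auto intro: norm_triangle_ineq)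
  qed
  then show ?thesis by (simp add: strong_seminorm_def[abs_def])
qed

lemma LC_seminorm_weak:
  assumes p: "1 \<le> p" and Z: "Z \<subseteq> curves r a b" "Z \<noteq> {}"
  shows "LC_seminorm p (weak_seminorm Z {a..b} :: ('n::finite) dfield \<Rightarrow> real)"
proof -
  have "LC_seminorm p (\<lambda>f :: 'n dfield. SUP z\<in>Z. norm (LINT t:{a..b}|lebesgue. f (t, z t)))"
  proof (rule LC_seminorm_SUP[OF Z(2)])
    show "norm (LINT t:{a..b}|lebesgue. (0 :: real ^ 'n)) = 0" by simp
    show "norm (LINT t:{a..b}|lebesgue. f (t, z t)) = norm (LINT t:{a..b}|lebesgue. g (t, z t))"
      if "z \<in> Z" "f \<in> LC p" "g \<in> LC p" "field_eq f g" for f g :: "'n dfield" and z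
      using field_eq_integral[OF that(4), of "{a..b}" "\<lambda>x. x" z] curve_integrable(6)[OF that(2) p, of z]
        curve_integrable(6)[OF that(3) p, of z] that(1) Z(1) by auto
    fix f :: "'n dfield" assume f: "f \<in> LC p"
    show "bdd_above ((\<lambda>z. norm (LINT t:{a..b}|lebesgue. f (t, z t))) ` Z)"
      by (rule weak_seminorm_upper(1)[OF f p Z(1)])
    fix z and g :: "'n dfield" assume g: "g \<in> LC p" and "z \<in> Z"
    then have z: "z \<in> curves r a b" using Z by blast
    have fg: "(\<lambda>w. f w + g w) \<in> LC p" using LC_add[OF f g] p by simp
    show "norm (LINT t:{a..b}|lebesgue. f (t, z t) + g (t, z t))
        \<le> norm (LINT t:{a..b}|lebesgue. f (t, z t)) + norm (LINT t:{a..b}|lebesgue. g (t, z t))"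
      unfolding curve_integrable(6)[OF f p z] curve_integrable(6)[OF g p z] curve_integrable(6)[OF fg p z]
        integral_add[OF curve_integrable(3)[OF f p z] curve_integrable(3)[OF g p z]] by (rule norm_triangle_ineq)
  qed
  then show ?thesis by (simp add: weak_seminorm_def[abs_def])
qed

section \<open>Continuity of translations in the p-th mean, uniformly along bounded curves\<close>

definition Lp_fun :: "nat \<Rightarrow> (real \<Rightarrow> 'a::euclidean_space) \<Rightarrow> bool" where
  "Lp_fun p h \<longleftrightarrow> h \<in> borel_measurable lebesgue \<and> (\<forall>a b. (\<lambda>t. norm (h t) ^ p) integrable_on {a..b})"

lemma Lp_fun_dominated:
  assumes h: "h \<in> borel_measurable lebesgue" and k: "\<And>a b. k integrable_on {a..b}" and le: "\<And>t. norm (h t) ^ p \<le> k t"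
  shows "Lp_fun p h"
  unfolding Lp_fun_def
proof (intro conjI allI h)
  fix a b
  have "(\<lambda>t. norm (h t) ^ p) \<in> borel_measurable (lebesgue_on {a..b})"
    by (rule measurable_restrict_space1) (use h in measurable)
  then show "(\<lambda>t. norm (h t) ^ p) integrable_on {a..b}"
    by (rule measurable_bounded_by_integrable_imp_integrable[OF _ k]) (use le in auto)
qed

lemma Lp_fun_diff:
  assumes "Lp_fun p h" "Lp_fun p g" shows "Lp_fun p (\<lambda>t. h t - g t)"
proof (rule Lp_fun_dominated)
  show "(\<lambda>t. 2 ^ p * (norm (h t) ^ p + norm (g t) ^ p)) integrable_on {a..b}" for a b
    using assms by (intro integrable_on_mult_right integrable_add) (auto simp: Lp_fun_def)
  show "norm (h t - g t) ^ p \<le> 2 ^ p * (norm (h t) ^ p + norm (g t) ^ p)" for t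
    using power_mono[OF norm_triangle_ineq4[of "h t" "g t"], of p] power_add_le[of "norm (h t)" "norm (g t)" p] by simp
qed (use assms in \<open>auto simp: Lp_fun_def\<close>)

lemma Lp_fun_shift: "Lp_fun p h \<Longrightarrow> Lp_fun p (\<lambda>t. h (t + c))"
  unfolding Lp_fun_def
  by (auto intro!: measurable_shift_lebesgue integrable_on_shift_real(1)[where f = "\<lambda>t. norm (h t) ^ p"])

lemma Lp_fun_continuous: 
  assumes h: "continuous_on UNIV h" shows "Lp_fun p h"
  unfolding Lp_fun_def
proof (intro conjI allI)
  show "h \<in> borel_measurable lebesgue"
    using continuous_imp_measurable_on_sets_lebesgue[OF h] by simp
  show "(\<lambda>t. norm (h t) ^ p) integrable_on {a..b}" for a b
    by (intro integrable_continuous_real continuous_intros continuous_on_subset[OF h]) auto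
qed

lemma Lp_fun_integrable: "Lp_fun p h \<Longrightarrow> (\<lambda>t. norm (h t) ^ p) integrable_on {a..b}"
  by (simp add: Lp_fun_def)

lemma power_add3_le: "\<lbrakk>0 \<le> a; 0 \<le> b; 0 \<le> c\<rbrakk> \<Longrightarrow> (a + b + c) ^ p \<le> 4 ^ p * (a ^ p + b ^ p + c ^ p)" for a b c :: real
proof -
  assume n: "0 \<le> a" "0 \<le> b" "0 \<le> c"
  have "(a + b + c) ^ p \<le> 2 ^ p * ((a + b) ^ p + c ^ p)" using n by (intro power_add_le) auto
  also have "\<dots> \<le> 2 ^ p * (2 ^ p * (a ^ p + b ^ p) + 2 ^ p * c ^ p)"
    using n power_add_le[of a b p] by (intro mult_left_mono add_mono) (auto simp: mult_le_cancel_right1)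
  also have "\<dots> = (2 ^ p * 2 ^ p) * (a ^ p + b ^ p + c ^ p)" by (simp only: distrib_left mult.assoc)
  also have "2 ^ p * 2 ^ p = (4 :: real) ^ p" using power_mult_distrib[of "2 :: real" 2 p] by simp
  finally show ?thesis .
qed

lemma norm_add_diff_le: "norm (a + b - c) \<le> norm a + norm b + norm c" for a b c :: "'a::real_normed_vector"
  using norm_triangle_ineq4[of "a + b" c] norm_triangle_ineq[of a b] by linarith

lemma tendsto_zero_power: "0 < p \<Longrightarrow> f \<longlonglongrightarrow> 0 \<Longrightarrow> (\<lambda>n. (f n :: real) ^ p) \<longlonglongrightarrow> 0"
  using tendsto_power[of f 0 sequentially p] by (simp add: zero_power)

text \<open>Truncation by projection onto balls of growing radius: each value is eventually
  unchanged, and dominated convergence applies.\<close>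

lemma Lp_approx_bounded:
  assumes h: "Lp_fun p h" and p: "1 \<le> p" and "0 < e"
  obtains M where "0 \<le> M" "integral {a..b} (\<lambda>t. norm (h t - pr M (h t)) ^ p) \<le> e" "Lp_fun p (\<lambda>t. pr M (h t))"
proof -
  have prm: "Lp_fun p (\<lambda>t. pr (real n) (h t))" for n
  proof (rule Lp_fun_dominated)
    have "(pr (real n) :: 'a \<Rightarrow> 'a) \<in> borel_measurable borel"
      using continuous_on_pr[of "real n" UNIV "\<lambda>x. x"] by (intro borel_measurable_continuous_onI) auto
    then show "(\<lambda>t. pr (real n) (h t)) \<in> borel_measurable lebesgue"
      using h by (auto simp: Lp_fun_def intro: measurable_compose)
    show "norm (pr (real n) (h t)) ^ p \<le> real n ^ p" for t by (intro power_mono norm_pr_le) auto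
  qed auto
  define F where "F n t = norm (h t - pr (real n) (h t)) ^ p" for n t
  have "(\<lambda>n. integral {a..b} (F n)) \<longlonglongrightarrow> integral {a..b} (\<lambda>t. 0)"
  proof (rule dominated_convergence(2))
    show "F n integrable_on {a..b}" for n
      unfolding F_def by (intro Lp_fun_integrable Lp_fun_diff h prm)
    show "(\<lambda>t. norm (h t) ^ p) integrable_on {a..b}" by (rule Lp_fun_integrable[OF h])
    \<comment> \<open>The ball contains 0, so the distance of \<open>h t\<close> to it is at most
      \<open>norm (h t)\<close>.\<close>
    show "norm (F n t) \<le> norm (h t) ^ p" for n t
      using closest_point_le[of "cball 0 (real n)" 0 "h t"] by (auto simp: F_def pr_def dist_norm intro!: power_mono)
    show "(\<lambda>n. F n t) \<longlonglongrightarrow> 0" for t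
    proof (rule tendsto_eventually)
      obtain m :: nat where "norm (h t) \<le> m" using real_arch_simple by blast
      then show "\<forall>\<^sub>F n in sequentially. F n t = 0"
        unfolding eventually_sequentially F_def using p by (intro exI[of _ m]) (auto simp: pr_self zero_power)
    qed
  qed
  then have "(\<lambda>n. integral {a..b} (F n)) \<longlonglongrightarrow> 0" by simp
  then obtain n where "integral {a..b} (F n) < e"
    using eventually_happens'[OF sequentially_bot order_tendstoD(2)[of _ 0 sequentially e]] \<open>0 < e\<close> by auto
  then have "integral {a..b} (\<lambda>t. norm (h t - pr (real n) (h t)) ^ p) \<le> e" by (simp add: F_def[abs_def])
  then show ?thesis by (intro that[of "real n"] prm) auto
qed

text \<open>Measurability supplies continuous functions converging almost everywhere but without a
  common bound. Projecting both \<open>h\<close> and these functions to radius \<open>M\<close>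
  gives the constant dominating function \<open>(2 * M) ^ p\<close>.\<close>

lemma Lp_approx_continuous:
  assumes h: "Lp_fun p h" and p: "1 \<le> p" and "0 < e"
  obtains g where "continuous_on UNIV g" "integral {a..b} (\<lambda>t. norm (h t - g t) ^ p) \<le> e"
proof -
  define e1 where "e1 = e / (2 * 2 ^ p)"
  have e1: "0 < e1" "2 ^ p * (e1 + e1) = e" using \<open>0 < e\<close> by (auto simp: e1_def)
  obtain M where M: "0 \<le> M" "integral {a..b} (\<lambda>t. norm (h t - pr M (h t)) ^ p) \<le> e1" "Lp_fun p (\<lambda>t. pr M (h t))"
    using Lp_approx_bounded[OF h p e1(1)] by metis
  have "h measurable_on {a..b}"
    by (rule lebesgue_measurable_imp_measurable_on) (use h in \<open>auto simp: Lp_fun_def\<close>)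
  then obtain N g where N: "negligible N" and g: "\<And>n. continuous_on UNIV (g n)"
    "\<And>t. t \<notin> N \<Longrightarrow> (\<lambda>n. g n t) \<longlonglongrightarrow> (if t \<in> {a..b} then h t else 0)"
    unfolding measurable_on_def by blast
  have pg: "continuous_on UNIV (\<lambda>t. pr M (g n t))" for n by (intro continuous_on_pr M(1) g(1))
  define F where "F n t = norm (pr M (h t) - pr M (g n t)) ^ p" for n t
  have Fi: "F n integrable_on {a..b}" for n
    unfolding F_def by (intro Lp_fun_integrable Lp_fun_diff M(3) Lp_fun_continuous pg)
  define F' where "F' n t = (if t \<in> N then 0 else F n t)" for n t
  have "(\<lambda>n. integral {a..b} (F' n)) \<longlonglongrightarrow> integral {a..b} (\<lambda>t. 0)"
  proof (rule dominated_convergence(2))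
    show "F' n integrable_on {a..b}" for n
      by (rule integrable_spike[OF Fi N]) (auto simp: F'_def)
    show "(\<lambda>t. (2 * M) ^ p) integrable_on {a..b}" by auto
    show "norm (F' n t) \<le> (2 * M) ^ p" for n t
    proof -
      have "norm (pr M (h t) - pr M (g n t)) \<le> 2 * M"
        using norm_triangle_ineq4[of "pr M (h t)" "pr M (g n t)"] norm_pr_le[OF M(1), of "h t"] norm_pr_le[OF M(1), of "g n t"] by simp
      then have "norm (pr M (h t) - pr M (g n t)) ^ p \<le> (2 * M) ^ p" by (intro power_mono) auto
      moreover have "0 \<le> (2 * M) ^ p" using M(1) by simp
      ultimately show ?thesis unfolding F'_def F_def by (simp del: power_mult_distrib)
    qed
    show "(\<lambda>n. F' n t) \<longlonglongrightarrow> 0" if t: "t \<in> {a..b}" for t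
    proof (cases "t \<in> N")
      case False
      have "(\<lambda>n. norm (pr M (h t) - pr M (g n t))) \<longlonglongrightarrow> 0"
      proof (rule tendsto_sandwich[OF _ _ tendsto_const])
        show "(\<lambda>n. norm (h t - g n t)) \<longlonglongrightarrow> 0"
          using tendsto_norm[OF tendsto_diff[OF tendsto_const[of "h t"] g(2)[OF False]]] t by simp
      qed (auto intro!: always_eventually pr_lipschitz M(1))
      then show ?thesis using False tendsto_zero_power[of p] p by (simp add: F'_def F_def)
    qed (simp add: F'_def)
  qed
  then have "(\<lambda>n. integral {a..b} (F' n)) \<longlonglongrightarrow> 0" by simp
  then obtain n where n: "integral {a..b} (F' n) < e1"
    using eventually_happens'[OF sequentially_bot order_tendstoD(2)[of _ 0 sequentially e1]] e1(1) by auto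
  have FF': "integral {a..b} (F n) = integral {a..b} (F' n)"
    by (rule integral_spike[OF N]) (auto simp: F'_def)
  have i1: "(\<lambda>t. norm (h t - pr M (h t)) ^ p) integrable_on {a..b}" by (intro Lp_fun_integrable Lp_fun_diff h M(3))
  have "integral {a..b} (\<lambda>t. norm (h t - pr M (g n t)) ^ p) \<le> integral {a..b} (\<lambda>t. 2 ^ p * (norm (h t - pr M (h t)) ^ p + F n t))"
  proof (rule integral_le)
    show "(\<lambda>t. norm (h t - pr M (g n t)) ^ p) integrable_on {a..b}"
      by (intro Lp_fun_integrable Lp_fun_diff h Lp_fun_continuous pg)
    show "(\<lambda>t. 2 ^ p * (norm (h t - pr M (h t)) ^ p + F n t)) integrable_on {a..b}"
      by (intro integrable_on_mult_right integrable_add i1 Fi)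
    fix t
    have "norm (h t - pr M (g n t)) \<le> norm (h t - pr M (h t)) + norm (pr M (h t) - pr M (g n t))"
      using norm_triangle_ineq[of "h t - pr M (h t)" "pr M (h t) - pr M (g n t)"] by simp
    then have "norm (h t - pr M (g n t)) ^ p \<le> (norm (h t - pr M (h t)) + norm (pr M (h t) - pr M (g n t))) ^ p"
      by (intro power_mono) auto
    also have "\<dots> \<le> 2 ^ p * (norm (h t - pr M (h t)) ^ p + F n t)"
      unfolding F_def by (rule power_add_le) auto
    finally show "norm (h t - pr M (g n t)) ^ p \<le> 2 ^ p * (norm (h t - pr M (h t)) ^ p + F n t)" .
  qed
  also have "\<dots> = 2 ^ p * (integral {a..b} (\<lambda>t. norm (h t - pr M (h t)) ^ p) + integral {a..b} (F n))"
    by (simp add: integral_add i1 Fi)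
  also have "\<dots> \<le> 2 ^ p * (e1 + e1)" using M(2) n FF' by (intro mult_left_mono) auto
  finally show ?thesis using that[OF pg] e1(2) by simp
qed

text \<open>Density of continuous functions reduces the claim to uniform continuity on a compact
  interval. Shifts are at most 1, so one approximation on \<open>{a-1..b+1}\<close> serves both the
  function and its translate; \<open>4 ^ p\<close> comes from splitting into three terms.\<close>

lemma Lp_translation_continuous:
  assumes h: "Lp_fun p h" and p: "1 \<le> p" and "0 < e"
  obtains \<delta> where "0 < \<delta>" "\<delta> \<le> 1" "\<And>c. \<bar>c\<bar> \<le> \<delta> \<Longrightarrow> integral {a..b} (\<lambda>s. norm (h (s + c) - h s) ^ p) \<le> e"
proof -
  define L where "L = \<bar>b - a\<bar> + 1"
  define e1 where "e1 = e / (4 ^ p * 3)"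
  have e1: "0 < e1" "4 ^ p * (e1 + e1 + e1) = e" using \<open>0 < e\<close> by (auto simp: e1_def)
  obtain g where g: "continuous_on UNIV g" "integral {a-1..b+1} (\<lambda>t. norm (h t - g t) ^ p) \<le> e1"
    using Lp_approx_continuous[OF h p e1(1)] by metis
  \<comment> \<open>Since \<open>\<eta> \<le> 1\<close>, the \<open>p\<close>-th power of an
    increment below \<open>\<eta>\<close> is at most \<open>\<eta>\<close>, and its integral over
    \<open>{a..b}\<close> at most \<open>\<eta> * L \<le> e1\<close>.\<close>
  define \<eta> where "\<eta> = min 1 (e1 / L)"
  have L: "0 < L" by (simp add: L_def)
  have \<eta>: "0 < \<eta>" "\<eta> \<le> 1" "\<eta> * L \<le> e1" using e1(1) L by (auto simp: \<eta>_def min_def field_simps)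
  have "uniformly_continuous_on {a-1..b+1} g"
    by (rule compact_uniformly_continuous[OF continuous_on_subset[OF g(1)]]) auto
  then obtain d where d: "0 < d" "\<And>s s'. \<lbrakk>s \<in> {a-1..b+1}; s' \<in> {a-1..b+1}; dist s' s < d\<rbrakk> \<Longrightarrow> dist (g s') (g s) < \<eta>"
    unfolding uniformly_continuous_on_def using \<eta>(1) by blast
  have hg: "Lp_fun p (\<lambda>t. h t - g t)" by (intro Lp_fun_diff h Lp_fun_continuous g(1))
  note hgi = Lp_fun_integrable[OF hg]
  show ?thesis
  proof (rule that[of "min (d / 2) 1"])
    fix c assume c: "\<bar>c\<bar> \<le> min (d / 2) 1"
    have hgc: "(\<lambda>s. norm (h (s + c) - g (s + c)) ^ p) integrable_on {a..b}"
      by (rule integrable_on_shift_real(1)[where f = "\<lambda>s. norm (h s - g s) ^ p", OF hgi])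
    have "integral {a..b} (\<lambda>s. norm (h (s + c) - h s) ^ p) \<le>
        integral {a..b} (\<lambda>s. 4 ^ p * (norm (h (s + c) - g (s + c)) ^ p + \<eta> + norm (h s - g s) ^ p))"
    proof (rule integral_le)
      show "(\<lambda>s. norm (h (s + c) - h s) ^ p) integrable_on {a..b}"
        by (intro Lp_fun_integrable Lp_fun_diff Lp_fun_shift h)
      show "(\<lambda>s. 4 ^ p * (norm (h (s + c) - g (s + c)) ^ p + \<eta> + norm (h s - g s) ^ p)) integrable_on {a..b}"
        by (intro integrable_on_mult_right integrable_add hgc hgi integrable_const_ivl)
      fix s assume s: "s \<in> {a..b}"
      have gs: "norm (g (s + c) - g s) \<le> \<eta>"
      proof -
        have "s \<in> {a-1..b+1}" "s + c \<in> {a-1..b+1}" "dist (s + c) s < d" using s c d(1) by (auto simp: dist_real_def)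
        then show ?thesis using d(2)[of s "s + c"] by (simp add: dist_norm less_imp_le)
      qed
      have eq: "h (s + c) - h s = (h (s + c) - g (s + c)) + (g (s + c) - g s) - (h s - g s)" by simp
      then have "norm (h (s + c) - h s) \<le> norm (h (s + c) - g (s + c)) + norm (g (s + c) - g s) + norm (h s - g s)"
        by (simp only: norm_add_diff_le)
      then have "norm (h (s + c) - h s) ^ p \<le> (norm (h (s + c) - g (s + c)) + norm (g (s + c) - g s) + norm (h s - g s)) ^ p"
        by (intro power_mono) auto
      also have "\<dots> \<le> 4 ^ p * (norm (h (s + c) - g (s + c)) ^ p + norm (g (s + c) - g s) ^ p + norm (h s - g s) ^ p)"
        by (rule power_add3_le) auto
      also have "norm (g (s + c) - g s) ^ p \<le> \<eta>"
      proof -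
        have "norm (g (s + c) - g s) ^ p \<le> \<eta> ^ p" by (intro power_mono gs) auto
        also have "\<dots> \<le> \<eta> ^ 1" by (rule power_decreasing) (use p \<eta> in auto)
        finally show ?thesis by simp
      qed
      finally show "norm (h (s + c) - h s) ^ p \<le> 4 ^ p * (norm (h (s + c) - g (s + c)) ^ p + \<eta> + norm (h s - g s) ^ p)"
        by simp
    qed
    also have "\<dots> = 4 ^ p * (integral {a..b} (\<lambda>s. norm (h (s + c) - g (s + c)) ^ p) + integral {a..b} (\<lambda>s. \<eta>) + integral {a..b} (\<lambda>s. norm (h s - g s) ^ p))"
      by (simp add: integral_add integrable_add hgc hgi integrable_const_ivl del: integral_const_real integral_const)
    also have "\<dots> \<le> 4 ^ p * (e1 + e1 + e1)"
    proof (intro mult_left_mono add_mono)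
      have "integral {a..b} (\<lambda>s. norm (h (s + c) - g (s + c)) ^ p) = integral {a + c..b + c} (\<lambda>s. norm (h s - g s) ^ p)"
        by (rule integrable_on_shift_real(2)[where f = "\<lambda>s. norm (h s - g s) ^ p", OF hgi])
      also have "\<dots> \<le> integral {a-1..b+1} (\<lambda>s. norm (h s - g s) ^ p)"
        by (rule integral_subset_le[OF _ hgi hgi]) (use c in auto)
      finally show "integral {a..b} (\<lambda>s. norm (h (s + c) - g (s + c)) ^ p) \<le> e1" using g(2) by simp
      have "integral {a..b} (\<lambda>s. norm (h s - g s) ^ p) \<le> integral {a-1..b+1} (\<lambda>s. norm (h s - g s) ^ p)"
        by (rule integral_subset_le[OF _ hgi hgi]) auto
      then show "integral {a..b} (\<lambda>s. norm (h s - g s) ^ p) \<le> e1" using g(2) by simp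
      have "integral {a..b} (\<lambda>s. \<eta>) \<le> \<eta> * L" using \<eta>(1) by (auto simp: L_def content_real_if)
      then show "integral {a..b} (\<lambda>s. \<eta>) \<le> e1" using \<eta>(3) by simp
    qed simp
    finally show "integral {a..b} (\<lambda>s. norm (h (s + c) - h s) ^ p) \<le> e" using e1(2) by simp
  qed (use d(1) in auto)
qed

lemma finite_net:
  fixes K :: "'a::metric_space set"
  assumes "compact K" "K \<subseteq> closure D" "0 < e"
  obtains F where "finite F" "F \<subseteq> D" "\<And>z. z \<in> K \<Longrightarrow> \<exists>w\<in>F. dist w z < e"
proof -
  have "K \<subseteq> (\<Union>w\<in>D. ball w e)"
  proof
    fix z assume "z \<in> K"
    then have "z \<in> closure D" using assms(2) by blast
    then show "z \<in> (\<Union>w\<in>D. ball w e)" using assms(3) by (auto simp: closure_approachable)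
  qed
  then obtain F where "F \<subseteq> D" "finite F" "K \<subseteq> (\<Union>w\<in>F. ball w e)"
    by (rule compactE_image[OF assms(1) open_ball])
  then show ?thesis by (intro that[of F]) (auto simp: subset_iff)
qed

text \<open>Uniformity in the curve comes from a finite net of the ball: replacing
  \<open>z s\<close> by a net point costs a multiple of the envelope, and for each net point
  \<open>w\<close> the function \<open>h (s, w)\<close> of time alone is translated
  continuously.\<close>

lemma LC_translation_continuous:
  fixes h :: "('n::finite) dfield"
  assumes h: "h \<in> LC p" and p: "1 \<le> p" and "0 < e"
  obtains \<delta> where "0 < \<delta>" "\<delta> \<le> 1" "\<And>c z. \<lbrakk>\<bar>c\<bar> \<le> \<delta>; z \<in> curves r a b\<rbrakk> \<Longrightarrow>
     integral {a..b} (\<lambda>s. norm (translate c h (s, z s) - h (s, z s)) ^ p) \<le> e"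
proof -
  obtain k N where env: "envelope p r h k N" using LC_envelope[OF h p] by blast
  note E = envelopeD[OF env]
  define K where "K = integral {a-1..b+1} (\<lambda>s. k s ^ p)"
  have K0: "0 \<le> K" unfolding K_def by (intro integral_nonneg E(3)) (simp add: E(2))
  \<comment> \<open>Chosen so that the two Lipschitz errors, of the field and of its translate,
    together take at most \<open>e / 2\<close>.\<close>
  define \<eta> where "\<eta> = min 1 (e / (4 ^ p * 4 * (K + 1)))"
  have \<eta>: "0 < \<eta>" "\<eta> \<le> 1" using \<open>0 < e\<close> K0 by (auto simp: \<eta>_def)
  have \<eta>K: "4 ^ p * (\<eta> ^ p * K + \<eta> ^ p * K) \<le> e / 2"
  proof -
    have "\<eta> ^ p \<le> \<eta>" using power_decreasing[of 1 p \<eta>] p \<eta> by simp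
    also have "\<eta> \<le> e / (4 ^ p * 4 * (K + 1))" by (simp add: \<eta>_def)
    finally have "\<eta> ^ p \<le> e / (4 ^ p * 4 * (K + 1))" .
    moreover have "0 < 4 ^ p * 4 * (K + 1)" using K0 by simp
    ultimately have "\<eta> ^ p * (4 ^ p * 4 * (K + 1)) \<le> e" by (simp only: pos_le_divide_eq)
    moreover have "0 \<le> \<eta> ^ p * (4 ^ p * 4)" using \<eta> by simp
    ultimately show ?thesis by (simp add: algebra_simps)
  qed
  obtain F where F: "finite F" "F \<subseteq> cball (0 :: (real ^ 'n) \<times> (real ^ 'n)) r" "\<And>z. z \<in> cball 0 r \<Longrightarrow> \<exists>w\<in>F. dist w z < \<eta>"
    using finite_net[OF compact_cball closure_subset \<eta>(1)] by metis
  \<comment> \<open>The value 0 on \<open>N\<close> lets the envelope dominate everywhere.\<close>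
  define H where "H w s = (if s \<in> N then 0 else h (s, w))" for w s
  have HL: "Lp_fun p (H w)" if w: "w \<in> F" for w
  proof (rule Lp_fun_dominated)
    have "(\<lambda>s. h (s, w)) \<in> borel_measurable lebesgue"
      using field_measurable[OF h, of "\<lambda>_. w" UNIV] by simp
    moreover have "{s \<in> space lebesgue. s \<in> N} \<in> sets lebesgue"
      using E(5) by (simp add: negligible_iff_null_sets null_setsD2)
    ultimately show "H w \<in> borel_measurable lebesgue" unfolding H_def by (intro measurable_If) auto
    show "(\<lambda>s. k s ^ p) integrable_on {a..b}" for a b by (rule E(3))
    show "norm (H w s) ^ p \<le> k s ^ p" for s
    proof (intro power_mono norm_ge_zero)
      have "norm w \<le> r" using subsetD[OF F(2) w] by simp
      then show "norm (H w s) \<le> k s" using E(2)[of s] E(6)[of s w] by (simp add: H_def)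
    qed
  qed
  define m where "m = real (card F) + 1"
  define e1 where "e1 = e / (2 * 4 ^ p * m)"
  have m: "0 < m" by (simp add: m_def)
  have e1: "0 < e1" using \<open>0 < e\<close> m by (simp add: e1_def)
  have "\<exists>d. 0 < d \<and> d \<le> 1 \<and> (\<forall>c. \<bar>c\<bar> \<le> d \<longrightarrow> integral {a..b} (\<lambda>s. norm (H w (s + c) - H w s) ^ p) \<le> e1)" if "w \<in> F" for w
    by (rule Lp_translation_continuous[OF HL[OF that] p e1, of a b]) blast
  then obtain d where d: "\<And>w. w \<in> F \<Longrightarrow> 0 < d w \<and> d w \<le> 1 \<and> (\<forall>c. \<bar>c\<bar> \<le> d w \<longrightarrow> integral {a..b} (\<lambda>s. norm (H w (s + c) - H w s) ^ p) \<le> e1)"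
    by metis
  define \<delta> where "\<delta> = Min (insert 1 (d ` F))"
  have \<delta>: "0 < \<delta>" "\<delta> \<le> 1" "\<And>w. w \<in> F \<Longrightarrow> \<delta> \<le> d w" using d F(1) by (auto simp: \<delta>_def)
  show ?thesis
  proof (rule that[OF \<delta>(1,2)])
    fix c and z :: "real \<Rightarrow> (real ^ 'n) \<times> (real ^ 'n)"
    assume c: "\<bar>c\<bar> \<le> \<delta>" and z: "z \<in> curves r a b"
    have hc: "(\<lambda>w. translate c h w - h w) \<in> LC p" by (rule LC_diff[OF LC_translate[OF h] h])
    have Hi: "(\<lambda>s. norm (H w (s + c) - H w s) ^ p) integrable_on {a..b}" if "w \<in> F" for w
      by (intro Lp_fun_integrable Lp_fun_diff Lp_fun_shift HL that)
    have kc: "(\<lambda>s. k (s + c) ^ p) integrable_on {a..b}"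
      by (rule integrable_on_shift_real(1)[where f = "\<lambda>s. k s ^ p", OF E(3)])
    \<comment> \<open>The nearest net point varies with \<open>s\<close> and need not depend on it
      measurably; summing over the whole net avoids selecting it.\<close>
    define G where "G s = 4 ^ p * ((\<Sum>w\<in>F. norm (H w (s + c) - H w s) ^ p) + \<eta> ^ p * k (s + c) ^ p + \<eta> ^ p * k s ^ p)" for s
    have Gi: "G integrable_on {a..b}" unfolding G_def
      by (intro integrable_on_mult_right integrable_add integrable_sum F(1) Hi kc E(3))
    have neg: "negligible (N \<union> {s. s + c \<in> N})" using E(5) negligible_shift by simp
    have "norm (integral {a..b} (\<lambda>s. norm (translate c h (s, z s) - h (s, z s)) ^ p)) \<le> integral {a..b} G"
    proof (rule absolutely_integrable_dominated(2)[OF _ _ Gi neg])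
      show "(\<lambda>s. norm (translate c h (s, z s) - h (s, z s)) ^ p) \<in> borel_measurable (lebesgue_on {a..b})"
        using curve_integrable(4)[OF hc p z] by (rule integrable_imp_measurable)
      fix s assume s: "s \<in> {a..b}" "s \<notin> N \<union> {s. s + c \<in> N}"
      have zs: "norm (z s) \<le> r" using z s(1) by (auto simp: curves_def)
      then obtain w where w: "w \<in> F" "dist w (z s) < \<eta>" using F(3)[of "z s"] by auto
      have wr: "norm w \<le> r" using w(1) F(2) by auto
      have A: "norm (h (s + c, z s) - h (s + c, w)) \<le> k (s + c) * \<eta>"
        using E(7)[of "s + c" "z s" w] s zs wr w(2) mult_left_mono[of "norm (z s - w)" \<eta> "k (s + c)"] E(2)[of "s + c"]
        by (auto simp: dist_norm norm_minus_commute)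
      have B: "norm (h (s, z s) - h (s, w)) \<le> k s * \<eta>"
        using E(7)[of s "z s" w] s zs wr w(2) mult_left_mono[of "norm (z s - w)" \<eta> "k s"] E(2)[of s]
        by (auto simp: dist_norm norm_minus_commute)
      have eq: "translate c h (s, z s) - h (s, z s) = (H w (s + c) - H w s) + (h (s + c, z s) - h (s + c, w)) - (h (s, z s) - h (s, w))"
        using s by (simp add: translate_def H_def)
      have "norm (translate c h (s, z s) - h (s, z s)) \<le> norm (H w (s + c) - H w s) + \<eta> * k (s + c) + \<eta> * k s"
        unfolding eq using A B norm_triangle_ineq4[of "(H w (s + c) - H w s) + (h (s + c, z s) - h (s + c, w))" "h (s, z s) - h (s, w)"]
          norm_triangle_ineq[of "H w (s + c) - H w s" "h (s + c, z s) - h (s + c, w)"] by (simp add: mult.commute)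
      then have "norm (translate c h (s, z s) - h (s, z s)) ^ p \<le> (norm (H w (s + c) - H w s) + \<eta> * k (s + c) + \<eta> * k s) ^ p"
        by (intro power_mono) auto
      also have "\<dots> \<le> 4 ^ p * (norm (H w (s + c) - H w s) ^ p + (\<eta> * k (s + c)) ^ p + (\<eta> * k s) ^ p)"
        using \<eta>(1) E(2) by (intro power_add3_le) auto
      also have "\<dots> \<le> G s"
        unfolding G_def power_mult_distrib using member_le_sum[OF w(1), of "\<lambda>w. norm (H w (s + c) - H w s) ^ p"] F(1) \<eta>(1)
        by (intro mult_left_mono add_mono) auto
      finally show "norm (norm (translate c h (s, z s) - h (s, z s)) ^ p) \<le> G s" by simp
    qed simp
    also have "integral {a..b} G = 4 ^ p * ((\<Sum>w\<in>F. integral {a..b} (\<lambda>s. norm (H w (s + c) - H w s) ^ p))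
        + \<eta> ^ p * integral {a..b} (\<lambda>s. k (s + c) ^ p) + \<eta> ^ p * integral {a..b} (\<lambda>s. k s ^ p))"
      unfolding G_def using Hi kc E(3) F(1)
      by (simp add: integral_add integral_sum integrable_add integrable_sum integrable_on_mult_right)
    also have "\<dots> \<le> 4 ^ p * (m * e1 + \<eta> ^ p * K + \<eta> ^ p * K)"
    proof (intro mult_left_mono add_mono)
      have "(\<Sum>w\<in>F. integral {a..b} (\<lambda>s. norm (H w (s + c) - H w s) ^ p)) \<le> (\<Sum>w\<in>F. e1)"
      proof (rule sum_mono)
        fix w assume w: "w \<in> F"
        show "integral {a..b} (\<lambda>s. norm (H w (s + c) - H w s) ^ p) \<le> e1"
          using d[OF w] \<delta>(3)[OF w] c by simp
      qed
      also have "\<dots> \<le> m * e1" using e1 by (simp add: m_def algebra_simps)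
      finally show "(\<Sum>w\<in>F. integral {a..b} (\<lambda>s. norm (H w (s + c) - H w s) ^ p)) \<le> m * e1" .
      have "integral {a..b} (\<lambda>s. k (s + c) ^ p) = integral {a + c..b + c} (\<lambda>s. k s ^ p)"
        by (rule integrable_on_shift_real(2)[where f = "\<lambda>s. k s ^ p", OF E(3)])
      also have "\<dots> \<le> K" unfolding K_def
        by (rule integral_subset_le[OF _ E(3) E(3)]) (use c \<delta>(2) E(2) in auto)
      finally show "integral {a..b} (\<lambda>s. k (s + c) ^ p) \<le> K" .
      show "integral {a..b} (\<lambda>s. k s ^ p) \<le> K" unfolding K_def
        by (rule integral_subset_le[OF _ E(3) E(3)]) (use E(2) in auto)
    qed (use \<eta> in auto)
    also have "\<dots> = 4 ^ p * (m * e1) + 4 ^ p * (\<eta> ^ p * K + \<eta> ^ p * K)" by (simp add: algebra_simps)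
    also have "\<dots> \<le> e / 2 + e / 2" using \<eta>K m by (intro add_mono) (auto simp: e1_def)
    finally show "integral {a..b} (\<lambda>s. norm (translate c h (s, z s) - h (s, z s)) ^ p) \<le> e" by simp
  qed
qed

section \<open>Bounds that pass to the hull\<close>

lemma set_nn_integral_eq_integral:
  fixes F :: "real \<Rightarrow> real"
  assumes F: "F absolutely_integrable_on {a..b}" "\<And>t. t \<in> {a..b} \<Longrightarrow> 0 \<le> F t"
  shows "(\<integral>\<^sup>+ t\<in>{a..b}. ennreal (F t) \<partial>lebesgue) = ennreal (integral {a..b} F)"
proof -
  have "(\<integral>\<^sup>+ t\<in>{a..b}. ennreal (F t) \<partial>lebesgue) = (\<integral>\<^sup>+ t. ennreal (indicator {a..b} t *\<^sub>R F t) \<partial>lebesgue)"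
    by (rule nn_integral_cong) (auto simp: indicator_def)
  also have "\<dots> = ennreal (LINT t|lebesgue. indicator {a..b} t *\<^sub>R F t)"
    using F by (intro nn_integral_eq_integral) (auto simp: set_integrable_def indicator_def)
  also have "(LINT t|lebesgue. indicator {a..b} t *\<^sub>R F t) = integral {a..b} F"
    using set_lebesgue_integral_eq_integral(2)[OF F(1)] by (simp add: set_lebesgue_integral_def)
  finally show ?thesis .
qed

lemma nn_integral_m_bound_shift:
  assumes f: "f \<in> LC p"
  shows "(\<integral>\<^sup>+ u\<in>{0..h}. m_bound j (translate \<tau> f) u \<partial>lebesgue) = (\<integral>\<^sup>+ u\<in>{\<tau>..\<tau> + h}. m_bound j f u \<partial>lebesgue)"
proof -
  note [measurable] = m_bound_measurable[OF f, of j]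
  have "(\<integral>\<^sup>+ u\<in>{\<tau>..\<tau> + h}. m_bound j f u \<partial>lebesgue) =
      (\<integral>\<^sup>+ u. m_bound j f (\<tau> + 1 * u) * indicator {\<tau>..\<tau> + h} (\<tau> + 1 * u) \<partial>lebesgue)"
    by (subst nn_integral_real_affine_lebesgue[where c = 1 and t = \<tau>])
      (auto intro!: borel_measurable_times_ennreal borel_measurable_indicator m_bound_measurable[OF f])
  then show ?thesis by (simp add: m_bound_translate add.commute indicator_def)
qed

text \<open>Equicontinuity bounds the mass of all intervals of one short length \<open>h\<close> by
  1, and finitely many of them cover an interval of length \<open>s\<close>. Finiteness matters
  because \<open>enn2real\<close> in \<open>m_bound_moduli\<close> would send infinity to 0.\<close>

lemma m_bound_SUP_finite:
  assumes f: "f \<in> LC p" and eq: "L1loc_equicontinuous_m_bounds f"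
  shows "(SUP t. \<integral>\<^sup>+ u\<in>{t..t + s}. m_bound j f u \<partial>lebesgue) < \<infinity>"
proof -
  note [measurable] = m_bound_measurable[OF f, of j]
  obtain \<delta> where \<delta>: "\<delta> > 0" "\<And>s t. \<lbrakk>- 1 \<le> s; s \<le> t; t \<le> 1; t - s < \<delta>\<rbrakk> \<Longrightarrow>
      (SUP \<tau>::real. \<integral>\<^sup>+ u\<in>{s..t}. m_bound j (translate \<tau> f) u \<partial>lebesgue) < ennreal 1"
    using eq[unfolded L1loc_equicontinuous_m_bounds_def, rule_format, of 1 1 j] by auto
  define h where "h = min (\<delta> / 2) 1"
  have h: "0 < h" "h \<le> 1" "h < \<delta>" using \<delta>(1) by (auto simp: h_def)
  have one: "(\<integral>\<^sup>+ u\<in>{\<tau>..\<tau> + h}. m_bound j f u \<partial>lebesgue) \<le> ennreal 1" for \<tau>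
  proof -
    have "(\<integral>\<^sup>+ u\<in>{\<tau>..\<tau> + h}. m_bound j f u \<partial>lebesgue) \<le> (SUP \<tau>::real. \<integral>\<^sup>+ u\<in>{0..h}. m_bound j (translate \<tau> f) u \<partial>lebesgue)"
      unfolding nn_integral_m_bound_shift[OF f, symmetric] by (rule SUP_upper) simp
    also have "\<dots> \<le> ennreal 1" using \<delta>(2)[of 0 h] h by (intro less_imp_le) auto
    finally show ?thesis .
  qed
  have n: "(\<integral>\<^sup>+ u\<in>{t..t + real n * h}. m_bound j f u \<partial>lebesgue) \<le> ennreal (1 + real n)" for n t
  proof (induction n)
    case 0
    have "(\<integral>\<^sup>+ u\<in>{t..t}. m_bound j f u \<partial>lebesgue) \<le> (\<integral>\<^sup>+ u\<in>{t..t + h}. m_bound j f u \<partial>lebesgue)"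
      using h by (intro nn_integral_mono) (auto simp: indicator_def)
    then show ?case using one[of t] by simp
  next
    case (Suc n)
    let ?t = "t + real n * h"
    have "(\<integral>\<^sup>+ u\<in>{t..t + real (Suc n) * h}. m_bound j f u \<partial>lebesgue) \<le>
        (\<integral>\<^sup>+ u. m_bound j f u * indicator {t..?t} u + m_bound j f u * indicator {?t..?t + h} u \<partial>lebesgue)"
      by (intro nn_integral_mono) (auto simp: indicator_def algebra_simps)
    also have "\<dots> = (\<integral>\<^sup>+ u\<in>{t..?t}. m_bound j f u \<partial>lebesgue) + (\<integral>\<^sup>+ u\<in>{?t..?t + h}. m_bound j f u \<partial>lebesgue)"
      by (intro nn_integral_add borel_measurable_times_ennreal borel_measurable_indicator m_bound_measurable[OF f]) auto
    also have "\<dots> \<le> ennreal (1 + real n) + ennreal 1" by (intro add_mono Suc one)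
    also have "\<dots> = ennreal (1 + real (Suc n))" by (subst ennreal_plus[symmetric]) auto
    finally show ?case .
  qed
  obtain n :: nat where "s < real n * h" using reals_Archimedean3[OF h(1)] by blast
  have "(SUP t. \<integral>\<^sup>+ u\<in>{t..t + s}. m_bound j f u \<partial>lebesgue) \<le> ennreal (1 + real n)"
  proof (rule SUP_least)
    fix t
    have "(\<integral>\<^sup>+ u\<in>{t..t + s}. m_bound j f u \<partial>lebesgue) \<le> (\<integral>\<^sup>+ u\<in>{t..t + real n * h}. m_bound j f u \<partial>lebesgue)"
      using \<open>s < real n * h\<close> by (intro nn_integral_mono) (auto simp: indicator_def)
    then show "(\<integral>\<^sup>+ u\<in>{t..t + s}. m_bound j f u \<partial>lebesgue) \<le> ennreal (1 + real n)" using n[of t n] by simp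
  qed
  then show ?thesis by (rule le_less_trans) simp
qed

text \<open>A real-valued, locally integrable version of \<open>m_bound\<close>; off a null set the
  envelope shows that the optimal bound is finite.\<close>

lemma m_bound_density:
  fixes f :: "('n::finite) dfield"
  assumes f: "f \<in> LC p" "1 \<le> p" and eq: "L1loc_equicontinuous_m_bounds f"
  obtains \<mu> N where "\<And>a b. \<mu> integrable_on {a..b}" "negligible N" "\<And>t z. \<lbrakk>t \<notin> N; norm z \<le> real j\<rbrakk> \<Longrightarrow> norm (f (t, z)) \<le> \<mu> t"
    "\<And>t s. 0 \<le> s \<Longrightarrow> integral {t..t + s} \<mu> \<le> m_bound_moduli f I j s"
proof -
  obtain k N where env: "envelope p (real j) f k N" using LC_envelope[OF f] by blast
  note E = envelopeD[OF env]
  define \<mu> where "\<mu> t = enn2real (m_bound j f t)" for t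
  have mk: "m_bound j f t \<le> ennreal (k t)" if "t \<notin> N" for t
    unfolding m_bound_def by (rule SUP_least) (use E(6)[OF that] in \<open>auto intro!: ennreal_leI\<close>)
  have fin: "ennreal (\<mu> t) = m_bound j f t" if "t \<notin> N" for t
    unfolding \<mu>_def by (rule ennreal_enn2real) (rule le_less_trans[OF mk[OF that] ennreal_less_top])
  have meas: "\<mu> \<in> borel_measurable lebesgue"
    unfolding \<mu>_def using m_bound_measurable[OF f(1), of j] by measurable
  have \<mu>0: "0 \<le> \<mu> t" for t by (simp add: \<mu>_def)
  have ai: "\<mu> absolutely_integrable_on {a..b}" for a b
  proof (rule absolutely_integrable_dominated(1)[OF measurable_restrict_space1[OF meas] _ E(4,5)])
    fix t assume "t \<notin> N"
    then have "ennreal (\<mu> t) \<le> ennreal (k t)" using mk fin by simp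
    then show "norm (\<mu> t) \<le> k t" using \<mu>0[of t] E(2)[of t] by simp
  qed simp
  show ?thesis
  proof (rule that)
    show "\<mu> integrable_on {a..b}" for a b using ai by (rule set_lebesgue_integral_eq_integral(1))
    show "negligible N" by (rule E(5))
    show "norm (f (t, z)) \<le> \<mu> t" if "t \<notin> N" "norm z \<le> real j" for t z
    proof -
      have "ennreal (norm (f (t, z))) \<le> m_bound j f t" unfolding m_bound_def by (rule SUP_upper) (use that in simp)
      then have "ennreal (norm (f (t, z))) \<le> ennreal (\<mu> t)" using fin[OF that(1)] by simp
      then show ?thesis using \<mu>0[of t] by (simp add: ennreal_le_iff)
    qed
    fix t s :: real assume "0 \<le> s"
    have "AE u in lebesgue. ennreal (\<mu> u) * indicator {t..t + s} u = m_bound j f u * indicator {t..t + s} u"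
      unfolding AE_lebesgue_negligible using E(5) fin by (intro exI[of _ N]) auto
    then have "(\<integral>\<^sup>+ u\<in>{t..t + s}. m_bound j f u \<partial>lebesgue) = (\<integral>\<^sup>+ u\<in>{t..t + s}. ennreal (\<mu> u) \<partial>lebesgue)"
      by (intro nn_integral_cong_AE) auto
    also have "\<dots> = ennreal (integral {t..t + s} \<mu>)"
      by (rule set_nn_integral_eq_integral[OF ai \<mu>0])
    finally have "ennreal (integral {t..t + s} \<mu>) \<le> (SUP t. \<integral>\<^sup>+ u\<in>{t..t + s}. m_bound j f u \<partial>lebesgue)"
      by (metis (no_types, lifting) SUP_upper UNIV_I)
    then have "enn2real (ennreal (integral {t..t + s} \<mu>)) \<le> m_bound_moduli f I j s"
      unfolding m_bound_moduli_def using m_bound_SUP_finite[OF f(1) eq, where s = s and j = j] by (intro enn2real_mono) (auto simp: infinity_ennreal_def)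
    moreover have "0 \<le> integral {t..t + s} \<mu>" using \<mu>0 set_lebesgue_integral_eq_integral(1)[OF ai] by (intro integral_nonneg) auto
    ultimately show "integral {t..t + s} \<mu> \<le> m_bound_moduli f I j s" by simp
  qed
qed

text \<open>The modulus is a supremum over all positions of an interval of given length, hence the
  same for every translate of \<open>f\<close>. The curve is merely measurable, because it will be a
  step function.\<close>

lemma orbit_bound:
  fixes f g :: "('n::finite) dfield"
  assumes f: "f \<in> LC p" "1 \<le> p" and eq: "L1loc_equicontinuous_m_bounds f"
    and g: "g \<in> LC p" "field_eq g (translate \<tau> f)" and "a \<le> b"
    and z: "z \<in> borel_measurable (lebesgue_on {a..b})" "\<And>t. t \<in> {a..b} \<Longrightarrow> norm (z t) \<le> real j"
  shows "norm (integral {a..b} (\<lambda>t. g (t, z t))) \<le> m_bound_moduli f I j (b - a)"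
proof -
  obtain \<mu> N where \<mu>: "\<And>a b. \<mu> integrable_on {a..b}" "negligible N" "\<And>t z. \<lbrakk>t \<notin> N; norm z \<le> real j\<rbrakk> \<Longrightarrow> norm (f (t, z)) \<le> \<mu> t"
    "\<And>t s. 0 \<le> s \<Longrightarrow> integral {t..t + s} \<mu> \<le> m_bound_moduli f I j s"
    using m_bound_density[OF f eq] by metis
  obtain M where M: "negligible M" "\<And>t z. t \<notin> M \<Longrightarrow> g (t, z) = translate \<tau> f (t, z)" using g(2) unfolding field_eq_def by blast
  have sh: "(\<lambda>t. \<mu> (t + \<tau>)) integrable_on {a..b}" "integral {a..b} (\<lambda>t. \<mu> (t + \<tau>)) = integral {a + \<tau>..b + \<tau>} \<mu>"
    by (rule integrable_on_shift_real[OF \<mu>(1)])+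
  have neg: "negligible (M \<union> {t. t + \<tau> \<in> N})" using M(1) negligible_shift[OF \<mu>(2)] by simp
  have "norm (integral {a..b} (\<lambda>t. g (t, z t))) \<le> integral {a..b} (\<lambda>t. \<mu> (t + \<tau>))"
  proof (rule absolutely_integrable_dominated(2)[OF field_measurable[OF g(1) z(1)] _ sh(1) neg])
    fix t assume "t \<in> {a..b}" "t \<notin> M \<union> {t. t + \<tau> \<in> N}"
    then show "norm (g (t, z t)) \<le> \<mu> (t + \<tau>)" using M(2) \<mu>(3) z(2) by (simp add: translate_def)
  qed simp
  also have "\<dots> = integral {a + \<tau>..(a + \<tau>) + (b - a)} \<mu>" by (simp add: sh(2) algebra_simps)
  also have "\<dots> \<le> m_bound_moduli f I j (b - a)" by (rule \<mu>(4)) (use \<open>a \<le> b\<close> in simp)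
  finally show ?thesis .
qed

text \<open>Where \<open>u t \<noteq> v t\<close>, dividing the increment by \<open>e\<close>
  instead of \<open>norm (u t - v t)\<close> only decreases it, so it stays below
  \<open>l2_bound\<close>. The comparison is by monotonicity of \<open>nn_integral\<close>, which
  holds without measurability of \<open>l2_bound\<close>.\<close>

lemma orbit_l2_bound:
  fixes f g :: "('n::finite) dfield"
  assumes f: "f \<in> LC p" "1 \<le> p"
    and C: "(SUP \<tau>::real. \<integral>\<^sup>+ t\<in>{-r..r}. l2_bound j (translate \<tau> f) t \<partial>lebesgue) \<le> ennreal C" "0 \<le> C"
    and g: "g \<in> LC p" "field_eq g (translate \<tau> f)" and ab: "-r \<le> a" "b \<le> r" and e: "0 < e"
    and m: "(\<lambda>t. (x t, u t)) \<in> borel_measurable (lebesgue_on {a..b})" "(\<lambda>t. (x t, v t)) \<in> borel_measurable (lebesgue_on {a..b})"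
    and z: "\<And>t. t \<in> {a..b} \<Longrightarrow> norm (x t, u t) \<le> real j" "\<And>t. t \<in> {a..b} \<Longrightarrow> norm (x t, v t) \<le> real j"
      "\<And>t. t \<in> {a..b} \<Longrightarrow> norm (u t - v t) \<le> e"
  shows "norm (integral {a..b} (\<lambda>t. g (t, x t, u t) - g (t, x t, v t))) \<le> C * e"
proof -
  let ?h = "translate \<tau> f"
  have h: "?h \<in> LC p" by (rule LC_translate[OF f(1)])
  obtain k N where env: "envelope p (real j) ?h k N" using LC_envelope[OF h f(2)] by blast
  define F where "F t = ?h (t, x t, u t) - ?h (t, x t, v t)" for t
  have F: "F absolutely_integrable_on {a..b}"
    unfolding F_def by (intro set_integral_diff field_integrable(1)[OF h env m(1) z(1)] field_integrable(1)[OF h env m(2) z(2)])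
  have Fn: "(\<lambda>t. norm (F t) / e) absolutely_integrable_on {a..b}"
    using absolutely_integrable_norm[OF F] by (intro set_integrable_divide) (simp_all add: comp_def)
  have "ennreal (integral {a..b} (\<lambda>t. norm (F t) / e)) = (\<integral>\<^sup>+ t\<in>{a..b}. ennreal (norm (F t) / e) \<partial>lebesgue)"
    using e by (intro set_nn_integral_eq_integral[OF Fn, symmetric]) auto
  also have "\<dots> \<le> (\<integral>\<^sup>+ t\<in>{-r..r}. l2_bound j ?h t \<partial>lebesgue)"
  proof (rule nn_integral_mono)
    fix t
    show "ennreal (norm (F t) / e) * indicator {a..b} t \<le> l2_bound j ?h t * indicator {-r..r} t"
    proof (cases "t \<in> {a..b} \<and> u t \<noteq> v t")
      case True
      then have t: "t \<in> {a..b}" "t \<in> {-r..r}" "0 < norm (u t - v t)" using ab by auto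
      have "norm (F t) / e \<le> norm (F t) / norm (u t - v t)" using z(3)[OF t(1)] t(3) e by (intro divide_left_mono) auto
      then have "ennreal (norm (F t) / e) \<le> ennreal (norm (F t) / norm (u t - v t))" by (rule ennreal_leI)
      also have "\<dots> \<le> l2_bound j ?h t"
        unfolding l2_bound_def F_def using z(1,2)[OF t(1)] True
        by (intro SUP_upper2[of "(x t, u t, v t)"]) auto
      finally show ?thesis using t by simp
    qed (auto simp: F_def indicator_def)
  qed
  also have "\<dots> \<le> (SUP \<tau>::real. \<integral>\<^sup>+ t\<in>{-r..r}. l2_bound j (translate \<tau> f) t \<partial>lebesgue)" by (rule SUP_upper) simp
  also have "\<dots> \<le> ennreal C" by (rule C(1))
  finally have "integral {a..b} (\<lambda>t. norm (F t) / e) \<le> C" using C(2) by simp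
  then have "integral {a..b} (\<lambda>t. norm (F t)) \<le> C * e" using e by (simp add: field_simps)
  moreover have "norm (integral {a..b} F) \<le> integral {a..b} (\<lambda>t. norm (F t))"
    using absolutely_integrable_norm[OF F] F
    by (intro integral_norm_bound_integral) (auto simp: comp_def dest: set_lebesgue_integral_eq_integral(1))
  moreover have "integral {a..b} (\<lambda>t. g (t, x t, u t) - g (t, x t, v t)) = integral {a..b} F"
  proof -
    obtain M where M: "negligible M" "\<And>t z. t \<notin> M \<Longrightarrow> g (t, z) = ?h (t, z)" using g(2) unfolding field_eq_def by blast
    show ?thesis by (rule integral_spike[OF M(1)]) (simp add: M(2) F_def)
  qed
  ultimately show ?thesis by simp
qed

section \<open>Step functions on uniform grids\<close>

definition cell_index :: "real \<Rightarrow> real \<Rightarrow> nat \<Rightarrow> real \<Rightarrow> nat" where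
  "cell_index a h n t = min (n - 1) (nat \<lfloor>(t - a) / h\<rfloor>)"

text \<open>The cap at \<open>n - 1\<close> assigns the right endpoint of the whole grid, where the
  floor would be \<open>n\<close>, to the last cell.\<close>

lemma cell_index:
  assumes "0 < h" "0 < n" "t \<in> {a..a + real n * h}"
  shows "cell_index a h n t < n" "t \<in> {a + real (cell_index a h n t) * h..a + real (cell_index a h n t) * h + h}"
proof -
  define q where "q = (t - a) / h"
  have q: "0 \<le> q" "q \<le> real n" "t = a + q * h" using assms by (auto simp: q_def field_simps)
  have fq: "real (nat \<lfloor>q\<rfloor>) \<le> q" "q \<le> real (nat \<lfloor>q\<rfloor>) + 1" using q(1) by linarith+
  have i: "cell_index a h n t = min (n - 1) (nat \<lfloor>q\<rfloor>)" by (simp add: cell_index_def q_def)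
  show "cell_index a h n t < n" using assms(2) by (simp add: i)
  have "real (cell_index a h n t) \<le> q" unfolding i using fq(1) by (simp add: min_def)
  moreover have "q \<le> real (cell_index a h n t) + 1"
    unfolding i using fq q(2) assms(2) by (auto simp: min_def)
  ultimately have "real (cell_index a h n t) * h \<le> q * h" "q * h \<le> (real (cell_index a h n t) + 1) * h"
    using assms(1) by (auto intro: mult_right_mono)
  then show "t \<in> {a + real (cell_index a h n t) * h..a + real (cell_index a h n t) * h + h}"
    by (simp add: q(3) algebra_simps)
qed

lemma cell_index_eq:
  assumes "0 < h" "k < n" "a + real k * h \<le> t" "t < a + real k * h + h"
  shows "cell_index a h n t = k"
proof -
  have "real k \<le> (t - a) / h" "(t - a) / h < real k + 1" using assms by (auto simp: field_simps)
  then have "\<lfloor>(t - a) / h\<rfloor> = int k" by linarith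
  then show ?thesis using assms(2) by (simp add: cell_index_def)
qed

lemma min_div_nat: "min a b div c = min (a div c) (b div c)" for a b c :: nat
  by (cases "a \<le> b") (auto simp: min_def div_le_mono intro: antisym dest: div_le_mono[of _ _ c])

text \<open>Each coarse cell splits into \<open>n\<close> fine ones, so integer division recovers
  the coarse index; the caps correspond because \<open>(m * n - 1) div n = m - 1\<close>. A coarse
  step function is thereby also a step function on the fine grid.\<close>

lemma cell_index_refine:
  assumes "0 < n" "0 < m" "0 < h"
  shows "cell_index a (h / real n) (m * n) t div n = cell_index a h m t"
proof -
  have "(m * n - 1) div n = m - 1"
  proof -
    have "m * n - 1 = (m - 1) * n + (n - 1)" using assms by (simp add: algebra_simps diff_mult_distrib)
    moreover have "((m - 1) * n + (n - 1)) div n = m - 1"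
    proof -
      have "((m - 1) * n + (n - 1)) div n = (m - 1) + (n - 1) div n" by (rule div_mult_self3) (use assms(1) in simp)
      then show ?thesis using assms(1) by simp
    qed
    ultimately show ?thesis by (simp only:)
  qed
  moreover have "nat \<lfloor>(t - a) / (h / real n)\<rfloor> div n = nat \<lfloor>(t - a) / h\<rfloor>"
  proof -
    have "\<lfloor>(t - a) / h\<rfloor> = \<lfloor>((t - a) / (h / real n)) / real_of_int (int n)\<rfloor>" using assms by simp
    also have "\<dots> = \<lfloor>(t - a) / (h / real n)\<rfloor> div int n" by (rule floor_divide_real_eq_div) simp
    finally show ?thesis by (simp add: nat_div_distrib')
  qed
  ultimately show ?thesis by (simp add: cell_index_def min_div_nat)
qed

lemma cell_index_measurable:
  fixes \<zeta> :: "nat \<Rightarrow> 'a::euclidean_space"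
  shows "(\<lambda>t. \<zeta> (cell_index a h n t)) \<in> borel_measurable (lebesgue_on S)"
proof -
  have "(\<lambda>t. \<lfloor>(t - a) / h\<rfloor>) \<in> borel \<rightarrow>\<^sub>M count_space UNIV" by measurable
  then have "(\<lambda>t. \<zeta> (min (n - 1) (nat \<lfloor>(t - a) / h\<rfloor>))) \<in> borel_measurable borel"
    by (rule measurable_compose) simp
  then have "(\<lambda>t. \<zeta> (cell_index a h n t)) \<in> borel_measurable lebesgue"
    unfolding cell_index_def by (simp add: measurable_completion)
  then show ?thesis by (rule measurable_restrict_space1)
qed

text \<open>Induction over the first \<open>m\<close> cells with the total number \<open>n\<close>
  fixed, since \<open>cell_index\<close> depends on \<open>n\<close>. The integrand may vary inside
  a cell; only the index is frozen.\<close>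

lemma has_integral_cells:
  fixes F :: "real \<Rightarrow> nat \<Rightarrow> 'b::euclidean_space"
  assumes h: "0 < h" and n: "m \<le> n"
    and F: "\<And>k. k < m \<Longrightarrow> (\<lambda>t. F t k) integrable_on {a + real k * h..a + real k * h + h}"
  shows "((\<lambda>t. F t (cell_index a h n t)) has_integral (\<Sum>k<m. integral {a + real k * h..a + real k * h + h} (\<lambda>t. F t k))) {a..a + real m * h}"
  using n F
proof (induction m)
  case 0 then show ?case by (auto intro: has_integral_refl)
next
  case (Suc m)
  let ?c = "a + real m * h"
  have "((\<lambda>t. F t m) has_integral integral {?c..?c + h} (\<lambda>t. F t m)) {?c..?c + h}"
    using Suc.prems(2)[of m] by (simp add: integrable_integral)
  then have "((\<lambda>t. F t (cell_index a h n t)) has_integral integral {?c..?c + h} (\<lambda>t. F t m)) {?c..?c + h}"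
  proof (rule has_integral_spike_finite[of "{?c + h}", rotated 2])
    \<comment> \<open>Only the right endpoint may be assigned to the next cell, and a single point
      does not affect the integral.\<close>
    show "F t (cell_index a h n t) = F t m" if "t \<in> {?c..?c + h} - {?c + h}" for t
      using cell_index_eq[OF h, of m n a t] that Suc.prems(1) by auto
  qed simp
  moreover have "((\<lambda>t. F t (cell_index a h n t)) has_integral (\<Sum>k<m. integral {a + real k * h..a + real k * h + h} (\<lambda>t. F t k))) {a..?c}"
    using Suc by simp
  ultimately have "((\<lambda>t. F t (cell_index a h n t)) has_integral (\<Sum>k<m. integral {a + real k * h..a + real k * h + h} (\<lambda>t. F t k))
      + integral {?c..?c + h} (\<lambda>t. F t m)) {a..?c + h}"
    using h by (intro has_integral_combine[of a ?c "?c + h"]) auto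
  then show ?case by (simp add: algebra_simps)
qed

text \<open>Uniform continuity plus density of \<open>D\<close>. The present argument may be frozen
  at any value, the delayed one only at points of \<open>D\<close>, as the seminorms demand;
  \<open>m * n\<close> cells are used so that the grid refines a given one with \<open>m\<close>
  cells.\<close>

lemma grid_approximation:
  fixes x :: "real \<Rightarrow> 'a::euclidean_space" and u :: "real \<Rightarrow> 'b::euclidean_space"
  assumes ab: "a < b" and x: "continuous_on {a..b} x" and u: "continuous_on {a..b} u" and D: "closure D = UNIV" and e: "0 < e" and m: "0 < m"
  obtains n d where "0 < n" "\<And>k. d k \<in> D"
    "\<And>k t. \<lbrakk>k < m * n; t \<in> {a + real k * ((b - a) / (m * n))..a + real k * ((b - a) / (m * n)) + (b - a) / (m * n)}\<rbrakk> \<Longrightarrow>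
       t \<in> {a..b} \<and> norm (x t - x (a + real k * ((b - a) / (m * n)))) \<le> e \<and> norm (u t - d k) \<le> e"
proof -
  have "uniformly_continuous_on {a..b} x" "uniformly_continuous_on {a..b} u"
    by (intro compact_uniformly_continuous x u compact_Icc)+
  then obtain d1 d2 where d1: "0 < d1" "\<And>s t. \<lbrakk>s \<in> {a..b}; t \<in> {a..b}; dist t s < d1\<rbrakk> \<Longrightarrow> dist (x t) (x s) < e"
    and d2: "0 < d2" "\<And>s t. \<lbrakk>s \<in> {a..b}; t \<in> {a..b}; dist t s < d2\<rbrakk> \<Longrightarrow> dist (u t) (u s) < e / 2"
    unfolding uniformly_continuous_on_def using e by (metis half_gt_zero)
  define \<delta> where "\<delta> = min d1 d2"
  have \<delta>: "0 < \<delta>" using d1 d2 by (simp add: \<delta>_def)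
  obtain n :: nat where n: "(b - a) / \<delta> < real n" using reals_Archimedean2 by blast
  have n0: "0 < n" using n ab \<delta> by (cases n) (auto simp: divide_less_0_iff)
  define h where "h = (b - a) / (m * n)"
  have h: "0 < h" "h < \<delta>" "real (m * n) * h = b - a"
  proof -
    show "0 < h" using ab m n0 by (simp add: h_def)
    have "b - a < real n * \<delta>" using n \<delta> by (simp add: field_simps)
    also have "\<dots> \<le> real (m * n) * \<delta>"
    proof (intro mult_right_mono)
      have "n \<le> m * n" using m by simp
      then show "real n \<le> real (m * n)" by (simp only: of_nat_le_iff)
    qed (use \<delta> in simp)
    finally show "h < \<delta>" using m n0 by (simp add: h_def field_simps)
    show "real (m * n) * h = b - a" using m n0 by (simp add: h_def)
  qed
  have "\<exists>d\<in>D. norm (u (a + real k * h) - d) \<le> e / 2" for k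
  proof -
    have "u (a + real k * h) \<in> closure D" using D by simp
    then obtain d where "d \<in> D" "dist d (u (a + real k * h)) < e / 2" using e unfolding closure_approachable by (meson half_gt_zero)
    then show ?thesis by (intro bexI[of _ d]) (auto simp: dist_norm norm_minus_commute)
  qed
  then obtain d where d: "\<And>k. d k \<in> D" "\<And>k. norm (u (a + real k * h) - d k) \<le> e / 2" by metis
  show ?thesis
  proof (rule that[OF n0 d(1)], unfold h_def[symmetric])
    fix k t assume k: "k < m * n" and t: "t \<in> {a + real k * h..a + real k * h + h}"
    have "real k + 1 \<le> real (m * n)" using k by (metis Suc_leI of_nat_Suc of_nat_mono add.commute)
    then have "(real k + 1) * h \<le> real (m * n) * h" using h(1) by (intro mult_right_mono) auto
    then have kh: "real k * h + h \<le> b - a" using h(3) by (simp add: algebra_simps)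
    have s: "a + real k * h \<in> {a..b}" using kh h(1) by auto
    have tt: "t \<in> {a..b}" using t kh h(1) by (auto intro: order_trans[of a "a + real k * h"])
    have "dist t (a + real k * h) < \<delta>" using t h(2) by (auto simp: dist_real_def)
    then have "dist (x t) (x (a + real k * h)) < e" "dist (u t) (u (a + real k * h)) < e / 2"
      using d1(2)[OF s tt] d2(2)[OF s tt] by (auto simp: \<delta>_def)
    moreover have "norm (u t - d k) \<le> norm (u t - u (a + real k * h)) + norm (u (a + real k * h) - d k)"
      using norm_triangle_ineq[of "u t - u (a + real k * h)" "u (a + real k * h) - d k"] by simp
    ultimately show "t \<in> {a..b} \<and> norm (x t - x (a + real k * h)) \<le> e \<and> norm (u t - d k) \<le> e"
      using d(2)[of k] tt by (simp add: dist_norm)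
  qed
qed

section \<open>Transfer of bounds from the orbit to its closure\<close>

lemma envelope_lipschitz_integral:
  fixes g :: "('n::finite) dfield"
  assumes g: "g \<in> LC p" and env: "envelope p r g k N"
    and z: "z \<in> borel_measurable (lebesgue_on {a..b})" "\<And>t. t \<in> {a..b} \<Longrightarrow> norm (z t) \<le> r"
    and w: "w \<in> borel_measurable (lebesgue_on {a..b})" "\<And>t. t \<in> {a..b} \<Longrightarrow> norm (w t) \<le> r"
    and e: "\<And>t. t \<in> {a..b} \<Longrightarrow> norm (z t - w t) \<le> e"
  shows "norm (integral {a..b} (\<lambda>t. g (t, z t)) - integral {a..b} (\<lambda>t. g (t, w t))) \<le> e * integral {a..b} k"
proof -
  note E = envelopeD[OF env]
  have i: "(\<lambda>t. g (t, z t)) integrable_on {a..b}" "(\<lambda>t. g (t, w t)) integrable_on {a..b}"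
    by (rule set_lebesgue_integral_eq_integral(1)[OF field_integrable(1)[OF g env z]], assumption)
      (rule set_lebesgue_integral_eq_integral(1)[OF field_integrable(1)[OF g env w]], assumption)
  have "norm (integral {a..b} (\<lambda>t. g (t, z t) - g (t, w t))) \<le> integral {a..b} (\<lambda>t. e * k t)"
  proof (rule absolutely_integrable_dominated(2)[OF _ _ _ E(5)])
    show "(\<lambda>t. g (t, z t) - g (t, w t)) \<in> borel_measurable (lebesgue_on {a..b})"
      by (intro borel_measurable_diff field_measurable[OF g] z(1) w(1))
    show "(\<lambda>t. e * k t) integrable_on {a..b}" by (intro integrable_on_mult_right E(4))
    fix t assume t: "t \<in> {a..b}" "t \<notin> N"
    have "norm (g (t, z t) - g (t, w t)) \<le> k t * norm (z t - w t)" by (rule E(7)[OF t(2) z(2)[OF t(1)] w(2)[OF t(1)]])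
    also have "\<dots> \<le> k t * e" by (intro mult_left_mono e t E(2))
    finally show "norm (g (t, z t) - g (t, w t)) \<le> e * k t" by (simp add: mult.commute)
  qed simp
  then show ?thesis by (simp add: integral_diff[OF i])
qed

lemma LC_class_in_LC_space: "f \<in> LC p \<Longrightarrow> LC_class p (translate \<tau> f) \<in> LC_space p"
  unfolding LC_space_iff using LC_translate by blast

text \<open>The assumption \<open>weak\<close> is a common consequence of all three topologies:
  integrals over rational intervals at constant arguments \<open>(c, d)\<close> depend continuously
  on the class. Both bounds are inherited from this alone.\<close>

locale weak_hull =
  fixes f :: "('n::finite) dfield" and p :: nat and T :: "'n dfield set topology" and D :: "(real ^ 'n) set"
  assumes f: "f \<in> LC p" and p: "1 \<le> p" and equi: "L1loc_equicontinuous_m_bounds f"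
    and top: "topspace T = LC_space p" and D: "closure D = UNIV"
    and weak: "\<And>G a b c d e. \<lbrakk>G \<in> LC_space p; a \<in> \<rat>; b \<in> \<rat>; a \<le> b; d \<in> D; 0 < e\<rbrakk> \<Longrightarrow>
      \<exists>U. openin T U \<and> G \<in> U \<and> (\<forall>G'\<in>U. norm (integral {a..b} (\<lambda>t. rep G' (t, c, d) - rep G (t, c, d))) \<le> e)"
begin

definition H :: "'n dfield set set" where "H = translation_hull p T f"

definition \<theta> :: "nat \<Rightarrow> real \<Rightarrow> real" where "\<theta> j s = m_bound_moduli f {} j s"

lemma m_bound_moduli_eq: "m_bound_moduli f I j s = \<theta> j s"
  by (simp add: \<theta>_def m_bound_moduli_def)

lemma H_subset: "H \<subseteq> LC_space p"
  unfolding H_def by (rule translation_hull_subset[OF top])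

lemma rep_H: "G \<in> H \<Longrightarrow> rep G \<in> LC p"
  using H_subset rep_LC by blast

lemma hull_orbit:
  assumes G: "G \<in> H" and U: "openin T U" "G \<in> U"
  obtains g \<tau> where "g \<in> LC p" "field_eq g (translate \<tau> f)" "LC_class p (translate \<tau> f) \<in> U" "g = rep (LC_class p (translate \<tau> f))"
proof -
  obtain \<tau> where \<tau>: "LC_class p (translate \<tau> f) \<in> U"
    using G U unfolding H_def translation_hull_def in_closure_of by blast
  show ?thesis
    by (rule that[OF rep_LC[OF LC_class_in_LC_space[OF f]] rep_LC_class[OF LC_translate[OF f] p] \<tau> refl])
qed

text \<open>A step function is constant on each of \<open>m\<close> rational cells; the
  neighbourhoods belonging to the cells, each with error \<open>e / m\<close>, are
  intersected.\<close>

lemma weak_cells: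
  assumes G: "G \<in> LC_space p" and a: "a \<in> \<rat>" and h: "h \<in> \<rat>" "0 < h" and m: "0 < m"
    and \<zeta>: "\<And>k. k < m \<Longrightarrow> snd (\<zeta> k) \<in> D" and e: "0 < e"
  obtains U where "openin T U" "G \<in> U"
    "\<And>G'. G' \<in> U \<Longrightarrow> norm (integral {a..a + real m * h} (\<lambda>t. rep G' (t, \<zeta> (cell_index a h m t)))
        - integral {a..a + real m * h} (\<lambda>t. rep G (t, \<zeta> (cell_index a h m t)))) \<le> e"
proof -
  define J where "J k = {a + real k * h..a + real k * h + h}" for k
  have "\<exists>U. openin T U \<and> G \<in> U \<and> (\<forall>G'\<in>U. norm (integral (J k) (\<lambda>t. rep G' (t, \<zeta> k) - rep G (t, \<zeta> k))) \<le> e / m)" if k: "k < m" for k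
  proof -
    have "a + real k * h \<in> \<rat>" "a + real k * h + h \<in> \<rat>" using a h(1) by auto
    then show ?thesis
      using weak[OF G, of "a + real k * h" "a + real k * h + h" "snd (\<zeta> k)" "e / m" "fst (\<zeta> k)"] \<zeta>[OF k] e m h(2)
      by (simp add: J_def)
  qed
  then have "\<forall>k\<in>{..<m}. \<exists>U. openin T U \<and> G \<in> U \<and> (\<forall>G'\<in>U. norm (integral (J k) (\<lambda>t. rep G' (t, \<zeta> k) - rep G (t, \<zeta> k))) \<le> e / m)"
    by simp
  from bchoice[OF this] obtain U where
    U0: "\<forall>k\<in>{..<m}. openin T (U k) \<and> G \<in> U k \<and> (\<forall>G'\<in>U k. norm (integral (J k) (\<lambda>t. rep G' (t, \<zeta> k) - rep G (t, \<zeta> k))) \<le> e / m)" ..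
  have U: "\<And>k. k < m \<Longrightarrow> openin T (U k)" "\<And>k. k < m \<Longrightarrow> G \<in> U k"
    "\<And>k G'. \<lbrakk>k < m; G' \<in> U k\<rbrakk> \<Longrightarrow> norm (integral (J k) (\<lambda>t. rep G' (t, \<zeta> k) - rep G (t, \<zeta> k))) \<le> e / m"
    using U0 by auto
  show ?thesis
  proof (rule that)
    show "openin T (\<Inter>k<m. U k)" using m U(1) by (intro openin_Inter) auto
    show "G \<in> (\<Inter>k<m. U k)" using U(2) by auto
    fix G' assume G': "G' \<in> (\<Inter>k<m. U k)"
    then have "G' \<in> U 0" using m by auto
    then have "G' \<in> LC_space p" using openin_subset[OF U(1)[of 0]] m top by auto
    note g' = rep_LC[OF this] and g = rep_LC[OF G]
    have ci: "((\<lambda>t. g (t, \<zeta> (cell_index a h m t))) has_integral (\<Sum>k<m. integral (J k) (\<lambda>t. g (t, \<zeta> k)))) {a..a + real m * h}"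
      if g: "g \<in> LC p" for g :: "'n dfield"
      unfolding J_def
    proof (rule has_integral_cells[OF h(2) order_refl])
      fix k
      have "(\<lambda>_. \<zeta> k) \<in> curves (norm (\<zeta> k)) (a + real k * h) (a + real k * h + h)" by (simp add: curves_def)
      from curve_integrable(3)[OF g p this] show "(\<lambda>t. g (t, \<zeta> k)) integrable_on {a + real k * h..a + real k * h + h}" .
    qed
    have "integral {a..a + real m * h} (\<lambda>t. rep G' (t, \<zeta> (cell_index a h m t)))
        - integral {a..a + real m * h} (\<lambda>t. rep G (t, \<zeta> (cell_index a h m t)))
        = (\<Sum>k<m. integral (J k) (\<lambda>t. rep G' (t, \<zeta> k) - rep G (t, \<zeta> k)))"
      using has_integral_diff[OF ci[OF g'] ci[OF g]] ci[OF LC_diff[OF g' g]] ci[OF g'] ci[OF g]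
      by (simp add: integral_unique has_integral_unique)
    also have "norm \<dots> \<le> (\<Sum>k<m. e / m)" by (rule sum_norm_le) (use U(3) G' in auto)
    also have "\<dots> = e" using m by simp
    finally show "norm (integral {a..a + real m * h} (\<lambda>t. rep G' (t, \<zeta> (cell_index a h m t)))
        - integral {a..a + real m * h} (\<lambda>t. rep G (t, \<zeta> (cell_index a h m t)))) \<le> e" .
  qed
qed

text \<open>The curve is replaced by a step function \<open>w\<close>, the limit field by an orbit
  element close to it along \<open>w\<close>, and there \<open>orbit_bound\<close> applies. The step
  function may leave the ball of radius \<open>j\<close>, which explains the index
  \<open>Suc j\<close>.\<close>

lemma hull_bound_rational:
  assumes G: "G \<in> H" and ab: "a \<in> \<rat>" "b \<in> \<rat>" "a < b"
    and x: "continuous_on {a..b} x" and u: "continuous_on {a..b} u" and xu: "\<And>t. t \<in> {a..b} \<Longrightarrow> norm (x t, u t) \<le> real j"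
  shows "norm (integral {a..b} (\<lambda>t. rep G (t, x t, u t))) \<le> \<theta> (Suc j) (b - a)"
proof (rule field_le_epsilon)
  fix \<epsilon> :: real assume "0 < \<epsilon>"
  note g = rep_H[OF G]
  obtain k N where env: "envelope p (real (Suc j)) (rep G) k N" using LC_envelope[OF g p] by blast
  define K where "K = integral {a..b} k"
  have K: "0 \<le> K" unfolding K_def by (intro integral_nonneg envelopeD(4)[OF env] envelopeD(2)[OF env])
  \<comment> \<open>The condition \<open>2 * e \<le> 1\<close> keeps the step function within radius
    \<open>Suc j\<close>, and \<open>2 * e * K\<close> is the Lipschitz cost of the
    replacement.\<close>
  define e where "e = min (1 / 2) (\<epsilon> / (4 * (K + 1)))"
  have e: "0 < e" "2 * e \<le> 1" using \<open>0 < \<epsilon>\<close> K by (auto simp: e_def)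
  have eK: "2 * e * K \<le> \<epsilon> / 2"
  proof -
    have "e \<le> \<epsilon> / (4 * (K + 1))" by (simp add: e_def)
    moreover have "0 < 4 * (K + 1)" using K by simp
    ultimately have "e * (4 * (K + 1)) \<le> \<epsilon>" by (simp only: pos_le_divide_eq)
    then show ?thesis using e by (simp add: algebra_simps)
  qed
  obtain n d where n: "0 < n" and d: "\<And>k. d k \<in> D"
    and dd: "\<And>k t. \<lbrakk>k < 1 * n; t \<in> {a + real k * ((b - a) / (1 * n))..a + real k * ((b - a) / (1 * n)) + (b - a) / (1 * n)}\<rbrakk> \<Longrightarrow>
       t \<in> {a..b} \<and> norm (x t - x (a + real k * ((b - a) / (1 * n)))) \<le> e \<and> norm (u t - d k) \<le> e"
    using grid_approximation[OF ab(3) x u D e(1) zero_less_one] by metis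
  define h where "h = (b - a) / n"
  have h: "h \<in> \<rat>" "0 < h" "a + real n * h = b" using ab n by (auto simp: h_def)
  define \<zeta> where "\<zeta> k = (x (a + real k * h), d k)" for k
  define w where "w t = \<zeta> (cell_index a h n t)" for t
  have close: "norm ((x t, u t) - w t) \<le> 2 * e" if "t \<in> {a..b}" for t
  proof -
    have t: "t \<in> {a..a + real n * h}" using that h(3) by simp
    note ci = cell_index[OF h(2) n t]
    have "norm (x t - x (a + real (cell_index a h n t) * h)) \<le> e" "norm (u t - d (cell_index a h n t)) \<le> e"
      using dd[of "cell_index a h n t" t] ci by (auto simp: h_def)
    then have "norm (x t - x (a + real (cell_index a h n t) * h), u t - d (cell_index a h n t)) \<le> 2 * e"
      by (rule norm_Pair_le_add)
    then show ?thesis by (simp add: w_def \<zeta>_def)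
  qed
  have wj: "norm (w t) \<le> real (Suc j)" if "t \<in> {a..b}" for t
    using close[OF that] xu[OF that] e(2) norm_triangle_ineq2[of "w t" "(x t, u t)"] by (simp add: norm_minus_commute)
  have wm: "w \<in> borel_measurable (lebesgue_on {a..b})" unfolding w_def by (rule cell_index_measurable)
  have zm: "(\<lambda>t. (x t, u t)) \<in> borel_measurable (lebesgue_on {a..b})"
    by (intro continuous_imp_measurable_on_sets_lebesgue continuous_intros x u) simp
  have 1: "norm (integral {a..b} (\<lambda>t. rep G (t, x t, u t)) - integral {a..b} (\<lambda>t. rep G (t, w t))) \<le> 2 * e * integral {a..b} k"
    by (rule envelope_lipschitz_integral[OF g env zm _ wm wj close]) (rule order_trans[OF xu], simp_all)
  obtain U where U: "openin T U" "G \<in> U"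
    "\<And>G'. G' \<in> U \<Longrightarrow> norm (integral {a..b} (\<lambda>t. rep G' (t, w t)) - integral {a..b} (\<lambda>t. rep G (t, w t))) \<le> \<epsilon> / 2"
  proof -
    have "snd (\<zeta> k) \<in> D" for k using d by (simp add: \<zeta>_def)
    moreover have "0 < \<epsilon> / 2" using \<open>0 < \<epsilon>\<close> by simp
    ultimately show ?thesis
      by (rule weak_cells[OF subsetD[OF H_subset G] ab(1) h(1,2) n, where \<zeta> = \<zeta>, unfolded h(3) w_def[symmetric]]) (rule that)
  qed
  obtain g' \<tau> where g': "g' \<in> LC p" "field_eq g' (translate \<tau> f)" "LC_class p (translate \<tau> f) \<in> U" "g' = rep (LC_class p (translate \<tau> f))"
    using hull_orbit[OF G U(1,2)] .
  have 2: "norm (integral {a..b} (\<lambda>t. g' (t, w t))) \<le> \<theta> (Suc j) (b - a)"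
    using orbit_bound[OF f p equi g'(1,2) _ wm wj, where I = "{}"] ab(3) by (simp add: \<theta>_def)
  have 3: "norm (integral {a..b} (\<lambda>t. g' (t, w t)) - integral {a..b} (\<lambda>t. rep G (t, w t))) \<le> \<epsilon> / 2"
    using U(3)[OF g'(3)] g'(4) by simp
  have tri: "norm A \<le> norm (A - B) + norm (C - B) + norm C" for A B C :: "real ^ 'n"
    using norm_triangle_ineq4[of "C + (A - B)" "C - B"] norm_triangle_ineq[of C "A - B"] by simp
  show "norm (integral {a..b} (\<lambda>t. rep G (t, x t, u t))) \<le> \<theta> (Suc j) (b - a) + \<epsilon>"
    using tri[of "integral {a..b} (\<lambda>t. rep G (t, x t, u t))" "integral {a..b} (\<lambda>t. rep G (t, w t))" "integral {a..b} (\<lambda>t. g' (t, w t))"]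
      1 2 3 eK unfolding K_def by linarith
qed

lemma \<theta>_suitable: "suitable_moduli (m_bound_moduli f)"
  by (rule suitable_m_bound_moduli[OF f equi])

lemma \<theta>_mono: "\<lbrakk>i \<le> j; 0 \<le> s; s \<le> t\<rbrakk> \<Longrightarrow> \<theta> i s \<le> \<theta> j t"
  and \<theta>_zero: "\<theta> j 0 = 0"
  and \<theta>_continuous: "continuous_on {0..} (\<theta> j)"
proof -
  have I: "{0..0::real} \<in> rational_intervals" unfolding rational_intervals_def by (intro CollectI exI[of _ 0]) simp
  have eq: "m_bound_moduli f {0..0} j = \<theta> j" for j by (rule ext) (rule m_bound_moduli_eq)
  note S = \<theta>_suitable[unfolded suitable_moduli_def]
  have S1: "\<theta> j ` {0..} \<subseteq> {0..} \<and> mono_on {0..} (\<theta> j) \<and> continuous_on {0..} (\<theta> j) \<and> \<theta> j 0 = 0" for j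
    using S I unfolding eq[symmetric] by blast
  have S2: "\<theta> i s \<le> \<theta> j s" if "i \<le> j" "0 \<le> s" for i j s
    using S I that unfolding eq[symmetric] by blast
  show "\<theta> j 0 = 0" "continuous_on {0..} (\<theta> j)" using S1[of j] by auto
  show "\<theta> i s \<le> \<theta> j t" if "i \<le> j" "0 \<le> s" "s \<le> t"
  proof -
    have "\<theta> i s \<le> \<theta> i t" using S1[of i] that unfolding mono_on_def by auto
    also have "\<dots> \<le> \<theta> j t" using that by (intro S2) auto
    finally show ?thesis .
  qed
qed

lemma \<theta>_small:
  assumes "0 < e" obtains \<delta> where "0 < \<delta>" "\<And>s. \<lbrakk>0 \<le> s; s \<le> \<delta>\<rbrakk> \<Longrightarrow> \<theta> j s \<le> e"
proof -
  obtain d where d: "0 < d" "\<And>s. \<lbrakk>s \<in> {0..}; dist s 0 < d\<rbrakk> \<Longrightarrow> dist (\<theta> j s) (\<theta> j 0) < e"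
    using \<theta>_continuous[of j, unfolded continuous_on_iff, rule_format, of 0 e] assms by auto
  show ?thesis
  proof (rule that[of "d / 2"])
    show "\<theta> j s \<le> e" if "0 \<le> s" "s \<le> d / 2" for s
      using d(2)[of s] d(1) that by (auto simp: dist_real_def \<theta>_zero)
  qed (use d in auto)
qed

text \<open>The indefinite integral is continuous, so the endpoints can be approximated from inside
  by rational ones; monotonicity of the modulus then gives the bound for the full length.\<close>

lemma hull_bound:
  assumes G: "G \<in> H" and ab: "a \<le> b"
    and x: "continuous_on {a..b} x" and u: "continuous_on {a..b} u" and xu: "\<And>t. t \<in> {a..b} \<Longrightarrow> norm (x t, u t) \<le> real j"
  shows "norm (integral {a..b} (\<lambda>t. rep G (t, x t, u t))) \<le> \<theta> (Suc j) (b - a)"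
proof (cases "a = b")
  case True
  then show ?thesis by (simp add: \<theta>_zero)
next
  case False
  then have ab: "a < b" using ab by simp
  have F: "(\<lambda>t. rep G (t, x t, u t)) integrable_on {a..b}"
    by (rule set_lebesgue_integral_eq_integral(1)[OF delay_field_integrable[OF rep_H[OF G] p x u]])
  define I where "I t = integral {a..t} (\<lambda>t. rep G (t, x t, u t))" for t
  have Ic: "continuous_on {a..b} I" unfolding I_def by (rule indefinite_integral_continuous_1[OF F])
  have Ist: "norm (I t - I s) \<le> \<theta> (Suc j) (b - a)" if st: "a < s" "s < t" "t < b" "s \<in> \<rat>" "t \<in> \<rat>" for s t
  proof -
    have "I t - I s = integral {s..t} (\<lambda>t. rep G (t, x t, u t))"
      using Henstock_Kurzweil_Integration.integral_combine[of a s t, OF _ _ integrable_on_subinterval[OF F]] st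
      by (auto simp: I_def algebra_simps)
    also have "norm \<dots> \<le> \<theta> (Suc j) (t - s)"
      by (rule hull_bound_rational[OF G st(4,5,2) continuous_on_subset[OF x] continuous_on_subset[OF u]]) (use st xu in auto)
    also have "\<dots> \<le> \<theta> (Suc j) (b - a)" using st by (intro \<theta>_mono) auto
    finally show ?thesis .
  qed
  have "norm (I b - I a) \<le> \<theta> (Suc j) (b - a)"
  proof (rule field_le_epsilon)
    fix e :: real assume "0 < e"
    obtain d1 where d1: "0 < d1" "\<And>s. \<lbrakk>s \<in> {a..b}; dist s a < d1\<rbrakk> \<Longrightarrow> dist (I s) (I a) < e / 2"
      using Ic[unfolded continuous_on_iff, rule_format, of a "e / 2"] ab \<open>0 < e\<close> by auto
    obtain d2 where d2: "0 < d2" "\<And>s. \<lbrakk>s \<in> {a..b}; dist s b < d2\<rbrakk> \<Longrightarrow> dist (I s) (I b) < e / 2"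
      using Ic[unfolded continuous_on_iff, rule_format, of b "e / 2"] ab \<open>0 < e\<close> by auto
    obtain s where s: "s \<in> \<rat>" "a < s" "s < min (a + d1) ((a + b) / 2)"
      using Rats_dense_in_real[of a "min (a + d1) ((a + b) / 2)"] ab d1(1) by auto
    obtain t where t: "t \<in> \<rat>" "max (b - d2) ((a + b) / 2) < t" "t < b"
      using Rats_dense_in_real[of "max (b - d2) ((a + b) / 2)" b] ab d2(1) by auto
    have "norm (I t - I s) \<le> \<theta> (Suc j) (b - a)" using s t by (intro Ist) auto
    moreover have "dist (I s) (I a) < e / 2" using s ab by (intro d1(2)) (auto simp: dist_real_def)
    moreover have "dist (I t) (I b) < e / 2" using t ab by (intro d2(2)) (auto simp: dist_real_def)
    moreover have "norm (I b - I a) \<le> norm (I t - I s) + norm (I s - I a) + norm (I t - I b)"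
      using norm_add_diff_le[of "I t - I s" "I s - I a" "I t - I b"] by simp
    ultimately show "norm (I b - I a) \<le> \<theta> (Suc j) (b - a) + e" by (simp add: dist_norm)
  qed
  then show ?thesis by (simp add: I_def)
qed

text \<open>To compare the limit field with an orbit element, both delayed curves must take values
  in \<open>D\<close> on rational cells. The grid of \<open>v\<close> is refined until
  \<open>x\<close> is nearly constant on cells and \<open>u\<close> nearly a value of
  \<open>D\<close>; since \<open>v\<close> remains a step function on the finer grid, the bound of
  the orbit can be used there.\<close>

lemma hull_l2_bound:
  assumes G: "G \<in> H"
    and C: "(SUP \<tau>::real. \<integral>\<^sup>+ t\<in>{-r..r}. l2_bound j (translate \<tau> f) t \<partial>lebesgue) \<le> ennreal C" "0 \<le> C"
    and a: "a \<in> \<rat>" and h: "h \<in> \<rat>" "0 < h" and m: "0 < m" and b: "b = a + real m * h" and abr: "-r \<le> a" "b \<le> r"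
    and x: "continuous_on {a..b} x" and u: "continuous_on {a..b} u"
    and v: "\<And>t. v t = w (cell_index a h m t)" "\<And>k. k < m \<Longrightarrow> w k \<in> D"
    and bd: "\<And>t. t \<in> {a..b} \<Longrightarrow> norm (x t) \<le> R" "\<And>t. t \<in> {a..b} \<Longrightarrow> norm (u t) \<le> R" "\<And>k. k < m \<Longrightarrow> norm (w k) \<le> R" "2 * (R + 1) \<le> real j"
    and \<eta>: "0 < \<eta>" "\<And>t. t \<in> {a..b} \<Longrightarrow> norm (u t - v t) \<le> \<eta>"
  shows "norm (integral {a..b} (\<lambda>t. rep G (t, x t, u t)) - integral {a..b} (\<lambda>t. rep G (t, x t, v t))) \<le> C * \<eta>"
proof (rule field_le_epsilon)
  fix \<epsilon> :: real assume "0 < \<epsilon>"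
  note g = rep_H[OF G]
  have ab: "a < b" using b h m by simp
  obtain k N where env: "envelope p (real j) (rep G) k N" using LC_envelope[OF g p] by blast
  define K where "K = integral {a..b} k"
  have K: "0 \<le> K" unfolding K_def by (intro integral_nonneg envelopeD(4)[OF env] envelopeD(2)[OF env])
  \<comment> \<open>Collects the coefficients of \<open>e\<close> in the final estimate: four
    Lipschitz replacements, the enlarged distance of the delayed curves, and two comparisons with
    the orbit element.\<close>
  define L where "L = 4 * K + C + 2"
  have L: "0 < L" using K C(2) by (simp add: L_def)
  define e where "e = min 1 (\<epsilon> / L)"
  have e: "0 < e" "e \<le> 1" "e * L \<le> \<epsilon>" using \<open>0 < \<epsilon>\<close> L by (auto simp: e_def simp flip: pos_le_divide_eq)
  obtain n d where n: "0 < n" and d: "\<And>k. d k \<in> D"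
    and dd: "\<And>k t. \<lbrakk>k < m * n; t \<in> {a + real k * ((b - a) / (m * n))..a + real k * ((b - a) / (m * n)) + (b - a) / (m * n)}\<rbrakk> \<Longrightarrow>
       t \<in> {a..b} \<and> norm (x t - x (a + real k * ((b - a) / (m * n)))) \<le> e \<and> norm (u t - d k) \<le> e"
    using grid_approximation[OF ab x u D e(1) m] by metis
  define h' where "h' = h / real n"
  have h': "h' \<in> \<rat>" "0 < h'" "a + real (m * n) * h' = b" "(b - a) / (m * n) = h'" using h n m by (auto simp: h'_def b)
  have mn: "0 < m * n" using m n by simp
  define ci where "ci t = cell_index a h' (m * n) t" for t
  have ci: "ci t < m * n" "ci t div n < m" "ci t div n = cell_index a h m t"
    "norm (x t - x (a + real (ci t) * h')) \<le> e" "norm (u t - d (ci t)) \<le> e" "a + real (ci t) * h' \<in> {a..b}" if "t \<in> {a..b}" for t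
  proof -
    have t: "t \<in> {a..a + real (m * n) * h'}" using that h'(3) by simp
    note i = cell_index[OF h'(2) mn t, folded ci_def]
    show 1: "ci t < m * n" by (rule i(1))
    show "ci t div n < m" using 1 n by (simp add: div_less_iff_less_mult)
    show "ci t div n = cell_index a h m t" unfolding ci_def h'_def by (rule cell_index_refine[OF n m h(2)])
    show "norm (x t - x (a + real (ci t) * h')) \<le> e" "norm (u t - d (ci t)) \<le> e"
      using dd[of "ci t" t] i unfolding h'(4) by auto
    show "a + real (ci t) * h' \<in> {a..b}" using dd[of "ci t" "a + real (ci t) * h'"] 1 h'(2) unfolding h'(4) by auto
  qed
  define X where "X t = x (a + real (ci t) * h')" for t
  define Y where "Y t = d (ci t)" for t
  \<comment> \<open>This is \<open>v\<close> expressed through the fine grid; the two agree on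
    \<open>{a..b}\<close> by \<open>cell_index_refine\<close>.\<close>
  define V where "V t = w (ci t div n)" for t
  have Vv: "V t = v t" if "t \<in> {a..b}" for t using ci(3)[OF that] by (simp add: V_def v(1))
  have XR: "norm (X t) \<le> R" if "t \<in> {a..b}" for t unfolding X_def by (rule bd(1)[OF ci(6)[OF that]])
  have YR: "norm (Y t) \<le> R + 1" if "t \<in> {a..b}" for t
    using ci(5)[OF that] bd(2)[OF that] e(2) norm_triangle_ineq2[of "d (ci t)" "u t"] by (simp add: Y_def norm_minus_commute)
  have VR: "norm (V t) \<le> R" if "t \<in> {a..b}" for t unfolding V_def by (rule bd(3)[OF ci(2)[OF that]])
  have pair: "norm (y, z) \<le> real j" if "norm y \<le> R + 1" "norm z \<le> R + 1" for y z :: "real ^ 'n"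
    using norm_Pair_le_add[OF that] bd(4) by simp
  have nXY: "norm (X t, Y t) \<le> real j" and nXV: "norm (X t, V t) \<le> real j" and nxu: "norm (x t, u t) \<le> real j" and nxv: "norm (x t, v t) \<le> real j"
    if "t \<in> {a..b}" for t
    using XR[OF that] YR[OF that] VR[OF that] bd(1,2)[OF that] Vv[OF that] by (auto intro!: pair)
  have mXY: "(\<lambda>t. (X t, Y t)) \<in> borel_measurable (lebesgue_on {a..b})" and mXV: "(\<lambda>t. (X t, V t)) \<in> borel_measurable (lebesgue_on {a..b})"
    unfolding X_def Y_def V_def ci_def
    by (rule cell_index_measurable[of "\<lambda>i. (x (a + real i * h'), d i)"], rule cell_index_measurable[of "\<lambda>i. (x (a + real i * h'), w (i div n))"])
  have mx: "x \<in> borel_measurable (lebesgue_on {a..b})" by (rule continuous_imp_measurable_on_sets_lebesgue[OF x]) simp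
  have mxu: "(\<lambda>t. (x t, u t)) \<in> borel_measurable (lebesgue_on {a..b})"
    by (intro continuous_imp_measurable_on_sets_lebesgue continuous_intros x u) simp
  have mxv: "(\<lambda>t. (x t, v t)) \<in> borel_measurable (lebesgue_on {a..b})"
    unfolding v(1) by (rule borel_measurable_Pair[OF mx cell_index_measurable])
  let ?I = "\<lambda>g x u. integral {a..b} (\<lambda>t. g (t, x t, u t))"
  have 1: "norm (?I (rep G) x u - ?I (rep G) X Y) \<le> 2 * e * K"
    unfolding K_def
  proof (rule envelope_lipschitz_integral[OF g env mxu nxu mXY nXY])
    fix t assume t: "t \<in> {a..b}"
    have "norm (x t - X t, u t - Y t) \<le> 2 * e" by (rule norm_Pair_le_add) (use ci[OF t] in \<open>auto simp: X_def Y_def\<close>)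
    then show "norm ((x t, u t) - (X t, Y t)) \<le> 2 * e" by simp
  qed
  have 2: "norm (?I (rep G) x v - ?I (rep G) X V) \<le> 2 * e * K"
    unfolding K_def
  proof (rule envelope_lipschitz_integral[OF g env mxv nxv mXV nXV])
    fix t assume t: "t \<in> {a..b}"
    have "norm (x t - X t, v t - V t) \<le> 2 * e" by (rule norm_Pair_le_add) (use ci[OF t] Vv[OF t] e in \<open>auto simp: X_def\<close>)
    then show "norm ((x t, v t) - (X t, V t)) \<le> 2 * e" by simp
  qed
  obtain U1 where U1: "openin T U1" "G \<in> U1" "\<And>G'. G' \<in> U1 \<Longrightarrow> norm (?I (rep G') X Y - ?I (rep G) X Y) \<le> e"
  proof -
    have "snd (x (a + real i * h'), d i) \<in> D" for i using d by simp
    note W = weak_cells[OF subsetD[OF H_subset G] a h'(1,2) mn, where \<zeta> = "\<lambda>i. (x (a + real i * h'), d i)", OF this e(1), unfolded h'(3)]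
    show ?thesis by (rule W) (rule that[unfolded X_def Y_def ci_def], assumption+)
  qed
  obtain U2 where U2: "openin T U2" "G \<in> U2" "\<And>G'. G' \<in> U2 \<Longrightarrow> norm (?I (rep G') X V - ?I (rep G) X V) \<le> e"
  proof -
    have "snd (x (a + real i * h'), w (i div n)) \<in> D" if "i < m * n" for i
      using v(2)[of "i div n"] that n by (simp add: div_less_iff_less_mult)
    note W = weak_cells[OF subsetD[OF H_subset G] a h'(1,2) mn, where \<zeta> = "\<lambda>i. (x (a + real i * h'), w (i div n))", OF this e(1), unfolded h'(3)]
    show ?thesis by (rule W, assumption) (rule that[unfolded X_def V_def ci_def], assumption+)
  qed
  \<comment> \<open>A single orbit element has to be good along both step functions, hence the
    intersection.\<close>
  obtain g' \<tau> where g': "g' \<in> LC p" "field_eq g' (translate \<tau> f)" "LC_class p (translate \<tau> f) \<in> U1 \<inter> U2" "g' = rep (LC_class p (translate \<tau> f))"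
    using hull_orbit[OF G openin_Int[OF U1(1) U2(1)]] U1(2) U2(2) by blast
  obtain k' N' where env': "envelope p (real j) g' k' N'" using LC_envelope[OF g'(1) p] by blast
  have i': "(\<lambda>t. g' (t, X t, Y t)) integrable_on {a..b}" "(\<lambda>t. g' (t, X t, V t)) integrable_on {a..b}"
    by (rule set_lebesgue_integral_eq_integral(1)[OF field_integrable(1)[OF g'(1) env' mXY nXY]], assumption)
      (rule set_lebesgue_integral_eq_integral(1)[OF field_integrable(1)[OF g'(1) env' mXV nXV]], assumption)
  have 3: "norm (?I g' X Y - ?I g' X V) \<le> C * (\<eta> + e)"
    unfolding integral_diff[OF i', symmetric]
  proof (rule orbit_l2_bound[OF f p C g'(1,2) abr _ mXY mXV nXY nXV])
    show "0 < \<eta> + e" using \<eta>(1) e(1) by simp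
    fix t assume t: "t \<in> {a..b}"
    have "norm (Y t - V t) \<le> norm (u t - v t) + norm (u t - Y t)"
      using norm_triangle_ineq4[of "u t - v t" "u t - Y t"] Vv[OF t] by simp
    then show "norm (Y t - V t) \<le> \<eta> + e" using \<eta>(2)[OF t] ci(5)[OF t] by (simp add: Y_def)
  qed
  have 4: "norm (?I g' X Y - ?I (rep G) X Y) \<le> e" "norm (?I g' X V - ?I (rep G) X V) \<le> e"
    using U1(3) U2(3) g'(3,4) by auto
  have tri: "norm (A - B) \<le> norm (A - A1) + norm (B - B1) + norm (A2 - B2) + norm (A2 - A1) + norm (B2 - B1)" for A B A1 B1 A2 B2 :: "real ^ 'n"
  proof -
    have "A - B = (A - A1) - (B - B1) + (A2 - B2) - (A2 - A1) + (B2 - B1)" by simp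
    then show ?thesis
      using norm_triangle_ineq[of "(A - A1) - (B - B1) + (A2 - B2) - (A2 - A1)" "B2 - B1"]
        norm_triangle_ineq4[of "(A - A1) - (B - B1) + (A2 - B2)" "A2 - A1"]
        norm_triangle_ineq[of "(A - A1) - (B - B1)" "A2 - B2"] norm_triangle_ineq4[of "A - A1" "B - B1"] by simp
  qed
  have "norm (?I (rep G) x u - ?I (rep G) x v) \<le> 2 * e * K + 2 * e * K + C * (\<eta> + e) + e + e"
    using tri[of "?I (rep G) x u" "?I (rep G) x v" "?I (rep G) X Y" "?I (rep G) X V" "?I g' X Y" "?I g' X V"] 1 2 3 4 by linarith
  also have "\<dots> = C * \<eta> + e * L" by (simp add: L_def algebra_simps)
  finally show "norm (?I (rep G) x u - ?I (rep G) x v) \<le> C * \<eta> + \<epsilon>" using e(3) by simp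
qed

end

section \<open>Translation of curve families\<close>

text \<open>The last clause lets a curve be shifted by any real amount and then extended to a larger
  interval. It is needed because a translated rational interval can have irrational endpoints and
  must be enclosed in a rational one.\<close>

definition curve_family :: "'i set \<Rightarrow> ('i \<Rightarrow> real set \<Rightarrow> (real \<Rightarrow> 'a::euclidean_space) set) \<Rightarrow> ('i \<Rightarrow> real) \<Rightarrow> bool" where
  "curve_family A Z r \<longleftrightarrow> A \<noteq> {} \<and>
     (\<forall>i\<in>A. \<forall>a b. a \<le> b \<longrightarrow> Z i {a..b} \<subseteq> curves (r i) a b \<and> Z i {a..b} \<noteq> {}) \<and>
     (\<forall>i\<in>A. \<forall>a b a' b' c. a \<le> b \<and> a' \<le> a + c \<and> b + c \<le> b' \<longrightarrow>
        (\<forall>z\<in>Z i {a..b}. \<exists>z'\<in>Z i {a'..b'}. \<forall>t\<in>{a..b}. z' (t + c) = z t))"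

lemma curve_familyD:
  assumes "curve_family A Z r" "i \<in> A" "a \<le> b"
  shows "Z i {a..b} \<subseteq> curves (r i) a b" "Z i {a..b} \<noteq> {}"
    "\<lbrakk>a' \<le> a + c; b + c \<le> b'; z \<in> Z i {a..b}\<rbrakk> \<Longrightarrow> \<exists>z'\<in>Z i {a'..b'}. \<forall>t\<in>{a..b}. z' (t + c) = z t"
  using assms unfolding curve_family_def by blast+

definition strong_seminorms :: "nat \<Rightarrow> 'i set \<Rightarrow> ('i \<Rightarrow> real set \<Rightarrow> (real \<Rightarrow> (real ^ 'n) \<times> (real ^ 'n)) set) \<Rightarrow> (('n::finite) dfield \<Rightarrow> real) set" where
  "strong_seminorms p A Z = {strong_seminorm p (Z i I) I | i I. i \<in> A \<and> I \<in> rational_intervals}"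

definition weak_seminorms :: "'i set \<Rightarrow> ('i \<Rightarrow> real set \<Rightarrow> (real \<Rightarrow> (real ^ 'n) \<times> (real ^ 'n)) set) \<Rightarrow> (('n::finite) dfield \<Rightarrow> real) set" where
  "weak_seminorms A Z = {weak_seminorm (Z i I) I | i I. i \<in> A \<and> I \<in> rational_intervals}"

lemma rational_intervalsI: "\<lbrakk>a \<in> \<rat>; b \<in> \<rat>; a \<le> b\<rbrakk> \<Longrightarrow> {a..b} \<in> rational_intervals"
  unfolding rational_intervals_def by blast

lemma rational_intervalsE:
  assumes "I \<in> rational_intervals"
  obtains a b where "I = {a..b}" "a \<in> \<rat>" "b \<in> \<rat>" "a \<le> b"
  using assms unfolding rational_intervals_def by blast

lemma seminorm_space_strong:
  assumes "curve_family A Z r" "1 \<le> p"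
  shows "seminorm_space p (strong_seminorms p A Z :: (('n::finite) dfield \<Rightarrow> real) set)"
proof
  obtain i where "i \<in> A" using assms(1) unfolding curve_family_def by blast
  then show "(strong_seminorms p A Z :: ('n dfield \<Rightarrow> real) set) \<noteq> {}"
    unfolding strong_seminorms_def using rational_intervalsI[of 0 0] by auto
  fix \<rho> :: "'n dfield \<Rightarrow> real" assume "\<rho> \<in> strong_seminorms p A Z"
  then obtain i I where iI: "\<rho> = strong_seminorm p (Z i I) I" "i \<in> A" "I \<in> rational_intervals" unfolding strong_seminorms_def by blast
  obtain a b where I: "I = {a..b}" "a \<le> b" using rational_intervalsE[OF iI(3)] by metis
  show "LC_seminorm p \<rho>"
    unfolding iI(1) I(1) by (rule LC_seminorm_strong[OF assms(2) curve_familyD(1,2)[OF assms(1) iI(2) I(2)]])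
qed (rule assms(2))

lemma seminorm_space_weak:
  assumes "curve_family A Z r" "1 \<le> p"
  shows "seminorm_space p (weak_seminorms A Z :: (('n::finite) dfield \<Rightarrow> real) set)"
proof
  obtain i where "i \<in> A" using assms(1) unfolding curve_family_def by blast
  then show "(weak_seminorms A Z :: ('n dfield \<Rightarrow> real) set) \<noteq> {}"
    unfolding weak_seminorms_def using rational_intervalsI[of 0 0] by auto
  fix \<rho> :: "'n dfield \<Rightarrow> real" assume "\<rho> \<in> weak_seminorms A Z"
  then obtain i I where iI: "\<rho> = weak_seminorm (Z i I) I" "i \<in> A" "I \<in> rational_intervals" unfolding weak_seminorms_def by blast
  obtain a b where I: "I = {a..b}" "a \<le> b" using rational_intervalsE[OF iI(3)] by metis
  show "LC_seminorm p \<rho>"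
    unfolding iI(1) I(1) by (rule LC_seminorm_weak[OF assms(2) curve_familyD(1,2)[OF assms(1) iI(2) I(2)]])
qed (rule assms(2))

lemma curve_shift_integral:
  fixes g :: "('n::finite) dfield"
  assumes "\<And>t. t \<in> {a..b} \<Longrightarrow> z' (t + c) = z t" "(\<lambda>t. F (g (t, z' t))) integrable_on {a + c..b + c}"
  shows "integral {a..b} (\<lambda>t. F (translate c g (t, z t))) = integral {a + c..b + c} (\<lambda>t. F (g (t, z' t)) :: 'b::euclidean_space)"
proof -
  have "integral {a..b} (\<lambda>t. F (translate c g (t, z t))) = integral {a..b} (\<lambda>t. F (g (t + c, z' (t + c))))"
    by (rule integral_cong) (simp add: translate_def assms(1))
  also have "\<dots> = integral {a + c..b + c} (\<lambda>t. F (g (t, z' t)))"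
    by (rule integrable_on_shift_real(2)[where f = "\<lambda>t. F (g (t, z' t))", OF assms(2)])
  finally show ?thesis .
qed

text \<open>The integrand is nonnegative, so passing to the larger interval can only increase the
  integral.\<close>

lemma strong_seminorm_translate:
  fixes g :: "('n::finite) dfield"
  assumes Z: "curve_family A Z r" "i \<in> A" and p: "1 \<le> p" and g: "g \<in> LC p" and ab: "a \<le> b" "a' \<le> a + c" "b + c \<le> b'"
  shows "strong_seminorm p (Z i {a..b}) {a..b} (translate c g) \<le> strong_seminorm p (Z i {a'..b'}) {a'..b'} g"
proof (rule strong_seminorm_least[OF LC_translate[OF g] p curve_familyD(1,2)[OF Z ab(1)]])
  fix z assume z: "z \<in> Z i {a..b}"
  obtain z' where z': "z' \<in> Z i {a'..b'}" "\<forall>t\<in>{a..b}. z' (t + c) = z t" using curve_familyD(3)[OF Z ab z] by blast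
  have a'b': "a' \<le> b'" using ab by simp
  have zc: "z' \<in> curves (r i) a' b'" using curve_familyD(1)[OF Z a'b'] z'(1) by blast
  note i' = curve_integrable(4)[OF g p zc]
  have i: "(\<lambda>t. norm (g (t, z' t)) ^ p) integrable_on {a + c..b + c}"
    by (rule integrable_on_subinterval[OF i']) (use ab in auto)
  have "integral {a..b} (\<lambda>t. norm (translate c g (t, z t)) ^ p) = integral {a + c..b + c} (\<lambda>t. norm (g (t, z' t)) ^ p)"
    by (rule curve_shift_integral[where F = "\<lambda>x. norm x ^ p", OF _ i]) (use z'(2) in auto)
  also have "\<dots> \<le> integral {a'..b'} (\<lambda>t. norm (g (t, z' t)) ^ p)"
    by (rule integral_subset_le[OF _ i i']) (use ab in auto)
  finally have "root p (integral {a..b} (\<lambda>t. norm (translate c g (t, z t)) ^ p)) \<le> root p (integral {a'..b'} (\<lambda>t. norm (g (t, z' t)) ^ p))"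
    using p by simp
  also have "\<dots> \<le> strong_seminorm p (Z i {a'..b'}) {a'..b'} g"
    by (rule strong_seminorm_upper(2)[OF g p curve_familyD(1)[OF Z a'b'] z'(1)])
  finally show "root p (integral {a..b} (\<lambda>t. norm (translate c g (t, z t)) ^ p)) \<le> strong_seminorm p (Z i {a'..b'}) {a'..b'} g" .
qed

lemma translate_diff: "(\<lambda>w. translate c f w - translate c g w) = translate c (\<lambda>w. f w - g w)"
  by (rule ext) (simp add: translate_def split: prod.split)

text \<open>The difference of two translates splits into the translated difference of the classes,
  by the new time, and the difference of two translates of the fixed class. Each may take a third of
  the error, which keeps the sum strictly below it.\<close>

lemma translation_continuous_criterion:
  fixes S :: "(('n::finite) dfield \<Rightarrow> real) set"
  assumes S: "seminorm_space p S"
    and est: "\<And>\<rho> t G \<epsilon>. \<lbrakk>\<rho> \<in> S; G \<in> LC_space p; G \<in> H; 0 < \<epsilon>\<rbrakk> \<Longrightarrow> \<exists>\<rho>'\<in>S. \<exists>\<epsilon>'>0. \<exists>\<delta>>0. \<forall>t' G'. \<bar>t' - t\<bar> < \<delta> \<and> G' \<in> LC_space p \<and> G' \<in> H \<and>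
      \<rho>' (\<lambda>w. rep G' w - rep G w) < \<epsilon>' \<longrightarrow>
      \<rho> (translate t' (\<lambda>w. rep G' w - rep G w)) \<le> \<epsilon> \<and> \<rho> (\<lambda>w. translate t' (rep G) w - translate t (rep G) w) \<le> \<epsilon>"
  shows "continuous_map (prod_topology (top_of_set {0..}) (subtopology (seminorm_topology (LC_space p) S) H))
      (seminorm_topology (LC_space p) S) (\<lambda>(t, G). translate t ` G)"
proof -
  interpret seminorm_space p S by (rule S)
  have ts: "topspace (prod_topology (top_of_set {0::real..}) (subtopology T H)) = {0..} \<times> (LC_space p \<inter> H)"
    by (simp add: topspace_T)
  show ?thesis
  proof (rule continuous_map_into_T)
    fix x :: "real \<times> 'n dfield set" assume "x \<in> topspace (prod_topology (top_of_set {0..}) (subtopology T H))"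
    then show "(case x of (t, G) \<Rightarrow> translate t ` G) \<in> LC_space p"
      unfolding ts using translate_image_LC_space(2) by auto
  next
    fix x :: "real \<times> 'n dfield set" and \<rho> and \<epsilon> :: real
    assume x: "x \<in> topspace (prod_topology (top_of_set {0..}) (subtopology T H))" and \<rho>: "\<rho> \<in> S" and "0 < \<epsilon>"
    obtain t G where tG: "x = (t, G)" by (cases x)
    have t: "0 \<le> t" and G: "G \<in> LC_space p" "G \<in> H" using x unfolding ts tG by auto
    obtain \<rho>' \<epsilon>' \<delta> where \<rho>': "\<rho>' \<in> S" "0 < \<epsilon>'" "0 < \<delta>"
      "\<And>t' G'. \<lbrakk>\<bar>t' - t\<bar> < \<delta>; G' \<in> LC_space p; G' \<in> H; \<rho>' (\<lambda>w. rep G' w - rep G w) < \<epsilon>'\<rbrakk> \<Longrightarrow>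
      \<rho> (translate t' (\<lambda>w. rep G' w - rep G w)) \<le> \<epsilon> / 3 \<and> \<rho> (\<lambda>w. translate t' (rep G) w - translate t (rep G) w) \<le> \<epsilon> / 3"
      using est[OF \<rho> G, of "\<epsilon> / 3" t] \<open>0 < \<epsilon>\<close> by auto
    define V where "V = ({0..} \<inter> {t - \<delta><..<t + \<delta>}) \<times> (nbh \<rho>' G \<epsilon>' \<inter> H)"
    show "\<exists>V. openin (prod_topology (top_of_set {0..}) (subtopology T H)) V \<and> x \<in> V \<and>
        (\<forall>y\<in>V. \<rho> (\<lambda>w. rep (case y of (t, G) \<Rightarrow> translate t ` G) w - rep (case x of (t, G) \<Rightarrow> translate t ` G) w) < \<epsilon>)"
    proof (intro exI conjI ballI)
      show "openin (prod_topology (top_of_set {0..}) (subtopology T H)) V"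
        unfolding V_def openin_prod_Times_iff using openin_nbh[OF \<rho>'(1) G(1) \<rho>'(2)]
        by (intro disjI2 conjI openin_open_Int openin_subtopology_Int) auto
      show "x \<in> V" using t G center_in_nbh[OF \<rho>'(1) G(1) \<rho>'(2)] \<rho>'(3) by (simp add: tG V_def)
      fix y assume y: "y \<in> V"
      obtain t' G' where y': "y = (t', G')" by (cases y)
      have t': "\<bar>t' - t\<bar> < \<delta>" and G': "G' \<in> LC_space p" "G' \<in> H" "\<rho>' (\<lambda>w. rep G' w - rep G w) < \<epsilon>'"
        using y unfolding y' V_def nbh_def by auto
      note g = rep_LC[OF G(1)] and g' = rep_LC[OF G'(1)]
      have "\<rho> (\<lambda>w. rep (translate t' ` G') w - rep (translate t ` G) w) = \<rho> (\<lambda>w. translate t' (rep G') w - translate t (rep G) w)"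
        by (rule LC_seminorm_cong[OF seminorm[OF \<rho>] rep_translate_image[OF G'(1) p] rep_translate_image[OF G(1) p]])
          (intro rep_LC translate_image_LC_space(2) G G'(1) LC_translate)+
      also have "\<dots> \<le> \<rho> (\<lambda>w. translate t' (rep G') w - translate t' (rep G) w) + \<rho> (\<lambda>w. translate t' (rep G) w - translate t (rep G) w)"
        by (rule LC_seminorm_triangle[OF seminorm[OF \<rho>]]) (intro LC_translate g g')+
      also have "\<dots> < \<epsilon>" using \<rho>'(4)[OF t' G'] \<open>0 < \<epsilon>\<close> by (simp add: translate_diff)
      finally show "\<rho> (\<lambda>w. rep (case y of (t, G) \<Rightarrow> translate t ` G) w - rep (case x of (t, G) \<Rightarrow> translate t ` G) w) < \<epsilon>"
        by (simp add: y' tG)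
    qed
  qed
qed

lemma strong_translation_continuous:
  assumes Z: "curve_family A Z r" and p: "1 \<le> p"
  defines "S \<equiv> (strong_seminorms p A Z :: (('n::finite) dfield \<Rightarrow> real) set)"
  shows "continuous_map (prod_topology (top_of_set {0..}) (subtopology (seminorm_topology (LC_space p) S) H))
      (seminorm_topology (LC_space p) S) (\<lambda>(t, G). translate t ` G)"
proof (rule translation_continuous_criterion)
  show "seminorm_space p S" unfolding S_def by (rule seminorm_space_strong[OF Z p])
  fix \<rho> t and G :: "'n dfield set" and \<epsilon> :: real
  assume \<rho>: "\<rho> \<in> S" and G: "G \<in> LC_space p" and "0 < \<epsilon>"
  obtain i I where iI: "\<rho> = strong_seminorm p (Z i I) I" "i \<in> A" "I \<in> rational_intervals"
    using \<rho> unfolding S_def strong_seminorms_def by blast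
  obtain a b where I: "I = {a..b}" "a \<le> b" using rational_intervalsE[OF iI(3)] by metis
  define h where "h = translate t (rep G)"
  have h: "h \<in> LC p" unfolding h_def by (rule LC_translate[OF rep_LC[OF G]])
  obtain \<delta> where \<delta>: "0 < \<delta>" "\<delta> \<le> 1" "\<And>c z. \<lbrakk>\<bar>c\<bar> \<le> \<delta>; z \<in> curves (r i) a b\<rbrakk> \<Longrightarrow>
     integral {a..b} (\<lambda>s. norm (translate c h (s, z s) - h (s, z s)) ^ p) \<le> \<epsilon> ^ p"
    using LC_translation_continuous[OF h p zero_less_power[OF \<open>0 < \<epsilon>\<close>], of "r i" a b p] by blast
  \<comment> \<open>A rational interval, fixed in advance, that contains \<open>{a..b}\<close>
    shifted by any time within distance 1 of \<open>t\<close>.\<close>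
  obtain a' where a': "a' \<in> \<rat>" "a + t - 2 < a'" "a' < a + t - 1" using Rats_dense_in_real[of "a + t - 2" "a + t - 1"] by auto
  obtain b' where b': "b' \<in> \<rat>" "b + t + 1 < b'" "b' < b + t + 2" using Rats_dense_in_real[of "b + t + 1" "b + t + 2"] by auto
  define \<rho>' :: "'n dfield \<Rightarrow> real" where "\<rho>' = strong_seminorm p (Z i {a'..b'}) {a'..b'}"
  have a'b': "a' \<le> b'" using a' b' I(2) by simp
  have \<rho>'S: "\<rho>' \<in> S" unfolding \<rho>'_def S_def strong_seminorms_def using iI(2) rational_intervalsI[OF a'(1) b'(1) a'b'] by blast
  have main: "\<rho> (translate t' (\<lambda>w. rep G' w - rep G w)) \<le> \<epsilon> \<and> \<rho> (\<lambda>w. translate t' (rep G) w - translate t (rep G) w) \<le> \<epsilon>"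
    if t': "\<bar>t' - t\<bar> < \<delta>" and G': "G' \<in> LC_space p" "\<rho>' (\<lambda>w. rep G' w - rep G w) < \<epsilon>" for t' and G' :: "'n dfield set"
  proof
    have d: "(\<lambda>w. rep G' w - rep G w) \<in> LC p" by (intro LC_diff rep_LC G G')
    have "\<rho> (translate t' (\<lambda>w. rep G' w - rep G w)) \<le> \<rho>' (\<lambda>w. rep G' w - rep G w)"
      unfolding iI(1) I(1) \<rho>'_def
      by (rule strong_seminorm_translate[OF Z iI(2) p d I(2)]) (use t' \<delta>(2) a' b' in auto)
    then show "\<rho> (translate t' (\<lambda>w. rep G' w - rep G w)) \<le> \<epsilon>" using G'(2) by simp
    have eq: "translate t' (rep G) = translate (t' - t) h" by (simp add: h_def translate_translate)
    show "\<rho> (\<lambda>w. translate t' (rep G) w - translate t (rep G) w) \<le> \<epsilon>"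
      unfolding iI(1) I(1) eq h_def[symmetric]
    proof (rule strong_seminorm_least[OF LC_diff[OF LC_translate[OF h] h] p curve_familyD(1,2)[OF Z iI(2) I(2)]])
      fix z assume "z \<in> Z i {a..b}"
      then have "z \<in> curves (r i) a b" using curve_familyD(1)[OF Z iI(2) I(2)] by blast
      then have "integral {a..b} (\<lambda>s. norm (translate (t' - t) h (s, z s) - h (s, z s)) ^ p) \<le> \<epsilon> ^ p"
        using t' by (intro \<delta>(3)) auto
      then have "root p (integral {a..b} (\<lambda>s. norm (translate (t' - t) h (s, z s) - h (s, z s)) ^ p)) \<le> root p (\<epsilon> ^ p)"
        using p by simp
      then show "root p (integral {a..b} (\<lambda>s. norm (translate (t' - t) h (s, z s) - h (s, z s)) ^ p)) \<le> \<epsilon>"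
        using p \<open>0 < \<epsilon>\<close> by (simp add: real_root_power_cancel)
    qed
  qed
  show "\<exists>\<rho>'\<in>S. \<exists>\<epsilon>'>0. \<exists>\<delta>>0. \<forall>t' G'. \<bar>t' - t\<bar> < \<delta> \<and> G' \<in> LC_space p \<and> G' \<in> H \<and> \<rho>' (\<lambda>w. rep G' w - rep G w) < \<epsilon>' \<longrightarrow>
      \<rho> (translate t' (\<lambda>w. rep G' w - rep G w)) \<le> \<epsilon> \<and> \<rho> (\<lambda>w. translate t' (rep G) w - translate t (rep G) w) \<le> \<epsilon>"
    using \<rho>'S main \<open>0 < \<epsilon>\<close> \<delta>(1) by blast
qed

text \<open>Pointwise \<open>x \<le> \<kappa> + x ^ p / \<kappa> ^ (p - 1)\<close> takes the place
  of Hoelder's inequality; \<open>\<kappa>\<close> is small enough for its integral to be at most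
  \<open>\<eta> / 2\<close>.\<close>

lemma L1_small_of_Lp_small:
  assumes p: "1 \<le> p" and ab: "a \<le> b" and "0 < \<eta>"
  obtains \<epsilon> where "0 < \<epsilon>" "\<And>F :: real \<Rightarrow> 'a::euclidean_space. \<lbrakk>(\<lambda>t. norm (F t)) integrable_on {a..b}; (\<lambda>t. norm (F t) ^ p) integrable_on {a..b};
     root p (integral {a..b} (\<lambda>t. norm (F t) ^ p)) < \<epsilon>\<rbrakk> \<Longrightarrow> integral {a..b} (\<lambda>t. norm (F t)) \<le> \<eta>"
proof -
  define \<kappa> where "\<kappa> = \<eta> / (2 * (b - a + 1))"
  have \<kappa>: "0 < \<kappa>" "\<kappa> * (b - a) \<le> \<eta> / 2" using assms by (auto simp: \<kappa>_def field_simps)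
  define q where "q = \<kappa> ^ (p - 1)"
  have q: "0 < q" using \<kappa> by (simp add: q_def)
  have le: "x \<le> \<kappa> + x ^ p / q" if "0 \<le> x" for x
  proof (cases "x \<le> \<kappa>")
    case True
    moreover have "0 \<le> x ^ p / q" using that q by simp
    ultimately show ?thesis by simp
  next
    case False
    have "x * q \<le> x * x ^ (p - 1)" unfolding q_def using False \<kappa> that by (intro mult_left_mono power_mono) auto
    also have "\<dots> = x ^ p" using p by (cases p) auto
    finally have "x \<le> x ^ p / q" using q by (simp add: field_simps)
    then show ?thesis using \<kappa> by simp
  qed
  show ?thesis
  proof (rule that[of "root p (\<eta> / 2 * q)"])
    show "0 < root p (\<eta> / 2 * q)" using p q \<open>0 < \<eta>\<close> by simp
    fix F :: "real \<Rightarrow> 'a"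
    assume F: "(\<lambda>t. norm (F t)) integrable_on {a..b}" "(\<lambda>t. norm (F t) ^ p) integrable_on {a..b}"
      "root p (integral {a..b} (\<lambda>t. norm (F t) ^ p)) < root p (\<eta> / 2 * q)"
    have "integral {a..b} (\<lambda>t. norm (F t)) \<le> integral {a..b} (\<lambda>t. \<kappa> + norm (F t) ^ p / q)"
      by (rule integral_le[OF F(1)]) (use le F(2) in \<open>auto intro!: integrable_add integrable_on_divide\<close>)
    also have "\<dots> = \<kappa> * (b - a) + integral {a..b} (\<lambda>t. norm (F t) ^ p) / q"
      using ab F(2) by (subst integral_add) (auto intro!: integrable_on_divide simp: mult.commute)
    also have "\<dots> \<le> \<eta> / 2 + \<eta> / 2"
    proof (intro add_mono \<kappa>(2))
      have "integral {a..b} (\<lambda>t. norm (F t) ^ p) < \<eta> / 2 * q" using F(3) p by simp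
      then show "integral {a..b} (\<lambda>t. norm (F t) ^ p) / q \<le> \<eta> / 2" using q by (simp add: field_simps)
    qed
    finally show "integral {a..b} (\<lambda>t. norm (F t)) \<le> \<eta>" by simp
  qed
qed

text \<open>The comparison of solutions needs ordinary integrals, while the seminorm measures the
  \<open>p\<close>-th mean; one neighbourhood works for the whole family of curves.\<close>

lemma strong_nbh_L1:
  fixes Z :: "'i \<Rightarrow> real set \<Rightarrow> (real \<Rightarrow> (real ^ 'n::finite) \<times> (real ^ 'n)) set"
  assumes Z: "curve_family A Z r" and p: "1 \<le> p" and i: "i \<in> A" and G: "G \<in> LC_space p"
    and ab: "a \<in> \<rat>" "b \<in> \<rat>" "a \<le> b" and \<eta>: "0 < \<eta>"
  obtains U where "openin (seminorm_topology (LC_space p) (strong_seminorms p A Z)) U" "G \<in> U"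
    "\<forall>G'\<in>U. \<forall>z\<in>Z i {a..b}. integral {a..b} (\<lambda>t. norm (rep G' (t, z t) - rep G (t, z t))) \<le> \<eta>"
proof -
  interpret seminorm_space p "strong_seminorms p A Z :: ('n dfield \<Rightarrow> real) set" by (rule seminorm_space_strong[OF Z p])
  obtain \<epsilon> where \<epsilon>: "0 < \<epsilon>" "\<And>F :: real \<Rightarrow> real ^ 'n. \<lbrakk>(\<lambda>t. norm (F t)) integrable_on {a..b}; (\<lambda>t. norm (F t) ^ p) integrable_on {a..b};
     root p (integral {a..b} (\<lambda>t. norm (F t) ^ p)) < \<epsilon>\<rbrakk> \<Longrightarrow> integral {a..b} (\<lambda>t. norm (F t)) \<le> \<eta>"
    using L1_small_of_Lp_small[OF p ab(3) \<eta>] by metis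
  define \<rho> :: "'n dfield \<Rightarrow> real" where "\<rho> = strong_seminorm p (Z i {a..b}) {a..b}"
  have \<rho>: "\<rho> \<in> strong_seminorms p A Z" unfolding \<rho>_def strong_seminorms_def using i rational_intervalsI[OF ab] by blast
  show ?thesis
  proof (rule that[OF openin_nbh[OF \<rho> G \<epsilon>(1)] center_in_nbh[OF \<rho> G \<epsilon>(1)]], intro ballI)
    fix G' z assume G': "G' \<in> nbh \<rho> G \<epsilon>" and z: "z \<in> Z i {a..b}"
    have d: "(\<lambda>w. rep G' w - rep G w) \<in> LC p" using G' by (intro LC_diff rep_LC G) (simp add: nbh_def)
    note Zc = curve_familyD(1)[OF Z i ab(3)]
    have zc: "z \<in> curves (r i) a b" using Zc z by blast
    have "root p (integral {a..b} (\<lambda>t. norm (rep G' (t, z t) - rep G (t, z t)) ^ p)) \<le> \<rho> (\<lambda>w. rep G' w - rep G w)"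
      unfolding \<rho>_def by (rule strong_seminorm_upper(2)[OF d p Zc z])
    then show "integral {a..b} (\<lambda>t. norm (rep G' (t, z t) - rep G (t, z t))) \<le> \<eta>"
      using G' by (intro \<epsilon>(2) curve_integrable(4,5)[OF d p zc]) (simp add: nbh_def)
  qed
qed

section \<open>Moduli on the hull, weak translations, and replacement of the delayed
  argument\<close>

context weak_hull
begin

lemma hull_bound_curve:
  assumes G: "G \<in> H" and ab: "a \<le> b" and z: "z \<in> curves r a b" and r: "r \<le> real j"
  shows "norm (integral {a..b} (\<lambda>t. rep G (t, z t))) \<le> \<theta> (Suc j) (b - a)"
proof -
  have c: "continuous_on {a..b} z" using z by (simp add: curves_def)
  have "norm (integral {a..b} (\<lambda>t. rep G (t, fst (z t), snd (z t)))) \<le> \<theta> (Suc j) (b - a)"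
    by (rule hull_bound[OF G ab continuous_on_fst[OF c] continuous_on_snd[OF c]]) (use z r in \<open>auto simp: curves_def intro: order_trans\<close>)
  then show ?thesis by simp
qed

lemma hull_bound_diff:
  assumes G: "G \<in> H" and G': "G' \<in> H" and ab: "a \<le> b" and z: "z \<in> curves r a b" and r: "r \<le> real j"
  shows "norm (integral {a..b} (\<lambda>t. rep G' (t, z t) - rep G (t, z t))) \<le> 2 * \<theta> (Suc j) (b - a)"
  unfolding integral_diff[OF curve_integrable(3)[OF rep_H[OF G'] p z] curve_integrable(3)[OF rep_H[OF G] p z]]
  using hull_bound_curve[OF G ab z r] hull_bound_curve[OF G' ab z r]
    norm_triangle_ineq4[of "integral {a..b} (\<lambda>t. rep G' (t, z t))" "integral {a..b} (\<lambda>t. rep G (t, z t))"] by linarith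

text \<open>Increments of the curve are dominated by integrals of its own field along it, to which
  \<open>hull_bound\<close> applies; the pair of arguments has norm at most \<open>2 * R\<close>,
  and the hull costs the step to \<open>Suc j\<close>.\<close>

lemma controlled_curve_modulus:
  assumes G: "G \<in> H" and y: "controlled_curve (rep G) \<phi> \<delta> R S y" and R: "2 * R \<le> real j"
    and st: "s \<in> {0..S}" "t \<in> {0..S}"
  shows "norm (y t - y s) \<le> \<theta> (Suc j) \<bar>t - s\<bar>"
proof -
  have *: "norm (y t - y s) \<le> \<theta> (Suc j) (t - s)" if st: "0 \<le> s" "s \<le> t" "t \<le> S" for s t
  proof -
    have c: "continuous_on {-1..S} y" using y by (simp add: controlled_curve_def)
    have "norm (y t - y s) \<le> norm (integral {s..t} (\<lambda>r. rep G (r, y r, y (r - 1))))"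
      using y st by (simp add: controlled_curve_def)
    also have "\<dots> \<le> \<theta> (Suc j) (t - s)"
    proof (rule hull_bound[OF G st(2)])
      show "continuous_on {s..t} y" by (rule continuous_on_subset[OF c]) (use st in auto)
      show "continuous_on {s..t} (\<lambda>r. y (r - 1))" by (rule continuous_on_subset[OF continuous_on_shift1[OF c]]) (use st in auto)
      fix r assume r: "r \<in> {s..t}"
      have "norm (y r) \<le> R" "norm (y (r - 1)) \<le> R" using y r st by (auto simp: controlled_curve_def)
      then show "norm (y r, y (r - 1)) \<le> real j" using norm_Pair_le_add R by fastforce
    qed
    finally show ?thesis .
  qed
  show ?thesis
    using *[of s t] *[of t s] st by (cases "s \<le> t") (auto simp: norm_minus_commute abs_if)
qed

text \<open>With the norm outside the integral the seminorm is not monotone in the interval. The two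
  end pieces between the shifted interval and a rational one around it are estimated by the uniform
  modulus of the hull; this is why both classes must belong to \<open>H\<close>.\<close>

lemma weak_translation_continuous:
  assumes Z: "curve_family A Z r"
  defines "S \<equiv> (weak_seminorms A Z :: ('n dfield \<Rightarrow> real) set)"
  shows "continuous_map (prod_topology (top_of_set {0..}) (subtopology (seminorm_topology (LC_space p) S) H))
      (seminorm_topology (LC_space p) S) (\<lambda>(t, G). translate t ` G)"
proof (rule translation_continuous_criterion)
  show "seminorm_space p S" unfolding S_def by (rule seminorm_space_weak[OF Z p])
  fix \<rho> t and G :: "'n dfield set" and \<epsilon> :: real
  assume \<rho>: "\<rho> \<in> S" and G: "G \<in> LC_space p" "G \<in> H" and "0 < \<epsilon>"
  obtain i I where iI: "\<rho> = weak_seminorm (Z i I) I" "i \<in> A" "I \<in> rational_intervals"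
    using \<rho> unfolding S_def weak_seminorms_def by blast
  obtain a b where I: "I = {a..b}" "a \<le> b" using rational_intervalsE[OF iI(3)] by metis
  obtain j :: nat where j: "r i \<le> real j" using real_arch_simple by blast
  define h where "h = translate t (rep G)"
  have h: "h \<in> LC p" unfolding h_def by (rule LC_translate[OF rep_LC[OF G(1)]])
  \<comment> \<open>The exponent 1 suffices here, since the weak seminorm is dominated by the
    integral of the norm.\<close>
  obtain \<delta> where \<delta>: "0 < \<delta>" "\<delta> \<le> 1" "\<And>c z. \<lbrakk>\<bar>c\<bar> \<le> \<delta>; z \<in> curves (r i) a b\<rbrakk> \<Longrightarrow>
     integral {a..b} (\<lambda>s. norm (translate c h (s, z s) - h (s, z s)) ^ 1) \<le> \<epsilon>"
    using LC_translation_continuous[OF LC_subset_LC1[OF p h] order_refl \<open>0 < \<epsilon>\<close>, of "r i" a b] by blast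
  \<comment> \<open>Two classes on each of two end pieces make four moduli of
    \<open>\<epsilon> / 8\<close>; the enclosing interval takes the other half of
    \<open>\<epsilon>\<close>.\<close>
  have "0 < \<epsilon> / 8" using \<open>0 < \<epsilon>\<close> by simp
  then obtain d where d: "0 < d" "\<And>s. \<lbrakk>0 \<le> s; s \<le> d\<rbrakk> \<Longrightarrow> \<theta> (Suc j) s \<le> \<epsilon> / 8" using \<theta>_small by blast
  \<comment> \<open>Each rational endpoint is within \<open>2 * \<eta>\<close> of the interval
    shifted by \<open>t\<close>, and \<open>t'\<close> moves by less than \<open>\<eta>\<close>; the
    end pieces are thus no longer than \<open>3 * \<eta> \<le> d\<close>.\<close>
  define \<eta> where "\<eta> = min (d / 3) \<delta>"
  have \<eta>: "0 < \<eta>" "3 * \<eta> \<le> d" "\<eta> \<le> \<delta>" using d(1) \<delta>(1) by (auto simp: \<eta>_def)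
  obtain a' where a': "a' \<in> \<rat>" "a + t - 2 * \<eta> < a'" "a' < a + t - \<eta>" using Rats_dense_in_real[of "a + t - 2 * \<eta>" "a + t - \<eta>"] \<eta>(1) by auto
  obtain b' where b': "b' \<in> \<rat>" "b + t + \<eta> < b'" "b' < b + t + 2 * \<eta>" using Rats_dense_in_real[of "b + t + \<eta>" "b + t + 2 * \<eta>"] \<eta>(1) by auto
  define \<rho>' :: "'n dfield \<Rightarrow> real" where "\<rho>' = weak_seminorm (Z i {a'..b'}) {a'..b'}"
  have a'b': "a' \<le> b'" using a' b' I(2) \<eta>(1) by simp
  have \<rho>'S: "\<rho>' \<in> S" unfolding \<rho>'_def S_def weak_seminorms_def using iI(2) rational_intervalsI[OF a'(1) b'(1) a'b'] by blast
  have main: "\<rho> (translate t' (\<lambda>w. rep G' w - rep G w)) \<le> \<epsilon> \<and> \<rho> (\<lambda>w. translate t' (rep G) w - translate t (rep G) w) \<le> \<epsilon>"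
    if t': "\<bar>t' - t\<bar> < \<eta>" and G': "G' \<in> LC_space p" "G' \<in> H" "\<rho>' (\<lambda>w. rep G' w - rep G w) < \<epsilon> / 2" for t' and G' :: "'n dfield set"
  proof
    let ?d = "\<lambda>w. rep G' w - rep G w"
    have dLC: "?d \<in> LC p" by (intro LC_diff rep_LC G G')
    note Zc = curve_familyD[OF Z iI(2)]
    have sub: "a' \<le> a + t'" "b + t' \<le> b'" "a + t' - a' \<le> d" "b' - (b + t') \<le> d" using t' a' b' \<eta> by auto
    show "\<rho> (translate t' ?d) \<le> \<epsilon>"
      unfolding iI(1) I(1)
    proof (rule weak_seminorm_least[OF LC_translate[OF dLC] p Zc(1,2)[OF I(2)]])
      fix z assume z: "z \<in> Z i {a..b}"
      obtain z' where z': "z' \<in> Z i {a'..b'}" "\<forall>t\<in>{a..b}. z' (t + t') = z t" using Zc(3)[OF I(2) sub(1,2) z] by blast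
      have zc: "z' \<in> curves (r i) a' b'" using Zc(1)[OF a'b'] z'(1) by blast
      have zs: "z' \<in> curves (r i) u v" if "a' \<le> u" "v \<le> b'" for u v
        using zc that by (auto simp: curves_def intro: continuous_on_subset)
      note i' = curve_integrable(3)[OF dLC p zc]
      have i: "(\<lambda>t. ?d (t, z' t)) integrable_on {a + t'..b + t'}" by (rule integrable_on_subinterval[OF i']) (use sub in auto)
      have eq: "integral {a..b} (\<lambda>t. translate t' ?d (t, z t)) = integral {a + t'..b + t'} (\<lambda>t. ?d (t, z' t))"
        by (rule curve_shift_integral[where F = "\<lambda>x. x", OF _ i]) (use z'(2) in auto)
      have i2: "(\<lambda>t. ?d (t, z' t)) integrable_on {a + t'..b'}" by (rule integrable_on_subinterval[OF i']) (use sub in auto)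
      have split: "integral {a'..b'} (\<lambda>t. ?d (t, z' t)) = integral {a'..a + t'} (\<lambda>t. ?d (t, z' t))
          + (integral {a + t'..b + t'} (\<lambda>t. ?d (t, z' t)) + integral {b + t'..b'} (\<lambda>t. ?d (t, z' t)))"
        using Henstock_Kurzweil_Integration.integral_combine[of a' "a + t'" b', OF sub(1) _ i']
          Henstock_Kurzweil_Integration.integral_combine[of "a + t'" "b + t'" b', OF _ sub(2) i2] sub I(2) by simp
      have 1: "norm (integral {a'..b'} (\<lambda>t. ?d (t, z' t))) \<le> \<epsilon> / 2"
        using weak_seminorm_upper(2)[OF dLC p Zc(1)[OF a'b'] z'(1)] G'(3) by (simp add: \<rho>'_def)
      have "norm (integral {a'..a + t'} (\<lambda>t. ?d (t, z' t))) \<le> 2 * \<theta> (Suc j) (a + t' - a')"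
        by (rule hull_bound_diff[OF G(2) G'(2) sub(1) zs j]) (use sub I(2) in auto)
      then have 2: "norm (integral {a'..a + t'} (\<lambda>t. ?d (t, z' t))) \<le> \<epsilon> / 4" using d(2)[of "a + t' - a'"] sub by simp
      have "norm (integral {b + t'..b'} (\<lambda>t. ?d (t, z' t))) \<le> 2 * \<theta> (Suc j) (b' - (b + t'))"
        by (rule hull_bound_diff[OF G(2) G'(2) sub(2) zs j]) (use sub I(2) in auto)
      then have 3: "norm (integral {b + t'..b'} (\<lambda>t. ?d (t, z' t))) \<le> \<epsilon> / 4" using d(2)[of "b' - (b + t')"] sub by simp
      have "norm (X - (Y + W)) \<le> norm X + norm Y + norm W" for X Y W :: "real ^ 'n"
        using norm_triangle_ineq4[of X "Y + W"] norm_triangle_ineq[of Y W] by linarith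
      from this[of "integral {a'..b'} (\<lambda>t. ?d (t, z' t))" "integral {a'..a + t'} (\<lambda>t. ?d (t, z' t))" "integral {b + t'..b'} (\<lambda>t. ?d (t, z' t))"]
      show "norm (integral {a..b} (\<lambda>t. translate t' ?d (t, z t))) \<le> \<epsilon>" unfolding eq using 1 2 3 by (simp add: split)
    qed
    have eq: "translate t' (rep G) = translate (t' - t) h" by (simp add: h_def translate_translate)
    have hd: "(\<lambda>w. translate (t' - t) h w - h w) \<in> LC p" by (rule LC_diff[OF LC_translate[OF h] h])
    show "\<rho> (\<lambda>w. translate t' (rep G) w - translate t (rep G) w) \<le> \<epsilon>"
      unfolding iI(1) I(1) eq h_def[symmetric]
    proof (rule weak_seminorm_least[OF hd p Zc(1,2)[OF I(2)]])
      fix z assume "z \<in> Z i {a..b}"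
      then have zc: "z \<in> curves (r i) a b" using Zc(1)[OF I(2)] by blast
      have "norm (integral {a..b} (\<lambda>s. translate (t' - t) h (s, z s) - h (s, z s))) \<le> integral {a..b} (\<lambda>s. norm (translate (t' - t) h (s, z s) - h (s, z s)))"
        by (rule integral_norm_bound_integral[OF curve_integrable(3,5)[OF hd p zc]]) simp
      also have "\<dots> \<le> \<epsilon>" using \<delta>(3)[of "t' - t", OF _ zc] t' \<eta>(3) by simp
      finally show "norm (integral {a..b} (\<lambda>s. translate (t' - t) h (s, z s) - h (s, z s))) \<le> \<epsilon>" .
    qed
  qed
  have "0 < \<epsilon> / 2" using \<open>0 < \<epsilon>\<close> by simp
  then show "\<exists>\<rho>'\<in>S. \<exists>\<epsilon>'>0. \<exists>\<delta>>0. \<forall>t' G'. \<bar>t' - t\<bar> < \<delta> \<and> G' \<in> LC_space p \<and> G' \<in> H \<and> \<rho>' (\<lambda>w. rep G' w - rep G w) < \<epsilon>' \<longrightarrow>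
      \<rho> (translate t' (\<lambda>w. rep G' w - rep G w)) \<le> \<epsilon> \<and> \<rho> (\<lambda>w. translate t' (rep G) w - translate t (rep G) w) \<le> \<epsilon>"
    using \<rho>'S main \<eta>(1) by blast
qed

text \<open>Only finitely many weak seminorms are available, so the delayed argument, which ranges over an equicontinuous
  family, is replaced by a step function with values in a finite net of \<open>D\<close>; the bounds on the Lipschitz
  constants in the delayed variable, which pass to the hull, control the error.\<close>

lemma weakly_close_of_weak_nbh:
  assumes l2: "L1loc_bounded_l2_bounds f"
    and nbh: "\<And>G j a b u \<epsilon>. \<lbrakk>G \<in> LC_space p; a \<in> \<rat>; b \<in> \<rat>; a \<le> b; u \<in> D; 0 < \<epsilon>\<rbrakk> \<Longrightarrow> \<exists>U. openin T U \<and> G \<in> U \<and>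
        (\<forall>G'\<in>U. \<forall>y\<in>moduli_ball (m_bound_moduli f) {a..b} j. norm (integral {a..b} (\<lambda>t. rep G' (t, y t, u) - rep G (t, y t, u))) \<le> \<epsilon>)"
    and G: "G \<in> H" and \<phi>: "continuous_on {-1..0} \<phi>" and R: "0 \<le> R" and S: "S \<in> \<rat>" "0 < S" and \<eta>: "0 < \<eta>"
  shows "\<exists>U \<delta>. openin T U \<and> G \<in> U \<and> 0 < \<delta> \<and> (\<forall>G'\<in>U \<inter> H. weakly_close (rep G') (rep G) \<phi> \<delta> R S \<eta>)"
proof -
  obtain j :: nat where j: "2 * (R + 2) \<le> real j" using real_arch_simple by blast
  define C where "C = enn2real (SUP \<tau>::real. \<integral>\<^sup>+ t\<in>{-(S + 1)..S + 1}. l2_bound j (translate \<tau> f) t \<partial>lebesgue)"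
  have C: "(SUP \<tau>::real. \<integral>\<^sup>+ t\<in>{-(S + 1)..S + 1}. l2_bound j (translate \<tau> f) t \<partial>lebesgue) \<le> ennreal C" "0 \<le> C"
  proof -
    have "(SUP \<tau>::real. \<integral>\<^sup>+ t\<in>{-(S + 1)..S + 1}. l2_bound j (translate \<tau> f) t \<partial>lebesgue) < \<infinity>"
      using l2[unfolded L1loc_bounded_l2_bounds_def, rule_format, of "S + 1" j] S(2) by simp
    then show "(SUP \<tau>::real. \<integral>\<^sup>+ t\<in>{-(S + 1)..S + 1}. l2_bound j (translate \<tau> f) t \<partial>lebesgue) \<le> ennreal C"
      unfolding C_def by (subst ennreal_enn2real) (auto simp: infinity_ennreal_def)
  qed (simp add: C_def)
  \<comment> \<open>The distance allowed between the delayed curve and its step function; the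
    replacement is made for two fields and costs at most
    \<open>2 * (C * e) \<le> \<eta> / 4\<close>.\<close>
  define e where "e = min 1 (\<eta> / (8 * (C + 1)))"
  have e: "0 < e" "e \<le> 1" "2 * (C * e) \<le> \<eta> / 4"
  proof -
    have "e \<le> \<eta> / (8 * (C + 1))" by (simp add: e_def)
    moreover have "0 < 8 * (C + 1)" using C(2) by simp
    ultimately have "e * (8 * (C + 1)) \<le> \<eta>" by (simp only: pos_le_divide_eq)
    moreover show "0 < e" using \<eta> C(2) by (simp add: e_def)
    ultimately show "2 * (C * e) \<le> \<eta> / 4" by (simp add: algebra_simps)
  qed (simp add: e_def)
  have "uniformly_continuous_on {-1..0} \<phi>" by (rule compact_uniformly_continuous[OF \<phi> compact_Icc])
  then obtain h1 where h1: "0 < h1" "\<And>s t. \<lbrakk>s \<in> {-1..0}; t \<in> {-1..0}; dist t s < h1\<rbrakk> \<Longrightarrow> dist (\<phi> t) (\<phi> s) < e / 8"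
    unfolding uniformly_continuous_on_def using e(1) by (metis divide_pos_pos zero_less_numeral)
  \<comment> \<open>The cell length must satisfy two demands on the modulus: small oscillation of
    the delayed curve inside a cell, and a negligible integral over the last incomplete
    cell.\<close>
  have "0 < min (e / 8) (\<eta> / 8)" using e(1) \<eta> by simp
  then obtain h2 where h2: "0 < h2" "\<And>s. \<lbrakk>0 \<le> s; s \<le> h2\<rbrakk> \<Longrightarrow> \<theta> (Suc j) s \<le> min (e / 8) (\<eta> / 8)" using \<theta>_small by blast
  obtain n :: nat where n: "S / min h1 h2 < real n" using reals_Archimedean2 by blast
  have n0: "0 < n" using n S(2) h1(1) h2(1) by (cases n) (auto simp: divide_less_0_iff min_def split: if_splits)
  define h where "h = S / n"
  have h: "0 < h" "h < h1" "h < h2" "h \<in> \<rat>" "real n * h = S"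
  proof -
    have "S < real n * min h1 h2" using n h1(1) h2(1) by (simp add: pos_divide_less_eq)
    moreover have "real n * min h1 h2 \<le> real n * h1" "real n * min h1 h2 \<le> real n * h2" by (intro mult_left_mono; simp)+
    ultimately have "S < real n * h1" "S < real n * h2" by linarith+
    then show "h < h1" "h < h2" using n0 by (simp_all add: h_def pos_divide_less_eq mult.commute)
  qed (use n0 S in \<open>auto simp: h_def\<close>)
  obtain F0 where F0: "finite F0" "F0 \<subseteq> D" "\<And>z. z \<in> cball (0 :: real ^ 'n) R \<Longrightarrow> \<exists>w\<in>F0. dist w z < e / 2"
    using finite_net[of "cball (0 :: real ^ 'n) R" D "e / 2"] D e(1) by auto
  \<comment> \<open>Net points outside the ball of radius \<open>R + 1\<close> approximate nothing
    relevant; discarding them bounds the step function.\<close>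
  define F where "F = {w \<in> F0. norm w \<le> R + 1}"
  have F: "finite F" "F \<subseteq> D" "\<And>w. w \<in> F \<Longrightarrow> norm w \<le> R + 1" using F0 by (auto simp: F_def)
  have net: "\<exists>w\<in>F. norm (w - z) < e / 2" if z: "norm z \<le> R" for z
  proof -
    obtain w where w: "w \<in> F0" "norm (w - z) < e / 2" using F0(3)[of z] z by (auto simp: dist_norm)
    have "norm w \<le> R + 1" using norm_triangle_sub[of w z] w(2) z e(2) by simp
    then show ?thesis using w by (auto simp: F_def)
  qed
  define J where "J k = {0 + real k * h..0 + real k * h + h}" for k :: nat
  have "\<exists>U. openin T U \<and> G \<in> U \<and> (\<forall>G'\<in>U. \<forall>y\<in>moduli_ball (m_bound_moduli f) (J k) (Suc j).
      norm (integral (J k) (\<lambda>t. rep G' (t, y t, u) - rep G (t, y t, u))) \<le> \<eta> / (4 * n))" if "u \<in> F" for k u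
  proof -
    have "0 + real k * h \<in> \<rat>" "0 + real k * h + h \<in> \<rat>" using h(4) by auto
    then show ?thesis unfolding J_def
      using H_subset G F(2) that h(1) \<eta> n0 by (intro nbh) auto
  qed
  then have "\<forall>ku\<in>{..<n} \<times> F. \<exists>U. openin T U \<and> G \<in> U \<and> (\<forall>G'\<in>U. \<forall>y\<in>moduli_ball (m_bound_moduli f) (J (fst ku)) (Suc j).
      norm (integral (J (fst ku)) (\<lambda>t. rep G' (t, y t, snd ku) - rep G (t, y t, snd ku))) \<le> \<eta> / (4 * n))" by auto
  from bchoice[OF this] obtain U where U: "\<forall>ku\<in>{..<n} \<times> F. openin T (U ku) \<and> G \<in> U ku \<and> (\<forall>G'\<in>U ku. \<forall>y\<in>moduli_ball (m_bound_moduli f) (J (fst ku)) (Suc j).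
      norm (integral (J (fst ku)) (\<lambda>t. rep G' (t, y t, snd ku) - rep G (t, y t, snd ku))) \<le> \<eta> / (4 * n))" ..
  \<comment> \<open>Nonemptiness of \<open>F\<close> makes the index set of the following
    intersection nonempty.\<close>
  obtain w0 where w0: "w0 \<in> F" using net[of 0] R by auto
  \<comment> \<open>All pairs of a cell and a net value are taken care of before the curve is known,
    so that one neighbourhood serves every curve.\<close>
  define V where "V = (\<Inter>ku\<in>{..<n} \<times> F. U ku)"
  have V: "openin T V" "G \<in> V"
    unfolding V_def using U F(1) w0 n0 by (auto intro!: openin_Inter)
  have close: "weakly_close (rep G') (rep G) \<phi> (e / 8) R S \<eta>" if G': "G' \<in> V \<inter> H" for G'
    unfolding weakly_close_def
  proof (intro allI impI ballI)
    fix y t assume y: "controlled_curve (rep G') \<phi> (e / 8) R S y" and t: "t \<in> {0..S}"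
    have yc: "continuous_on {-1..S} y" and yR: "\<And>t. t \<in> {-1..S} \<Longrightarrow> norm (y t) \<le> R" and y\<phi>: "\<And>t. t \<in> {-1..0} \<Longrightarrow> norm (\<phi> t - y t) \<le> e / 8"
      using y by (auto simp: controlled_curve_def)
    have G'H: "G' \<in> H" using G' by simp
    have ymod: "norm (y t - y s) \<le> \<theta> (Suc j) \<bar>t - s\<bar>" if "s \<in> {0..S}" "t \<in> {0..S}" for s t
      by (rule controlled_curve_modulus[OF G'H y _ that]) (use j R in simp)
    \<comment> \<open>On the history part the oscillation is that of \<open>\<phi>\<close> plus
      twice the distance to it, \<open>3 * e / 8\<close>; on the solution part it is
      \<open>e / 8\<close> by the modulus. An interval across 0 needs both.\<close>
    have near: "norm (y t - y s) \<le> e / 2" if st: "s \<in> {-1..S}" "t \<in> {-1..S}" "s \<le> t" "t - s \<le> h" for s t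
    proof -
      have neg: "norm (y t - y s) \<le> 3 * e / 8" if "s \<in> {-1..0}" "t \<in> {-1..0}" "s \<le> t" "t - s \<le> h" for s t
      proof -
        have "norm (\<phi> t - \<phi> s) < e / 8" using h1(2)[of s t] that h(2) by (simp add: dist_norm)
        moreover have "norm (y t - y s) \<le> norm (\<phi> t - \<phi> s) + norm (\<phi> s - y s) + norm (\<phi> t - y t)"
          using norm_add_diff_le[of "\<phi> t - \<phi> s" "\<phi> s - y s" "\<phi> t - y t"] by simp
        ultimately show ?thesis using y\<phi>[OF that(1)] y\<phi>[OF that(2)] by simp
      qed
      have pos: "norm (y t - y s) \<le> e / 8" if "s \<in> {0..S}" "t \<in> {0..S}" "s \<le> t" "t - s \<le> h" for s t
        using ymod[OF that(1,2)] h2(2)[of "t - s"] that h(3) by simp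
      consider "t \<le> 0" | "0 \<le> s" | "s < 0" "0 < t" by linarith
      then show ?thesis
      proof cases
        case 1 then show ?thesis using neg[of s t] st e(1) by simp
      next
        case 2 then show ?thesis using pos[of s t] st e(1) by simp
      next
        case 3
        have "norm (y t - y s) \<le> norm (y t - y 0) + norm (y 0 - y s)" using norm_triangle_ineq[of "y t - y 0" "y 0 - y s"] by simp
        then show ?thesis using pos[of 0 t] neg[of s 0] 3 st by simp
      qed
    qed
    define u where "u s = y (s - 1)" for s
    have uc: "continuous_on {0..S} u" unfolding u_def by (rule continuous_on_shift1[OF yc])
    have "\<exists>w\<in>F. norm (w - u (real k * h)) < e / 2" if "k < n" for k
    proof (rule net)
      have "real k * h \<le> real n * h" using that h(1) by (intro mult_right_mono) auto
      then show "norm (u (real k * h)) \<le> R" unfolding u_def using h(1,5) by (intro yR) auto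
    qed
    then have "\<forall>k\<in>{..<n}. \<exists>w. w \<in> F \<and> norm (w - u (real k * h)) < e / 2" by auto
    from bchoice[OF this] obtain w where w: "\<forall>k\<in>{..<n}. w k \<in> F \<and> norm (w k - u (real k * h)) < e / 2" ..
    let ?d = "\<lambda>x. rep G' x - rep G x"
    have dLC: "?d \<in> LC p" by (intro LC_diff rep_H G G'H)
    \<comment> \<open>The time \<open>t\<close> need not be a grid point: \<open>{0..t}\<close> is
      split at the left end of the cell that contains it.\<close>
    define m where "m = cell_index 0 h n t"
    have tn: "t \<in> {0..0 + real n * h}" using t h(5) by simp
    have m: "m < n" "real m * h \<le> t" "t \<le> real m * h + h" using cell_index[OF h(1) n0 tn] by (auto simp: m_def)
    have mh: "0 \<le> real m * h" using h(1) by simp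
    have mS: "real m * h \<le> S" using m t by simp
    let ?b = "0 + real m * h"
    have yu: "(\<lambda>s. (y s, u s)) \<in> curves (2 * R) a b" if "0 \<le> a" "b \<le> S" for a b
      unfolding curves_def using that yR continuous_on_subset[OF yc] continuous_on_subset[OF uc]
      by (auto simp: u_def intro!: continuous_on_Pair norm_Pair_le_add)
    have i1: "(\<lambda>s. ?d (s, y s, u s)) integrable_on {0..t}"
      using curve_integrable(3)[OF dLC p yu[of 0 t]] t by simp
    have rest: "norm (integral {?b..t} (\<lambda>s. ?d (s, y s, u s))) \<le> \<eta> / 4"
    proof -
      have "norm (integral {?b..t} (\<lambda>s. ?d (s, y s, u s))) \<le> 2 * \<theta> (Suc j) (t - ?b)"
        by (rule hull_bound_diff[OF G G'H _ yu]) (use m mh t j in auto)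
      moreover have "\<theta> (Suc j) (t - ?b) \<le> \<eta> / 8" using h2(2)[of "t - ?b"] m h(3) by simp
      ultimately show ?thesis by simp
    qed
    have main: "norm (integral {0..?b} (\<lambda>s. ?d (s, y s, u s))) \<le> 3 * \<eta> / 4"
    proof (cases "m = 0")
      case True
      then show ?thesis using \<eta> by simp
    next
      case False
      then have m0: "0 < m" by simp
      \<comment> \<open>On each cell the delayed curve is replaced by a net value close to it at the
        left end of the cell.\<close>
      define v where "v s = w (cell_index 0 h m s)" for s
      have uv: "norm (u s - v s) \<le> e" if "s \<in> {0..?b}" for s
      proof -
        have ci: "cell_index 0 h m s < m" "s \<in> {0 + real (cell_index 0 h m s) * h..0 + real (cell_index 0 h m s) * h + h}"
          using cell_index[OF h(1) m0, of s 0] that by auto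
        have "norm (u s - u (real (cell_index 0 h m s) * h)) \<le> e / 2"
          unfolding u_def using ci that mS h(1) by (intro near) auto
        moreover have "norm (w (cell_index 0 h m s) - u (real (cell_index 0 h m s) * h)) < e / 2" using w ci(1) m(1) by auto
        moreover have "norm (u s - v s) \<le> norm (u s - u (real (cell_index 0 h m s) * h)) + norm (w (cell_index 0 h m s) - u (real (cell_index 0 h m s) * h))"
          using norm_triangle_ineq4[of "u s - u (real (cell_index 0 h m s) * h)" "w (cell_index 0 h m s) - u (real (cell_index 0 h m s) * h)"]
          by (simp add: v_def)
        ultimately show ?thesis by simp
      qed
      have wF: "w k \<in> F" if "k < m" for k using w that m(1) by auto
      have l2b: "norm (integral {0..?b} (\<lambda>s. rep K (s, y s, u s)) - integral {0..?b} (\<lambda>s. rep K (s, y s, v s))) \<le> C * e" if K: "K \<in> H" for K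
      proof (rule hull_l2_bound[where a = 0 and h = h and m = m and w = w and R = "R + 1" and r = "S + 1" and j = j])
        show "K \<in> H" by (rule K)
        show "(SUP \<tau>::real. \<integral>\<^sup>+ t\<in>{-(S + 1)..S + 1}. l2_bound j (translate \<tau> f) t \<partial>lebesgue) \<le> ennreal C" by (rule C(1))
        show "v s = w (cell_index 0 h m s)" for s by (rule v_def)
        show "norm (u s - v s) \<le> e" if "s \<in> {0..?b}" for s by (rule uv[OF that])
        show "continuous_on {0..?b} y" by (rule continuous_on_subset[OF yc]) (use mS in auto)
        show "continuous_on {0..?b} u" by (rule continuous_on_subset[OF uc]) (use mS in auto)
        show "w k \<in> D" if "k < m" for k using wF[OF that] F(2) by blast
        show "norm (w k) \<le> R + 1" if "k < m" for k using wF[OF that] F(3) by blast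
        show "norm (y s) \<le> R + 1" if "s \<in> {0..?b}" for s using yR[of s] that mS by simp
        show "norm (u s) \<le> R + 1" if "s \<in> {0..?b}" for s using yR[of "s - 1"] that mS by (simp add: u_def)
        show "2 * (R + 1 + 1) \<le> real j" using j by simp
      qed (use S mS mh h(1,4) m0 C(2) e(1) in auto)
      have cells: "((\<lambda>s. g (s, y s, v s)) has_integral (\<Sum>k<m. integral {0 + real k * h..0 + real k * h + h} (\<lambda>s. g (s, y s, w k)))) {0..?b}"
        if g: "g \<in> LC p" for g :: "'n dfield"
        unfolding v_def
      proof (rule has_integral_cells[OF h(1) order_refl])
        fix k assume k: "k < m"
        have "real k * h + h \<le> S"
        proof -
          have "(real k + 1) * h \<le> real n * h" using k m(1) h(1) by (intro mult_right_mono) auto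
          then show ?thesis using h(5) by (simp add: algebra_simps)
        qed
        moreover have "0 \<le> real k * h" using h(1) by simp
        ultimately have "continuous_on {0 + real k * h..0 + real k * h + h} y" by (intro continuous_on_subset[OF yc]) auto
        then show "(\<lambda>s. g (s, y s, w k)) integrable_on {0 + real k * h..0 + real k * h + h}"
          by (intro set_lebesgue_integral_eq_integral(1) delay_field_integrable[OF g p] continuous_on_const)
      qed
      have step: "norm (integral {0..?b} (\<lambda>s. ?d (s, y s, v s))) \<le> \<eta> / 4"
      proof -
        have "norm (integral {0..?b} (\<lambda>s. ?d (s, y s, v s))) \<le> (\<Sum>k<m. norm (integral (J k) (\<lambda>s. ?d (s, y s, w k))))"
          unfolding integral_unique[OF cells[OF dLC]] J_def by (rule norm_sum)
        also have "\<dots> \<le> (\<Sum>k<m. \<eta> / (4 * n))"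
        proof (rule sum_mono)
          fix k assume k: "k \<in> {..<m}"
          have kS: "real k * h + h \<le> S"
          proof -
            have "(real k + 1) * h \<le> real n * h" using k m(1) h(1) by (intro mult_right_mono) auto
            then show ?thesis using h(5) by (simp add: algebra_simps)
          qed
          have JS: "s \<in> {0..S}" if "s \<in> J k" for s
            using that kS h(1) unfolding J_def by (auto intro: order_trans[of 0 "real k * h"])
          have "y \<in> moduli_ball (m_bound_moduli f) (J k) (Suc j)"
            unfolding moduli_ball_def m_bound_moduli_eq
          proof (intro CollectI conjI ballI)
            show "continuous_on (J k) y" by (rule continuous_on_subset[OF yc]) (use JS in force)
            show "y ` J k \<subseteq> cball 0 (real (Suc j))"
            proof clarify
              fix s assume "s \<in> J k"
              then have "norm (y s) \<le> R" using JS[of s] by (intro yR) auto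
              then show "y s \<in> cball 0 (real (Suc j))" using j R by simp
            qed
          qed (use ymod JS in blast)
          moreover have "G' \<in> U (k, w k)" using G' k m(1) wF[of k] by (auto simp: V_def)
          ultimately show "norm (integral (J k) (\<lambda>s. ?d (s, y s, w k))) \<le> \<eta> / (4 * n)"
            using U[rule_format, of "(k, w k)"] k m(1) wF[of k] by auto
        qed
        also have "\<dots> = real m / real n * (\<eta> / 4)" by simp
        also have "\<dots> \<le> 1 * (\<eta> / 4)" using m(1) \<eta> by (intro mult_right_mono) auto
        finally show ?thesis by simp
      qed
      have ig: "(\<lambda>s. rep K (s, y s, u s)) integrable_on {0..?b}" if "K \<in> H" for K
        using curve_integrable(3)[OF rep_H[OF that] p yu[of 0 ?b]] mS by simp
      have iv: "(\<lambda>s. rep K (s, y s, v s)) integrable_on {0..?b}" if "K \<in> H" for K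
        using cells[OF rep_H[OF that]] by blast
      \<comment> \<open>The delayed curve is replaced by \<open>v\<close> under both fields, which
        the Lipschitz bounds permit, and the fields are compared along \<open>v\<close>, where only
        values from \<open>D\<close> occur.\<close>
      have eq: "integral {0..?b} (\<lambda>s. ?d (s, y s, u s)) = (integral {0..?b} (\<lambda>s. rep G' (s, y s, u s)) - integral {0..?b} (\<lambda>s. rep G' (s, y s, v s)))
          + integral {0..?b} (\<lambda>s. ?d (s, y s, v s)) - (integral {0..?b} (\<lambda>s. rep G (s, y s, u s)) - integral {0..?b} (\<lambda>s. rep G (s, y s, v s)))"
        unfolding integral_diff[OF ig[OF G'H] ig[OF G]] integral_diff[OF iv[OF G'H] iv[OF G]] by simp
      have "norm (integral {0..?b} (\<lambda>s. ?d (s, y s, u s))) \<le> C * e + \<eta> / 4 + C * e"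
        unfolding eq using l2b[OF G'H] l2b[OF G] step
          norm_add_diff_le[of "integral {0..?b} (\<lambda>s. rep G' (s, y s, u s)) - integral {0..?b} (\<lambda>s. rep G' (s, y s, v s))"
            "integral {0..?b} (\<lambda>s. ?d (s, y s, v s))" "integral {0..?b} (\<lambda>s. rep G (s, y s, u s)) - integral {0..?b} (\<lambda>s. rep G (s, y s, v s))"]
        by linarith
      then show ?thesis using e(3) \<eta> by simp
    qed
    have eq: "integral {0..t} (\<lambda>s. ?d (s, y s, u s)) = integral {0..?b} (\<lambda>s. ?d (s, y s, u s)) + integral {?b..t} (\<lambda>s. ?d (s, y s, u s))"
      using Henstock_Kurzweil_Integration.integral_combine[of 0 ?b t, OF _ _ i1] m mh by simp
    have "norm (integral {0..t} (\<lambda>s. ?d (s, y s, u s))) \<le> 3 * \<eta> / 4 + \<eta> / 4"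
      unfolding eq using main rest norm_triangle_ineq[of "integral {0..?b} (\<lambda>s. ?d (s, y s, u s))" "integral {?b..t} (\<lambda>s. ?d (s, y s, u s))"] by linarith
    then show "norm (integral {0..t} (\<lambda>r. rep G' (r, y r, y (r - 1)) - rep G (r, y r, y (r - 1)))) \<le> \<eta>"
      by (simp add: u_def)
  qed
  show ?thesis
    by (rule exI[of _ V], rule exI[of _ "e / 8"]) (use V close e(1) in auto)
qed

end

section \<open>The three topologies\<close>

lemma m_bound_moduli_mono:
  fixes f :: "('n::finite) dfield"
  assumes "f \<in> LC p" "L1loc_equicontinuous_m_bounds f" "0 \<le> s" "s \<le> t"
  shows "m_bound_moduli f I j s \<le> m_bound_moduli f J j t"
proof -
  have "{0..0::real} \<in> rational_intervals" by (rule rational_intervalsI) auto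
  then have "mono_on {0..} (m_bound_moduli f {0..0} j)"
    using suitable_m_bound_moduli[OF assms(1,2)] unfolding suitable_moduli_def by blast
  then have "m_bound_moduli f {0..0} j s \<le> m_bound_moduli f {0..0} j t" by (rule mono_onD) (use assms(3,4) in auto)
  then show ?thesis by (simp add: m_bound_moduli_def)
qed

lemma moduli_ball_const: "norm c \<le> real j \<Longrightarrow> (\<lambda>_. c) \<in> moduli_ball (m_bound_moduli f) I j"
  by (auto simp: moduli_ball_def m_bound_moduli_def)

lemma moduli_ball_bound: "\<lbrakk>x \<in> moduli_ball \<Theta> I j; t \<in> I\<rbrakk> \<Longrightarrow> norm (x t) \<le> real j"
  by (auto simp: moduli_ball_def image_subset_iff)

text \<open>Clamping the shifted time to \<open>{a..b}\<close> is 1-Lipschitz, so it preserves a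
  nondecreasing modulus; here the moduli are the same for all intervals, and the extension lies in
  the class of the larger interval.\<close>

lemma moduli_ball_extend:
  fixes f :: "('n::finite) dfield"
  assumes f: "f \<in> LC p" "L1loc_equicontinuous_m_bounds f" and ab: "a \<le> b" and x: "x \<in> moduli_ball (m_bound_moduli f) {a..b} j"
  shows "(\<lambda>s. x (max a (min b (s - c)))) \<in> moduli_ball (m_bound_moduli f) J j"
proof -
  define \<pi> where "\<pi> s = max a (min b (s - c))" for s
  have \<pi>: "\<pi> s \<in> {a..b}" "\<bar>\<pi> s - \<pi> t\<bar> \<le> \<bar>s - t\<bar>" for s t using ab by (auto simp: \<pi>_def)
  have "continuous_on {a..b} x" using x by (simp add: moduli_ball_def)
  then have "continuous_on J (\<lambda>s. x (\<pi> s))"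
    by (rule continuous_on_compose2) (use \<pi>(1) in \<open>auto simp: \<pi>_def intro!: continuous_intros\<close>)
  moreover have "x (\<pi> s) \<in> cball 0 (real j)" for s using x \<pi>(1)[of s] unfolding moduli_ball_def by blast
  moreover have "norm (x (\<pi> t) - x (\<pi> s)) \<le> m_bound_moduli f J j \<bar>t - s\<bar>" for s t
  proof -
    have "norm (x (\<pi> t) - x (\<pi> s)) \<le> m_bound_moduli f {a..b} j \<bar>\<pi> t - \<pi> s\<bar>"
      using x \<pi>(1)[of s] \<pi>(1)[of t] unfolding moduli_ball_def by blast
    also have "\<dots> \<le> m_bound_moduli f J j \<bar>t - s\<bar>" by (rule m_bound_moduli_mono[OF f _ \<pi>(2)]) simp
    finally show ?thesis .
  qed
  ultimately show ?thesis unfolding moduli_ball_def \<pi>_def[symmetric] by blast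
qed

text \<open>The delayed argument is stored as the second component \<open>u (t - 1)\<close>, with
  \<open>u\<close> living on the shifted interval. This puts the seminorms of
  \<open>T_ThetaB\<close> into the common form; \<open>section_curves\<close> does so for constant
  delayed values.\<close>

definition delay_curves :: "('n::finite) dfield \<Rightarrow> nat \<Rightarrow> real set \<Rightarrow> (real \<Rightarrow> (real ^ 'n) \<times> (real ^ 'n)) set" where
  "delay_curves f j I = (\<lambda>(x, u) t. (x t, u (t - 1))) ` (moduli_ball (m_bound_moduli f) I j \<times>
     {u. continuous_on ((\<lambda>t. t - 1) ` I) u \<and> u ` ((\<lambda>t. t - 1) ` I) \<subseteq> cball 0 (real j)})"

definition section_curves :: "('n::finite) dfield \<Rightarrow> (real ^ 'n) \<times> nat \<Rightarrow> real set \<Rightarrow> (real \<Rightarrow> (real ^ 'n) \<times> (real ^ 'n)) set" where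
  "section_curves f i I = (\<lambda>x t. (x t, fst i)) ` moduli_ball (m_bound_moduli f) I (snd i)"

lemma delay_curvesI:
  assumes "x \<in> moduli_ball (m_bound_moduli f) {a..b} j" "continuous_on {a - 1..b - 1} u" "\<And>t. t \<in> {a - 1..b - 1} \<Longrightarrow> norm (u t) \<le> real j"
  shows "(\<lambda>t. (x t, u (t - 1))) \<in> delay_curves f j {a..b}"
proof -
  have "(\<lambda>t. t - 1) ` {a..b} = {a - 1..b - 1}" by (rule image_minus_const_atLeastAtMost')
  then show ?thesis unfolding delay_curves_def using assms by (intro image_eqI[of _ _ "(x, u)"]) auto
qed

lemma delay_curvesE:
  assumes "z \<in> delay_curves f j {a..b}"
  obtains x u where "z = (\<lambda>t. (x t, u (t - 1)))" "x \<in> moduli_ball (m_bound_moduli f) {a..b} j" "continuous_on {a - 1..b - 1} u"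
    "\<forall>t\<in>{a - 1..b - 1}. norm (u t) \<le> real j"
proof -
  have "(\<lambda>t. t - 1) ` {a..b} = {a - 1..b - 1}" by (rule image_minus_const_atLeastAtMost')
  then show ?thesis using assms that unfolding delay_curves_def by (force simp: image_subset_iff)
qed

lemma curve_family_delay_curves:
  fixes f :: "('n::finite) dfield"
  assumes f: "f \<in> LC p" "L1loc_equicontinuous_m_bounds f"
  shows "curve_family UNIV (delay_curves f) (\<lambda>j. 2 * real j)"
  unfolding curve_family_def
proof (intro conjI ballI allI impI)
  fix j :: nat and a b :: real
  show "delay_curves f j {a..b} \<subseteq> curves (2 * real j) a b"
  proof
    fix z assume "z \<in> delay_curves f j {a..b}"
    then obtain x u where xu: "z = (\<lambda>t. (x t, u (t - 1)))" "x \<in> moduli_ball (m_bound_moduli f) {a..b} j" "continuous_on {a - 1..b - 1} u"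
      "\<forall>t\<in>{a - 1..b - 1}. norm (u t) \<le> real j" by (rule delay_curvesE)
    have "continuous_on {a..b} (\<lambda>t. u (t - 1))"
      by (rule continuous_on_compose2[OF xu(3)]) (auto intro!: continuous_intros)
    moreover have "continuous_on {a..b} x" using xu(2) by (simp add: moduli_ball_def)
    moreover note moduli_ball_bound[OF xu(2)]
    moreover have "norm (u (t - 1)) \<le> real j" if "t \<in> {a..b}" for t using that by (intro bspec[OF xu(4)]) auto
    ultimately show "z \<in> curves (2 * real j) a b"
      unfolding curves_def xu(1) by (auto intro!: continuous_on_Pair norm_Pair_le_add)
  qed
  have "(\<lambda>t. (0, 0)) \<in> delay_curves f j {a..b}"
    using delay_curvesI[OF moduli_ball_const[of 0 j f "{a..b}"], of "\<lambda>_. 0"] by simp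
  then show "delay_curves f j {a..b} \<noteq> {}" by blast
next
  fix j :: nat and a b a' b' c :: real and z
  assume ab: "a \<le> b \<and> a' \<le> a + c \<and> b + c \<le> b'" and "z \<in> delay_curves f j {a..b}"
  then obtain x u where xu: "z = (\<lambda>t. (x t, u (t - 1)))" "x \<in> moduli_ball (m_bound_moduli f) {a..b} j" "continuous_on {a - 1..b - 1} u"
    "\<forall>t\<in>{a - 1..b - 1}. norm (u t) \<le> real j" by - (erule delay_curvesE)
  \<comment> \<open>Only continuity and the bound are demanded of the delayed curve, so constant
    continuation beyond the endpoints is enough.\<close>
  define u' where "u' s = u (max (a - 1) (min (b - 1) (s - c)))" for s
  have "a \<le> b" using ab by simp
  have "continuous_on {a' - 1..b' - 1} u'"
    unfolding u'_def by (rule continuous_on_compose2[OF xu(3)]) (use ab in \<open>auto intro!: continuous_intros\<close>)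
  moreover have "norm (u' t) \<le> real j" for t unfolding u'_def using ab by (intro bspec[OF xu(4)]) auto
  ultimately have "(\<lambda>t. (x (max a (min b (t - c))), u' (t - 1))) \<in> delay_curves f j {a'..b'}"
    by (intro delay_curvesI moduli_ball_extend[OF f \<open>a \<le> b\<close> xu(2)])
  moreover have "(x (max a (min b (t + c - c))), u' (t + c - 1)) = z t" if "t \<in> {a..b}" for t
    using that by (simp add: xu(1) u'_def)
  ultimately show "\<exists>z'\<in>delay_curves f j {a'..b'}. \<forall>t\<in>{a..b}. z' (t + c) = z t" by (intro bexI) auto
qed simp

lemma curve_family_section_curves:
  fixes f :: "('n::finite) dfield"
  assumes f: "f \<in> LC p" "L1loc_equicontinuous_m_bounds f" and D: "D \<noteq> {}"
  shows "curve_family (D \<times> UNIV) (section_curves f) (\<lambda>(u, j). real j + norm u)"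
  unfolding curve_family_def
proof (intro conjI ballI allI impI)
  show "D \<times> (UNIV :: nat set) \<noteq> {}" using D by simp
next
  fix i and a b :: real
  show "section_curves f i {a..b} \<subseteq> curves (case i of (u, j) \<Rightarrow> real j + norm u) a b"
  proof
    fix z assume "z \<in> section_curves f i {a..b}"
    then obtain x where x: "z = (\<lambda>t. (x t, fst i))" "x \<in> moduli_ball (m_bound_moduli f) {a..b} (snd i)"
      unfolding section_curves_def by blast
    have "norm (x t, fst i) \<le> real (snd i) + norm (fst i)" if "t \<in> {a..b}" for t
    proof -
      have "norm (x t) \<le> real (snd i)" by (rule moduli_ball_bound[OF x(2) that])
      then show ?thesis using norm_Pair_le[of "x t" "fst i"] by linarith
    qed
    moreover have "continuous_on {a..b} x" using x(2) by (simp add: moduli_ball_def)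
    ultimately show "z \<in> curves (case i of (u, j) \<Rightarrow> real j + norm u) a b"
      unfolding curves_def x(1) by (auto simp: split_beta intro!: continuous_on_Pair)
  qed
  show "section_curves f i {a..b} \<noteq> {}"
    unfolding section_curves_def using moduli_ball_const[of 0 "snd i" f "{a..b}"] by auto
next
  fix i and a b a' b' c :: real and z
  assume ab: "a \<le> b \<and> a' \<le> a + c \<and> b + c \<le> b'" and "z \<in> section_curves f i {a..b}"
  then obtain x where x: "z = (\<lambda>t. (x t, fst i))" "x \<in> moduli_ball (m_bound_moduli f) {a..b} (snd i)"
    unfolding section_curves_def by blast
  have "a \<le> b" using ab by simp
  have "(\<lambda>t. (x (max a (min b (t - c))), fst i)) \<in> section_curves f i {a'..b'}"
    unfolding section_curves_def by (rule imageI[OF moduli_ball_extend[OF f \<open>a \<le> b\<close> x(2)]])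
  moreover have "(x (max a (min b (t + c - c))), fst i) = z t" if "t \<in> {a..b}" for t
    using that by (simp add: x(1))
  ultimately show "\<exists>z'\<in>section_curves f i {a'..b'}. \<forall>t\<in>{a..b}. z' (t + c) = z t" by (intro bexI) auto
qed

lemma T_ThetaB_eq: "T_ThetaB (m_bound_moduli f) p = seminorm_topology (LC_space p) (strong_seminorms p UNIV (delay_curves f))"
proof -
  have "seminorm_ThetaB (m_bound_moduli f) p I j = strong_seminorm p (delay_curves f j I) I" for I j
    by (rule ext) (simp add: seminorm_ThetaB_def strong_seminorm_def delay_curves_def image_image split_beta)
  then show ?thesis unfolding T_ThetaB_def strong_seminorms_def by (auto intro!: arg_cong[where f = "seminorm_topology _"])
qed

lemma T_ThetaD_eq: "T_ThetaD (m_bound_moduli f) D = seminorm_topology (LC_space 1) (strong_seminorms 1 (D \<times> UNIV) (section_curves f))"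
proof -
  have "seminorm_ThetaD (m_bound_moduli f) u I j = strong_seminorm 1 (section_curves f (u, j) I) I" for u I j
    by (rule ext) (simp add: seminorm_ThetaD_def strong_seminorm_def section_curves_def image_image)
  then have "{seminorm_ThetaD (m_bound_moduli f) u I j | u I j. u \<in> D \<and> I \<in> rational_intervals} = strong_seminorms 1 (D \<times> UNIV) (section_curves f)"
    unfolding strong_seminorms_def by auto
  then show ?thesis unfolding T_ThetaD_def by simp
qed

lemma sigma_ThetaD_eq: "sigma_ThetaD (m_bound_moduli f) D = seminorm_topology (LC_space 1) (weak_seminorms (D \<times> UNIV) (section_curves f))"
proof -
  have "seminorm_sigma_ThetaD (m_bound_moduli f) u I j = weak_seminorm (section_curves f (u, j) I) I" for u I j
    by (rule ext) (simp add: seminorm_sigma_ThetaD_def weak_seminorm_def section_curves_def image_image)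
  then have "{seminorm_sigma_ThetaD (m_bound_moduli f) u I j | u I j. u \<in> D \<and> I \<in> rational_intervals} = weak_seminorms (D \<times> UNIV) (section_curves f)"
    unfolding weak_seminorms_def by auto
  then show ?thesis unfolding sigma_ThetaD_def by simp
qed

text \<open>With the norm inside, the integral over the full interval controls all shorter ones, so
  every upper limit \<open>t\<close> is handled by one seminorm.\<close>

lemma integral_norm_diff_bound:
  fixes g g' :: "('n::finite) dfield"
  assumes "g \<in> LC p" "g' \<in> LC p" "1 \<le> p" and z: "z \<in> curves r a b" and t: "t \<le> b"
  shows "norm (integral {a..t} (\<lambda>s. g' (s, z s) - g (s, z s))) \<le> integral {a..b} (\<lambda>s. norm (g' (s, z s) - g (s, z s)))"
proof -
  note i = curve_integrable(3,5)[OF LC_diff[OF assms(2,1)] assms(3) z]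
  have sub: "{a..t} \<subseteq> {a..b}" using t by simp
  note i' = integrable_on_subinterval[OF i(1) sub] integrable_on_subinterval[OF i(2) sub]
  have "norm (integral {a..t} (\<lambda>s. g' (s, z s) - g (s, z s))) \<le> integral {a..t} (\<lambda>s. norm (g' (s, z s) - g (s, z s)))"
    by (rule integral_norm_bound_integral[OF i' order_refl])
  also have "\<dots> \<le> integral {a..b} (\<lambda>s. norm (g' (s, z s) - g (s, z s)))" by (rule integral_subset_le[OF sub i'(2) i(2)]) simp
  finally show ?thesis .
qed

text \<open>A constant has zero increments, so it satisfies every modulus and is an admissible test
  curve once \<open>j\<close> exceeds its norm.\<close>

lemma weak_hull_of_nbh:
  fixes f :: "('n::finite) dfield"
  assumes f: "f \<in> LC p" "L1loc_equicontinuous_m_bounds f" "1 \<le> p" and T: "topspace T = LC_space p" and D: "closure D = UNIV"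
    and nbh: "\<And>G j a b u \<epsilon>. \<lbrakk>G \<in> LC_space p; a \<in> \<rat>; b \<in> \<rat>; a \<le> b; u \<in> D; 0 < \<epsilon>\<rbrakk> \<Longrightarrow> \<exists>U. openin T U \<and> G \<in> U \<and>
        (\<forall>G'\<in>U. \<forall>y\<in>moduli_ball (m_bound_moduli f) {a..b} j. norm (integral {a..b} (\<lambda>t. rep G' (t, y t, u) - rep G (t, y t, u))) \<le> \<epsilon>)"
  shows "weak_hull f p T D"
proof
  fix G :: "'n dfield set" and a b :: real and c d :: "real ^ 'n" and e :: real
  assume *: "G \<in> LC_space p" "a \<in> \<rat>" "b \<in> \<rat>" "a \<le> b" "d \<in> D" "0 < e"
  obtain j :: nat where "norm c \<le> real j" using real_arch_simple by blast
  then have c: "(\<lambda>_. c) \<in> moduli_ball (m_bound_moduli f) {a..b} j" by (rule moduli_ball_const)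
  obtain U where U: "openin T U" "G \<in> U"
    "\<forall>G'\<in>U. \<forall>y\<in>moduli_ball (m_bound_moduli f) {a..b} j. norm (integral {a..b} (\<lambda>t. rep G' (t, y t, d) - rep G (t, y t, d))) \<le> e"
    using nbh[OF *, of j] by blast
  have "\<forall>G'\<in>U. norm (integral {a..b} (\<lambda>t. rep G' (t, c, d) - rep G (t, c, d))) \<le> e"
    using bspec[OF bspec[OF U(3)] c] by simp
  then show "\<exists>U. openin T U \<and> G \<in> U \<and> (\<forall>G'\<in>U. norm (integral {a..b} (\<lambda>t. rep G' (t, c, d) - rep G (t, c, d))) \<le> e)"
    using U(1,2) by blast
qed (use f T D in auto)

context weak_hull
begin

lemma semiflow_of_weak_nbh:
  assumes l2: "L1loc_bounded_l2_bounds f"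
    and nbh: "\<And>G j a b u \<epsilon>. \<lbrakk>G \<in> LC_space p; a \<in> \<rat>; b \<in> \<rat>; a \<le> b; u \<in> D; 0 < \<epsilon>\<rbrakk> \<Longrightarrow> \<exists>U. openin T U \<and> G \<in> U \<and>
        (\<forall>G'\<in>U. \<forall>y\<in>moduli_ball (m_bound_moduli f) {a..b} j. norm (integral {a..b} (\<lambda>t. rep G' (t, y t, u) - rep G (t, y t, u))) \<le> \<epsilon>)"
    and cont: "continuous_map (prod_topology (top_of_set {0..}) (subtopology T H)) T (\<lambda>(t, G). translate t ` G)"
  shows "defines_skew_product_semiflow p T f"
  by (rule skew_product_semiflow_criterion[OF p f top H_def _ cont], rule weakly_close_of_weak_nbh[OF l2 nbh])

end

lemma semiflow_T_ThetaB:
  fixes f :: "('n::finite) dfield"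
  assumes p: "1 \<le> p" and f: "f \<in> LC p" "L1loc_equicontinuous_m_bounds f"
  shows "defines_skew_product_semiflow p (T_ThetaB (m_bound_moduli f) p) f"
proof -
  note Z = curve_family_delay_curves[OF f]
  define T :: "'n dfield set topology" where "T = T_ThetaB (m_bound_moduli f) p"
  note T_eq = T_def[unfolded T_ThetaB_eq]
  have ts: "topspace T = LC_space p"
    unfolding T_eq by (rule seminorm_space.topspace_T[OF seminorm_space_strong[OF Z p]])
  have nbh: "\<exists>U. openin T U \<and> G \<in> U \<and> (\<forall>G'\<in>U. \<forall>z\<in>delay_curves f j {a..b}. \<forall>t\<in>{a..b}.
      norm (integral {a..t} (\<lambda>s. rep G' (s, z s) - rep G (s, z s))) \<le> \<epsilon>)"
    if G: "G \<in> LC_space p" and ab: "a \<in> \<rat>" "b \<in> \<rat>" "a \<le> b" and \<epsilon>: "0 < \<epsilon>" for G :: "'n dfield set" and j a b \<epsilon>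
  proof -
    obtain U where U: "openin T U" "G \<in> U"
      "\<forall>G'\<in>U. \<forall>z\<in>delay_curves f j {a..b}. integral {a..b} (\<lambda>t. norm (rep G' (t, z t) - rep G (t, z t))) \<le> \<epsilon>"
      unfolding T_eq by (rule strong_nbh_L1[OF Z p UNIV_I G ab \<epsilon>, of j])
    have "norm (integral {a..t} (\<lambda>s. rep G' (s, z s) - rep G (s, z s))) \<le> \<epsilon>"
      if G': "G' \<in> U" and z: "z \<in> delay_curves f j {a..b}" and t: "t \<in> {a..b}" for G' z t
    proof -
      have "G' \<in> LC_space p" using openin_subset[OF U(1)] G' ts by auto
      moreover have "z \<in> curves (2 * real j) a b" using curve_familyD(1)[OF Z UNIV_I ab(3)] z by blast
      ultimately show ?thesis
        using integral_norm_diff_bound[OF rep_LC[OF G] rep_LC p, of G' z "2 * real j" a b t] bspec[OF bspec[OF U(3) G'] z] t by simp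
    qed
    then show ?thesis using U(1,2) by blast
  qed
  \<comment> \<open>The test curves of this topology allow every constant delayed value, so the
    whole space plays the part of the dense set.\<close>
  have "weak_hull f p T UNIV"
  proof
    fix G :: "'n dfield set" and a b :: real and c d :: "real ^ 'n" and e :: real
    assume *: "G \<in> LC_space p" "a \<in> \<rat>" "b \<in> \<rat>" "a \<le> b" "0 < e"
    obtain j :: nat where "max (norm c) (norm d) \<le> real j" using real_arch_simple by blast
    then have j: "norm c \<le> real j" "norm d \<le> real j" by auto
    obtain U where U: "openin T U" "G \<in> U" "\<forall>G'\<in>U. \<forall>z\<in>delay_curves f j {a..b}. \<forall>t\<in>{a..b}.
      norm (integral {a..t} (\<lambda>s. rep G' (s, z s) - rep G (s, z s))) \<le> e" using nbh[OF *, of j] by blast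
    have z: "(\<lambda>t. (c, d)) \<in> delay_curves f j {a..b}"
      using delay_curvesI[OF moduli_ball_const[OF j(1)], of a b "\<lambda>_. d" f] j(2) by simp
    have "b \<in> {a..b}" using *(4) by simp
    then have "\<forall>G'\<in>U. norm (integral {a..b} (\<lambda>t. rep G' (t, c, d) - rep G (t, c, d))) \<le> e"
      using bspec[OF bspec[OF bspec[OF U(3)] z]] by blast
    then show "\<exists>U. openin T U \<and> G \<in> U \<and> (\<forall>G'\<in>U. norm (integral {a..b} (\<lambda>t. rep G' (t, c, d) - rep G (t, c, d))) \<le> e)"
      using U(1,2) by blast
  qed (use f p ts in auto)
  then interpret weak_hull f p T UNIV .
  have "defines_skew_product_semiflow p T f"
  proof (rule skew_product_semiflow_criterion[OF p f(1) ts H_def])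
    fix G \<phi> and R S \<eta> :: real assume G: "G \<in> H" and R: "0 \<le> R" and S: "S \<in> \<rat>" "0 < S" and \<eta>: "0 < \<eta>"
    \<comment> \<open>Curves of radius \<open>R\<close> inherit the modulus of index
      \<open>Suc j\<close> from the hull, so the test family of that index is used.\<close>
    obtain j :: nat where j: "2 * R \<le> real j" using real_arch_simple by blast
    have "G \<in> LC_space p" using G H_subset by blast
    then obtain U where U: "openin T U" "G \<in> U" "\<And>G' z t. \<lbrakk>G' \<in> U; z \<in> delay_curves f (Suc j) {0..S}; t \<in> {0..S}\<rbrakk> \<Longrightarrow>
      norm (integral {0..t} (\<lambda>s. rep G' (s, z s) - rep G (s, z s))) \<le> \<eta>" using nbh[of G 0 S \<eta> "Suc j"] S \<eta> by auto
    have "weakly_close (rep G') (rep G) \<phi> 1 R S \<eta>" if G': "G' \<in> U \<inter> H" for G'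
      unfolding weakly_close_def
    proof (intro allI impI ballI)
      fix y t assume y: "controlled_curve (rep G') \<phi> 1 R S y" and t: "t \<in> {0..S}"
      have yc: "continuous_on {-1..S} y" and yR: "\<And>t. t \<in> {-1..S} \<Longrightarrow> norm (y t) \<le> R" using y by (auto simp: controlled_curve_def)
      have bd: "norm (y t) \<le> real (Suc j)" if "t \<in> {-1..S}" for t using yR[OF that] j R by simp
      have "y \<in> moduli_ball (m_bound_moduli f) {0..S} (Suc j)"
        unfolding moduli_ball_def m_bound_moduli_eq
      proof (intro CollectI conjI ballI)
        show "continuous_on {0..S} y" by (rule continuous_on_subset[OF yc]) auto
        show "y ` {0..S} \<subseteq> cball 0 (real (Suc j))" using bd by fastforce
        show "norm (y t - y s) \<le> \<theta> (Suc j) \<bar>t - s\<bar>" if "t \<in> {0..S}" "s \<in> {0..S}" for s t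
          using controlled_curve_modulus[OF _ y j that(2,1)] G' by simp
      qed
      then have "(\<lambda>t. (y t, y (t - 1))) \<in> delay_curves f (Suc j) {0..S}"
      proof (rule delay_curvesI)
        show "continuous_on {0 - 1..S - 1} y" by (rule continuous_on_subset[OF yc]) auto
        show "norm (y t) \<le> real (Suc j)" if "t \<in> {0 - 1..S - 1}" for t using that by (intro bd) auto
      qed
      then show "norm (integral {0..t} (\<lambda>r. rep G' (r, y r, y (r - 1)) - rep G (r, y r, y (r - 1)))) \<le> \<eta>"
        using U(3)[OF _ _ t, of G' "\<lambda>t. (y t, y (t - 1))"] G' by simp
    qed
    then show "\<exists>U \<delta>. openin T U \<and> G \<in> U \<and> 0 < \<delta> \<and> (\<forall>G'\<in>U \<inter> H. weakly_close (rep G') (rep G) \<phi> \<delta> R S \<eta>)"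
      using U(1,2) zero_less_one by blast
  next
    show "continuous_map (prod_topology (top_of_set {0..}) (subtopology T H)) T (\<lambda>(t, G). translate t ` G)"
      unfolding T_eq by (rule strong_translation_continuous[OF Z p])
  qed
  then show ?thesis unfolding T_def .
qed

lemma semiflow_T_ThetaD:
  fixes f :: "('n::finite) dfield"
  assumes f: "f \<in> LC 1" "L1loc_equicontinuous_m_bounds f" and l2: "L1loc_bounded_l2_bounds f" and D: "closure D = UNIV"
  shows "defines_skew_product_semiflow 1 (T_ThetaD (m_bound_moduli f) D) f"
proof -
  have "D \<noteq> {}" using D by auto
  note Z = curve_family_section_curves[OF f this]
  define T :: "'n dfield set topology" where "T = T_ThetaD (m_bound_moduli f) D"
  note T_eq = T_def[unfolded T_ThetaD_eq]
  have ts: "topspace T = LC_space 1"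
    unfolding T_eq by (rule seminorm_space.topspace_T[OF seminorm_space_strong[OF Z order_refl]])
  have nbh: "\<exists>U. openin T U \<and> G \<in> U \<and> (\<forall>G'\<in>U. \<forall>y\<in>moduli_ball (m_bound_moduli f) {a..b} j.
      norm (integral {a..b} (\<lambda>t. rep G' (t, y t, u) - rep G (t, y t, u))) \<le> \<epsilon>)"
    if G: "G \<in> LC_space 1" and ab: "a \<in> \<rat>" "b \<in> \<rat>" "a \<le> b" and u: "u \<in> D" and \<epsilon>: "0 < \<epsilon>" for G :: "'n dfield set" and j a b u \<epsilon>
  proof -
    have i: "(u, j) \<in> D \<times> UNIV" using u by simp
    obtain U where U: "openin T U" "G \<in> U"
      "\<forall>G'\<in>U. \<forall>z\<in>section_curves f (u, j) {a..b}. integral {a..b} (\<lambda>t. norm (rep G' (t, z t) - rep G (t, z t))) \<le> \<epsilon>"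
      unfolding T_eq by (rule strong_nbh_L1[OF Z order_refl i G ab \<epsilon>])
    have "norm (integral {a..b} (\<lambda>t. rep G' (t, y t, u) - rep G (t, y t, u))) \<le> \<epsilon>"
      if G': "G' \<in> U" and y: "y \<in> moduli_ball (m_bound_moduli f) {a..b} j" for G' y
    proof -
      have "G' \<in> LC_space 1" using openin_subset[OF U(1)] G' ts by auto
      moreover have z: "(\<lambda>t. (y t, u)) \<in> section_curves f (u, j) {a..b}" using y by (auto simp: section_curves_def)
      moreover have "(\<lambda>t. (y t, u)) \<in> curves (real j + norm u) a b" using curve_familyD(1)[OF Z i ab(3)] z by auto
      ultimately show ?thesis
        using integral_norm_diff_bound[OF rep_LC[OF G] rep_LC order_refl, of G' "\<lambda>t. (y t, u)" "real j + norm u" a b b] bspec[OF bspec[OF U(3) G'] z] by simp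
    qed
    then show ?thesis using U(1,2) by blast
  qed
  interpret weak_hull f 1 T D by (rule weak_hull_of_nbh[OF f order_refl ts D nbh])
  \<comment> \<open>The norm is inside the integral of these seminorms, so translation is treated as
    for continuous delayed curves; only the comparison of solutions needs the bounds in the delayed
    variable.\<close>
  have "continuous_map (prod_topology (top_of_set {0..}) (subtopology T H)) T (\<lambda>(t, G). translate t ` G)"
    unfolding T_eq by (rule strong_translation_continuous[OF Z order_refl])
  from semiflow_of_weak_nbh[OF l2 nbh this] show ?thesis unfolding T_def .
qed

lemma semiflow_sigma_ThetaD:
  fixes f :: "('n::finite) dfield"
  assumes f: "f \<in> LC 1" "L1loc_equicontinuous_m_bounds f" and l2: "L1loc_bounded_l2_bounds f" and D: "closure D = UNIV"
  shows "defines_skew_product_semiflow 1 (sigma_ThetaD (m_bound_moduli f) D) f"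
proof -
  have "D \<noteq> {}" using D by auto
  note Z = curve_family_section_curves[OF f this]
  define T :: "'n dfield set topology" where "T = sigma_ThetaD (m_bound_moduli f) D"
  note T_eq = T_def[unfolded sigma_ThetaD_eq]
  interpret seminorm_space 1 "weak_seminorms (D \<times> UNIV) (section_curves f) :: ('n dfield \<Rightarrow> real) set"
    by (rule seminorm_space_weak[OF Z order_refl])
  have nbh: "\<exists>U. openin T U \<and> G \<in> U \<and> (\<forall>G'\<in>U. \<forall>y\<in>moduli_ball (m_bound_moduli f) {a..b} j.
      norm (integral {a..b} (\<lambda>t. rep G' (t, y t, u) - rep G (t, y t, u))) \<le> \<epsilon>)"
    if G: "G \<in> LC_space 1" and ab: "a \<in> \<rat>" "b \<in> \<rat>" "a \<le> b" and u: "u \<in> D" and \<epsilon>: "0 < \<epsilon>" for G :: "'n dfield set" and j a b u \<epsilon>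
  proof -
    have i: "(u, j) \<in> D \<times> UNIV" using u by simp
    define \<rho> :: "'n dfield \<Rightarrow> real" where "\<rho> = weak_seminorm (section_curves f (u, j) {a..b}) {a..b}"
    have \<rho>: "\<rho> \<in> weak_seminorms (D \<times> UNIV) (section_curves f)"
      unfolding \<rho>_def weak_seminorms_def using i rational_intervalsI[OF ab] by blast
    have "norm (integral {a..b} (\<lambda>t. rep G' (t, y t, u) - rep G (t, y t, u))) \<le> \<epsilon>"
      if G': "G' \<in> nbh \<rho> G \<epsilon>" and y: "y \<in> moduli_ball (m_bound_moduli f) {a..b} j" for G' y
    proof -
      have G'': "G' \<in> LC_space 1" "\<rho> (\<lambda>w. rep G' w - rep G w) < \<epsilon>" using G' unfolding nbh_def by blast+
      have d: "(\<lambda>w. rep G' w - rep G w) \<in> LC 1" by (intro LC_diff rep_LC G G''(1))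
      have "(\<lambda>t. (y t, u)) \<in> section_curves f (u, j) {a..b}" using y by (auto simp: section_curves_def)
      from weak_seminorm_upper(2)[OF d order_refl curve_familyD(1)[OF Z i ab(3)] this] show ?thesis
        using G''(2) unfolding \<rho>_def by simp
    qed
    then show ?thesis unfolding T_eq using openin_nbh[OF \<rho> G \<epsilon>] center_in_nbh[OF \<rho> G \<epsilon>] by blast
  qed
  have ts: "topspace T = LC_space 1" unfolding T_eq by (rule topspace_T)
  interpret W: weak_hull f 1 T D by (rule weak_hull_of_nbh[OF f order_refl ts D nbh])
  have "continuous_map (prod_topology (top_of_set {0..}) (subtopology T W.H)) T (\<lambda>(t, G). translate t ` G)"
    unfolding T_eq by (rule W.weak_translation_continuous[OF Z, unfolded T_eq])
  from W.semiflow_of_weak_nbh[OF l2 nbh this] show ?thesis unfolding T_def .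
qed

theorem theorem3p10:
  fixes f :: "('n::finite) dfield" and p :: nat and D :: "(real ^ 'n) set"
  assumes "1 \<le> p"
    and "f \<in> LC p"
    and "L1loc_equicontinuous_m_bounds f"
    and "countable D" and "closure D = UNIV"
  shows "defines_skew_product_semiflow p (T_ThetaB (m_bound_moduli f) p) f \<and>
         (L1loc_bounded_l2_bounds f \<longrightarrow>
           defines_skew_product_semiflow 1 (T_ThetaD (m_bound_moduli f) D) f \<and>
           defines_skew_product_semiflow 1 (sigma_ThetaD (m_bound_moduli f) D) f)"
proof -
  \<comment> \<open>The topologies of the second part live on \<open>LC 1\<close>, so
    \<open>f\<close> is first regarded as an element of that larger space.\<close>
  have f1: "f \<in> LC 1" by (rule LC_subset_LC1[OF assms(1,2)])
  show ?thesis
    using semiflow_T_ThetaB[OF assms(1-3)] semiflow_T_ThetaD[OF f1 assms(3) _ assms(5)]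
      semiflow_sigma_ThetaD[OF f1 assms(3) _ assms(5)] by blast
qed

end
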